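(* Let $(\ell_i)_{i=1,\dots,N}\in(0,+\infty)^N$ and $T>0$. Then there exist $\epsilon>0$ and $C>0$ such that for all $\underline u^0\in\mathbb L^2(\mathcal T)$ with $\|\underline u^0\|_{\mathbb L^2(\mathcal T)}<\epsilon$, there exists a unique solution $\underline u\in\mathbb B$ of the system $$\begin{cases}(\partial_tu_j+\partial_xu_j+u_j\partial_xu_j+\partial_x^3u_j)(t,x)=0,& x\in(0,\ell_j),\ t\in(0,T),\ j=1,\dots,N,\\ u_j(t,0)=u_k(t,0),& j,k=1,\dots,N,\ t\in(0,T),\\ \sum_{j=1}^N\partial_x^2u_j(t,0)=-\alpha u_1(t,0)-\frac N3u_1^2(t,0),& t\in(0,T),\\ u_j(t,\ell_j)=\partial_xu_j(t,\ell_j)=0,& t\in(0,T),\ j=1,\dots,N,\\ u_j(0,x)=u_j^0(x),& x\in(0,\ell_j),\ j=1,\dots,N,\end{cases}$$ that satisfies $\|\underline u\|_{\mathbb B}\le C\|\underline u^0\|_{\mathbb L^2(\mathcal T)}$.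
   Context: $N\ge1$ is an integer and $\alpha>\frac N2$ is fixed. The star-shaped network $\mathcal T$ consists of $N$ edges, the $j$-th one identified with $[0,\ell_j]$, all joined at the central node $x=0$. Functions are real-valued. $\mathbb L^2(\mathcal T)=\prod_{j=1}^NL^2(0,\ell_j)$ with $\|\underline u\|^2_{\mathbb L^2(\mathcal T)}=\sum_j\int_0^{\ell_j}|u_j|^2dx$. For $s=1,2$, $\mathbb H^s_e(\mathcal T)$ is the set of $\underline u\in\prod_jH^s(0,\ell_j)$ with $u_j^{(i-1)}(\ell_j)=0$ for $1\le i\le s$ and $u_j(0)=u_k(0)$ for all $j,k$, with the norm of $\prod_jH^s(0,\ell_j)$. $\mathbb B=C([0,T],\mathbb L^2(\mathcal T))\cap L^2(0,T;\mathbb H^1_e(\mathcal T))$ with norm $\|\underline u\|_{\mathbb B}=\max_{t\in[0,T]}\|\underline u(t,\cdot)\|_{\mathbb L^2(\mathcal T)}+\big(\int_0^T\|\underline u(t,\cdot)\|_{\mathbb H^1_e(\mathcal T)}^2dt\big)^{1/2}$. Notion of solution: $\underline u\in\mathbb B$ is a solution if it is the mild solution of the linear problem $\partial_tv_j+\partial_xv_j+\partial_x^3v_j=f_j$, $v_j(t,0)=v_k(t,0)$, $\sum_j\partial_x^2v_j(t,0)=-\alpha v_1(t,0)+g(t)$, $v_j(t,\ell_j)=\partial_xv_j(t,\ell_j)=0$, $v_j(0,\cdot)=u^0_j$, with $f_j=-u_j\partial_xu_j\in L^1(0,T;L^2(0,\ell_j))$ and $g=-\frac N3u_1(\cdot,0)^2\in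 L^2(0,T)$. Here the mild solution of the linear problem is the sum of $\int_0^te^{(t-s)\mathcal A}\underline f(s)ds$ and the limit in $\mathbb B$ of classical solutions with $\underline f=\underline0$ and regular data ($\underline u^0\in\mathcal D(\mathcal A)$, $g\in C^2([0,T])$, $g(0)=0$) converging to the given data in $\mathbb L^2(\mathcal T)\times L^2(0,T)$; $\mathcal A\underline u=(-u_j'-u_j''')_j$ with domain $\mathcal D(\mathcal A)=\{\underline u\in\mathbb H^2_e(\mathcal T)\cap\prod_jH^3(0,\ell_j):\sum_ju_j''(0)=-\alpha u_1(0)\}$. *)

theory Defs
  imports "HOL-Analysis.Analysis"
begin

section \<open>The Hilbert space of square integrable functions on the real line\<close>

definition square_integrable_on :: "(real \<Rightarrow> real) \<Rightarrow> real set \<Rightarrow> bool"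
    (infix "square'_integrable'_on" 50) where
  "f square_integrable_on S \<longleftrightarrow>
     f \<in> borel_measurable (lebesgue_on S) \<and> integrable (lebesgue_on S) (\<lambda>x. (f x)\<^sup>2)"

lemma square_integrable_UNIV_iff:
  "f square_integrable_on UNIV \<longleftrightarrow>
     f \<in> borel_measurable lebesgue \<and> integrable lebesgue (\<lambda>x. (f x)\<^sup>2)"
  by (simp add: square_integrable_on_def lebesgue_on_UNIV_eq)

lemma square_integrable_mult:
  assumes "f square_integrable_on UNIV" "g square_integrable_on UNIV"
  shows "integrable lebesgue (\<lambda>x. f x * g x)"
proof (rule Bochner_Integration.integrable_bound)
  show "integrable lebesgue (\<lambda>x. (f x)\<^sup>2 + (g x)\<^sup>2)"
    using assms by (auto simp: square_integrable_UNIV_iff)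
  show "(\<lambda>x. f x * g x) \<in> borel_measurable lebesgue"
    using assms by (auto simp: square_integrable_UNIV_iff)
  have "norm (f x * g x) \<le> norm ((f x)\<^sup>2 + (g x)\<^sup>2)" for x
  proof -
    have "0 \<le> (\<bar>f x\<bar> - \<bar>g x\<bar>)\<^sup>2" by simp
    moreover have "(\<bar>f x\<bar> - \<bar>g x\<bar>)\<^sup>2 = (f x)\<^sup>2 + (g x)\<^sup>2 - 2 * \<bar>f x * g x\<bar>"
      by (simp add: power2_diff abs_mult)
    moreover have "0 \<le> \<bar>f x * g x\<bar>" by simp
    ultimately show ?thesis by simp
  qed
  then show "AE x in lebesgue. norm (f x * g x) \<le> norm ((f x)\<^sup>2 + (g x)\<^sup>2)" by simp
qed

lemma square_integrable_add:
  assumes "f square_integrable_on UNIV" "g square_integrable_on UNIV"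
  shows "(\<lambda>x. f x + g x) square_integrable_on UNIV"
  using assms square_integrable_mult[OF assms]
  by (auto simp: square_integrable_UNIV_iff power2_sum mult.assoc)

lemma square_integrable_scale:
  assumes "f square_integrable_on UNIV"
  shows "(\<lambda>x. c * f x) square_integrable_on UNIV"
  using assms by (auto simp: square_integrable_UNIV_iff power_mult_distrib)

lemma square_integrable_uminus:
  assumes "f square_integrable_on UNIV"
  shows "(\<lambda>x. - f x) square_integrable_on UNIV"
  using square_integrable_scale[OF assms, of "-1"] by simp

lemma square_integrable_diff:
  assumes "f square_integrable_on UNIV" "g square_integrable_on UNIV"
  shows "(\<lambda>x. f x - g x) square_integrable_on UNIV"
  using square_integrable_add[OF assms(1) square_integrable_uminus[OF assms(2)]] by simp

lemma square_integrable_0: "(\<lambda>x. 0) square_integrable_on UNIV"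
  by (auto simp: square_integrable_UNIV_iff)

lemma square_integrable_eq_0_iff:
  assumes f: "f square_integrable_on UNIV"
  shows "integral\<^sup>L lebesgue (\<lambda>x. f x * f x) = 0 \<longleftrightarrow> (AE x in lebesgue. f x = 0)"
  using integral_nonneg_eq_0_iff_AE[OF square_integrable_mult[OF f f]] by simp

quotient_type L2 = "real \<Rightarrow> real" / partial:
  "\<lambda>f g. f square_integrable_on UNIV \<and> g square_integrable_on UNIV \<and> (AE x in lebesgue. f x = g x)"
  morphisms fun_of_L2 L2_class
proof (rule part_equivpI)
  show "\<exists>f. f square_integrable_on UNIV \<and> f square_integrable_on UNIV \<and> (AE x in lebesgue. f x = f x)"
    using square_integrable_0 by auto
  show "symp (\<lambda>f g. f square_integrable_on UNIV \<and> g square_integrable_on UNIV \<and> (AE x in lebesgue. f x = g x))"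
    by (auto simp: symp_def)
  show "transp (\<lambda>f g. f square_integrable_on UNIV \<and> g square_integrable_on UNIV \<and> (AE x in lebesgue. f x = g x))"
    by (auto simp: transp_def)
qed

instantiation L2 :: real_inner
begin

lift_definition zero_L2 :: L2 is "\<lambda>x. 0" by (simp add: square_integrable_0)

lift_definition plus_L2 :: "L2 \<Rightarrow> L2 \<Rightarrow> L2" is "\<lambda>f g x. f x + g x"
  by (auto intro: square_integrable_add)

lift_definition minus_L2 :: "L2 \<Rightarrow> L2 \<Rightarrow> L2" is "\<lambda>f g x. f x - g x"
  by (auto intro: square_integrable_diff)

lift_definition uminus_L2 :: "L2 \<Rightarrow> L2" is "\<lambda>f x. - f x"
  by (auto intro: square_integrable_uminus)

lift_definition scaleR_L2 :: "real \<Rightarrow> L2 \<Rightarrow> L2" is "\<lambda>c f x. c * f x"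
  by (auto intro: square_integrable_scale)

lift_definition inner_L2 :: "L2 \<Rightarrow> L2 \<Rightarrow> real" is "\<lambda>f g. LINT x|lebesgue. f x * g x"
  by (intro integral_cong_AE) (auto simp: square_integrable_UNIV_iff)

definition norm_L2 :: "L2 \<Rightarrow> real" where "norm_L2 f = sqrt (inner f f)"
definition sgn_L2 :: "L2 \<Rightarrow> L2" where "sgn_L2 f = scaleR (inverse (norm f)) f"
definition dist_L2 :: "L2 \<Rightarrow> L2 \<Rightarrow> real" where "dist_L2 f g = norm (f - g)"
definition uniformity_L2 :: "(L2 \<times> L2) filter" where
  "uniformity_L2 = (INF e\<in>{0<..}. principal {(x, y). dist x y < e})"
definition open_L2 :: "L2 set \<Rightarrow> bool" where
  "open_L2 U \<longleftrightarrow> (\<forall>x\<in>U. \<forall>\<^sub>F (x', y) in uniformity. x' = x \<longrightarrow> y \<in> U)"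

instance
proof
  fix a b c :: L2 and r s :: real
  show "dist a b = norm (a - b)" by (rule dist_L2_def)
  show "sgn a = scaleR (inverse (norm a)) a" by (rule sgn_L2_def)
  show "a + b + c = a + (b + c)"
    by transfer (auto intro!: square_integrable_add simp: add.assoc)
  show "a + b = b + a" by transfer (auto intro!: square_integrable_add)
  show "0 + a = a" by transfer (auto intro!: square_integrable_add)
  show "- a + a = 0" by transfer (auto intro!: square_integrable_0)
  show "a - b = a + - b" by transfer (auto intro!: square_integrable_add square_integrable_diff square_integrable_uminus)
  show "r *\<^sub>R (a + b) = r *\<^sub>R a + r *\<^sub>R b"
    by transfer (auto intro!: square_integrable_add square_integrable_scale simp: distrib_left)
  show "(r + s) *\<^sub>R a = r *\<^sub>R a + s *\<^sub>R a"
    by transfer (auto intro!: square_integrable_add square_integrable_scale simp: distrib_right)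
  show "r *\<^sub>R s *\<^sub>R a = (r * s) *\<^sub>R a"
    by transfer (auto intro!: square_integrable_scale simp: mult.assoc)
  show "1 *\<^sub>R a = a" by transfer auto
  show "inner a b = inner b a" by transfer (simp add: mult.commute)
  show "inner (a + b) c = inner a c + inner b c"
    by transfer (auto simp: distrib_right square_integrable_mult)
  show "inner (r *\<^sub>R a) b = r * inner a b"
    by transfer (auto simp: mult.assoc)
  show "0 \<le> inner a a" by transfer auto
  show "inner a a = 0 \<longleftrightarrow> a = 0"
    by transfer (auto simp: square_integrable_eq_0_iff square_integrable_0)
  show "norm a = sqrt (inner a a)" by (rule norm_L2_def)
qed (rule uniformity_L2_def open_L2_def)+

end

text \<open>The class of \<open>f\<close>; the value \<open>0\<close> for functions that are not square integrable is a dummy.\<close>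

definition L2_of :: "(real \<Rightarrow> real) \<Rightarrow> L2" where
  "L2_of f = (if f square_integrable_on UNIV then L2_class f else 0)"

lemma fun_of_L2_square_integrable: "fun_of_L2 a square_integrable_on UNIV"
  using Quotient_rep_reflp[OF Quotient_L2, of a] by simp

lemma L2_class_fun_of_L2: "L2_class (fun_of_L2 a) = a"
  using Quotient_abs_rep[OF Quotient_L2] .

lemma fun_of_L2_class:
  "f square_integrable_on UNIV \<Longrightarrow> AE x in lebesgue. fun_of_L2 (L2_class f) x = f x"
  using Quotient_rep_abs[OF Quotient_L2, of f] by auto

lemma L2_class_eq_iff:
  "f square_integrable_on UNIV \<Longrightarrow> g square_integrable_on UNIV \<Longrightarrow>
     L2_class f = L2_class g \<longleftrightarrow> (AE x in lebesgue. f x = g x)"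
  using Quotient_rel[OF Quotient_L2, of f g] by auto

lemma L2_class_diff:
  "f square_integrable_on UNIV \<Longrightarrow> g square_integrable_on UNIV \<Longrightarrow>
     L2_class f - L2_class g = L2_class (\<lambda>x. f x - g x)"
  by (simp add: minus_L2.abs_eq)

lemma L2_class_add:
  "f square_integrable_on UNIV \<Longrightarrow> g square_integrable_on UNIV \<Longrightarrow>
     L2_class f + L2_class g = L2_class (\<lambda>x. f x + g x)"
  by (simp add: plus_L2.abs_eq)

lemma L2_class_scale:
  "f square_integrable_on UNIV \<Longrightarrow> c *\<^sub>R L2_class f = L2_class (\<lambda>x. c * f x)"
  by (simp add: scaleR_L2.abs_eq)

lemma norm_L2_class:
  "f square_integrable_on UNIV \<Longrightarrow> (norm (L2_class f))\<^sup>2 = (LINT x|lebesgue. (f x)\<^sup>2)"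
  by (simp add: norm_L2_def inner_L2.abs_eq power2_eq_square)

lemma nn_integral_L2_class:
  assumes "f square_integrable_on UNIV"
  shows "(\<integral>\<^sup>+ x. ennreal ((f x)\<^sup>2) \<partial>lebesgue) = ennreal ((norm (L2_class f))\<^sup>2)"
  using assms by (simp add: norm_L2_class nn_integral_eq_integral square_integrable_UNIV_iff)

lemma square_integrable_nn:
  assumes "f \<in> borel_measurable lebesgue" "(\<integral>\<^sup>+ x. ennreal ((f x)\<^sup>2) \<partial>lebesgue) < \<infinity>"
  shows "f square_integrable_on UNIV"
  using assms by (auto simp: square_integrable_UNIV_iff intro!: integrableI_bounded)

instance L2 :: complete_space
proof
  fix X :: "nat \<Rightarrow> L2" assume X: "Cauchy X"
  have "\<exists>N. \<forall>m\<ge>N. \<forall>n\<ge>N. norm (X m - X n) < (1/4)^k" for k :: nat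
    using X by (auto simp: Cauchy_iff)
  then obtain N where N: "\<And>k m n. N k \<le> m \<Longrightarrow> N k \<le> n \<Longrightarrow> norm (X m - X n) < (1/4)^k"
    by metis
  define r where "r k = (\<Sum>i\<le>k. Suc (N i))" for k
  have r_N: "N k \<le> r k" for k
    unfolding r_def by (rule order_trans[OF _ member_le_sum[of k]]) auto
  have r_mono: "strict_mono r"
    by (rule strict_monoI_Suc) (simp add: r_def)
  define F where "F k = fun_of_L2 (X (r k))" for k
  have F: "F k square_integrable_on UNIV" for k
    by (simp add: F_def fun_of_L2_square_integrable)
  have XF: "X (r k) = L2_class (F k)" for k
    by (simp add: F_def L2_class_fun_of_L2)
  have Fm[measurable]: "F k \<in> borel_measurable lebesgue" for k
    using F[of k] by (simp add: square_integrable_UNIV_iff)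
  have dF: "(\<integral>\<^sup>+ x. ennreal ((F m x - F n x)\<^sup>2) \<partial>lebesgue) = ennreal ((norm (X (r m) - X (r n)))\<^sup>2)" for m n
    by (simp add: XF L2_class_diff F nn_integral_L2_class square_integrable_diff)
  have small: "(\<integral>\<^sup>+ x. ennreal (2^k) * ennreal ((F (Suc k) x - F k x)\<^sup>2) \<partial>lebesgue) \<le> ennreal ((1/8)^k)" for k
  proof -
    have "norm (X (r (Suc k)) - X (r k)) < (1/4)^k"
      by (intro N r_N order_trans[OF r_N]) (auto intro: strict_mono_leD[OF r_mono])
    then have "(norm (X (r (Suc k)) - X (r k)))\<^sup>2 \<le> ((1/4)^k)\<^sup>2"
      by (intro power_mono) auto
    also have "((1/4)^k)\<^sup>2 = (1/16::real)^k"
      by (simp add: power2_eq_square flip: power_mult_distrib)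
    finally have "2^k * (norm (X (r (Suc k)) - X (r k)))\<^sup>2 \<le> 2^k * (1/16)^k"
      by simp
    also have "\<dots> = (1/8::real)^k" by (simp flip: power_mult_distrib)
    finally have le: "2^k * (norm (X (r (Suc k)) - X (r k)))\<^sup>2 \<le> (1/8::real)^k" .
    have "(\<integral>\<^sup>+ x. ennreal (2^k) * ennreal ((F (Suc k) x - F k x)\<^sup>2) \<partial>lebesgue)
        = ennreal (2^k) * (\<integral>\<^sup>+ x. ennreal ((F (Suc k) x - F k x)\<^sup>2) \<partial>lebesgue)"
      by (rule nn_integral_cmult) simp
    also have "\<dots> = ennreal (2^k * (norm (X (r (Suc k)) - X (r k)))\<^sup>2)"
      unfolding dF by (simp add: ennreal_mult)
    also have "\<dots> \<le> ennreal ((1/8)^k)" by (rule ennreal_leI[OF le])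
    finally show ?thesis .
  qed
  have "(\<integral>\<^sup>+ x. (\<Sum>k. ennreal (2^k) * ennreal ((F (Suc k) x - F k x)\<^sup>2)) \<partial>lebesgue)
      = (\<Sum>k. \<integral>\<^sup>+ x. ennreal (2^k) * ennreal ((F (Suc k) x - F k x)\<^sup>2) \<partial>lebesgue)"
    by (rule nn_integral_suminf) simp
  also have "\<dots> \<le> (\<Sum>k. ennreal ((1/8)^k))"
    by (intro suminf_le small) auto
  also have "\<dots> = ennreal (\<Sum>k. (1/8)^k)"
    by (intro suminf_ennreal2) auto
  also have "\<dots> < \<infinity>" by simp
  finally have "AE x in lebesgue. (\<Sum>k. ennreal (2^k) * ennreal ((F (Suc k) x - F k x)\<^sup>2)) \<noteq> \<infinity>"
    by (intro nn_integral_PInf_AE) auto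
  then have conv: "AE x in lebesgue. convergent (\<lambda>k. F k x)"
  proof eventually_elim
    case (elim x)
    define a where "a k = F (Suc k) x - F k x" for k
    have "(\<Sum>k. ennreal (2^k * (a k)\<^sup>2)) \<noteq> top"
      using elim by (simp add: a_def ennreal_mult)
    then have sm: "summable (\<lambda>k. 2^k * (a k)\<^sup>2)"
      by (intro summable_suminf_not_top) auto
    have "norm (a k) \<le> sqrt (\<Sum>k. 2^k * (a k)\<^sup>2) * (sqrt (1/2))^k" for k
    proof -
      have "2^k * (a k)\<^sup>2 \<le> (\<Sum>k. 2^k * (a k)\<^sup>2)"
        using sum_le_suminf[OF sm, of "{k}"] by simp
      then have "(a k)\<^sup>2 \<le> (\<Sum>k. 2^k * (a k)\<^sup>2) * (1/2)^k"
        by (simp add: field_simps)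
      then have "sqrt ((a k)\<^sup>2) \<le> sqrt ((\<Sum>k. 2^k * (a k)\<^sup>2) * (1/2)^k)"
        by (rule real_sqrt_le_mono)
      then show ?thesis unfolding real_sqrt_abs real_sqrt_mult real_sqrt_power[of "1/2"] by simp
    qed
    then have bd: "\<And>k. 0 \<le> k \<Longrightarrow> norm (a k) \<le> sqrt (\<Sum>k. 2^k * (a k)\<^sup>2) * (sqrt (1/2))^k" .
    have "summable (\<lambda>k. sqrt (1/2) ^ k)"
      by (rule summable_geometric) (simp add: real_sqrt_divide)
    then have "summable (\<lambda>k. sqrt (\<Sum>k. 2^k * (a k)\<^sup>2) * (sqrt (1/2))^k)"
      by (rule summable_mult)
    from summable_comparison_test'[OF this bd] have "summable a" .
    then have "convergent (\<lambda>n. \<Sum>k<n. a k)" by (simp add: summable_iff_convergent)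
    then have "convergent (\<lambda>n. F n x - F 0 x)"
      by (simp add: a_def sum_lessThan_telescope[of "\<lambda>n. F n x"])
    then have "convergent (\<lambda>n. (F n x - F 0 x) + F 0 x)"
      by (intro convergent_add convergent_const)
    then show ?case by simp
  qed
  define f where "f x = lim (\<lambda>k. F k x)" for x
  have fm[measurable]: "f \<in> borel_measurable lebesgue"
    unfolding f_def by measurable
  have lim: "AE x in lebesgue. (\<lambda>k. F k x) \<longlonglongrightarrow> f x"
    using conv by eventually_elim (simp add: f_def convergent_LIMSEQ_iff)
  have fatou: "(\<integral>\<^sup>+ x. ennreal ((f x - F k x)\<^sup>2) \<partial>lebesgue) \<le> ennreal (((1/4)^k)\<^sup>2)" for k
  proof -
    have "(\<integral>\<^sup>+ x. ennreal ((f x - F k x)\<^sup>2) \<partial>lebesgue)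
        = (\<integral>\<^sup>+ x. liminf (\<lambda>m. ennreal ((F m x - F k x)\<^sup>2)) \<partial>lebesgue)"
    proof (rule nn_integral_cong_AE)
      show "AE x in lebesgue. ennreal ((f x - F k x)\<^sup>2) = liminf (\<lambda>m. ennreal ((F m x - F k x)\<^sup>2))"
        using lim
      proof eventually_elim
        case (elim x)
        then have "(\<lambda>m. ennreal ((F m x - F k x)\<^sup>2)) \<longlonglongrightarrow> ennreal ((f x - F k x)\<^sup>2)"
          by (intro tendsto_intros)
        from lim_imp_Liminf[OF sequentially_bot this] show ?case by (rule sym)
      qed
    qed
    also have "\<dots> \<le> liminf (\<lambda>m. \<integral>\<^sup>+ x. ennreal ((F m x - F k x)\<^sup>2) \<partial>lebesgue)"
      by (rule nn_integral_liminf) simp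
    also have "\<dots> \<le> ennreal (((1/4)^k)\<^sup>2)"
    proof -
      have "\<forall>\<^sub>F m in sequentially. (\<integral>\<^sup>+ x. ennreal ((F m x - F k x)\<^sup>2) \<partial>lebesgue) \<le> ennreal (((1/4)^k)\<^sup>2)"
        using eventually_ge_at_top[of k]
      proof eventually_elim
        case (elim m)
        have "norm (X (r m) - X (r k)) < (1/4)^k"
          by (intro N r_N order_trans[OF r_N]) (auto intro: strict_mono_leD[OF r_mono] elim)
        then show ?case unfolding dF by (intro ennreal_leI power_mono) auto
      qed
      then show ?thesis
        by (rule order_trans[OF Liminf_le_Limsup[OF sequentially_bot] Limsup_bounded])
    qed
    finally show ?thesis .
  qed
  have sq: "(\<lambda>x. f x - F k x) square_integrable_on UNIV" for k
    by (rule square_integrable_nn) (auto intro: le_less_trans[OF fatou])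
  have f: "f square_integrable_on UNIV"
    using square_integrable_add[OF sq[of 0] F[of 0]] by simp
  have "norm (X (r k) - L2_class f) \<le> (1/4)^k" for k
  proof -
    have "ennreal ((norm (L2_class f - X (r k)))\<^sup>2) \<le> ennreal (((1/4)^k)\<^sup>2)"
      using fatou[of k] by (simp add: XF L2_class_diff f F nn_integral_L2_class sq)
    then have "(norm (L2_class f - X (r k)))\<^sup>2 \<le> ((1/4)^k)\<^sup>2"
      by (simp add: ennreal_le_iff)
    then have "norm (L2_class f - X (r k)) \<le> (1/4)^k"
      by (rule power2_le_imp_le) simp
    then show ?thesis by (simp add: norm_minus_commute)
  qed
  then have bd: "\<forall>\<^sub>F k in sequentially. norm (X (r k) - L2_class f) \<le> (1/4)^k"
    by (intro always_eventually allI)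
  have "(\<lambda>k. (1/4::real)^k) \<longlonglongrightarrow> 0" by (rule LIMSEQ_power_zero) simp
  from Lim_null_comparison[OF bd this] have "(\<lambda>k. X (r k) - L2_class f) \<longlonglongrightarrow> 0" .
  then have "(X \<circ> r) \<longlonglongrightarrow> L2_class f"
    by (subst LIM_zero_iff[symmetric]) (simp add: comp_def)
  then have "X \<longlonglongrightarrow> L2_class f"
    using Cauchy_converges_subseq[OF X r_mono] by (simp add: comp_def)
  then show "convergent X" by (rule convergentI)
qed

instance L2 :: banach ..


lemma L2_class_tendsto:
  assumes f: "f square_integrable_on UNIV" and F: "\<And>n. F n square_integrable_on UNIV"
    and g: "g square_integrable_on UNIV" and bd: "\<And>n x. \<bar>F n x\<bar> \<le> \<bar>g x\<bar>"
    and lim: "\<And>x. (\<lambda>n. F n x) \<longlonglongrightarrow> f x"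
  shows "(\<lambda>n. L2_class (F n)) \<longlonglongrightarrow> L2_class f"
proof -
  have [measurable]: "f \<in> borel_measurable lebesgue" "F n \<in> borel_measurable lebesgue" for n
    using f F by (auto simp: square_integrable_UNIV_iff)
  have fg: "\<bar>f x\<bar> \<le> \<bar>g x\<bar>" for x
    using lim[of x] by (intro LIMSEQ_le_const2[OF tendsto_rabs]) (auto simp: bd)
  have "(\<lambda>n. LINT x|lebesgue. (F n x - f x)\<^sup>2) \<longlonglongrightarrow> integral\<^sup>L lebesgue (\<lambda>x::real. 0::real)"
  proof (rule integral_dominated_convergence[where w = "\<lambda>x. 4 * (g x)\<^sup>2"])
    show "integrable lebesgue (\<lambda>x. 4 * (g x)\<^sup>2)" using g by (auto simp: square_integrable_UNIV_iff)
    show "AE x in lebesgue. (\<lambda>n. (F n x - f x)\<^sup>2) \<longlonglongrightarrow> 0"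
      using lim by (intro AE_I2) (auto intro!: tendsto_eq_intros)
    have "(F n x - f x)\<^sup>2 \<le> 4 * (g x)\<^sup>2" for n x
    proof -
      have "\<bar>F n x - f x\<bar> \<le> 2 * \<bar>g x\<bar>" using bd[of n x] fg[of x] by linarith
      then have "\<bar>F n x - f x\<bar>\<^sup>2 \<le> (2 * \<bar>g x\<bar>)\<^sup>2" by (rule power_mono) simp
      then show ?thesis by (simp add: power_mult_distrib)
    qed
    then show "AE x in lebesgue. norm ((F n x - f x)\<^sup>2) \<le> 4 * (g x)\<^sup>2" for n by simp
  qed auto
  then have "(\<lambda>n. (norm (L2_class (F n) - L2_class f))\<^sup>2) \<longlonglongrightarrow> 0"
    by (simp add: L2_class_diff f F norm_L2_class square_integrable_diff)
  then have "(\<lambda>n. sqrt ((norm (L2_class (F n) - L2_class f))\<^sup>2)) \<longlonglongrightarrow> sqrt 0"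
    by (rule tendsto_real_sqrt)
  then show ?thesis by (simp add: tendsto_norm_zero_iff LIM_zero_iff)
qed

lemma square_integrable_indicator:
  assumes "A \<in> sets lebesgue" "emeasure lebesgue A < \<infinity>"
  shows "(indicator A :: real \<Rightarrow> real) square_integrable_on UNIV"
proof -
  have "(\<lambda>x. (indicator A x :: real)\<^sup>2) = indicator A"
    by (auto simp: fun_eq_iff indicator_def)
  then show ?thesis using assms by (auto simp: square_integrable_UNIV_iff)
qed

lemma L2_class_cong: "f square_integrable_on UNIV \<Longrightarrow> g \<in> borel_measurable lebesgue \<Longrightarrow>
    AE x in lebesgue. f x = g x \<Longrightarrow> g square_integrable_on UNIV \<and> L2_class f = L2_class g"
proof -
  assume f: "f square_integrable_on UNIV" and g[measurable]: "g \<in> borel_measurable lebesgue"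
    and eq: "AE x in lebesgue. f x = g x"
  have [measurable]: "f \<in> borel_measurable lebesgue" using f by (auto simp: square_integrable_UNIV_iff)
  have "integrable lebesgue (\<lambda>x. (g x)\<^sup>2) \<longleftrightarrow> integrable lebesgue (\<lambda>x. (f x)\<^sup>2)"
    using eq by (intro integrable_cong_AE) auto
  then have "g square_integrable_on UNIV" using f by (auto simp: square_integrable_UNIV_iff)
  then show ?thesis using f eq by (simp add: L2_class_eq_iff)
qed

lemma L2_countable_dense: "\<exists>D :: L2 set. countable D \<and> closure D = UNIV"
proof -
  obtain B :: "real set set" where B: "countable B" "topological_basis B"
    using ex_countable_basis by auto
  define G where "G = Inter ` {b. finite b \<and> b \<subseteq> B}"
  have G_count: "countable G"
    unfolding G_def by (intro countable_image countable_Collect_finite_subset B)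
  have "B \<subseteq> G" unfolding G_def by (auto intro!: image_eqI[of _ _ "{_}"])
  have G_open: "open g" if "g \<in> G" for g
    using that topological_basis_open[OF B(2)] unfolding G_def by auto
  have "topological_basis G"
    unfolding topological_basis_def
  proof (intro conjI allI impI)
    show "\<forall>b\<in>G. open b" using G_open by auto
    fix U :: "real set" assume "open U"
    then show "\<exists>B'\<subseteq>G. \<Union> B' = U"
      using B(2) \<open>B \<subseteq> G\<close> unfolding topological_basis_def by (meson order_trans)
  qed
  then have "borel = sigma UNIV G" by (rule borel_eq_countable_basis[OF G_count])
  then have borel_G: "sets borel = sigma_sets UNIV G"
    by (metis Pow_UNIV sets_measure_of subset_UNIV)
  have G_int: "Int_stable G"
  proof (rule Int_stableI)
    fix a b assume "a \<in> G" "b \<in> G"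
    then obtain x y where "finite x" "x \<subseteq> B" "a = \<Inter>x" "finite y" "y \<subseteq> B" "b = \<Inter>y"
      unfolding G_def by auto
    then show "a \<inter> b \<in> G" unfolding G_def by (intro image_eqI[of _ _ "x \<union> y"]) auto
  qed
  define I where "I n = {- real n..real n}" for n
  have I_sets: "I n \<in> sets borel" for n unfolding I_def by simp
  define e where "e A n = L2_class (indicator (A \<inter> I n))" for A n
  have sqI: "(indicator (A \<inter> I n) :: real \<Rightarrow> real) square_integrable_on UNIV" if "A \<in> sets lebesgue" for A n
  proof (rule square_integrable_indicator)
    show "A \<inter> I n \<in> sets lebesgue" using that I_sets[of n] by (intro sets.Int) auto
    have "emeasure lebesgue (A \<inter> I n) \<le> emeasure lebesgue (I n)"
      using that I_sets[of n] by (intro emeasure_mono) auto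
    also have "\<dots> < \<infinity>" unfolding I_def by simp
    finally show "emeasure lebesgue (A \<inter> I n) < \<infinity>" .
  qed
  define D where "D = (\<lambda>xs. \<Sum>(q, g, n)\<leftarrow>xs. real_of_rat q *\<^sub>R e g n) ` lists (UNIV \<times> G \<times> UNIV)"
  have D_count: "countable D"
    unfolding D_def by (intro countable_image countable_lists countable_SIGMA G_count) auto
  define V where "V = closure D"
  have D0: "0 \<in> D" unfolding D_def by (auto intro!: image_eqI[of _ _ "[]"])
  have D_add: "a + b \<in> D" if "a \<in> D" "b \<in> D" for a b
  proof -
    from that obtain xs ys where "xs \<in> lists (UNIV \<times> G \<times> UNIV)" "ys \<in> lists (UNIV \<times> G \<times> UNIV)"
      "a = (\<Sum>(q, g, n)\<leftarrow>xs. real_of_rat q *\<^sub>R e g n)" "b = (\<Sum>(q, g, n)\<leftarrow>ys. real_of_rat q *\<^sub>R e g n)"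
      unfolding D_def by auto
    then show ?thesis unfolding D_def by (intro image_eqI[of _ _ "xs @ ys"]) auto
  qed
  have D_scale: "real_of_rat r *\<^sub>R a \<in> D" if "a \<in> D" for a r
  proof -
    from that obtain xs where xs: "xs \<in> lists (UNIV \<times> G \<times> UNIV)"
      "a = (\<Sum>(q, g, n)\<leftarrow>xs. real_of_rat q *\<^sub>R e g n)"
      unfolding D_def by auto
    have "real_of_rat r *\<^sub>R (\<Sum>(q, g, n)\<leftarrow>xs. real_of_rat q *\<^sub>R e g n)
        = (\<Sum>(q, g, n)\<leftarrow>map (\<lambda>(q, g, n). (r * q, g, n)) xs. real_of_rat q *\<^sub>R e g n)"
      by (induction xs) (auto simp: scaleR_add_right of_rat_mult)
    with xs show ?thesis
      unfolding D_def by (intro image_eqI[of _ _ "map (\<lambda>(q, g, n). (r * q, g, n)) xs"]) auto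
  qed
  have V0: "0 \<in> V" unfolding V_def using D0 closure_subset by auto
  have V_add: "a + b \<in> V" if "a \<in> V" "b \<in> V" for a b
  proof -
    from that obtain x y where xy: "\<And>n. x n \<in> D" "x \<longlonglongrightarrow> a" "\<And>n. y n \<in> D" "y \<longlonglongrightarrow> b"
      unfolding V_def closure_sequential by auto
    then show ?thesis unfolding V_def closure_sequential
      by (intro exI[of _ "\<lambda>n. x n + y n"]) (auto intro: D_add tendsto_add)
  qed
  have V_scale: "c *\<^sub>R a \<in> V" if "a \<in> V" for a c
  proof -
    from that obtain x where x: "\<And>n. x n \<in> D" "x \<longlonglongrightarrow> a"
      unfolding V_def closure_sequential by auto
    have "c \<in> closure \<rat>" by (simp add: Rats_closure_real)
    then obtain q where q: "\<And>n. q n \<in> \<rat>" "q \<longlonglongrightarrow> c"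
      unfolding closure_sequential by auto
    show ?thesis unfolding V_def closure_sequential
    proof (intro exI[of _ "\<lambda>n. q n *\<^sub>R x n"] conjI allI)
      show "q n *\<^sub>R x n \<in> D" for n using q(1)[of n] x(1)[of n] by (auto elim!: Rats_cases intro: D_scale)
      show "(\<lambda>n. q n *\<^sub>R x n) \<longlonglongrightarrow> c *\<^sub>R a" by (intro tendsto_scaleR q x)
    qed
  qed
  have V_diff: "a - b \<in> V" if "a \<in> V" "b \<in> V" for a b
    using V_add[OF that(1) V_scale[OF that(2), of "-1"]] by simp
  have V_lim: "a \<in> V" if "\<And>n. x n \<in> V" "x \<longlonglongrightarrow> a" for a and x :: "nat \<Rightarrow> L2"
    using that closed_sequentially[of V x a] unfolding V_def by auto
  have borel_leb: "A \<in> sets lebesgue" if "A \<in> sets borel" for A :: "real set"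
    using that by simp
  have e_G: "e g n \<in> V" if "g \<in> G" for g n
  proof -
    have "e g n \<in> D" unfolding D_def using that by (intro image_eqI[of _ _ "[(1, g, n)]"]) auto
    then show ?thesis unfolding V_def using closure_subset by auto
  qed
  have e_borel: "e A n \<in> V" if "A \<in> sets borel" for A n
  proof -
    have A: "A \<in> sigma_sets UNIV G" using that borel_G by simp
    have G_UNIV: "UNIV \<in> G" unfolding G_def by (intro image_eqI[of _ _ "{}"]) auto
    have GP: "G \<subseteq> Pow UNIV" by simp
    from G_int GP A show ?thesis
    proof (induction rule: sigma_sets_induct_disjoint)
      case (basic A)
      then show ?case by (rule e_G)
    next
      case empty
      have "e {} n = 0" unfolding e_def
        by (simp add: indicator_def[abs_def] zero_L2_def)
      then show ?case using V0 by simp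
    next
      case (compl A)
      have A: "A \<in> sets lebesgue" using compl(1) borel_leb[of A] unfolding borel_G by blast
      have "(\<lambda>x. indicator (UNIV \<inter> I n) x - indicator (A \<inter> I n) x :: real) = indicator ((UNIV - A) \<inter> I n)"
        by (auto simp: fun_eq_iff indicator_def)
      then have "e (UNIV - A) n = e UNIV n - e A n"
        unfolding e_def by (subst L2_class_diff[OF sqI sqI]) (simp_all add: A)
      then show ?case using V_diff e_G[OF G_UNIV] compl by simp
    next
      case (union A)
      have A: "A i \<in> sets lebesgue" for i using union(2) borel_leb[of "A i"] unfolding borel_G by blast
      define C where "C k = (\<Union>i<k. A i)" for k :: nat
      have C: "C k \<in> sets lebesgue" for k unfolding C_def using A by auto
      have "e (C k) n \<in> V" for k
      proof (induction k)
        case 0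
        have "e {} n = 0" unfolding e_def
          by (simp add: indicator_def[abs_def] zero_L2_def)
        then show ?case using V0 by (simp add: C_def)
      next
        case (Suc k)
        have "A k \<inter> A i = {}" if "i < k" for i
          using disjoint_family_onD[OF union(1), of k i] that by simp
        then have "A k \<inter> C k = {}" unfolding C_def by blast
        then have "(\<lambda>x. indicator (C k \<inter> I n) x + indicator (A k \<inter> I n) x :: real) = indicator (C (Suc k) \<inter> I n)"
          by (auto simp: fun_eq_iff indicator_def C_def lessThan_Suc)
        then have "e (C (Suc k)) n = e (C k) n + e (A k) n"
          unfolding e_def by (subst L2_class_add[OF sqI sqI]) (simp_all add: A C)
        then show ?case using V_add Suc union by simp
      qed
      moreover have "(\<lambda>k. e (C k) n) \<longlonglongrightarrow> e (\<Union>i. A i) n"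
        unfolding e_def
      proof (rule L2_class_tendsto[where g = "indicator (UNIV \<inter> I n)"])
        fix x
        show "(\<lambda>k. indicator (C k \<inter> I n) x :: real) \<longlonglongrightarrow> indicator (\<Union> (range A) \<inter> I n) x"
        proof (cases "x \<in> (\<Union>i. A i)")
          case True
          then obtain i where i: "x \<in> A i" by auto
          have "\<forall>\<^sub>F k in sequentially. indicator (C k \<inter> I n) x = (indicator (\<Union> (range A) \<inter> I n) x :: real)"
            using eventually_gt_at_top[of i] by eventually_elim (use i in \<open>auto simp: indicator_def C_def\<close>)
          then show ?thesis by (rule tendsto_eventually)
        next
          case False
          then have "indicator (C k \<inter> I n) x = (0::real)" for k by (auto simp: C_def)
          then show ?thesis using False by simp
        qed
      qed (use A C sqI[of UNIV n] in \<open>auto intro!: sqI simp: indicator_def\<close>)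
      ultimately show ?case by (rule V_lim)
    qed
  qed
  have e_leb: "e A n \<in> V" if A: "A \<in> sets lebesgue" for A n
  proof -
    obtain A' N' where AN: "A' \<in> sets borel" "N' \<in> null_sets lebesgue" "(A' - A) \<union> (A - A') \<subseteq> N'"
    proof -
      obtain S N N0 where "A = S \<union> N" "N \<subseteq> N0" "N0 \<in> null_sets lborel" "S \<in> sets lborel"
        using A by (rule sets_completionE)
      moreover have "N0 \<in> null_sets lebesgue"
        using \<open>N0 \<in> null_sets lborel\<close> by (simp add: null_sets_completionI)
      ultimately show ?thesis by (intro that[of S N0]) auto
    qed
    have "AE x in lebesgue. x \<notin> N'" using AN(2) by (rule AE_not_in)
    then have "AE x in lebesgue. indicator (A' \<inter> I n) x = (indicator (A \<inter> I n) x :: real)"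
      by eventually_elim (use AN(3) in \<open>auto simp: indicator_def\<close>)
    then have "e A' n = e A n"
      unfolding e_def using sqI A AN(1) by (subst L2_class_eq_iff) auto
    then show ?thesis using e_borel[OF AN(1), of n] by simp
  qed
  have ind: "L2_class (indicator A) \<in> V" if "A \<in> sets lebesgue" "emeasure lebesgue A < \<infinity>" for A
  proof -
    have "(\<lambda>n. e A n) \<longlonglongrightarrow> L2_class (indicator A)"
      unfolding e_def
    proof (rule L2_class_tendsto[where g = "indicator A"])
      fix x
      have "\<forall>\<^sub>F n in sequentially. \<bar>x\<bar> \<le> real n"
        using filterlim_real_sequentially by (auto simp: filterlim_at_top)
      then have "\<forall>\<^sub>F n in sequentially. indicator (A \<inter> I n) x = (indicator A x :: real)"
        by eventually_elim (auto simp: indicator_def I_def)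
      then show "(\<lambda>n. indicator (A \<inter> I n) x :: real) \<longlonglongrightarrow> indicator A x"
        by (rule tendsto_eventually)
    qed (use that in \<open>auto intro!: sqI square_integrable_indicator simp: indicator_def\<close>)
    then show ?thesis by (rule V_lim[rotated]) (rule e_leb[OF that(1)])
  qed
  have simple: "L2_class s \<in> V" if s: "simple_function lebesgue s" "s square_integrable_on UNIV" for s
  proof -
    have fin: "finite (range s)" using s(1) by (simp add: simple_function_def)
    have sets: "s -` {y} \<in> sets lebesgue" for y
    proof -
      have "s -` {y} \<inter> space lebesgue \<in> sets lebesgue"
        using s(2) by (intro measurable_sets[of s lebesgue borel]) (auto simp: square_integrable_UNIV_iff)
      then show ?thesis by simp
    qed
    have fm: "emeasure lebesgue (s -` {y}) < \<infinity>" if y: "y \<noteq> 0" for y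
    proof -
      have "ennreal (y\<^sup>2) * emeasure lebesgue (s -` {y}) = (\<integral>\<^sup>+ x. ennreal (y\<^sup>2) * indicator (s -` {y}) x \<partial>lebesgue)"
        using sets by (simp add: nn_integral_cmult_indicator)
      also have "\<dots> \<le> (\<integral>\<^sup>+ x. ennreal ((s x)\<^sup>2) \<partial>lebesgue)"
        by (intro nn_integral_mono) (auto simp: indicator_def)
      also have "\<dots> < \<infinity>" using nn_integral_L2_class[OF s(2)] by simp
      finally show ?thesis using y by (auto simp: ennreal_mult_less_top)
    qed
    have *: "(\<lambda>x. \<Sum>y\<in>Y. y * indicator (s -` {y}) x) square_integrable_on UNIV \<and>
          L2_class (\<lambda>x. \<Sum>y\<in>Y. y * indicator (s -` {y}) x) \<in> V"
      if "finite Y" for Y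
      using that
    proof induction
      case empty
      then show ?case using V0 by (simp add: square_integrable_0 zero_L2_def)
    next
      case (insert y Y)
      have "(\<lambda>x. y * indicator (s -` {y}) x) square_integrable_on UNIV \<and> L2_class (\<lambda>x. y * indicator (s -` {y}) x) \<in> V"
      proof (cases "y = 0")
        case True
        then show ?thesis using V0 by (simp add: square_integrable_0 zero_L2_def)
      next
        case False
        have q: "(indicator (s -` {y}) :: real \<Rightarrow> real) square_integrable_on UNIV"
          by (intro square_integrable_indicator sets fm False)
        show ?thesis
          using V_scale[OF ind[OF sets fm[OF False]], of y] q
          by (simp add: L2_class_scale square_integrable_scale)
      qed
      then have p: "(\<lambda>x. y * indicator (s -` {y}) x) square_integrable_on UNIV"
        "L2_class (\<lambda>x. y * indicator (s -` {y}) x) \<in> V" by simp_all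
      from insert.IH have q: "(\<lambda>x. \<Sum>y\<in>Y. y * indicator (s -` {y}) x) square_integrable_on UNIV"
        "L2_class (\<lambda>x. \<Sum>y\<in>Y. y * indicator (s -` {y}) x) \<in> V" by simp_all
      show ?case
        unfolding sum.insert[OF insert.hyps]
        using square_integrable_add[OF p(1) q(1)] V_add[OF p(2) q(2)] L2_class_add[OF p(1) q(1)]
        by simp
    qed
    have "(\<lambda>x. \<Sum>y\<in>range s. y * indicator (s -` {y}) x) = s"
    proof
      fix x
      have "(\<Sum>y\<in>range s. y * indicator (s -` {y}) x) = (\<Sum>y\<in>range s. if y = s x then s x else 0)"
        by (intro sum.cong) (auto simp: indicator_def)
      then show "(\<Sum>y\<in>range s. y * indicator (s -` {y}) x) = s x" using fin by simp
    qed
    then show ?thesis using *[OF fin] by simp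
  qed
  have "L2_class f \<in> V" if f: "f square_integrable_on UNIV" for f
  proof -
    have "f \<in> borel_measurable lebesgue" using f by (simp add: square_integrable_UNIV_iff)
    from borel_measurable_implies_sequence_metric[OF this, of 0]
    obtain F where F: "\<And>i. simple_function lebesgue (F i)" "\<And>x. (\<lambda>i. F i x) \<longlonglongrightarrow> f x"
      "\<And>i x. \<bar>F i x\<bar> \<le> 2 * \<bar>f x\<bar>" by auto
    have g: "(\<lambda>x. 2 * f x) square_integrable_on UNIV" using f by (rule square_integrable_scale)
    have FL: "F i square_integrable_on UNIV" for i
      unfolding square_integrable_UNIV_iff
    proof
      show m: "F i \<in> borel_measurable lebesgue" using F(1) by (rule borel_measurable_simple_function)
      have "(F i x)\<^sup>2 \<le> (2 * f x)\<^sup>2" for x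
        using F(3)[of i x] by (intro abs_le_square_iff[THEN iffD1]) (simp add: abs_mult)
      then have le: "AE x in lebesgue. norm ((F i x)\<^sup>2) \<le> norm ((2 * f x)\<^sup>2)"
        by simp
      have "(\<lambda>x. (F i x)\<^sup>2) \<in> borel_measurable lebesgue"
        using m by (rule borel_measurable_power)
      moreover have "integrable lebesgue (\<lambda>x. (2 * f x)\<^sup>2)"
        using g unfolding square_integrable_UNIV_iff by simp
      ultimately show "integrable lebesgue (\<lambda>x. (F i x)\<^sup>2)"
        using le by (metis Bochner_Integration.integrable_bound)
    qed
    have "(\<lambda>i. L2_class (F i)) \<longlonglongrightarrow> L2_class f"
      by (rule L2_class_tendsto[OF f FL g _ F(2)]) (use F(3) in \<open>auto simp: abs_mult\<close>)
    then show ?thesis by (rule V_lim[rotated]) (rule simple[OF F(1) FL])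
  qed
  then have "a \<in> V" for a
    using fun_of_L2_square_integrable[of a] L2_class_fun_of_L2[of a] by metis
  then show ?thesis using D_count unfolding V_def by auto
qed

lemma countable_dense_imp_countable_basis:
  fixes D :: "'a::metric_space set"
  assumes "countable D" "closure D = UNIV"
  shows "\<exists>B::'a set set. countable B \<and> open = generate_topology B"
proof -
  define B where "B = (\<lambda>(d, n). ball d (1 / real (Suc n))) ` (D \<times> UNIV)"
  have "topological_basis B"
  proof (rule topological_basisI)
    show "open b" if "b \<in> B" for b using that by (auto simp: B_def)
    fix U :: "'a set" and x assume "open U" "x \<in> U"
    then obtain r where r: "r > 0" "ball x r \<subseteq> U" by (meson open_contains_ball)
    obtain n where n: "1 / real (Suc n) < r / 2"
      using reals_Archimedean[of "r / 2"] r by (auto simp: field_simps)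
    have "x \<in> closure D" using assms by simp
    then obtain d where d: "d \<in> D" "dist d x < 1 / real (Suc n)"
      unfolding closure_approachable by (meson of_nat_0_less_iff zero_less_Suc zero_less_divide_1_iff)
    show "\<exists>b\<in>B. x \<in> b \<and> b \<subseteq> U"
    proof (intro bexI conjI)
      show "ball d (1 / real (Suc n)) \<in> B" unfolding B_def using d by auto
      show "x \<in> ball d (1 / real (Suc n))" using d by simp
      have "ball d (1 / real (Suc n)) \<subseteq> ball x r"
      proof
        fix y assume "y \<in> ball d (1 / real (Suc n))"
        then have "dist d y < r / 2" "dist d x < r / 2" using n d by auto
        then show "y \<in> ball x r" using dist_triangle2[of x y d] by (simp add: dist_commute)
      qed
      then show "ball d (1 / real (Suc n)) \<subseteq> U" using r by auto
    qed
  qed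
  moreover have "countable B" unfolding B_def using assms(1) by auto
  ultimately show ?thesis using topological_basis_imp_subbasis by blast
qed

instance L2 :: second_countable_topology
  using L2_countable_dense countable_dense_imp_countable_basis by intro_classes blast

instance vec :: ("{metric_space, second_countable_topology}", finite) second_countable_topology
proof
  obtain A :: "'a set set" where A: "countable A" "topological_basis A"
    using ex_countable_basis by auto
  define B where "B = (\<lambda>b :: 'b \<Rightarrow> 'a set. {x :: 'a^'b. \<forall>i. x $ i \<in> b i}) ` {b. \<forall>i. b i \<in> A}"
  have "topological_basis B"
  proof (rule topological_basisI)
    show "open b" if "b \<in> B" for b
    proof -
      from that obtain c :: "'b \<Rightarrow> 'a set" where c: "\<And>i. c i \<in> A" "b = {x. \<forall>i. x $ i \<in> c i}"
        unfolding B_def by blast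
      show ?thesis
        unfolding c(2) by (intro open_vector_box allI) (rule topological_basis_open[OF A(2) c(1)])
    qed
    fix U :: "('a^'b) set" and x assume "open U" "x \<in> U"
    then obtain S where S: "\<And>i. open (S i) \<and> x $ i \<in> S i" "\<And>y. (\<forall>i. y $ i \<in> S i) \<Longrightarrow> y \<in> U"
      unfolding open_vec_def by metis
    have "\<exists>b\<in>A. x $ i \<in> b \<and> b \<subseteq> S i" for i
      using S(1)[of i] by (meson topological_basisE[OF A(2)])
    then obtain b where b: "\<And>i. b i \<in> A" "\<And>i. x $ i \<in> b i" "\<And>i. b i \<subseteq> S i" by metis
    show "\<exists>b\<in>B. x \<in> b \<and> b \<subseteq> U"
    proof (intro bexI conjI)
      show "{y. \<forall>i. y $ i \<in> b i} \<in> B" unfolding B_def using b(1) by (intro imageI) simp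
      show "x \<in> {y. \<forall>i. y $ i \<in> b i}" using b(2) by simp
      show "{y. \<forall>i. y $ i \<in> b i} \<subseteq> U" using b(3) S(2) by blast
    qed
  qed
  moreover have "countable B"
  proof -
    have "countable (\<Pi>\<^sub>E i\<in>(UNIV :: 'b set). A)" using A by (intro countable_PiE) auto
    moreover have "{b. \<forall>i. b i \<in> A} = (\<Pi>\<^sub>E i\<in>(UNIV :: 'b set). A)" by (auto simp: PiE_UNIV_domain)
    ultimately show ?thesis unfolding B_def by simp
  qed
  ultimately show "\<exists>B::('a^'b) set set. countable B \<and> open = generate_topology B"
    using topological_basis_imp_subbasis by blast
qed


section \<open>Sobolev spaces on an interval\<close>

text \<open>
  \<open>L\<^sup>2(0,l)\<close> is represented inside \<open>L\<^sup>2(\<real>)\<close> through extension by zero, which preserves the norm.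
\<close>

definition L2_on :: "real set \<Rightarrow> L2 set" where
  "L2_on S = {f. AE x in lebesgue. x \<notin> S \<longrightarrow> fun_of_L2 f x = 0}"

definition test_functions :: "real \<Rightarrow> (real \<Rightarrow> real) set" where
  "test_functions l = {\<phi>. (\<forall>k x. (deriv ^^ k) \<phi> field_differentiable at x) \<and>
     (\<exists>a b. 0 < a \<and> a < b \<and> b < l \<and> (\<forall>x. x \<notin> {a..b} \<longrightarrow> \<phi> x = 0))}"

definition has_weak_deriv :: "real \<Rightarrow> nat \<Rightarrow> L2 \<Rightarrow> L2 \<Rightarrow> bool" where
  "has_weak_deriv l k f g \<longleftrightarrow> (\<forall>\<phi>\<in>test_functions l.
     (LINT x:{0<..<l}|lebesgue. fun_of_L2 f x * (deriv ^^ k) \<phi> x) =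
     (-1) ^ k * (LINT x:{0<..<l}|lebesgue. fun_of_L2 g x * \<phi> x))"

definition weak_deriv :: "real \<Rightarrow> nat \<Rightarrow> L2 \<Rightarrow> L2" where
  "weak_deriv l k f = (THE g. g \<in> L2_on {0<..<l} \<and> has_weak_deriv l k f g)"

definition Sobolev :: "nat \<Rightarrow> real \<Rightarrow> L2 set" where
  "Sobolev s l = {f \<in> L2_on {0<..<l}.
     \<forall>k\<le>s. \<exists>g\<in>L2_on {0<..<l}. has_weak_deriv l k f g}"

text \<open>
  \<open>point_value l f x\<close>, for \<open>x \<in> [0,l]\<close>, is the value at \<open>x\<close> of the representative of \<open>f\<close> that is
  continuous on the closed interval; it exists and is unique for \<open>f\<close> in \<open>H\<^sup>1(0,l)\<close>.
\<close>

definition point_value :: "real \<Rightarrow> L2 \<Rightarrow> real \<Rightarrow> real" where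
  "point_value l f x = (THE y. \<exists>h. continuous_on {0..l} h \<and>
     (AE z in lebesgue_on {0<..<l}. fun_of_L2 f z = h z) \<and> y = h x)"


section \<open>Function spaces on the star-shaped network\<close>

text \<open>
  The edges are the elements of the finite type \<open>'n\<close>, so that \<open>N = CARD('n)\<close>, and edge \<open>j\<close> is
  \<open>[0, len j]\<close>.  The norm of \<open>L2 ^ 'n\<close> is the Euclidean one.
\<close>

definition net_L2 :: "('n::finite \<Rightarrow> real) \<Rightarrow> (L2 ^ 'n) set" where
  "net_L2 len = {u. \<forall>j. u $ j \<in> L2_on {0<..<len j}}"

definition net_deriv :: "('n::finite \<Rightarrow> real) \<Rightarrow> nat \<Rightarrow> L2 ^ 'n \<Rightarrow> L2 ^ 'n" where
  "net_deriv len k u = (\<chi> j. weak_deriv (len j) k (u $ j))"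

definition net_Sobolev :: "nat \<Rightarrow> ('n::finite \<Rightarrow> real) \<Rightarrow> (L2 ^ 'n) set" where
  "net_Sobolev s len = {u. \<forall>j. u $ j \<in> Sobolev s (len j)}"

definition net_He :: "nat \<Rightarrow> ('n::finite \<Rightarrow> real) \<Rightarrow> (L2 ^ 'n) set" where
  "net_He s len = {u \<in> net_Sobolev s len.
     (\<forall>j. \<forall>i\<in>{1..s}. point_value (len j) (net_deriv len (i - 1) u $ j) (len j) = 0) \<and>
     (\<forall>j k. point_value (len j) (u $ j) 0 = point_value (len k) (u $ k) 0)}"

definition net_H1_norm :: "('n::finite \<Rightarrow> real) \<Rightarrow> L2 ^ 'n \<Rightarrow> real" where
  "net_H1_norm len u = sqrt (\<Sum>j\<in>UNIV. (norm (u $ j))\<^sup>2 + (norm (net_deriv len 1 u $ j))\<^sup>2)"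

text \<open>
  The space \<open>C([0,T], L\<^sup>2) \<inter> L\<^sup>2(0,T; H\<^sup>1\<^sub>e)\<close>.  As \<open>v \<mapsto> (v, v')\<close> identifies \<open>H\<^sup>1\<close> isometrically with a
  closed subspace of \<open>L\<^sup>2 \<times> L\<^sup>2\<close>, strong measurability with values in \<open>H\<^sup>1\<^sub>e\<close> is strong measurability
  of \<open>u\<close> and \<open>\<partial>\<^sub>xu\<close> with values in \<open>L\<^sup>2\<close>.  Elements are functions of \<open>t \<in> \<real>\<close> whose values outside
  \<open>[0,T]\<close> are irrelevant.
\<close>

definition energy_space :: "real \<Rightarrow> ('n::finite \<Rightarrow> real) \<Rightarrow> (real \<Rightarrow> L2 ^ 'n) set" where
  "energy_space T len = {u.
     (\<forall>t\<in>{0..T}. u t \<in> net_L2 len) \<and> continuous_on {0..T} u \<and>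
     (AE t in lebesgue_on {0<..<T}. u t \<in> net_He 1 len) \<and>
     u \<in> borel_measurable (lebesgue_on {0<..<T}) \<and>
     (\<lambda>t. net_deriv len 1 (u t)) \<in> borel_measurable (lebesgue_on {0<..<T}) \<and>
     integrable (lebesgue_on {0<..<T}) (\<lambda>t. (net_H1_norm len (u t))\<^sup>2)}"

text \<open>By continuity, the supremum over \<open>[0,T]\<close> is a maximum.\<close>

definition energy_norm :: "real \<Rightarrow> ('n::finite \<Rightarrow> real) \<Rightarrow> (real \<Rightarrow> L2 ^ 'n) \<Rightarrow> real" where
  "energy_norm T len u =
     (SUP t\<in>{0..T}. norm (u t)) +
     sqrt (LINT t|lebesgue_on {0<..<T}. (net_H1_norm len (u t))\<^sup>2)"


section \<open>The semigroup generated by the Korteweg-de Vries operator\<close>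

definition C0_semigroup_on :: "'a::real_normed_vector set \<Rightarrow> (real \<Rightarrow> 'a \<Rightarrow> 'a) \<Rightarrow> bool" where
  "C0_semigroup_on X S \<longleftrightarrow>
     (\<forall>t\<ge>0. (\<forall>x\<in>X. S t x \<in> X) \<and>
       (\<forall>x\<in>X. \<forall>y\<in>X. \<forall>a b. S t (a *\<^sub>R x + b *\<^sub>R y) = a *\<^sub>R S t x + b *\<^sub>R S t y) \<and>
       (\<exists>K. \<forall>x\<in>X. norm (S t x) \<le> K * norm x)) \<and>
     (\<forall>x\<in>X. S 0 x = x) \<and>
     (\<forall>s\<ge>0. \<forall>t\<ge>0. \<forall>x\<in>X. S (s + t) x = S s (S t x)) \<and>
     (\<forall>x\<in>X. ((\<lambda>t. S t x) \<longlongrightarrow> x) (at_right 0))"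

definition is_generator :: "'a::real_normed_vector set \<Rightarrow> (real \<Rightarrow> 'a \<Rightarrow> 'a) \<Rightarrow> 'a set \<Rightarrow> ('a \<Rightarrow> 'a) \<Rightarrow> bool" where
  "is_generator X S D A \<longleftrightarrow> D \<subseteq> X \<and>
     (\<forall>x\<in>X. \<forall>y. ((\<lambda>h. (S h x - x) /\<^sub>R h) \<longlongrightarrow> y) (at_right 0) \<longleftrightarrow> x \<in> D \<and> y = A x)"

definition kdv_operator :: "('n::finite \<Rightarrow> real) \<Rightarrow> L2 ^ 'n \<Rightarrow> L2 ^ 'n" where
  "kdv_operator len u = - net_deriv len 1 u - net_deriv len 3 u"

text \<open>The argument \<open>e1\<close> below is the edge labelled 1.\<close>

definition kdv_domain :: "real \<Rightarrow> ('n::finite \<Rightarrow> real) \<Rightarrow> 'n \<Rightarrow> (L2 ^ 'n) set" where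
  "kdv_domain \<alpha> len e1 = {u \<in> net_He 2 len \<inter> net_Sobolev 3 len.
     (\<Sum>j\<in>UNIV. point_value (len j) (net_deriv len 2 u $ j) 0) = - \<alpha> * point_value (len e1) (u $ e1) 0}"

text \<open>
  \<open>e\<^bsup>t\<A>\<^esup>\<close>.  A semigroup is determined by its generator, so the choice is immaterial for the values
  at times \<open>t \<ge> 0\<close> on \<open>net_L2 len\<close>, the only ones that are used.
\<close>

definition kdv_semigroup :: "real \<Rightarrow> ('n::finite \<Rightarrow> real) \<Rightarrow> 'n \<Rightarrow> real \<Rightarrow> L2 ^ 'n \<Rightarrow> L2 ^ 'n" where
  "kdv_semigroup \<alpha> len e1 = (SOME S. C0_semigroup_on (net_L2 len) S \<and>
     is_generator (net_L2 len) S (kdv_domain \<alpha> len e1) (kdv_operator len))"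


section \<open>Solutions\<close>

text \<open>
  Classical solutions, of class \<open>C\<^sup>1([0,T], L\<^sup>2)\<close>, of the linear system without interior source term.
  The conditions at the outer nodes and the continuity at the central node are part of \<open>net_He 2 len\<close>.
\<close>

definition classical_solution ::
  "real \<Rightarrow> ('n::finite \<Rightarrow> real) \<Rightarrow> 'n \<Rightarrow> real \<Rightarrow> L2 ^ 'n \<Rightarrow> (real \<Rightarrow> real) \<Rightarrow> (real \<Rightarrow> L2 ^ 'n) \<Rightarrow> bool" where
  "classical_solution \<alpha> len e1 T u0 g v \<longleftrightarrow>
     v 0 = u0 \<and>
     (\<forall>t\<in>{0..T}. v t \<in> net_He 2 len \<inter> net_Sobolev 3 len \<and>
       (\<Sum>j\<in>UNIV. point_value (len j) (net_deriv len 2 (v t) $ j) 0) =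
         - \<alpha> * point_value (len e1) (v t $ e1) 0 + g t \<and>
       (v has_vector_derivative kdv_operator len (v t)) (at t within {0..T})) \<and>
     continuous_on {0..T} (\<lambda>t. kdv_operator len (v t))"

definition C2_on :: "real \<Rightarrow> (real \<Rightarrow> real) \<Rightarrow> bool" where
  "C2_on T g \<longleftrightarrow> (\<exists>g' g''.
     (\<forall>t\<in>{0..T}. (g has_real_derivative g' t) (at t within {0..T}) \<and>
       (g' has_real_derivative g'' t) (at t within {0..T})) \<and>
     continuous_on {0..T} g'')"

definition homogeneous_mild_solution ::
  "real \<Rightarrow> ('n::finite \<Rightarrow> real) \<Rightarrow> 'n \<Rightarrow> real \<Rightarrow> L2 ^ 'n \<Rightarrow> (real \<Rightarrow> real) \<Rightarrow> (real \<Rightarrow> L2 ^ 'n) \<Rightarrow> bool" where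
  "homogeneous_mild_solution \<alpha> len e1 T u0 g w \<longleftrightarrow>
     w \<in> energy_space T len \<and>
     (\<exists>U0 G W.
       (\<forall>n::nat. U0 n \<in> kdv_domain \<alpha> len e1 \<and> C2_on T (G n) \<and> G n 0 = 0 \<and>
         W n \<in> energy_space T len \<and> classical_solution \<alpha> len e1 T (U0 n) (G n) (W n)) \<and>
       U0 \<longlonglongrightarrow> u0 \<and>
       (\<lambda>n. LINT t|lebesgue_on {0<..<T}. (G n t - g t)\<^sup>2) \<longlonglongrightarrow> 0 \<and>
       (\<lambda>n. energy_norm T len (\<lambda>t. W n t - w t)) \<longlonglongrightarrow> 0)"

text \<open>The data are \<open>f \<in> L\<^sup>1(0,T; L\<^sup>2)\<close> and \<open>g \<in> L\<^sup>2(0,T)\<close>; the integral is a Bochner integral.\<close>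

definition linear_mild_solution ::
  "real \<Rightarrow> ('n::finite \<Rightarrow> real) \<Rightarrow> 'n \<Rightarrow> real \<Rightarrow> L2 ^ 'n \<Rightarrow> (real \<Rightarrow> L2 ^ 'n) \<Rightarrow> (real \<Rightarrow> real) \<Rightarrow>
     (real \<Rightarrow> L2 ^ 'n) \<Rightarrow> bool" where
  "linear_mild_solution \<alpha> len e1 T u0 f g v \<longleftrightarrow>
     (AE t in lebesgue_on {0<..<T}. f t \<in> net_L2 len) \<and> integrable (lebesgue_on {0<..<T}) f \<and>
     g square_integrable_on {0<..<T} \<and>
     (\<exists>w. homogeneous_mild_solution \<alpha> len e1 T u0 g w \<and>
       (\<forall>t\<in>{0..T}. v t = (LINT s:{0..t}|lebesgue. kdv_semigroup \<alpha> len e1 (t - s) (f s)) + w t))"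

definition kdv_nonlinearity :: "('n::finite \<Rightarrow> real) \<Rightarrow> L2 ^ 'n \<Rightarrow> L2 ^ 'n" where
  "kdv_nonlinearity len u =
     (\<chi> j. L2_of (\<lambda>x. - (fun_of_L2 (u $ j) x * fun_of_L2 (net_deriv len 1 u $ j) x)))"

definition kdv_solution ::
  "real \<Rightarrow> ('n::finite \<Rightarrow> real) \<Rightarrow> 'n \<Rightarrow> real \<Rightarrow> L2 ^ 'n \<Rightarrow> (real \<Rightarrow> L2 ^ 'n) \<Rightarrow> bool" where
  "kdv_solution \<alpha> len e1 T u0 u \<longleftrightarrow>
     u \<in> energy_space T len \<and>
     linear_mild_solution \<alpha> len e1 T u0
       (\<lambda>t. kdv_nonlinearity len (u t))
       (\<lambda>t. - (real CARD('n) / 3) * (point_value (len e1) (u t $ e1) 0)\<^sup>2)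
       u"

end

theory Submission
 imports Defs
begin

text \<open>
 The solution is a fixed point in the energy space of the map that sends \<open>u\<close> to the solution of the
 linear problem with source \<open>-u \<partial>\<^sub>x u\<close> and boundary datum \<open>-N/3 u(0)\<^sup>2\<close> (\<open>step\<close>). Everything rests on
 the bound \<open>linear_mild_solution_estimate\<close> for the linear problem, with initial data in \<open>L\<^sup>2\<close>, sources
 in \<open>L\<^sup>1(0,T; L\<^sup>2)\<close> and boundary data in \<open>L\<^sup>2(0,T)\<close>. Both nonlinear terms map the energy space
 quadratically into these data spaces: the first because \<open>H\<^sup>1\<close> embeds into bounded functions, the
 second because \<open>u(0)\<^sup>2 \<le> 2 \<parallel>u\<parallel> \<parallel>\<partial>\<^sub>x u\<parallel>\<close> (\<open>nonlinearity_Lipschitz\<close>, \<open>node_square_Lipschitz\<close>). For small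
 initial data the map is therefore a contraction of a small ball (\<open>small_data_well_posed\<close>).

 The linear bound is an energy estimate. Multiplying the equation by \<open>v\<close> and using the node condition
 \<open>\<Sum> \<partial>\<^sub>x\<^sup>2 v\<^sub>j(0) = -\<alpha> v(0) + g\<close> gives
 \<open>d/dt \<parallel>v\<parallel>\<^sup>2 = -(2\<alpha> - N) v(0)\<^sup>2 + 2 g v(0) - \<Sum> (\<partial>\<^sub>x v\<^sub>j(0))\<^sup>2 + 2 (f, v)\<close>, so that \<open>\<alpha> > N/2\<close> makes the
 node dissipative. The derivative of \<open>\<Sum> \<integral> x v\<^sub>j\<^sup>2\<close> contains \<open>-3 \<parallel>\<partial>\<^sub>x v\<parallel>\<^sup>2\<close>, the smoothing effect of
 Kato, and a boundary term \<open>-2 v(0) \<Sum> \<partial>\<^sub>x v\<^sub>j(0)\<close> that, taken with a small factor, is absorbed by the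
 dissipation at the node (\<open>energy_dissipation\<close>, \<open>forced_energy_estimate\<close>).

 Existence for the linear problem starts from the stationary equation. On each edge it is solved
 explicitly through a fundamental solution; the coupling is one scalar equation for the value at the
 central node, whose coefficient is positive by the energy identity on the edges (\<open>solve_stationary\<close>).
 Thus the operator is m-dissipative and generates a contraction semigroup, the limit of implicit Euler
 steps (\<open>generates_semigroup\<close>). The semigroup in the definition of solutions is an arbitrary one with
 that generator, so the properties that are used are derived from the generator alone
 (\<open>m_dissipative_semigroup\<close>).

 Solutions for regular boundary data and sources are only constructed for finite sums of exponentials
 \<open>e\<^bsup>\<lambda>t\<^esup>\<close>: if \<open>y\<close> solves the stationary problem with spectral parameter \<open>\<lambda>\<close>, then \<open>e\<^bsup>\<lambda>t\<^esup> y\<close> solves the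
 system with exponential data, and an orbit of the semigroup corrects the initial value. These sums are
 dense in \<open>L\<^sup>2(0,T)\<close> and in \<open>L\<^sup>1(0,T; L\<^sup>2)\<close> by the theorem of Weierstrass (\<open>exp_sum_dense_L2\<close>,
 \<open>exp_sum_dense_L1\<close>), and the energy estimate carries existence and bounds over to the limit, both for
 boundary data (\<open>homogeneous_mild_solution_exists\<close>) and for the integral of Duhamel (\<open>duhamel_energy\<close>).

 Weak derivatives enter only through the representation of Sobolev functions by iterated primitives
 (\<open>Sobolev_1_rep\<close>, \<open>Sobolev_3_rep\<close>), which turns every energy identity into an integration by parts for
 absolutely continuous functions. A function in \<open>H\<^sup>1\<^sub>e\<close> is the primitive of its derivative that
 vanishes at the outer nodes, and these derivatives form a closed subspace of \<open>L\<^sup>2\<close>; completeness of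
 the energy space follows (\<open>energy_space_complete\<close>).
\<close>

section \<open>Contraction semigroups in Hilbert space\<close>

lemma norm_triangle3: "norm (a + b - c) \<le> norm a + norm b + norm (c::'a::real_normed_vector)"
 using norm_triangle_ineq4[of "a + b" c] norm_triangle_ineq[of a b] by linarith

lemma norm_triangle4: "norm (a + b + c - d) \<le> norm a + norm b + norm c + norm (d::'a::real_normed_vector)"
 using norm_triangle3[of "a + b" c d] norm_triangle_ineq[of a b] by linarith

lemma tendsto_0_if_norm_le:
 fixes f :: "nat \<Rightarrow> 'a::real_normed_vector"
 assumes "\<And>k. norm (f k) \<le> g k" "g \<longlonglongrightarrow> 0"
 shows "f \<longlonglongrightarrow> 0"
 using Lim_null_comparison[of f g sequentially] assms by simp

lemma inner_le_zero_iff: "inner w w \<le> 0 \<longleftrightarrow> (w::'a::real_inner) = 0"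
 using inner_gt_zero_iff[of w] by (auto simp: not_less[symmetric])

text \<open>
 The hypotheses of the theorem of Lumer and Phillips, relative to a closed subspace of the ambient
 Hilbert space. The density of \<open>D\<close> is a consequence, \<open>D_dense\<close>.
\<close>

locale m_dissipative =
 fixes X D :: "'a::{real_inner,banach} set" and A :: "'a \<Rightarrow> 'a"
 assumes X_subspace: "subspace X" and X_closed: "closed X"
  and D_subspace: "subspace D" and D_X: "D \<subseteq> X"
  and A_X: "x \<in> D \<Longrightarrow> A x \<in> X"
  and A_add: "x \<in> D \<Longrightarrow> y \<in> D \<Longrightarrow> A (x + y) = A x + A y"
  and A_scale: "x \<in> D \<Longrightarrow> A (c *\<^sub>R x) = c *\<^sub>R A x"
  and dissipative: "x \<in> D \<Longrightarrow> inner (A x) x \<le> 0"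
  and range_condition: "0 < h \<Longrightarrow> f \<in> X \<Longrightarrow> \<exists>u\<in>D. u - h *\<^sub>R A u = f"
begin

lemma D_diff: "x \<in> D \<Longrightarrow> y \<in> D \<Longrightarrow> x - y \<in> D"
 using D_subspace by (rule subspace_diff)

lemma X_diff: "x \<in> X \<Longrightarrow> y \<in> X \<Longrightarrow> x - y \<in> X"
 using X_subspace by (rule subspace_diff)

lemma A_diff: "x \<in> D \<Longrightarrow> y \<in> D \<Longrightarrow> A (x - y) = A x - A y"
 using A_add[of x "(-1) *\<^sub>R y"] A_scale[of y "-1"] subspace_scale[OF D_subspace, of y "-1"] by simp

lemma A_0: "A 0 = 0"
 using A_scale[of 0 0] subspace_0[OF D_subspace] by simp

lemma norm_le_resolvent:
 assumes "u \<in> D" "0 \<le> h"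
 shows "norm u \<le> norm (u - h *\<^sub>R A u)"
proof -
 have "norm u * norm u = inner u u" by (simp add: norm_eq_sqrt_inner)
 also have "\<dots> \<le> inner (u - h *\<^sub>R A u) u"
  using dissipative[OF assms(1)] assms(2) by (simp add: inner_diff_left mult_nonneg_nonpos)
 also have "\<dots> \<le> norm (u - h *\<^sub>R A u) * norm u" by (rule norm_cauchy_schwarz)
 finally show ?thesis
  by (cases "norm u = 0") (auto simp: mult_le_cancel_right)
qed

lemma resolvent_unique:
 assumes "u \<in> D" "v \<in> D" "0 \<le> h" "u - h *\<^sub>R A u = v - h *\<^sub>R A v"
 shows "u = v"
 using norm_le_resolvent[OF D_diff[OF assms(1,2)] assms(3)] assms
 by (simp add: A_diff algebra_simps)

definition J :: "real \<Rightarrow> 'a \<Rightarrow> 'a" where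
 "J h f = (THE u. u \<in> D \<and> u - h *\<^sub>R A u = f)"

lemma J_eqI: "0 < h \<Longrightarrow> u \<in> D \<Longrightarrow> u - h *\<^sub>R A u = f \<Longrightarrow> J h f = u"
 unfolding J_def
 by (rule the_equality, simp) (rule resolvent_unique[of _ u h], auto)

lemma J:
 assumes "0 < h" "f \<in> X"
 shows "J h f \<in> D" "J h f - h *\<^sub>R A (J h f) = f"
proof -
 obtain u where u: "u \<in> D" "u - h *\<^sub>R A u = f" using range_condition[OF assms] by blast
 then have "J h f = u" using assms(1) by (intro J_eqI)
 then show "J h f \<in> D" "J h f - h *\<^sub>R A (J h f) = f" using u by auto
qed

lemma J_X: "0 < h \<Longrightarrow> f \<in> X \<Longrightarrow> J h f \<in> X"
 using J(1) D_X by blast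

lemma J_norm: "0 < h \<Longrightarrow> f \<in> X \<Longrightarrow> norm (J h f) \<le> norm f"
 using norm_le_resolvent[of "J h f" h] J[of h f] by simp

lemma J_diff: "0 < h \<Longrightarrow> f \<in> X \<Longrightarrow> g \<in> X \<Longrightarrow> J h (f - g) = J h f - J h g"
proof (rule J_eqI)
 assume *: "0 < h" "f \<in> X" "g \<in> X"
 show "J h f - J h g \<in> D" using J(1) * by (intro D_diff) auto
 have "J h f - J h g - h *\<^sub>R A (J h f - J h g) = (J h f - h *\<^sub>R A (J h f)) - (J h g - h *\<^sub>R A (J h g))"
  using J(1) * by (simp add: A_diff algebra_simps)
 then show "J h f - J h g - h *\<^sub>R A (J h f - J h g) = f - g" using J(2) * by simp
qed

lemma J_scale: "0 < h \<Longrightarrow> f \<in> X \<Longrightarrow> J h (c *\<^sub>R f) = c *\<^sub>R J h f"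
proof (rule J_eqI)
 assume *: "0 < h" "f \<in> X"
 show "c *\<^sub>R J h f \<in> D" using J(1)[OF *] subspace_scale[OF D_subspace] by blast
 show "c *\<^sub>R J h f - h *\<^sub>R A (c *\<^sub>R J h f) = c *\<^sub>R f"
  using arg_cong[OF J(2)[OF *], of "\<lambda>v. c *\<^sub>R v"] J(1)[OF *] by (simp add: A_scale scaleR_right_diff_distrib mult.commute)
qed

lemma A_J:
 assumes "0 < h" "x \<in> D"
 shows "A (J h x) = J h (A x)" "A (J h x) \<in> D"
proof -
 define u where "u = J h x"
 have u: "u \<in> D" "u - h *\<^sub>R A u = x" using J[of h x] assms D_X by (auto simp: u_def)
 have "u - x = h *\<^sub>R A u" using u(2) by (simp add: algebra_simps)
 then have "A u = (1/h) *\<^sub>R (u - x)" using assms by simp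
 then have AuD: "A u \<in> D" using D_diff[OF u(1) assms(2)] subspace_scale[OF D_subspace] by simp
 have "A u - h *\<^sub>R A (A u) = A x"
  using A_diff[OF u(1) subspace_scale[OF D_subspace AuD, of h]] u A_scale[OF AuD, of h] by simp
 then have "J h (A x) = A u" using AuD assms by (intro J_eqI) auto
 then show "A (J h x) = J h (A x)" "A (J h x) \<in> D" using AuD by (auto simp: u_def)
qed

lemma J_minus: "0 < h \<Longrightarrow> x \<in> D \<Longrightarrow> J h x - x = h *\<^sub>R J h (A x)"
 using J(2)[of h x] D_X A_J(1)[of h x] by (auto simp: algebra_simps)

lemma Jn_X: "0 < h \<Longrightarrow> x \<in> X \<Longrightarrow> (J h ^^ n) x \<in> X"
 by (induction n) (auto intro: J_X)

lemma Jn_D: "0 < h \<Longrightarrow> x \<in> D \<Longrightarrow> (J h ^^ n) x \<in> D \<and> A ((J h ^^ n) x) = (J h ^^ n) (A x)"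
 by (induction n) (use J(1) D_X A_J in auto)

lemma Jn_norm: "0 < h \<Longrightarrow> x \<in> X \<Longrightarrow> norm ((J h ^^ n) x) \<le> norm x"
 by (induction n) (auto intro: order_trans[OF J_norm] Jn_X)

lemma Jn_diff: "0 < h \<Longrightarrow> x \<in> X \<Longrightarrow> y \<in> X \<Longrightarrow> (J h ^^ n) (x - y) = (J h ^^ n) x - (J h ^^ n) y"
 by (induction n) (auto simp: J_diff Jn_X)

lemma Jn_scale: "0 < h \<Longrightarrow> x \<in> X \<Longrightarrow> (J h ^^ n) (c *\<^sub>R x) = c *\<^sub>R (J h ^^ n) x"
 by (induction n) (auto simp: J_scale Jn_X)

lemma Jn_add: "0 < h \<Longrightarrow> x \<in> X \<Longrightarrow> y \<in> X \<Longrightarrow> (J h ^^ n) (x + y) = (J h ^^ n) x + (J h ^^ n) y"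
 using Jn_diff[of h x "(-1) *\<^sub>R y" n] Jn_scale[of h y n "-1"] subspace_scale[OF X_subspace, of y "-1"] by simp

lemma Jn_step: 
 assumes "0 < h" "x \<in> D"
 shows "(J h ^^ Suc n) x - (J h ^^ n) x = h *\<^sub>R (J h ^^ Suc n) (A x)"
proof -
 have "(J h ^^ Suc n) x - (J h ^^ n) x = (J h ^^ n) (J h x - x)"
  using assms J_X D_X by (subst Jn_diff) (auto simp: funpow_swap1)
 also have "\<dots> = h *\<^sub>R (J h ^^ Suc n) (A x)"
  using assms A_X J_X by (simp add: J_minus Jn_scale funpow_swap1)
 finally show ?thesis .
qed

lemma Jn_minus:
 assumes "0 < h" "x \<in> D"
 shows "norm ((J h ^^ n) x - x) \<le> real n * h * norm (A x)"
proof (induction n)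
 case (Suc n)
 have "norm (h *\<^sub>R (J h ^^ Suc n) (A x)) \<le> h * norm (A x)"
  using Jn_norm[of h "A x" "Suc n"] assms A_X by simp
 then have "norm ((J h ^^ Suc n) x - (J h ^^ n) x) \<le> h * norm (A x)"
  unfolding Jn_step[OF assms] .
 then have "norm (((J h ^^ Suc n) x - (J h ^^ n) x) + ((J h ^^ n) x - x)) \<le> h * norm (A x) + real n * h * norm (A x)"
  using Suc by (intro norm_triangle_le) auto
 then show ?case by (simp add: algebra_simps)
qed simp

lemma Jn_minus_Jm:
 assumes "0 < h" "x \<in> D" "m \<le> n"
 shows "norm ((J h ^^ n) x - (J h ^^ m) x) \<le> real (n - m) * h * norm (A x)"
proof -
 have "(J h ^^ n) x - (J h ^^ m) x = (J h ^^ m) ((J h ^^ (n - m)) x - x)"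
  using assms D_X Jn_D[OF assms(1,2), of "n - m"] funpow_add[of m "n - m" "J h"]
  by (subst Jn_diff) auto
 then have "norm ((J h ^^ n) x - (J h ^^ m) x) \<le> norm ((J h ^^ (n - m)) x - x)"
  using assms D_X Jn_norm[OF assms(1), of "(J h ^^ (n - m)) x - x" m] Jn_X[OF assms(1), of x] X_diff by auto
 then show ?thesis using Jn_minus[OF assms(1,2), of "n - m"] by linarith
qed

text \<open>
 \<open>(I - h A) - (I - h/2 A)\<^sup>2 = - h\<^sup>2/4 A\<^sup>2\<close>, so one implicit Euler step of size \<open>h\<close> and two of size
 \<open>h/2\<close> differ by \<open>O(h\<^sup>2)\<close> on the domain of \<open>A\<^sup>2\<close>, and the error of \<open>m\<close> steps is \<open>m\<close> times that.
\<close>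

lemma Jn_halve:
 assumes h: "0 < h" and x: "x \<in> D" "A x \<in> D"
 shows "norm ((J h ^^ m) x - (J (h/2) ^^ (2 * m)) x) \<le> real m * (h\<^sup>2 / 4) * norm (A (A x))"
proof (induction m)
 case (Suc m)
 have h2: "0 < h / 2" using h by simp
 define y where "y = (J (h/2) ^^ (2 * m)) x"
 have y: "y \<in> D" "A y = (J (h/2) ^^ (2 * m)) (A x)" "A y \<in> D"
  using Jn_D[OF h2 x(1)] Jn_D[OF h2 x(2)] by (auto simp: y_def)
 have AAy: "norm (A (A y)) \<le> norm (A (A x))"
  using Jn_D[OF h2 x(2), of "2*m"] Jn_norm[OF h2 A_X[OF x(2)]] y(2) by metis
 define z where "z = J (h/2) (J (h/2) y)"
 have w: "J (h/2) y \<in> D" "J (h/2) (A y) = A (J (h/2) y)" "A (J (h/2) y) \<in> D"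
  using J(1)[OF h2] y D_X A_J[OF h2 y(1)] by auto
 have z: "z \<in> D" "A z \<in> D" "A (A z) = J (h/2) (J (h/2) (A (A y)))"
  using J(1)[OF h2, of "J (h/2) y"] w D_X A_J[OF h2 w(1)] A_J[OF h2 w(3)] A_J(1)[OF h2 y(3)]
  by (auto simp: z_def)
 have "norm (A (A z)) \<le> norm (J (h/2) (A (A y)))"
  unfolding z(3) by (intro J_norm h2 J_X A_X y)
 also have "\<dots> \<le> norm (A (A y))" by (intro J_norm h2 A_X y)
 finally have AAz: "norm (A (A z)) \<le> norm (A (A x))" using AAy by linarith
 have v: "z - (h/2) *\<^sub>R A z = J (h/2) y" unfolding z_def using J(2)[OF h2] w D_X by blast
 have "J (h/2) y - (h/2) *\<^sub>R A (J (h/2) y) = y" using J(2)[OF h2] y D_X by blast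
 then have "(z - (h/2) *\<^sub>R A z) - (h/2) *\<^sub>R (A z - (h/2) *\<^sub>R A (A z)) = y"
  unfolding v[symmetric] using z subspace_scale[OF D_subspace] by (simp add: A_diff A_scale)
 moreover have halves: "(h/2) *\<^sub>R a + (h/2) *\<^sub>R a = h *\<^sub>R a" for a :: 'a by (simp flip: scaleR_add_left)
 ultimately have "z - h *\<^sub>R A z - y = - ((h\<^sup>2 / 4) *\<^sub>R A (A z))"
  using halves[of "A z"] by (simp add: algebra_simps power2_eq_square)
 then have yz: "z - h *\<^sub>R A z - y = - ((h\<^sup>2 / 4) *\<^sub>R A (A z))" .
 have "z - J h y = J h (z - h *\<^sub>R A z - y)"
 proof -
  have "J h (z - h *\<^sub>R A z) = z" by (rule J_eqI) (use h z in auto)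
  moreover have "z - h *\<^sub>R A z \<in> X" using z D_X A_X subspace_scale[OF X_subspace] X_diff by blast
  ultimately show ?thesis using y D_X h by (subst J_diff) auto
 qed
 then have "z - J h y = J h (- ((h\<^sup>2 / 4) *\<^sub>R A (A z)))" unfolding yz .
 then have "norm (z - J h y) \<le> norm (- ((h\<^sup>2 / 4) *\<^sub>R A (A z)))"
  using J_norm[OF h, of "- ((h\<^sup>2 / 4) *\<^sub>R A (A z))"] z(2) A_X subspace_scale[OF X_subspace] subspace_neg[OF X_subspace] by simp
 also have "\<dots> = (h\<^sup>2 / 4) * norm (A (A z))" by simp
 also have "\<dots> \<le> (h\<^sup>2 / 4) * norm (A (A x))" using AAz by (simp add: mult_left_mono)
 finally have 1: "norm (J h y - z) \<le> (h\<^sup>2 / 4) * norm (A (A x))" by (simp add: norm_minus_commute)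
 have "norm (J h ((J h ^^ m) x - y)) \<le> norm ((J h ^^ m) x - y)"
  using x D_X h y Jn_X[OF h] by (intro J_norm X_diff) auto
 then have 2: "norm (J h ((J h ^^ m) x) - J h y) \<le> real m * (h\<^sup>2 / 4) * norm (A (A x))"
  using Suc x D_X h y Jn_X[OF h] by (subst J_diff[symmetric]) (auto simp: y_def)
 have "norm ((J h ((J h ^^ m) x) - J h y) + (J h y - z)) \<le> real m * (h\<^sup>2 / 4) * norm (A (A x)) + (h\<^sup>2 / 4) * norm (A (A x))"
  using 1 2 by (intro norm_triangle_le) auto
 then show ?case by (simp add: z_def y_def algebra_simps)
qed simp

text \<open>
 The errors \<open>a\<^sub>h = x - J\<^sub>h x\<close> of the resolvents are Cauchy as \<open>h\<close> decreases: dissipativity applied to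
 \<open>J\<^sub>h x - J\<^sub>k x\<close> bounds \<open>\<parallel>a\<^sub>h - a\<^sub>k\<parallel>\<^sup>2\<close> by \<open>\<parallel>a\<^sub>k\<parallel>\<^sup>2 - \<parallel>a\<^sub>h\<parallel>\<^sup>2\<close>.  Their limit is annihilated by \<open>J\<^sub>1\<close>.
\<close>

lemma J_error_Cauchy:
 assumes "0 < h" "h < k" "x \<in> X"
 shows "(norm ((x - J h x) - (x - J k x)))\<^sup>2 \<le> (norm (x - J k x))\<^sup>2 - (norm (x - J h x))\<^sup>2"
proof -
 define a b where "a = x - J h x" and "b = x - J k x"
 \<comment> \<open>In terms of \<open>p > q\<close>, the generator maps the two resolvents to \<open>- p a\<close> and \<open>- q b\<close>.\<close>
 define p q where "p = 1 / h" and "q = 1 / k"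
 have pq: "0 < q" "q < p" using assms by (auto simp: p_def q_def frac_less2)
 have Jh: "A (J h x) = - (p *\<^sub>R a)"
 proof -
  have "a = - (h *\<^sub>R A (J h x))" using J[of h x] assms by (auto simp: a_def algebra_simps)
  then show ?thesis using assms by (simp add: p_def)
 qed
 have Jk: "A (J k x) = - (q *\<^sub>R b)"
 proof -
  have "b = - (k *\<^sub>R A (J k x))" using J[of k x] assms by (auto simp: b_def algebra_simps)
  then show ?thesis using assms by (simp add: q_def)
 qed
 have "inner (A (J h x - J k x)) (J h x - J k x) \<le> 0"
  using assms by (intro dissipative D_diff J) auto
 then have "inner (q *\<^sub>R b - p *\<^sub>R a) (b - a) \<le> 0"
  using assms J(1)[of h x] J(1)[of k x] by (simp add: A_diff Jh Jk) (simp add: a_def b_def)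
 then have *: "q * inner b b + p * inner a a \<le> (p + q) * inner a b"
  by (simp add: inner_diff_left inner_diff_right algebra_simps inner_commute)
 have ab: "(norm (a - b))\<^sup>2 = inner a a + inner b b - 2 * inner a b"
  by (simp add: power2_norm_eq_inner inner_diff_left inner_diff_right inner_commute)
 have "(p + q) * (norm (a - b))\<^sup>2 \<le> (p - q) * (inner b b - inner a a)"
  using * unfolding ab by (simp add: algebra_simps)
 moreover have "(p - q) * (inner b b - inner a a) \<le> (p + q) * (inner b b - inner a a)"
 proof -
  have "0 \<le> (p + q) * (norm (a - b))\<^sup>2" using pq by simp
  then have "0 \<le> (p - q) * (inner b b - inner a a)" using calculation by linarith
  then have "0 \<le> inner b b - inner a a" using pq by (simp add: zero_le_mult_iff)
  then show ?thesis using pq by (intro mult_right_mono) auto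
 qed
 ultimately have "(p + q) * (norm (a - b))\<^sup>2 \<le> (p + q) * (inner b b - inner a a)" by linarith
 then have "(norm (a - b))\<^sup>2 \<le> inner b b - inner a a" using pq by simp
 then show ?thesis by (simp add: a_def b_def power2_norm_eq_inner)
qed

lemma J_tendsto:
 assumes x: "x \<in> X"
 shows "(\<lambda>n. J ((1/2)^n) x) \<longlonglongrightarrow> x"
proof -
 define h where "h n = (1/2::real)^n" for n :: nat
 have h: "0 < h n" for n by (simp add: h_def)
 have h_mono: "h n < h m" if "m < n" for m n using that by (simp add: h_def)
 define a where "a n = x - J (h n) x" for n
 have aX: "a n \<in> X" for n unfolding a_def using x h J_X X_diff by blast
 have step: "(norm (a n - a m))\<^sup>2 \<le> (norm (a m))\<^sup>2 - (norm (a n))\<^sup>2" if "m < n" for m n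
  unfolding a_def using J_error_Cauchy[OF h h_mono[OF that] x] .
 have "decseq (\<lambda>n. (norm (a n))\<^sup>2)"
  unfolding decseq_Suc_iff
 proof
  fix n
  have "0 \<le> (norm (a (Suc n) - a n))\<^sup>2" by simp
  then show "(norm (a (Suc n)))\<^sup>2 \<le> (norm (a n))\<^sup>2" using step[of n "Suc n"] by linarith
 qed
 then have "Cauchy (\<lambda>n. (norm (a n))\<^sup>2)"
  using decseq_convergent[of "\<lambda>n. (norm (a n))\<^sup>2" 0] LIMSEQ_imp_Cauchy by (metis zero_le_power2)
 have "Cauchy a"
  unfolding Cauchy_iff
 proof (intro allI impI)
  fix e :: real assume e: "e > 0"
  then obtain N where N: "\<bar>(norm (a m))\<^sup>2 - (norm (a n))\<^sup>2\<bar> < e\<^sup>2" if "m \<ge> N" "n \<ge> N" for m n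
   using \<open>Cauchy (\<lambda>n. (norm (a n))\<^sup>2)\<close> unfolding Cauchy_iff by (metis real_norm_def zero_less_power)
  have "norm (a n - a m) < e" if "m \<ge> N" "n \<ge> N" "m < n" for m n
  proof -
   have "(norm (a n - a m))\<^sup>2 < e\<^sup>2" using step[OF that(3)] N[OF that(1,2)] by linarith
   then show ?thesis using e by (simp add: power_less_imp_less_base)
  qed
  note * = this
  have "norm (a m - a n) < e" if "m \<ge> N" "n \<ge> N" for m n
   using *[OF that] *[OF that(2,1)] e
   by (cases m n rule: linorder_cases) (simp_all add: norm_minus_commute)
  then show "\<exists>N. \<forall>m\<ge>N. \<forall>n\<ge>N. norm (a m - a n) < e" by blast
 qed
 then obtain b where b: "a \<longlonglongrightarrow> b" using Cauchy_convergent_iff convergent_def by blast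
 have bX: "b \<in> X" by (rule closed_sequentially[OF X_closed aX b])
 have "norm (J 1 b) \<le> norm (a n - b) + 2 * norm x * h n" for n
 proof -
  define y where "y = J (h n) x"
  have y: "y \<in> D" "a n = - (h n *\<^sub>R A y)" "norm y \<le> norm x"
   using J[OF h x] J_norm[OF h x] by (auto simp: y_def a_def algebra_simps)
  have "J 1 (a n) = - (h n *\<^sub>R J 1 (A y))"
   using J_scale[of 1 "A y" "- h n"] A_X y by simp
  also have "\<dots> = - (h n *\<^sub>R (J 1 y - y))" using J_minus[of 1 y] y by simp
  finally have "norm (J 1 (a n)) = h n * norm (J 1 y - y)" using h[of n] by simp
  also have "\<dots> \<le> h n * (norm x + norm x)"
   using h[of n] y D_X J_norm[of 1 y] by (intro mult_left_mono order_trans[OF norm_triangle_ineq4] add_mono) auto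
  finally have 1: "norm (J 1 (a n)) \<le> 2 * norm x * h n" by (simp add: mult_ac)
  have "norm (J 1 (a n - b)) \<le> norm (a n - b)" using aX bX X_diff by (intro J_norm) auto
  then have "norm (J 1 (a n) - J 1 b) \<le> norm (a n - b)" using aX bX by (simp add: J_diff)
  then show ?thesis using 1 norm_triangle_sub[of "J 1 b" "J 1 (a n)"] by (simp add: norm_minus_commute)
 qed
 moreover have "(\<lambda>n. norm (a n - b) + 2 * norm x * h n) \<longlonglongrightarrow> 0 + 2 * norm x * 0"
  unfolding h_def using b by (intro tendsto_intros LIMSEQ_power_zero) (auto simp: tendsto_norm_zero_iff LIM_zero_iff)
 ultimately have "norm (J 1 b) \<le> 0"
  using LIMSEQ_le_const[of "\<lambda>n. norm (a n - b) + 2 * norm x * h n" 0 "norm (J 1 b)"] by auto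
 then have "b = 0" using J[of 1 b] bX by (simp add: A_0)
 then have "(\<lambda>n. x - a n) \<longlonglongrightarrow> x - 0" using b by (intro tendsto_intros) simp
 then show ?thesis by (simp add: a_def h_def)
qed

lemma D_dense:
 assumes "x \<in> X" "0 < e"
 shows "\<exists>y\<in>D. norm (x - y) < e"
proof -
 obtain n where "norm (J ((1/2)^n) x - x) < e"
  using LIMSEQ_D[OF J_tendsto[OF assms(1)] assms(2)] by blast
 then show ?thesis using J(1)[of "(1/2)^n" x] assms by (intro bexI[of _ "J ((1/2)^n) x"]) (auto simp: norm_minus_commute)
qed

lemma D2_dense:
 assumes "x \<in> X" "0 < e"
 shows "\<exists>y\<in>D. A y \<in> D \<and> norm (x - y) < e"
proof -
 obtain z where z: "z \<in> D" "norm (x - z) < e / 2" using D_dense[of x "e/2"] assms by auto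
 obtain n where n: "norm (J ((1/2)^n) z - z) < e / 2"
  using LIMSEQ_D[OF J_tendsto[of z], of "e/2"] assms z D_X by auto
 have "norm (x - J ((1/2)^n) z) < e"
  using norm_triangle_ineq[of "x - z" "z - J ((1/2)^n) z"] n z(2) by (simp add: norm_minus_commute)
 then show ?thesis using J(1)[of "(1/2)^n" z] A_J(2)[of "(1/2)^n" z] z D_X by auto
qed


text \<open>
 \<open>e\<^bsup>tA\<^esup> x\<close> is the limit of \<open>\<lfloor>t/h\<rfloor>\<close> implicit Euler steps of size \<open>h = 2\<^bsup>-k\<^esup>\<close>.  With a step that does not
 depend on \<open>t\<close>, the semigroup law holds up to one step before passing to the limit.
\<close>

definition euler :: "nat \<Rightarrow> real \<Rightarrow> 'a \<Rightarrow> 'a" where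
 "euler k t x = (J ((1/2)^k) ^^ nat \<lfloor>2^k * t\<rfloor>) x"

definition semigroup :: "real \<Rightarrow> 'a \<Rightarrow> 'a" where
 "semigroup t x = lim (\<lambda>k. euler k t x)"

lemma euler_X: "x \<in> X \<Longrightarrow> euler k t x \<in> X"
 by (simp add: euler_def Jn_X)

lemma euler_norm: "x \<in> X \<Longrightarrow> norm (euler k t x) \<le> norm x"
 by (simp add: euler_def Jn_norm)

lemma euler_diff: "x \<in> X \<Longrightarrow> y \<in> X \<Longrightarrow> euler k t (x - y) = euler k t x - euler k t y"
 by (simp add: euler_def Jn_diff)

lemma euler_steps:
 assumes "0 \<le> t"
 shows "real (nat \<lfloor>2^k * t\<rfloor>) * (1/2)^k \<le> t" "t - (1/2)^k \<le> real (nat \<lfloor>2^k * t\<rfloor>) * (1/2)^k"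
proof -
 have "0 \<le> 2^k * t" using assms by simp
 then have n: "real (nat \<lfloor>2^k * t\<rfloor>) \<le> 2^k * t" "2^k * t - 1 \<le> real (nat \<lfloor>2^k * t\<rfloor>)" by linarith+
 have p: "(2^k * t) * (1/2)^k = t" by (simp add: field_simps power_one_over)
 show "real (nat \<lfloor>2^k * t\<rfloor>) * (1/2)^k \<le> t"
  using mult_right_mono[OF n(1), of "(1/2)^k"] p by simp
 show "t - (1/2)^k \<le> real (nat \<lfloor>2^k * t\<rfloor>) * (1/2)^k"
  using mult_right_mono[OF n(2), of "(1/2)^k"] p by (simp add: left_diff_distrib)
qed

text \<open>Halving the step turns \<open>n\<close> steps into \<open>2n\<close> or \<open>2n + 1\<close> steps of half the size.\<close>

lemma euler_step_diff:
 assumes x: "x \<in> D" "A x \<in> D" and t: "0 \<le> t"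
 shows "norm (euler (Suc k) t x - euler k t x) \<le> (t / 4 * norm (A (A x)) + norm (A x)) * (1/2)^k"
proof -
 define h where "h = (1/2::real)^k"
 define n n' where "n = nat \<lfloor>2^k * t\<rfloor>" and "n' = nat \<lfloor>2^Suc k * t\<rfloor>"
 have h: "0 < h" "(1/2)^Suc k = h / 2" by (auto simp: h_def)
 have "2 * \<lfloor>2^k * t\<rfloor> \<le> \<lfloor>2^Suc k * t\<rfloor>" "\<lfloor>2^Suc k * t\<rfloor> \<le> 2 * \<lfloor>2^k * t\<rfloor> + 1"
  unfolding power_Suc mult.assoc by linarith+
 moreover have "0 \<le> \<lfloor>2^k * t\<rfloor>" using t by simp
 ultimately have n': "2 * n \<le> n'" "n' - 2 * n \<le> 1" unfolding n_def n'_def by linarith+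
 have "norm ((J (h/2) ^^ n') x - (J (h/2) ^^ (2*n)) x) \<le> real (n' - 2*n) * (h/2) * norm (A x)"
  using h x n' by (intro Jn_minus_Jm) auto
 also have "\<dots> \<le> 1 * (h/2) * norm (A x)" using n' h by (intro mult_right_mono) auto
 also have "\<dots> \<le> h * norm (A x)" using h by (intro mult_right_mono) auto
 finally have 1: "norm ((J (h/2) ^^ n') x - (J (h/2) ^^ (2*n)) x) \<le> h * norm (A x)" .
 have "norm ((J h ^^ n) x - (J (h/2) ^^ (2 * n)) x) \<le> real n * (h\<^sup>2 / 4) * norm (A (A x))"
  using h x by (intro Jn_halve) auto
 also have "\<dots> = (real n * h) * (h / 4 * norm (A (A x)))" by (simp add: power2_eq_square)
 also have "\<dots> \<le> t * (h / 4 * norm (A (A x)))"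
  using euler_steps(1)[OF t, of k] h unfolding h_def[symmetric] n_def[symmetric] by (intro mult_right_mono) auto
 finally have 2: "norm ((J h ^^ n) x - (J (h/2) ^^ (2 * n)) x) \<le> t * (h / 4 * norm (A (A x)))" .
 have "norm (((J (h/2) ^^ n') x - (J (h/2) ^^ (2*n)) x) - ((J h ^^ n) x - (J (h/2) ^^ (2 * n)) x))
   \<le> h * norm (A x) + t * (h / 4 * norm (A (A x)))"
  using 1 2 by (intro norm_triangle_le_diff) auto
 then show ?thesis
  unfolding euler_def h(2) h_def[symmetric] n_def[symmetric] n'_def[symmetric] by (simp add: algebra_simps)
qed

lemma Cauchy_if_summable_diff:
 fixes u :: "nat \<Rightarrow> 'a"
 assumes "\<And>k. norm (u (Suc k) - u k) \<le> C * (1/2)^k"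
 shows "Cauchy u"
proof -
 have "summable (\<lambda>k. C * (1/2::real)^k)" by (intro summable_mult summable_geometric) auto
 then have "summable (\<lambda>k. u (Suc k) - u k)"
  by (rule summable_comparison_test'[where N = 0]) (use assms in auto)
 then have "convergent (\<lambda>n. \<Sum>k<n. u (Suc k) - u k)" by (simp add: summable_iff_convergent)
 then have "convergent (\<lambda>n. (u n - u 0) + u 0)"
  by (intro convergent_add convergent_const) (simp add: sum_lessThan_telescope)
 then show ?thesis by (simp add: Cauchy_convergent_iff)
qed

lemma euler_Cauchy:
 assumes x: "x \<in> X" and t: "0 \<le> t"
 shows "Cauchy (\<lambda>k. euler k t x)"
 unfolding Cauchy_iff
proof (intro allI impI)
 fix e :: real assume e: "e > 0"
 obtain y where y: "y \<in> D" "A y \<in> D" "norm (x - y) < e / 3" using D2_dense[OF x, of "e/3"] e by auto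
 have "Cauchy (\<lambda>k. euler k t y)"
  by (rule Cauchy_if_summable_diff) (rule euler_step_diff[OF y(1,2) t])
 then obtain N where N: "norm (euler m t y - euler n t y) < e / 3" if "m \<ge> N" "n \<ge> N" for m n
  unfolding Cauchy_iff using e by (metis divide_pos_pos zero_less_numeral)
 have close: "norm (euler k t x - euler k t y) < e / 3" for k
  using euler_norm[of "x - y" k t] x y D_X X_diff by (simp add: euler_diff subset_iff)
 show "\<exists>N. \<forall>m\<ge>N. \<forall>n\<ge>N. norm (euler m t x - euler n t x) < e"
 proof (intro exI allI impI)
  fix m n assume mn: "N \<le> m" "N \<le> n"
  have "norm ((euler m t x - euler m t y) + (euler m t y - euler n t y) - (euler n t x - euler n t y)) < e / 3 + e / 3 + e / 3"
   using close[of m] close[of n] N[OF mn] by (intro le_less_trans[OF norm_triangle3]) linarith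
  then show "norm (euler m t x - euler n t x) < e" by simp
 qed
qed

lemma euler_tendsto: "x \<in> X \<Longrightarrow> 0 \<le> t \<Longrightarrow> (\<lambda>k. euler k t x) \<longlonglongrightarrow> semigroup t x"
 unfolding semigroup_def using euler_Cauchy by (simp add: Cauchy_convergent_iff convergent_LIMSEQ_iff)

lemma semigroup_X: "x \<in> X \<Longrightarrow> 0 \<le> t \<Longrightarrow> semigroup t x \<in> X"
 by (rule closed_sequentially[OF X_closed euler_X euler_tendsto])

lemma semigroup_norm: "x \<in> X \<Longrightarrow> 0 \<le> t \<Longrightarrow> norm (semigroup t x) \<le> norm x"
 using euler_norm by (intro LIMSEQ_le_const2[OF tendsto_norm[OF euler_tendsto]]) auto

lemma semigroup_lin:
 assumes "x \<in> X" "y \<in> X" "0 \<le> t"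
 shows "semigroup t (a *\<^sub>R x + b *\<^sub>R y) = a *\<^sub>R semigroup t x + b *\<^sub>R semigroup t y"
proof -
 have X: "a *\<^sub>R x \<in> X" "b *\<^sub>R y \<in> X" using assms subspace_scale[OF X_subspace] by auto
 have "euler k t (a *\<^sub>R x + b *\<^sub>R y) = a *\<^sub>R euler k t x + b *\<^sub>R euler k t y" for k
  using assms X by (simp add: euler_def Jn_add Jn_scale)
 then have "(\<lambda>k. euler k t (a *\<^sub>R x + b *\<^sub>R y)) \<longlonglongrightarrow> a *\<^sub>R semigroup t x + b *\<^sub>R semigroup t y"
  using assms by (simp add: tendsto_add tendsto_scaleR euler_tendsto)
 moreover have "(\<lambda>k. euler k t (a *\<^sub>R x + b *\<^sub>R y)) \<longlonglongrightarrow> semigroup t (a *\<^sub>R x + b *\<^sub>R y)"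
  using X subspace_add[OF X_subspace] assms by (intro euler_tendsto) auto
 ultimately show ?thesis using LIMSEQ_unique by blast
qed

lemma semigroup_diff: "x \<in> X \<Longrightarrow> y \<in> X \<Longrightarrow> 0 \<le> t \<Longrightarrow> semigroup t (x - y) = semigroup t x - semigroup t y"
 using semigroup_lin[of x y t 1 "-1"] by simp

lemma semigroup_0: "x \<in> X \<Longrightarrow> semigroup 0 x = x"
 by (rule LIMSEQ_unique[OF euler_tendsto]) (auto simp: euler_def)

lemma semigroup_add_D:
 assumes x: "x \<in> D" and s: "0 \<le> s" and t: "0 \<le> t"
 shows "semigroup (s + t) x = semigroup s (semigroup t x)"
proof -
 have xX: "x \<in> X" using x D_X by auto
 define h where "h k = (1/2::real)^k" for k :: nat
 have h: "0 < h k" for k by (simp add: h_def)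
 have "norm (euler k (s + t) x - euler k s (euler k t x)) \<le> h k * norm (A x)" for k
 proof -
  define a b c where "a = nat \<lfloor>2^k * s\<rfloor>" and "b = nat \<lfloor>2^k * t\<rfloor>" and "c = nat \<lfloor>2^k * (s + t)\<rfloor>"
  have st: "0 \<le> 2^k * s" "0 \<le> 2^k * t" using s t by auto
  have abc: "a + b \<le> c" "c - (a + b) \<le> 1"
   using st unfolding a_def b_def c_def distrib_left by linarith+
  have "norm ((J (h k) ^^ c) x - (J (h k) ^^ (a + b)) x) \<le> real (c - (a + b)) * h k * norm (A x)"
   using h x abc by (intro Jn_minus_Jm) auto
  also have "\<dots> \<le> 1 * h k * norm (A x)" using abc h[of k] by (intro mult_right_mono) auto
  finally show ?thesis
   by (simp add: euler_def funpow_add a_def b_def c_def h_def)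
 qed
 moreover have "(\<lambda>k. h k * norm (A x)) \<longlonglongrightarrow> 0"
  unfolding h_def by (rule tendsto_mult_left_zero) (rule LIMSEQ_power_zero, simp)
 ultimately have 1: "(\<lambda>k. euler k (s + t) x - euler k s (euler k t x)) \<longlonglongrightarrow> 0"
  by (rule tendsto_0_if_norm_le)
 have "norm (euler k s (euler k t x) - euler k s (semigroup t x)) \<le> norm (euler k t x - semigroup t x)" for k
  using euler_norm[of "euler k t x - semigroup t x" k s] xX t euler_X semigroup_X X_diff
  by (simp add: euler_diff)
 moreover have "(\<lambda>k. norm (euler k t x - semigroup t x)) \<longlonglongrightarrow> 0"
  using euler_tendsto[OF xX t] by (simp add: tendsto_norm_zero_iff LIM_zero_iff)
 ultimately have 2: "(\<lambda>k. euler k s (euler k t x) - euler k s (semigroup t x)) \<longlonglongrightarrow> 0"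
  by (rule tendsto_0_if_norm_le)
 have 3: "(\<lambda>k. euler k s (semigroup t x)) \<longlonglongrightarrow> semigroup s (semigroup t x)"
  using xX s t semigroup_X by (intro euler_tendsto) auto
 have "(\<lambda>k. (euler k (s + t) x - euler k s (euler k t x)) + (euler k s (euler k t x) - euler k s (semigroup t x))
   + euler k s (semigroup t x)) \<longlonglongrightarrow> 0 + 0 + semigroup s (semigroup t x)"
  by (intro tendsto_add 1 2 3)
 then have "(\<lambda>k. euler k (s + t) x) \<longlonglongrightarrow> semigroup s (semigroup t x)" by simp
 then show ?thesis using euler_tendsto[OF xX, of "s + t"] s t LIMSEQ_unique by (metis add_nonneg_nonneg)
qed

lemma D_dense_seq:
 assumes "x \<in> X" obtains y where "\<And>n. y n \<in> D" "y \<longlonglongrightarrow> x"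
proof
 show "J ((1/2)^n) x \<in> D" for n using assms by (intro J) auto
 show "(\<lambda>n. J ((1/2)^n) x) \<longlonglongrightarrow> x" by (rule J_tendsto[OF assms])
qed

lemma semigroup_cont:
 assumes "\<And>n. y n \<in> X" "y \<longlonglongrightarrow> x" "0 \<le> t"
 shows "(\<lambda>n. semigroup t (y n)) \<longlonglongrightarrow> semigroup t x"
proof -
 have xX: "x \<in> X" by (rule closed_sequentially[OF X_closed assms(1,2)])
 have "norm (semigroup t (y n) - semigroup t x) \<le> norm (y n - x)" for n
  using semigroup_norm[of "y n - x" t] assms xX X_diff by (simp add: semigroup_diff)
 moreover have "(\<lambda>n. norm (y n - x)) \<longlonglongrightarrow> 0"
  using assms(2) by (simp add: tendsto_norm_zero_iff LIM_zero_iff)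
 ultimately have "(\<lambda>n. semigroup t (y n) - semigroup t x) \<longlonglongrightarrow> 0"
  by (rule tendsto_0_if_norm_le)
 then show ?thesis by (simp add: LIM_zero_iff)
qed

lemma semigroup_add:
 assumes x: "x \<in> X" and s: "0 \<le> s" and t: "0 \<le> t"
 shows "semigroup (s + t) x = semigroup s (semigroup t x)"
proof -
 obtain y where y: "\<And>n. y n \<in> D" "y \<longlonglongrightarrow> x" using D_dense_seq[OF x] by blast
 have yX: "y n \<in> X" for n using y D_X by auto
 have "(\<lambda>n. semigroup (s + t) (y n)) \<longlonglongrightarrow> semigroup (s + t) x"
  using s t by (intro semigroup_cont yX y) auto
 moreover have "(\<lambda>n. semigroup s (semigroup t (y n))) \<longlonglongrightarrow> semigroup s (semigroup t x)"
  using s t by (intro semigroup_cont yX y semigroup_X) auto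
 ultimately show ?thesis using semigroup_add_D[OF y(1) s t] by (simp add: LIMSEQ_unique)
qed

text \<open>
 As \<open>A x\<close> is only in \<open>X\<close>, it is compared with some \<open>z\<close> in \<open>D\<close>, which each step moves by \<open>O(h)\<close> only.
 The bound depends on \<open>n\<close> and \<open>h\<close> only through \<open>n h\<close>, hence survives the limit of small steps.
\<close>

lemma Jn_taylor:
 assumes "0 < h" and x: "x \<in> D" and z: "z \<in> D"
 shows "norm ((J h ^^ n) x - x - (real n * h) *\<^sub>R A x)
   \<le> (real n * h) * (2 * norm (A x - z) + (real n * h) * norm (A z))"
proof (induction n)
 case (Suc n)
 have zX: "z \<in> X" using z D_X by auto
 have "(J h ^^ Suc n) (A x) - A x = (J h ^^ Suc n) (A x - z) + ((J h ^^ Suc n) z - z) - (A x - z)"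
  using assms A_X zX by (subst Jn_diff) auto
 also have "norm \<dots> \<le> norm ((J h ^^ Suc n) (A x - z)) + norm ((J h ^^ Suc n) z - z) + norm (A x - z)"
  by (rule norm_triangle3)
 also have "\<dots> \<le> norm (A x - z) + real (Suc n) * h * norm (A z) + norm (A x - z)"
  using assms A_X zX X_diff Jn_minus[OF assms(1) z, of "Suc n"]
  by (intro add_mono Jn_norm) auto
 finally have step: "norm (h *\<^sub>R ((J h ^^ Suc n) (A x) - A x)) \<le> h * (2 * norm (A x - z) + real (Suc n) * h * norm (A z))"
  using assms by simp
 have "(J h ^^ Suc n) x - x - (real (Suc n) * h) *\<^sub>R A x
   = ((J h ^^ n) x - x - (real n * h) *\<^sub>R A x) + h *\<^sub>R ((J h ^^ Suc n) (A x) - A x)"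
  using Jn_step[OF assms(1,2), of n] by (simp add: algebra_simps)
 then have "norm ((J h ^^ Suc n) x - x - (real (Suc n) * h) *\<^sub>R A x)
   \<le> norm ((J h ^^ n) x - x - (real n * h) *\<^sub>R A x) + norm (h *\<^sub>R ((J h ^^ Suc n) (A x) - A x))"
  by (metis norm_triangle_ineq)
 also have "\<dots> \<le> (real n * h) * (2 * norm (A x - z) + (real n * h) * norm (A z))
    + h * (2 * norm (A x - z) + real (Suc n) * h * norm (A z))"
  using Suc step by (rule add_mono)
 also have "\<dots> \<le> (real n * h) * (2 * norm (A x - z) + (real (Suc n) * h) * norm (A z))
    + h * (2 * norm (A x - z) + real (Suc n) * h * norm (A z))"
  using assms by (intro add_mono mult_left_mono mult_right_mono) auto
 finally show ?case by (simp add: algebra_simps)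
qed simp

lemma semigroup_taylor:
 assumes x: "x \<in> D" and z: "z \<in> D" and t: "0 \<le> t"
 shows "norm (semigroup t x - x - t *\<^sub>R A x) \<le> t * (2 * norm (A x - z) + t * norm (A z))"
proof -
 define \<tau> where "\<tau> k = real (nat \<lfloor>2^k * t\<rfloor>) * (1/2)^k" for k :: nat
 have "(\<lambda>k. (1/2::real)^k) \<longlonglongrightarrow> 0" by (intro LIMSEQ_power_zero) auto
 then have lim: "(\<lambda>k. t - (1/2::real)^k) \<longlonglongrightarrow> t" by (auto intro: tendsto_eq_intros)
 have \<tau>: "\<tau> \<longlonglongrightarrow> t"
  by (rule real_tendsto_sandwich[OF _ _ lim tendsto_const])
   (use euler_steps[OF t] in \<open>auto simp: \<tau>_def\<close>)
 have "norm (euler k t x - x - \<tau> k *\<^sub>R A x) \<le> \<tau> k * (2 * norm (A x - z) + \<tau> k * norm (A z))" for k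
  unfolding \<tau>_def euler_def by (rule Jn_taylor[OF _ x z]) simp
 moreover have "(\<lambda>k. norm (euler k t x - x - \<tau> k *\<^sub>R A x)) \<longlonglongrightarrow> norm (semigroup t x - x - t *\<^sub>R A x)"
  using x D_X t by (intro tendsto_intros \<tau> euler_tendsto) auto
 moreover have "(\<lambda>k. \<tau> k * (2 * norm (A x - z) + \<tau> k * norm (A z))) \<longlonglongrightarrow> t * (2 * norm (A x - z) + t * norm (A z))"
  by (intro tendsto_intros \<tau>)
 ultimately show ?thesis by (intro LIMSEQ_le) auto
qed

text \<open>By density \<open>z\<close> can be taken close to \<open>A x\<close> in the Taylor estimate.\<close>

lemma semigroup_deriv_0:
 assumes x: "x \<in> D"
 shows "((\<lambda>h. (semigroup h x - x) /\<^sub>R h) \<longlongrightarrow> A x) (at_right 0)"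
proof (rule tendstoI)
 fix e :: real assume e: "e > 0"
 obtain z where z: "z \<in> D" "norm (A x - z) < e / 4" using D_dense[OF A_X[OF x], of "e/4"] e by auto
 \<comment> \<open>makes \<open>h * norm (A z)\<close> smaller than \<open>e / 2\<close> for \<open>h < d\<close>\<close>
 define d where "d = e / (2 * (norm (A z) + 1))"
 have d: "0 < d" using e by (simp add: d_def add_nonneg_pos)
 show "\<forall>\<^sub>F h in at_right 0. dist ((semigroup h x - x) /\<^sub>R h) (A x) < e"
  using eventually_at_right_real[OF d]
 proof eventually_elim
  case (elim h)
  then have h: "0 < h" "h < d" by auto
  have "norm (semigroup h x - x - h *\<^sub>R A x) \<le> h * (2 * norm (A x - z) + h * norm (A z))"
   using h by (intro semigroup_taylor x z) auto
  also have "h * norm (A z) \<le> d * (norm (A z) + 1)" using h by (intro mult_mono) auto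
  also have "d * (norm (A z) + 1) = e / 2" unfolding d_def by (simp add: field_simps add_nonneg_eq_0_iff)
  also have "h * (2 * norm (A x - z) + e / 2) < h * e" using h z by (intro mult_strict_left_mono) auto
  finally have "norm (semigroup h x - x - h *\<^sub>R A x) < h * e" using h by simp
  moreover have "(semigroup h x - x) /\<^sub>R h - A x = (semigroup h x - x - h *\<^sub>R A x) /\<^sub>R h"
   using h by (simp add: algebra_simps)
  ultimately have "norm ((semigroup h x - x) /\<^sub>R h - A x) < e"
   using h by (simp add: pos_divide_less_eq mult.commute divide_inverse_commute[symmetric])
  then show ?case by (simp add: dist_norm)
 qed
qed

text \<open>
 The generator \<open>B\<close> of the limit semigroup extends \<open>A\<close> and is dissipative because the semigroup
 contracts; as \<open>I - A\<close> is onto and \<open>I - B\<close> is injective, \<open>B\<close> is no larger than \<open>A\<close>.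
\<close>

theorem generates_semigroup: "C0_semigroup_on X semigroup" "is_generator X semigroup D A"
proof -
 show "C0_semigroup_on X semigroup"
  unfolding C0_semigroup_on_def
 proof (intro conjI allI impI ballI)
  show "\<exists>K. \<forall>x\<in>X. norm (semigroup t x) \<le> K * norm x" if "0 \<le> t" for t
   using semigroup_norm that by (intro exI[of _ 1]) auto
  fix x assume x: "x \<in> X"
  show "((\<lambda>t. semigroup t x) \<longlongrightarrow> x) (at_right 0)"
  proof (rule tendstoI)
   fix e :: real assume e: "e > 0"
   obtain y where y: "y \<in> D" "norm (x - y) < e / 3" using D_dense[OF x, of "e/3"] e by auto
   have yX: "y \<in> X" using y D_X by auto
   have "((\<lambda>t. t * (2 * norm (A y - 0) + t * norm (A 0))) \<longlongrightarrow> 0 * (2 * norm (A y - 0) + 0 * norm (A 0))) (at_right (0::real))"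
    by (intro tendsto_intros)
   from tendstoD[OF this, of "e / 6"] e
   have ev1: "\<forall>\<^sub>F t in at_right 0. \<bar>t * (2 * norm (A y - 0) + t * norm (A 0))\<bar> < e / 6"
    by (simp add: dist_real_def)
   have "((\<lambda>t. t *\<^sub>R A y) \<longlongrightarrow> 0 *\<^sub>R A y) (at_right (0::real))" by (intro tendsto_intros)
   from tendstoD[OF this, of "e / 6"] e
   have ev2: "\<forall>\<^sub>F t in at_right 0. norm (t *\<^sub>R A y) < e / 6" by (simp add: dist_norm)
   have pos: "\<forall>\<^sub>F t in at_right (0::real). 0 < t" by (simp add: eventually_at_filter)
   show "\<forall>\<^sub>F t in at_right 0. dist (semigroup t x) x < e"
    using ev1 ev2 pos
   proof eventually_elim
    case (elim t)
    have 1: "norm (semigroup t (x - y)) \<le> norm (x - y)" using elim x yX X_diff by (intro semigroup_norm) auto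
    have 2: "norm (semigroup t y - y - t *\<^sub>R A y) \<le> t * (2 * norm (A y - 0) + t * norm (A 0))"
     using elim y subspace_0[OF D_subspace] by (intro semigroup_taylor) auto
    have "semigroup t x - x = semigroup t (x - y) + (semigroup t y - y - t *\<^sub>R A y) + t *\<^sub>R A y - (x - y)"
     using x yX elim by (simp add: semigroup_diff)
    also have "norm \<dots> < e / 3 + e / 6 + e / 6 + e / 3"
     using 1 2 elim y by (intro le_less_trans[OF norm_triangle4]) linarith
    finally show ?case by (simp add: dist_norm)
   qed
  qed
 qed (auto simp: semigroup_X semigroup_lin semigroup_0 semigroup_add)
 show "is_generator X semigroup D A"
  unfolding is_generator_def
 proof (intro conjI[OF D_X] ballI allI iffI)
  fix x y assume x: "x \<in> X" and lim: "((\<lambda>h. (semigroup h x - x) /\<^sub>R h) \<longlongrightarrow> y) (at_right 0)"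
  have pos: "\<forall>\<^sub>F t in at_right (0::real). 0 < t" by (simp add: eventually_at_filter)
  have "\<forall>\<^sub>F h in at_right 0. (semigroup h x - x) /\<^sub>R h \<in> X"
   using pos by eventually_elim (use x X_diff semigroup_X subspace_scale[OF X_subspace] in auto)
  then have y: "y \<in> X" by (rule Lim_in_closed_set[OF X_closed _ _ lim]) simp
  define u where "u = J 1 (x - y)"
  have u: "u \<in> D" "u - A u = x - y" "u \<in> X" using J[of 1 "x - y"] x y X_diff D_X by (auto simp: u_def)
  define w where "w = x - u"
  have w: "w \<in> X" "y - A u = w" using u x X_diff by (auto simp: w_def algebra_simps)
  have "((\<lambda>h. (semigroup h x - x) /\<^sub>R h - (semigroup h u - u) /\<^sub>R h) \<longlongrightarrow> y - A u) (at_right 0)"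
   by (intro tendsto_diff lim semigroup_deriv_0 u)
  moreover have "\<forall>\<^sub>F h in at_right 0. (semigroup h x - x) /\<^sub>R h - (semigroup h u - u) /\<^sub>R h = (semigroup h w - w) /\<^sub>R h"
   using pos by eventually_elim (use x u in \<open>auto simp: w_def semigroup_diff algebra_simps\<close>)
  ultimately have "((\<lambda>h. (semigroup h w - w) /\<^sub>R h) \<longlongrightarrow> w) (at_right 0)"
   using w by (auto elim: Lim_transform_eventually)
  then have lim': "((\<lambda>h. inner ((semigroup h w - w) /\<^sub>R h) w) \<longlongrightarrow> inner w w) (at_right 0)"
   by (intro tendsto_inner tendsto_const)
  have "\<forall>\<^sub>F h in at_right 0. inner ((semigroup h w - w) /\<^sub>R h) w \<le> 0"
   using pos
  proof eventually_elim
   case (elim h)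
   have "inner (semigroup h w) w \<le> norm w * norm w"
    using norm_cauchy_schwarz[of "semigroup h w" w] semigroup_norm[of w h] w elim
    by (meson less_imp_le mult_right_mono norm_ge_zero order_trans)
   then have "inner (semigroup h w - w) w \<le> 0"
    by (simp add: inner_diff_left power2_norm_eq_inner[symmetric] power2_eq_square)
   then show ?case using elim by (simp add: mult_nonneg_nonpos)
  qed
  then have "inner w w \<le> 0" by (rule tendsto_upperbound[OF lim']) simp
  then have "w = 0" by (simp add: inner_le_zero_iff)
  then show "x \<in> D \<and> y = A x" using u w by (simp add: w_def)
 qed (use semigroup_deriv_0 in auto)
qed

end


text \<open>
 The principle of uniform boundedness for maps that are linear on a closed subspace only: the points
 with orbit bounded by \<open>m\<close> form closed sets that exhaust the subspace, so by Baire one of them has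
 interior points.
\<close>

lemma uniform_boundedness_subspace:
 fixes X :: "'a::banach set" and T :: "nat \<Rightarrow> 'a \<Rightarrow> 'b::real_normed_vector"
 assumes X: "subspace X" "closed X"
  and diff: "\<And>n x y. x \<in> X \<Longrightarrow> y \<in> X \<Longrightarrow> T n (x - y) = T n x - T n y"
  and scale: "\<And>n x c. x \<in> X \<Longrightarrow> T n (c *\<^sub>R x) = c *\<^sub>R T n x"
  and bounded: "\<And>n. \<exists>K. \<forall>x\<in>X. norm (T n x) \<le> K * norm x"
  and pointwise: "\<And>x. x \<in> X \<Longrightarrow> \<exists>M. \<forall>n. norm (T n x) \<le> M"
 shows "\<exists>M. \<forall>n. \<forall>x\<in>X. norm (T n x) \<le> M * norm x"
proof -
 obtain K where K: "\<And>n x. x \<in> X \<Longrightarrow> norm (T n x) \<le> K n * norm x" using bounded by metis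
 define F where "F m = {x \<in> X. \<forall>n. norm (T n x) \<le> real m}" for m :: nat
 have cont: "continuous_on X (T n)" for n
 proof (rule continuous_onI)
  fix x e :: real and x0 assume "x0 \<in> X" "(0::real) < e"
  then show "\<exists>d>0. \<forall>x'\<in>X. dist x' x0 < d \<longrightarrow> dist (T n x') (T n x0) \<le> e"
  proof (intro exI[of _ "e / (\<bar>K n\<bar> + 1)"] conjI ballI impI)
   fix x' assume x': "x' \<in> X" "dist x' x0 < e / (\<bar>K n\<bar> + 1)"
   have "norm (T n x' - T n x0) \<le> K n * norm (x' - x0)"
    using K[of "x' - x0" n] diff[of x' x0 n] x' \<open>x0 \<in> X\<close> subspace_diff[OF X(1)] by simp
   also have "\<dots> \<le> (\<bar>K n\<bar> + 1) * norm (x' - x0)" by (intro mult_right_mono) auto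
   also have "\<dots> \<le> e" using x'(2) by (simp add: dist_norm field_simps)
   finally show "dist (T n x') (T n x0) \<le> e" by (simp add: dist_norm)
  qed auto
 qed
 have closedF: "closed (F m)" for m
 proof -
  have "F m = (\<Inter>n. {x \<in> X. norm (T n x) \<le> real m})" by (auto simp: F_def)
  moreover have "closed {x \<in> X. norm (T n x) \<le> real m}" for n
  proof -
   have "closed (X \<inter> T n -` cball 0 (real m))"
    using cont X(2) by (intro continuous_closed_preimage) auto
   moreover have "X \<inter> T n -` cball 0 (real m) = {x \<in> X. norm (T n x) \<le> real m}" by auto
   ultimately show ?thesis by simp
  qed
  ultimately show ?thesis by auto
 qed
 have un: "(\<Union>m. F m) = X"
 proof
  show "X \<subseteq> (\<Union>m. F m)"
  proof
   fix x assume x: "x \<in> X"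
   then obtain M where M: "\<And>n. norm (T n x) \<le> M" using pointwise by blast
   obtain m where "M \<le> real m" using real_arch_simple by blast
   then have "x \<in> F m" using x M order_trans by (auto simp: F_def)
   then show "x \<in> (\<Union>m. F m)" by blast
  qed
 qed (auto simp: F_def)
 have "\<exists>m. (top_of_set X) interior_of (F m) \<noteq> {}"
 proof (rule ccontr)
  assume *: "\<not> (\<exists>m. (top_of_set X) interior_of (F m) \<noteq> {})"
  have "(top_of_set X) interior_of \<Union>(range F) = {}"
  proof (rule Baire_category_alt)
   show "completely_metrizable_space (top_of_set X) \<or> locally_compact_space (top_of_set X) \<and> regular_space (top_of_set X)"
    using X(2) closed_closedin completely_metrizable_space_closedin completely_metrizable_space_euclidean by blast
   show "countable (range F)" by simp
   show "closedin (top_of_set X) S \<and> (top_of_set X) interior_of S = {}" if S: "S \<in> range F" for S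
    using * S closedF by (auto intro!: closed_subset simp: F_def)
  qed
  then have "X = {}" using interior_of_topspace[of "top_of_set X"] un by simp
  then show False using subspace_0[OF X(1)] by simp
 qed
 then obtain m x where "x \<in> (top_of_set X) interior_of (F m)" by blast
 then obtain U where U: "openin (top_of_set X) U" "x \<in> U" "U \<subseteq> F m"
  unfolding interior_of_def by blast
 then obtain r where r: "r > 0" "ball x r \<inter> X \<subseteq> U" "x \<in> X"
  unfolding openin_contains_ball by blast
 have bd: "norm (T n y) \<le> (4 * real m / r) * norm y" if y: "y \<in> X" for n y
 proof (cases "y = 0")
  case True
  then show ?thesis using K[OF y, of n] by simp
 next
  case False
  \<comment> \<open>so that \<open>x - c y\<close> stays in the ball around \<open>x\<close>\<close>
  define c where "c = r / (2 * norm y)"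
  have c: "c > 0" using r False by (simp add: c_def)
  have cy: "c *\<^sub>R y \<in> X" using X(1) y by (rule subspace_scale)
  have "x - c *\<^sub>R y \<in> ball x r"
   using r False by (simp add: dist_norm c_def)
  then have "x - c *\<^sub>R y \<in> F m" using U r subspace_diff[OF X(1) r(3) cy] by blast
  moreover have "x \<in> F m" using U by blast
  ultimately have "norm (T n x - T n (x - c *\<^sub>R y)) \<le> real m + real m"
   unfolding F_def by (intro norm_triangle_le_diff add_mono) auto
  then have "c * norm (T n y) \<le> 2 * real m"
   using diff[OF r(3) cy, of n] scale[OF y, of n c] c by simp
  then show ?thesis using c False r by (simp add: c_def field_simps)
 qed
 then show ?thesis by blast
qed

text \<open>
 Any strongly continuous semigroup generated by \<open>A\<close> contracts.  Strong continuity is only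
 assumed from the right at \<open>0\<close>; uniform boundedness turns it into local boundedness, which
 gives left derivatives of the orbits.
\<close>

locale m_dissipative_semigroup = m_dissipative X D A
 for X D :: "'a::{real_inner,banach} set" and A :: "'a \<Rightarrow> 'a" +
 fixes S :: "real \<Rightarrow> 'a \<Rightarrow> 'a"
 assumes C0: "C0_semigroup_on X S" and generator: "is_generator X S D A"
begin

lemma S_X: "0 \<le> t \<Longrightarrow> x \<in> X \<Longrightarrow> S t x \<in> X"
 using C0 unfolding C0_semigroup_on_def by blast

lemma S_lin: "0 \<le> t \<Longrightarrow> x \<in> X \<Longrightarrow> y \<in> X \<Longrightarrow> S t (a *\<^sub>R x + b *\<^sub>R y) = a *\<^sub>R S t x + b *\<^sub>R S t y"
 using C0 unfolding C0_semigroup_on_def by blast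

lemma S_scale: "0 \<le> t \<Longrightarrow> x \<in> X \<Longrightarrow> S t (a *\<^sub>R x) = a *\<^sub>R S t x"
 using S_lin[of t x x a 0] by simp

lemma S_diff: "0 \<le> t \<Longrightarrow> x \<in> X \<Longrightarrow> y \<in> X \<Longrightarrow> S t (x - y) = S t x - S t y"
 using S_lin[of t x y 1 "-1"] by simp

lemma S_bounded: "0 \<le> t \<Longrightarrow> \<exists>K. \<forall>x\<in>X. norm (S t x) \<le> K * norm x"
 using C0 unfolding C0_semigroup_on_def by blast

lemma S_0: "x \<in> X \<Longrightarrow> S 0 x = x"
 using C0 unfolding C0_semigroup_on_def by blast

lemma S_semigroup: "0 \<le> s \<Longrightarrow> 0 \<le> t \<Longrightarrow> x \<in> X \<Longrightarrow> S (s + t) x = S s (S t x)"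
 using C0 unfolding C0_semigroup_on_def by blast

lemma S_tendsto_0: "x \<in> X \<Longrightarrow> ((\<lambda>t. S t x) \<longlongrightarrow> x) (at_right 0)"
 using C0 unfolding C0_semigroup_on_def by blast

lemma S_near_0:
 assumes "x \<in> X" "0 < e"
 shows "\<exists>d>0. \<forall>h. 0 \<le> h \<and> h < d \<longrightarrow> norm (S h x - x) < e"
proof -
 have "\<forall>\<^sub>F h in at_right 0. norm (S h x - x) < e"
  using tendstoD[OF S_tendsto_0[OF assms(1)] assms(2)] by (simp add: dist_norm)
 then obtain d where "d > 0" "\<And>h. 0 < h \<Longrightarrow> h < d \<Longrightarrow> norm (S h x - x) < e"
  unfolding eventually_at_right_field by blast
 then show ?thesis using assms S_0
  by (intro exI[of _ d]) (metis diff_self norm_zero order_le_less)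
qed

text \<open>
 Otherwise there are times \<open>t\<^sub>n\<close> tending to \<open>0\<close> along which the operators are unbounded although they
 converge pointwise.
\<close>

lemma S_bounded_near_0: "\<exists>d>0. \<exists>M. \<forall>t x. 0 \<le> t \<and> t \<le> d \<and> x \<in> X \<longrightarrow> norm (S t x) \<le> M * norm x"
proof (rule ccontr)
 assume "\<not> ?thesis"
 then have "\<exists>t x. 0 \<le> t \<and> t \<le> 1 / real (Suc n) \<and> x \<in> X \<and> \<not> norm (S t x) \<le> real n * norm x" for n
  by (meson of_nat_0_less_iff zero_less_Suc zero_less_divide_1_iff)
 then obtain t x where t: "\<And>n. 0 \<le> t n" "\<And>n. t n \<le> 1 / real (Suc n)"
  and x: "\<And>n. x n \<in> X" "\<And>n. \<not> norm (S (t n) (x n)) \<le> real n * norm (x n)" by metis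
 have t0: "t \<longlonglongrightarrow> 0"
  by (rule real_tendsto_sandwich[OF _ _ tendsto_const LIMSEQ_inverse_real_of_nat])
   (use t in \<open>auto simp: inverse_eq_divide\<close>)
 have "\<exists>M. \<forall>n. norm (S (t n) y) \<le> M" if y: "y \<in> X" for y
 proof -
  have "(\<lambda>n. S (t n) y) \<longlonglongrightarrow> y"
  proof (rule LIMSEQ_I)
   fix e :: real assume "0 < e"
   then obtain d where d: "d > 0" "\<And>h. 0 \<le> h \<Longrightarrow> h < d \<Longrightarrow> norm (S h y - y) < e"
    using S_near_0[OF y] by blast
   obtain N where "\<And>n. n \<ge> N \<Longrightarrow> norm (t n - 0) < d" using LIMSEQ_D[OF t0 d(1)] by blast
   then show "\<exists>N. \<forall>n\<ge>N. norm (S (t n) y - y) < e" using d t(1) by (intro exI[of _ N]) auto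
  qed
  then have "Bseq (\<lambda>n. S (t n) y)" by (intro convergent_imp_Bseq) (auto simp: convergent_def)
  then show ?thesis unfolding Bseq_def by blast
 qed
 then have "\<exists>M. \<forall>n. \<forall>x\<in>X. norm (S (t n) x) \<le> M * norm x"
  using t by (intro uniform_boundedness_subspace X_subspace X_closed S_diff S_scale S_bounded)
 then obtain M where M: "\<And>n x. x \<in> X \<Longrightarrow> norm (S (t n) x) \<le> M * norm x" by blast
 obtain n where "M \<le> real n" using real_arch_simple by blast
 then have "M * norm (x n) \<le> real n * norm (x n)" by (intro mult_right_mono) auto
 then show False using M[OF x(1), of n n] x(2)[of n] by linarith
qed

lemma S_locally_bounded: "\<exists>M\<ge>0. \<forall>t x. 0 \<le> t \<and> t \<le> \<tau> \<and> x \<in> X \<longrightarrow> norm (S t x) \<le> M * norm x"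
proof -
 obtain d M where d: "d > 0" and M: "\<And>t x. 0 \<le> t \<Longrightarrow> t \<le> d \<Longrightarrow> x \<in> X \<Longrightarrow> norm (S t x) \<le> M * norm x"
  using S_bounded_near_0 by blast
 define M' where "M' = max 1 M"
 have M': "norm (S t x) \<le> M' * norm x" if "0 \<le> t" "t \<le> d" "x \<in> X" for t x
  using M[OF that] mult_right_mono[of M M' "norm x"] by (simp add: M'_def)
 have "M' \<ge> 1" by (simp add: M'_def)
 have *: "norm (S t x) \<le> M' ^ n * norm x" if "0 \<le> t" "t \<le> real n * d" "x \<in> X" for n t x
  using that
 proof (induction n arbitrary: t)
  case 0
  then show ?case using S_0 by simp
 next
  case (Suc n)
  show ?case
  proof (cases "t \<le> d")
   case True
   have "M' ^ 1 \<le> M' ^ Suc n" using \<open>M' \<ge> 1\<close> by (intro power_increasing) auto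
   then have "M' * norm x \<le> M' ^ Suc n * norm x" by (intro mult_right_mono) auto
   then show ?thesis using M'[OF Suc.prems(1) True Suc.prems(3)] by linarith
  next
   case False
   have "S t x = S d (S (t - d) x)" using S_semigroup[of d "t - d" x] False d Suc.prems by simp
   also have "norm \<dots> \<le> M' * norm (S (t - d) x)"
    using False d Suc.prems S_X by (intro M') auto
   also have "\<dots> \<le> M' * (M' ^ n * norm x)"
    using False Suc.prems \<open>M' \<ge> 1\<close> by (intro mult_left_mono Suc.IH) (auto simp: algebra_simps)
   finally show ?thesis by simp
  qed
 qed
 obtain n where "\<tau> / d \<le> real n" using real_arch_simple by blast
 then have "\<tau> \<le> real n * d" using d by (simp add: field_simps)
 then show ?thesis using * \<open>M' \<ge> 1\<close> by (intro exI[of _ "M' ^ n"]) auto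
qed

lemma S_taylor:
 assumes "x \<in> D" "0 < e"
 shows "\<exists>d>0. \<forall>h. 0 \<le> h \<and> h < d \<longrightarrow> norm (S h x - x - h *\<^sub>R A x) \<le> e * h"
proof -
 have "((\<lambda>h. (S h x - x) /\<^sub>R h) \<longlongrightarrow> A x) (at_right 0)"
  using generator assms(1) D_X unfolding is_generator_def by blast
 from tendstoD[OF this assms(2)] obtain d
  where d: "d > 0" "\<And>h. 0 < h \<Longrightarrow> h < d \<Longrightarrow> dist ((S h x - x) /\<^sub>R h) (A x) < e"
  unfolding eventually_at_right_field by blast
 have "norm (S h x - x - h *\<^sub>R A x) \<le> e * h" if h: "0 \<le> h" "h < d" for h
 proof (cases "h = 0")
  case True
  then show ?thesis using S_0 assms D_X by auto
 next
  case False
  then have "S h x - x - h *\<^sub>R A x = h *\<^sub>R ((S h x - x) /\<^sub>R h - A x)"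
   by (simp add: algebra_simps)
  then have "norm (S h x - x - h *\<^sub>R A x) = h * norm ((S h x - x) /\<^sub>R h - A x)"
   using h by simp
  also have "\<dots> \<le> h * e" using d(2)[of h] False h by (intro mult_left_mono) (auto simp: dist_norm)
  finally show ?thesis by (simp add: mult.commute)
 qed
 then show ?thesis using d by blast
qed

lemma S_D:
 assumes x: "x \<in> D" and t: "0 \<le> t"
 shows "S t x \<in> D" "A (S t x) = S t (A x)"
proof -
 have xX: "x \<in> X" using x D_X by auto
 obtain K where K: "\<And>x. x \<in> X \<Longrightarrow> norm (S t x) \<le> K * norm x" using S_bounded[OF t] by blast
 have lim: "((\<lambda>h. (S h x - x) /\<^sub>R h) \<longlongrightarrow> A x) (at_right 0)"
  using generator x xX unfolding is_generator_def by blast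
 have pos: "\<forall>\<^sub>F h in at_right (0::real). 0 < h" by (simp add: eventually_at_filter)
 have lim0: "((\<lambda>h. K * norm ((S h x - x) /\<^sub>R h - A x)) \<longlongrightarrow> 0) (at_right 0)"
  using lim by (intro tendsto_mult_right_zero) (simp add: tendsto_norm_zero_iff LIM_zero_iff)
 have "((\<lambda>h. (S h (S t x) - S t x) /\<^sub>R h - S t (A x)) \<longlongrightarrow> 0) (at_right 0)"
 proof (rule Lim_null_comparison[OF _ lim0])
  show "\<forall>\<^sub>F h in at_right 0. norm ((S h (S t x) - S t x) /\<^sub>R h - S t (A x)) \<le> K * norm ((S h x - x) /\<^sub>R h - A x)"
   using pos
  proof eventually_elim
   case (elim h)
   have q: "(S h x - x) /\<^sub>R h \<in> X"
    using elim xX S_X X_diff subspace_scale[OF X_subspace] by simp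
   have "S h (S t x) = S t (S h x)"
    using S_semigroup[of h t x] S_semigroup[of t h x] elim t xX by (simp add: add.commute)
   then have "(S h (S t x) - S t x) /\<^sub>R h - S t (A x) = S t ((S h x - x) /\<^sub>R h - A x)"
    using elim t xX S_X[of h x] X_diff q A_X[OF x] by (simp add: S_diff S_scale)
   then show ?case using K[of "(S h x - x) /\<^sub>R h - A x"] q A_X[OF x] X_diff by simp
  qed
 qed
 then have "((\<lambda>h. (S h (S t x) - S t x) /\<^sub>R h) \<longlongrightarrow> S t (A x)) (at_right 0)"
  by (simp add: LIM_zero_iff)
 then have "S t x \<in> D \<and> S t (A x) = A (S t x)"
  using generator S_X[OF t xX] unfolding is_generator_def by blast
 then show "S t x \<in> D" "A (S t x) = S t (A x)" by auto
qed

text \<open>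
 The difference quotient to the left of \<open>t\<close> is \<open>S (t - h)\<close> applied to the one to the right of \<open>0\<close>;
 local boundedness controls the error uniformly in \<open>h\<close>.
\<close>

lemma S_has_derivative:
 assumes x: "x \<in> D" and t: "0 \<le> t"
 shows "((\<lambda>s. S s x) has_vector_derivative A (S t x)) (at t within {0..})"
 unfolding has_vector_derivative_def has_derivative_within_alt
proof (intro conjI allI impI)
 show "bounded_linear (\<lambda>h. h *\<^sub>R A (S t x))" by (intro bounded_linear_intros)
 fix e :: real assume e: "0 < e"
 have xX: "x \<in> X" and AxX: "A x \<in> X" using x D_X A_X by auto
 obtain M where M: "M \<ge> 0" "\<And>s y. 0 \<le> s \<Longrightarrow> s \<le> t \<Longrightarrow> y \<in> X \<Longrightarrow> norm (S s y) \<le> M * norm y"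
  using S_locally_bounded by blast
 \<comment> \<open>the error is at most \<open>2 M e'\<close> times \<open>h\<close>, see the two cases below\<close>
 define e' where "e' = e / (2 * (M + 1))"
 have e': "0 < e'" "M * (2 * e') \<le> e" using e M by (auto simp: e'_def field_simps)
 obtain d1 where d1: "d1 > 0" "\<And>h. 0 \<le> h \<Longrightarrow> h < d1 \<Longrightarrow> norm (S h x - x - h *\<^sub>R A x) \<le> e' * h"
  using S_taylor[OF x e'(1)] by blast
 obtain d2 where d2: "d2 > 0" "\<And>h. 0 \<le> h \<Longrightarrow> h < d2 \<Longrightarrow> norm (S h (A x) - A x) < e'"
  using S_near_0[OF AxX e'(1)] by blast
 show "\<exists>d>0. \<forall>y\<in>{0..}. norm (y - t) < d \<longrightarrow>
   norm (S y x - S t x - (y - t) *\<^sub>R A (S t x)) \<le> e * norm (y - t)"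
 proof (intro exI[of _ "min d1 d2"] conjI ballI impI)
  fix s assume s: "s \<in> {0..}" "norm (s - t) < min d1 d2"
  define h where "h = \<bar>s - t\<bar>"
  define q where "q = S h x - x - h *\<^sub>R A x"
  have h: "0 \<le> h" "h < d1" "h < d2" using s by (auto simp: h_def)
  have ShX: "S h x \<in> X" "S h (A x) \<in> X" using h xX AxX S_X by auto
  have qX: "q \<in> X" unfolding q_def using ShX xX AxX X_diff subspace_scale[OF X_subspace] by auto
  have q: "norm q \<le> e' * h" using d1(2)[OF h(1,2)] by (simp add: q_def)
  have ASt: "A (S t x) = S t (A x)" by (rule S_D[OF x t])
  show "norm (S s x - S t x - (s - t) *\<^sub>R A (S t x)) \<le> e * norm (s - t)"
  proof (cases "t \<le> s")
   case True
   then have "S s x = S t (S h x)" using S_semigroup[of t h x] h t xX by (simp add: h_def)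
   then have "S s x - S t x - (s - t) *\<^sub>R A (S t x) = S t q"
    using True t ShX xX AxX X_diff subspace_scale[OF X_subspace]
    unfolding q_def ASt by (simp add: S_diff S_scale h_def)
   also have "norm \<dots> \<le> M * norm q" using t qX by (intro M) auto
   also have "\<dots> \<le> M * (e' * h)" using q M by (intro mult_left_mono) auto
   also have "\<dots> \<le> (M * (2 * e')) * h" using e' h M by (simp add: mult_left_mono)
   also have "\<dots> \<le> e * h" using e' h by (intro mult_right_mono) auto
   finally show ?thesis by (simp add: h_def)
  next
   case False
   then have s0: "0 \<le> s" "s \<le> t" "t = s + h" using s by (auto simp: h_def)
   then have St: "S t x = S s (S h x)" "S t (A x) = S s (S h (A x))"
    using S_semigroup[of s h] h xX AxX by auto
   define r where "r = h *\<^sub>R (S h (A x) - A x)"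
   have rX: "r \<in> X" unfolding r_def using ShX AxX X_diff subspace_scale[OF X_subspace] by auto
   have "norm r \<le> h * e'" unfolding r_def using d2(2)[OF h(1,3)] h by (simp add: mult_left_mono less_imp_le)
   then have nr: "norm r \<le> e' * h" by (simp add: mult.commute)
   have "S s x - S t x - (s - t) *\<^sub>R A (S t x) = S s (r - q)"
   proof -
    have e1: "S s q = S s (S h x) - S s x - h *\<^sub>R S s (A x)"
     unfolding q_def using s0 ShX xX AxX X_diff subspace_scale[OF X_subspace] by (simp add: S_diff S_scale)
    have e2: "S s r = h *\<^sub>R (S s (S h (A x)) - S s (A x))"
     unfolding r_def using s0 ShX AxX X_diff by (simp add: S_diff S_scale)
    have e3: "S s (r - q) = S s r - S s q" using s0 qX rX by (simp add: S_diff)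
    show ?thesis unfolding ASt unfolding St e3 e1 e2 using s0(3) by (simp add: algebra_simps)
   qed
   also have "norm \<dots> \<le> M * norm (r - q)" using s0 qX rX X_diff by (intro M) auto
   also have "\<dots> \<le> M * (e' * h + e' * h)"
    using q nr M by (intro mult_left_mono norm_triangle_le_diff) auto
   also have "\<dots> = (M * (2 * e')) * h" by (simp add: algebra_simps)
   also have "\<dots> \<le> e * h" using e' h by (intro mult_right_mono) auto
   finally show ?thesis by (simp add: h_def)
  qed
 qed (use d1 d2 in auto)
qed

lemma S_contraction_D:
 assumes x: "x \<in> D" and t: "0 \<le> t"
 shows "norm (S t x) \<le> norm x"
proof -
 define \<phi> where "\<phi> s = inner (S s x) (S s x)" for s
 have der: "(\<phi> has_vector_derivative (inner (S s x) (A (S s x)) + inner (A (S s x)) (S s x))) (at s within {0..})"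
  if "0 \<le> s" for s
  unfolding \<phi>_def using S_has_derivative[OF x that]
  by (intro bounded_bilinear.has_vector_derivative[OF bounded_bilinear_inner])
 have "\<phi> t \<le> \<phi> 0"
 proof (rule DERIV_nonpos_imp_decreasing_open[OF t])
  fix s assume s: "0 < s" "s < t"
  have "at s within {0..} = at s" using s by (intro at_within_interior) auto
  then have "(\<phi> has_real_derivative (inner (S s x) (A (S s x)) + inner (A (S s x)) (S s x))) (at s)"
   using der[of s] s by (simp add: has_real_derivative_iff_has_vector_derivative)
  moreover have "inner (S s x) (A (S s x)) + inner (A (S s x)) (S s x) \<le> 0"
   using dissipative[OF S_D(1)[OF x, of s]] s by (simp add: inner_commute)
  ultimately show "\<exists>y. (\<phi> has_real_derivative y) (at s) \<and> y \<le> 0" by blast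
 next
  have "continuous_on {0..} \<phi>"
   using der by (intro continuous_on_vector_derivative) auto
  then show "continuous_on {0..t} \<phi>" by (rule continuous_on_subset) auto
 qed
 then have "(norm (S t x))\<^sup>2 \<le> (norm x)\<^sup>2"
  using S_0 x D_X by (auto simp: \<phi>_def power2_norm_eq_inner)
 then show ?thesis by (rule power2_le_imp_le) simp
qed

lemma S_contraction:
 assumes x: "x \<in> X" and t: "0 \<le> t"
 shows "norm (S t x) \<le> norm x"
proof -
 obtain y where y: "\<And>n. y n \<in> D" "y \<longlonglongrightarrow> x" using D_dense_seq[OF x] by blast
 have yX: "y n \<in> X" for n using y D_X by auto
 obtain K where K: "\<And>x. x \<in> X \<Longrightarrow> norm (S t x) \<le> K * norm x" using S_bounded[OF t] by blast
 have "norm (S t (y n) - S t x) \<le> K * norm (y n - x)" for n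
  using K[of "y n - x"] yX x X_diff t by (simp add: S_diff)
 moreover have "(\<lambda>n. K * norm (y n - x)) \<longlonglongrightarrow> 0"
  using y(2) by (intro tendsto_mult_right_zero) (simp add: tendsto_norm_zero_iff LIM_zero_iff)
 ultimately have "(\<lambda>n. S t (y n) - S t x) \<longlonglongrightarrow> 0" by (rule tendsto_0_if_norm_le)
 then have "(\<lambda>n. S t (y n)) \<longlonglongrightarrow> S t x" by (simp add: LIM_zero_iff)
 from LIMSEQ_le[OF tendsto_norm[OF this] tendsto_norm[OF y(2)]]
 show ?thesis using S_contraction_D[OF y(1) t] by auto
qed

lemma S_orbit_diff:
 assumes "x \<in> X" "0 \<le> s" "0 \<le> t"
 shows "norm (S s x - S t x) \<le> norm (S \<bar>s - t\<bar> x - x)"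
proof -
 have *: "norm (S (r + h) x - S r x) \<le> norm (S h x - x)" if "0 \<le> r" "0 \<le> h" for r h
  using S_semigroup[OF that assms(1)] S_contraction[of "S h x - x" r] that assms S_X X_diff
  by (simp add: S_diff)
 show ?thesis
  using *[of t "s - t"] *[of s "t - s"] assms
  by (cases "t \<le> s") (auto simp: norm_minus_commute)
qed

lemma S_jointly_continuous: "continuous_on ({0..} \<times> X) (\<lambda>(t, x). S t x)"
proof (rule continuous_onI)
 fix z :: "real \<times> 'a" and e :: real assume "z \<in> {0..} \<times> X" and e: "0 < e"
 then obtain t x where z: "z = (t, x)" "0 \<le> t" "x \<in> X" by (cases z) auto
 obtain d where d: "d > 0" "\<And>h. 0 \<le> h \<Longrightarrow> h < d \<Longrightarrow> norm (S h x - x) < e / 2"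
  using S_near_0[OF z(3), of "e/2"] e by auto
 show "\<exists>d>0. \<forall>w\<in>{0..} \<times> X. dist w z < d \<longrightarrow> dist (case w of (t, x) \<Rightarrow> S t x) (case z of (t, x) \<Rightarrow> S t x) \<le> e"
 proof (intro exI[of _ "min d (e/2)"] conjI ballI impI)
  fix w assume "w \<in> {0..} \<times> X" and dw: "dist w z < min d (e/2)"
  then obtain s y where w: "w = (s, y)" "0 \<le> s" "y \<in> X" by (cases w) auto
  have dist: "\<bar>s - t\<bar> < d" "norm (y - x) < e / 2"
   using dw dist_fst_le[of w z] dist_snd_le[of w z] by (auto simp: w z dist_real_def dist_norm)
  have "norm (S s (y - x)) \<le> norm (y - x)" using w z X_diff by (intro S_contraction) auto
  moreover have "norm (S s x - S t x) < e / 2"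
   using S_orbit_diff[OF z(3) w(2) z(2)] d(2)[of "\<bar>s - t\<bar>"] dist by linarith
  moreover have eq: "S s y - S t x = S s (y - x) + (S s x - S t x)" using w z by (simp add: S_diff)
  ultimately have "norm (S s y - S t x) \<le> e / 2 + e / 2"
   unfolding eq using norm_triangle_ineq[of "S s (y - x)" "S s x - S t x"] dist by linarith
  then show "dist (case w of (t, x) \<Rightarrow> S t x) (case z of (t, x) \<Rightarrow> S t x) \<le> e"
   by (simp add: w z dist_norm)
 qed (use d e in auto)
qed

lemma S_orbit_continuous:
 assumes "x \<in> X"
 shows "continuous_on {0..} (\<lambda>t. S t x)"
proof -
 have "continuous_on {0..} (\<lambda>t::real. (t, x))" by (intro continuous_intros)
 from continuous_on_compose2[OF S_jointly_continuous this] assms show ?thesis by auto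
qed

end


section \<open>Integration by parts for absolutely continuous functions\<close>

lemmas LINT_cong = Bochner_Integration.integral_cong
lemmas LINT_HK = set_lebesgue_integral_eq_integral
lemmas HK_diff = Henstock_Kurzweil_Integration.integral_diff
lemmas HK_combine = Henstock_Kurzweil_Integration.integral_combine

lemma sigma_finite_lebesgue: "sigma_finite_measure (lebesgue :: real measure)"
proof
 have "\<Union> (range (\<lambda>n. {- real n..real n})) = space lebesgue"
 proof -
  have "x \<in> {- real (nat \<lceil>\<bar>x\<bar>\<rceil>)..real (nat \<lceil>\<bar>x\<bar>\<rceil>)}" for x
   using real_nat_ceiling_ge[of "\<bar>x\<bar>"] by (simp only: atLeastAtMost_iff) linarith
  then have "(\<Union>n. {- real n..real n}) = UNIV" by blast
  then show ?thesis by simp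
 qed
 then show "\<exists>A::real set set. countable A \<and> A \<subseteq> sets lebesgue \<and> \<Union> A = space lebesgue \<and> (\<forall>a\<in>A. emeasure lebesgue a \<noteq> \<infinity>)"
  by (intro exI[of _ "range (\<lambda>n. {- real n..real n})"]) auto
qed

interpretation lebesgue_pair: pair_sigma_finite "lebesgue :: real measure" "lebesgue :: real measure"
 by (intro pair_sigma_finite.intro sigma_finite_lebesgue)

lemma measurable_ident_lebesgue_borel [measurable]: "(\<lambda>x::real. x) \<in> borel_measurable lebesgue"
 by (rule measurable_completion) simp

lemma integrable_pair_mult:
 fixes f g :: "real \<Rightarrow> real"
 assumes f: "integrable lebesgue f" and g: "integrable lebesgue g"
 shows "integrable (lebesgue \<Otimes>\<^sub>M lebesgue) (\<lambda>(x, y). f x * g y)"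
proof (rule lebesgue_pair.Fubini_integrable)
 have [measurable]: "f \<in> borel_measurable lebesgue" "g \<in> borel_measurable lebesgue" using f g by auto
 show "(\<lambda>(x, y). f x * g y) \<in> borel_measurable (lebesgue \<Otimes>\<^sub>M lebesgue)" by measurable
 have "integrable lebesgue (\<lambda>x. \<bar>f x\<bar> * (LINT y|lebesgue. \<bar>g y\<bar>))" using f by (intro integrable_mult_left) auto
 then show "integrable lebesgue (\<lambda>x. LINT y|lebesgue. norm (case (x, y) of (x, y) \<Rightarrow> f x * g y))" by (simp add: abs_mult)
 show "AE x in lebesgue. integrable lebesgue (\<lambda>y. case (x, y) of (x, y) \<Rightarrow> f x * g y)" using g by simp
qed

text \<open>
 The square of \<open>\<real>\<close> is cut along the diagonal, and Fubini is applied to \<open>f x * g y\<close> on the two halves.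
\<close>

lemma integral_by_parts_primitives:
 fixes f g :: "real \<Rightarrow> real"
 assumes f: "integrable lebesgue f" and g: "integrable lebesgue g"
 shows "integrable lebesgue (\<lambda>x. f x * (LINT y:{..x}|lebesgue. g y))"
  "integrable lebesgue (\<lambda>y. g y * (LINT x:{..y}|lebesgue. f x))"
  "(LINT x|lebesgue. f x * (LINT y:{..x}|lebesgue. g y)) + (LINT y|lebesgue. g y * (LINT x:{..y}|lebesgue. f x))
   = (LINT x|lebesgue. f x) * (LINT y|lebesgue. g y)"
proof -
 have [measurable]: "f \<in> borel_measurable lebesgue" "g \<in> borel_measurable lebesgue" using f g by auto
 define h where "h = (\<lambda>(x, y). f x * g y)"
 define h1 where "h1 = (\<lambda>(x, y). (if y \<le> x then f x * g y else 0))"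
 define h2 where "h2 = (\<lambda>(x, y). (if y \<le> x then 0 else f x * g y))"
 have h: "integrable (lebesgue \<Otimes>\<^sub>M lebesgue) h" unfolding h_def by (rule integrable_pair_mult[OF f g])
 have m1: "h1 \<in> borel_measurable (lebesgue \<Otimes>\<^sub>M lebesgue)" unfolding h1_def by measurable
 have m2: "h2 \<in> borel_measurable (lebesgue \<Otimes>\<^sub>M lebesgue)" unfolding h2_def by measurable
 have h1: "integrable (lebesgue \<Otimes>\<^sub>M lebesgue) h1"
  by (rule Bochner_Integration.integrable_bound[OF h m1]) (auto simp: h1_def h_def)
 have h2: "integrable (lebesgue \<Otimes>\<^sub>M lebesgue) h2"
  by (rule Bochner_Integration.integrable_bound[OF h m2]) (auto simp: h2_def h_def)
 have i1: "(LINT y|lebesgue. h1 (x, y)) = f x * (LINT y:{..x}|lebesgue. g y)" for x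
 proof -
  have "(LINT y|lebesgue. h1 (x, y)) = (LINT y|lebesgue. f x * (indicator {..x} y *\<^sub>R g y))"
   by (intro LINT_cong) (auto simp: h1_def indicator_def)
  then show ?thesis by (simp add: set_lebesgue_integral_def)
 qed
 have i2: "(LINT x|lebesgue. h2 (x, y)) = g y * (LINT x:{..y}|lebesgue. f x)" for y
 proof -
  have [measurable]: "{..y} \<in> sets lebesgue" by simp
  have "(LINT x|lebesgue. h2 (x, y)) = (LINT x|lebesgue. g y * (indicator {..y} x *\<^sub>R f x))"
  proof (rule integral_cong_AE)
   show "(\<lambda>x. h2 (x, y)) \<in> borel_measurable lebesgue" unfolding h2_def by simp
   show "(\<lambda>x. g y * (indicator {..y} x *\<^sub>R f x)) \<in> borel_measurable lebesgue" by measurable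
   have "AE x in lebesgue. x \<notin> {y}" by (intro AE_not_in) simp
   then show "AE x in lebesgue. h2 (x, y) = g y * (indicator {..y} x *\<^sub>R f x)"
    by eventually_elim (auto simp: h2_def indicator_def)
  qed
  then show ?thesis by (simp add: set_lebesgue_integral_def)
 qed
 show "integrable lebesgue (\<lambda>x. f x * (LINT y:{..x}|lebesgue. g y))"
  using lebesgue_pair.integrable_fst'[OF h1] by (simp add: i1)
 show "integrable lebesgue (\<lambda>y. g y * (LINT x:{..y}|lebesgue. f x))"
  using lebesgue_pair.integrable_snd[of "\<lambda>x y. h2 (x, y)"] h2 by (simp add: i2)
 have "integral\<^sup>L (lebesgue \<Otimes>\<^sub>M lebesgue) h = integral\<^sup>L (lebesgue \<Otimes>\<^sub>M lebesgue) (\<lambda>z. h1 z + h2 z)"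
  by (intro LINT_cong) (auto simp: h_def h1_def h2_def)
 also have "\<dots> = integral\<^sup>L (lebesgue \<Otimes>\<^sub>M lebesgue) h1 + integral\<^sup>L (lebesgue \<Otimes>\<^sub>M lebesgue) h2"
  by (rule Bochner_Integration.integral_add[OF h1 h2])
 also have "integral\<^sup>L (lebesgue \<Otimes>\<^sub>M lebesgue) h1 = (LINT x|lebesgue. f x * (LINT y:{..x}|lebesgue. g y))"
  using lebesgue_pair.integral_fst'[OF h1] by (simp add: i1)
 also have "integral\<^sup>L (lebesgue \<Otimes>\<^sub>M lebesgue) h2 = (LINT y|lebesgue. g y * (LINT x:{..y}|lebesgue. f x))"
  using lebesgue_pair.integral_snd[of "\<lambda>x y. h2 (x, y)"] h2 by (simp add: i2)
 also have "integral\<^sup>L (lebesgue \<Otimes>\<^sub>M lebesgue) h = (LINT x|lebesgue. f x) * (LINT y|lebesgue. g y)"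
  using lebesgue_pair.integral_fst'[OF h] by (simp add: h_def)
 finally show "(LINT x|lebesgue. f x * (LINT y:{..x}|lebesgue. g y)) + (LINT y|lebesgue. g y * (LINT x:{..y}|lebesgue. f x))
   = (LINT x|lebesgue. f x) * (LINT y|lebesgue. g y)" by simp
qed

text \<open>
 \<open>F\<close> is absolutely continuous on \<open>[0,l]\<close> with derivative \<open>f\<close>, expressed by the fundamental theorem of
 calculus.
\<close>

definition primitive_on :: "real \<Rightarrow> (real \<Rightarrow> real) \<Rightarrow> (real \<Rightarrow> real) \<Rightarrow> bool" where
 "primitive_on l F f \<longleftrightarrow> f absolutely_integrable_on {0..l} \<and> (\<forall>x\<in>{0..l}. integral {0..x} f = F x - F 0)"

lemma primitive_on_integrable: "primitive_on l F f \<Longrightarrow> f absolutely_integrable_on {0..l}"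
 by (simp add: primitive_on_def)

lemma abs_integrable_subinterval:
 fixes f :: "real \<Rightarrow> real"
 shows "f absolutely_integrable_on {0..l} \<Longrightarrow> 0 \<le> a \<Longrightarrow> b \<le> l \<Longrightarrow> f absolutely_integrable_on {a..b}"
 by (rule set_integrable_subset[of _ "{0..l}"]) auto

lemma primitive_on_subinterval: "primitive_on l F f \<Longrightarrow> x \<le> l \<Longrightarrow> primitive_on x F f"
 unfolding primitive_on_def using abs_integrable_subinterval[of l f 0 x] by auto

lemma primitive_on_continuous:
 assumes "primitive_on l F f"
 shows "continuous_on {0..l} F"
proof -
 have "f integrable_on {0..l}"
  using assms LINT_HK(1) by (auto simp: primitive_on_def)
 then have "continuous_on {0..l} (\<lambda>x. F 0 + integral {0..x} f)"
  by (intro continuous_intros indefinite_integral_continuous_1)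
 then show ?thesis
  by (rule continuous_on_eq) (use assms in \<open>auto simp: primitive_on_def\<close>)
qed

lemma abs_integrable_mult_continuous:
 fixes f g :: "real \<Rightarrow> real"
 assumes g: "continuous_on {a..b} g" and f: "f absolutely_integrable_on {a..b}"
 shows "(\<lambda>x. f x * g x) absolutely_integrable_on {a..b}"
proof -
 have "(\<lambda>x. g x * f x) absolutely_integrable_on {a..b}"
 proof (rule absolutely_integrable_bounded_measurable_product_real[OF _ _ _ f])
  show "g \<in> borel_measurable (lebesgue_on {a..b})"
   by (intro continuous_imp_measurable_on_sets_lebesgue g) auto
  show "bounded (g ` {a..b})" using g by (intro compact_imp_bounded compact_continuous_image) auto
 qed auto
 then show ?thesis by (simp add: mult.commute)
qed

lemma abs_integrable_mult_primitive:
 assumes "primitive_on l G g" "f absolutely_integrable_on {0..l}"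
 shows "(\<lambda>x. f x * G x) absolutely_integrable_on {0..l}"
 using abs_integrable_mult_continuous[OF primitive_on_continuous] assms .

theorem integral_by_parts:
 assumes F: "primitive_on l F f" and G: "primitive_on l G g" and l: "0 \<le> l"
 shows "integral {0..l} (\<lambda>x. f x * G x + F x * g x) = F l * G l - F 0 * G 0"
proof -
 have f: "f absolutely_integrable_on {0..l}" and g: "g absolutely_integrable_on {0..l}"
  using F G by (auto simp: primitive_on_def)
 define f' g' where "f' = (\<lambda>x. indicator {0..l} x *\<^sub>R f x)" and "g' = (\<lambda>x. indicator {0..l} x *\<^sub>R g x)"
 have fg': "integrable lebesgue f'" "integrable lebesgue g'"
  using f g unfolding f'_def g'_def set_integrable_def by auto
 have prim: "(LINT y:{..x}|lebesgue. indicator {0..l} y *\<^sub>R h y) = H x - H 0"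
  if H: "primitive_on l H h" and x: "x \<in> {0..l}" for H h x
 proof -
  have "(LINT y:{..x}|lebesgue. indicator {0..l} y *\<^sub>R h y) = (LINT y:{0..x}|lebesgue. h y)"
   unfolding set_lebesgue_integral_def using x by (intro LINT_cong) (auto simp: indicator_def)
  also have "\<dots> = integral {0..x} h"
   using x by (intro LINT_HK(2) abs_integrable_subinterval[OF primitive_on_integrable[OF H]]) auto
  finally show ?thesis using H x by (auto simp: primitive_on_def)
 qed
 have tot: "(LINT x|lebesgue. indicator {0..l} x *\<^sub>R h x) = H l - H 0" if H: "primitive_on l H h" for H h
  using LINT_HK(2)[OF primitive_on_integrable[OF H]] H l
  unfolding primitive_on_def set_lebesgue_integral_def by simp
 have conv: "(LINT x|lebesgue. (indicator {0..l} x *\<^sub>R h x) * (LINT y:{..x}|lebesgue. indicator {0..l} y *\<^sub>R k y))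
   = integral {0..l} (\<lambda>x. h x * K x) - K 0 * integral {0..l} h"
  if h: "h absolutely_integrable_on {0..l}" and K: "primitive_on l K k" for h k K
 proof -
  have "(LINT x|lebesgue. (indicator {0..l} x *\<^sub>R h x) * (LINT y:{..x}|lebesgue. indicator {0..l} y *\<^sub>R k y))
    = (LINT x:{0..l}|lebesgue. h x * (K x - K 0))"
   unfolding set_lebesgue_integral_def[of lebesgue "{0..l}"]
  proof (rule LINT_cong[OF refl])
   fix x
   show "(indicator {0..l} x *\<^sub>R h x) * (LINT y:{..x}|lebesgue. indicator {0..l} y *\<^sub>R k y)
     = indicator {0..l} x *\<^sub>R (h x * (K x - K 0))"
    by (cases "x \<in> {0..l}") (simp_all only: prim[OF K] indicator_simps, simp_all)
  qed
  also have "(\<lambda>x. h x * (K x - K 0)) = (\<lambda>x. h x * K x - h x * K 0)" by (simp add: algebra_simps)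
  also have "(LINT x:{0..l}|lebesgue. h x * K x - h x * K 0) = (LINT x:{0..l}|lebesgue. h x * K x) - (LINT x:{0..l}|lebesgue. h x * K 0)"
   by (rule set_integral_diff(2)[OF abs_integrable_mult_primitive[OF K h] set_integrable_mult_left]) (use h in simp)
  also have "(LINT x:{0..l}|lebesgue. h x * K x) = integral {0..l} (\<lambda>x. h x * K x)"
   by (rule LINT_HK(2)[OF abs_integrable_mult_primitive[OF K h]])
  also have "(LINT x:{0..l}|lebesgue. h x * K 0) = K 0 * integral {0..l} h"
   using LINT_HK(2)[OF h] by simp
  finally show ?thesis .
 qed
 have "(integral {0..l} (\<lambda>x. f x * G x) - G 0 * integral {0..l} f)
   + (integral {0..l} (\<lambda>x. g x * F x) - F 0 * integral {0..l} g) = (F l - F 0) * (G l - G 0)"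
  using integral_by_parts_primitives(3)[OF fg'] unfolding f'_def g'_def
  by (simp only: conv[OF f G] conv[OF g F] tot[OF F] tot[OF G])
 moreover have "integral {0..l} f = F l - F 0" "integral {0..l} g = G l - G 0"
  using F G l by (auto simp: primitive_on_def)
 moreover have "integral {0..l} (\<lambda>x. f x * G x + g x * F x) = integral {0..l} (\<lambda>x. f x * G x) + integral {0..l} (\<lambda>x. g x * F x)"
  using abs_integrable_mult_primitive[OF G f] abs_integrable_mult_primitive[OF F g]
  by (intro integral_add LINT_HK(1))
 ultimately show ?thesis by (simp add: algebra_simps)
qed

lemma primitive_on_mult:
 assumes F: "primitive_on l F f" and G: "primitive_on l G g"
 shows "primitive_on l (\<lambda>x. F x * G x) (\<lambda>x. f x * G x + F x * g x)"
proof -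
 have "(\<lambda>x. f x * G x + g x * F x) absolutely_integrable_on {0..l}"
  using F G by (intro set_integral_add abs_integrable_mult_primitive[OF G] abs_integrable_mult_primitive[OF F])
   (auto simp: primitive_on_def)
 moreover have "integral {0..x} (\<lambda>x. f x * G x + F x * g x) = F x * G x - F 0 * G 0" if "x \<in> {0..l}" for x
  using integral_by_parts[OF primitive_on_subinterval[OF F] primitive_on_subinterval[OF G], of x] that by simp
 ultimately show ?thesis by (simp add: primitive_on_def mult.commute)
qed

lemma primitive_on_C1:
 assumes deriv: "\<And>x. x \<in> {0..l} \<Longrightarrow> (F has_real_derivative f x) (at x within {0..l})" and cont: "continuous_on {0..l} f"
 shows "primitive_on l F f"
 unfolding primitive_on_def
proof (intro conjI ballI)
 show "f absolutely_integrable_on {0..l}" using cont by (rule absolutely_integrable_continuous_real)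
 fix x assume x: "x \<in> {0..l}"
 have "(f has_integral (F x - F 0)) {0..x}"
  by (intro fundamental_theorem_of_calculus)
   (use x deriv in \<open>auto simp flip: has_real_derivative_iff_has_vector_derivative
    intro!: has_field_derivative_subset[of F "f _" _ "{0..l}" "{0..x}"]\<close>)
 then show "integral {0..x} f = F x - F 0" by (simp add: integral_unique)
qed

lemma primitive_on_add:
 assumes F: "primitive_on l F f" and G: "primitive_on l G g"
 shows "primitive_on l (\<lambda>x. F x + G x) (\<lambda>x. f x + g x)"
 unfolding primitive_on_def
proof (intro conjI ballI)
 show "(\<lambda>x. f x + g x) absolutely_integrable_on {0..l}" using F G by (auto simp: primitive_on_def)
 fix x assume x: "x \<in> {0..l}"
 have "f integrable_on {0..x}" "g integrable_on {0..x}"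
  using F G x by (auto simp: primitive_on_def intro!: LINT_HK(1) abs_integrable_subinterval[of l _ 0 x])
 then have "integral {0..x} (\<lambda>x. f x + g x) = integral {0..x} f + integral {0..x} g" by (rule integral_add)
 then show "integral {0..x} (\<lambda>x. f x + g x) = F x + G x - (F 0 + G 0)"
  using F G x by (auto simp: primitive_on_def)
qed

lemma primitive_on_cmult:
 assumes "primitive_on l F f"
 shows "primitive_on l (\<lambda>x. c * F x) (\<lambda>x. c * f x)"
 using assms by (auto simp: primitive_on_def right_diff_distrib)

lemma primitive_on_const: "0 \<le> l \<Longrightarrow> primitive_on l (\<lambda>x. c) (\<lambda>x. 0)"
 by (auto simp: primitive_on_def)

lemma primitive_on_cong:
 assumes "primitive_on l F f" "\<And>x. x \<in> {0..l} \<Longrightarrow> F x = G x" "\<And>x. x \<in> {0..l} \<Longrightarrow> f x = g x" "0 \<le> l"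
 shows "primitive_on l G g"
proof -
 have "g absolutely_integrable_on {0..l} \<longleftrightarrow> f absolutely_integrable_on {0..l}"
  unfolding set_integrable_def using assms(3)
  by (intro Bochner_Integration.integrable_cong) (auto simp: indicator_def)
 moreover have "integral {0..x} g = integral {0..x} f" if "x \<in> {0..l}" for x
  using assms(3) that by (intro integral_cong) auto
 ultimately show ?thesis using assms by (auto simp: primitive_on_def)
qed

text \<open>
 A convolution with base point at the right end of the interval. As \<open>f\<close> is merely integrable, its
 derivative is found by Fubini: the integral of the candidate over \<open>[0,X]\<close> is evaluated with the order
 of integration exchanged.
\<close>

lemma primitive_on_Volterra:
 fixes k k' f :: "real \<Rightarrow> real"
 assumes l: "0 \<le> l" and f: "f absolutely_integrable_on {0..l}"
  and k: "\<And>s. (k has_real_derivative k' s) (at s)" and k': "continuous_on UNIV k'"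
 shows "primitive_on l (\<lambda>x. integral {x..l} (\<lambda>y. k (x - y) * f y))
  (\<lambda>x. integral {x..l} (\<lambda>y. k' (x - y) * f y) - k 0 * f x)"
proof -
 define V where "V x = integral {x..l} (\<lambda>y. k' (x - y) * f y)" for x
 define W where "W x = integral {x..l} (\<lambda>y. k (x - y) * f y)" for x
 have kc: "continuous_on A k" for A
  using k by (meson DERIV_isCont continuous_at_imp_continuous_on)
 have k'm [measurable]: "k' \<in> borel_measurable borel" using k' by (rule borel_measurable_continuous_onI)
 define fh where "fh = (\<lambda>y. indicator {0..l} y *\<^sub>R f y)"
 have fh: "integrable lebesgue fh" using f unfolding fh_def set_integrable_def .
 then have [measurable]: "fh \<in> borel_measurable lebesgue" by auto
 have "bounded (k' ` {-l..l})"
  using k' by (intro compact_imp_bounded compact_continuous_image) (auto intro: continuous_on_subset)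
 then obtain M where "\<And>s. s \<in> {-l..l} \<Longrightarrow> \<bar>k' s\<bar> \<le> M"
  unfolding bounded_iff by (metis image_eqI real_norm_def)
 then have M: "s \<in> {-l..l} \<Longrightarrow> \<bar>k' s\<bar> \<le> \<bar>M\<bar>" for s by (meson abs_ge_self order_trans)
 define h where "h X = (\<lambda>(z, y). indicator {0..X} z * (if z \<le> y then k' (z - y) * fh y else 0))" for X :: real
 have h: "integrable (lebesgue \<Otimes>\<^sub>M lebesgue) (h X)" if X: "X \<in> {0..l}" for X
 proof (rule Bochner_Integration.integrable_bound)
  show "integrable (lebesgue \<Otimes>\<^sub>M lebesgue) (\<lambda>z. M * (case z of (z, y) \<Rightarrow> indicator {0..X} z * fh y))"
   by (intro integrable_mult_right integrable_pair_mult fh integrable_real_indicator) (use X in auto)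
  show "h X \<in> borel_measurable (lebesgue \<Otimes>\<^sub>M lebesgue)" unfolding h_def by measurable
  have "norm (h X z) \<le> norm (M * (case z of (z, y) \<Rightarrow> indicator {0..X} z * fh y))" for z
   using X M[of "fst z - snd z"]
   by (auto simp: h_def fh_def indicator_def abs_mult split: prod.splits intro!: mult_right_mono)
  then show "AE z in lebesgue \<Otimes>\<^sub>M lebesgue. norm (h X z) \<le> norm (M * (case z of (z, y) \<Rightarrow> indicator {0..X} z * fh y))"
   by simp
 qed
 have i1: "(LINT y|lebesgue. h X (z, y)) = indicator {0..X} z *\<^sub>R V z" if X: "X \<in> {0..l}" for X z
 proof (cases "z \<in> {0..X}")
  case True
  have "(LINT y|lebesgue. h X (z, y)) = (LINT y:{z..l}|lebesgue. k' (z - y) * f y)"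
   unfolding set_lebesgue_integral_def using True X
   by (intro LINT_cong) (auto simp: h_def fh_def indicator_def)
  also have "\<dots> = V z" unfolding V_def
  proof (rule LINT_HK(2))
   have "(\<lambda>y. f y * k' (z - y)) absolutely_integrable_on {z..l}"
    using True by (intro abs_integrable_mult_continuous abs_integrable_subinterval[OF f] continuous_on_compose2[OF k'] continuous_intros) auto
   then show "(\<lambda>y. k' (z - y) * f y) absolutely_integrable_on {z..l}" by (simp add: mult.commute)
  qed
  finally show ?thesis using True by simp
 qed (auto simp: h_def)
 have i2: "(LINT z|lebesgue. h X (z, y)) = fh y * (k (min X y - y) - k (- y))" if X: "X \<in> {0..l}" for X y
 proof (cases "y \<in> {0..l}")
  case True
  have m: "0 \<le> min X y" using X True by auto
  have "(LINT z|lebesgue. h X (z, y)) = (LINT z|lebesgue. fh y * (indicator {0..min X y} z *\<^sub>R k' (z - y)))"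
   by (intro LINT_cong) (auto simp: h_def fh_def indicator_def)
  also have "\<dots> = fh y * (LINT z:{0..min X y}|lebesgue. k' (z - y))" by (simp add: set_lebesgue_integral_def)
  also have "(LINT z:{0..min X y}|lebesgue. k' (z - y)) = integral {0..min X y} (\<lambda>z. k' (z - y))"
   by (intro LINT_HK absolutely_integrable_continuous_real continuous_on_compose2[OF k'] continuous_intros) auto
  also have "\<dots> = k (min X y - y) - k (0 - y)"
  proof (rule integral_unique, rule fundamental_theorem_of_calculus[OF m])
   fix z assume "z \<in> {0..min X y}"
   have "((\<lambda>z. k (z - y)) has_real_derivative k' (z - y) * (1 - 0)) (at z)"
    by (rule DERIV_chain2[OF k]) (auto intro!: derivative_eq_intros)
   then show "((\<lambda>z. k (z - y)) has_vector_derivative k' (z - y)) (at z within {0..min X y})"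
    by (simp add: has_real_derivative_iff_has_vector_derivative has_vector_derivative_at_within)
  qed
  finally show ?thesis by simp
 next
  case False
  then have "fh y = 0" by (auto simp: fh_def)
  then show ?thesis by (simp add: h_def cong: if_cong)
 qed
 have V_int: "V absolutely_integrable_on {0..l}"
  unfolding set_integrable_def
  using lebesgue_pair.integrable_fst'[OF h[of l]] l by (simp add: i1)
 have fk: "(\<lambda>y. f y * c y) absolutely_integrable_on {a..b}" if "0 \<le> a" "b \<le> l" "continuous_on {a..b} c" for a b c
  by (intro abs_integrable_mult_continuous that abs_integrable_subinterval[OF f])
 have eq: "integral {0..X} (\<lambda>x. V x - k 0 * f x) = W X - W 0" if X: "X \<in> {0..l}" for X
 proof -
  have Xl: "0 \<le> X" "X \<le> l" using X by auto
  have "integral {0..X} V = (LINT z|lebesgue. (LINT y|lebesgue. h X (z, y)))"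
   using LINT_HK(2)[OF abs_integrable_subinterval[OF V_int, of 0 X]] X
   by (simp add: i1[OF X] set_lebesgue_integral_def)
  also have "\<dots> = (LINT y|lebesgue. (LINT z|lebesgue. h X (z, y)))"
   using lebesgue_pair.Fubini_integral[of "\<lambda>z y. h X (z, y)"] h[OF X] by simp
  also have "\<dots> = (LINT y:{0..l}|lebesgue. f y * (k (min X y - y) - k (- y)))"
   unfolding i2[OF X] set_lebesgue_integral_def fh_def by (simp add: mult.assoc)
  also have "\<dots> = integral {0..l} (\<lambda>y. f y * (k (min X y - y) - k (- y)))"
   by (intro LINT_HK fk continuous_intros continuous_on_compose2[OF kc[of UNIV]]) auto
  also have "\<dots> = integral {0..l} (\<lambda>y. f y * k (min X y - y) - f y * k (- y))" by (simp add: right_diff_distrib)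
  also have "\<dots> = integral {0..l} (\<lambda>y. f y * k (min X y - y)) - integral {0..l} (\<lambda>y. f y * k (- y))"
   by (intro HK_diff LINT_HK(1) fk continuous_intros continuous_on_compose2[OF kc[of UNIV]]) auto
  also have "integral {0..l} (\<lambda>y. f y * k (- y)) = W 0" by (simp add: W_def mult.commute)
  also have "integral {0..l} (\<lambda>y. f y * k (min X y - y))
    = integral {0..X} (\<lambda>y. f y * k (min X y - y)) + integral {X..l} (\<lambda>y. f y * k (min X y - y))"
   by (rule HK_combine[symmetric, OF Xl])
    (intro LINT_HK(1) fk continuous_intros continuous_on_compose2[OF kc[of UNIV]], auto)
  also have "integral {0..X} (\<lambda>y. f y * k (min X y - y)) = integral {0..X} (\<lambda>y. k 0 * f y)"
   by (intro integral_cong) auto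
  also have "integral {X..l} (\<lambda>y. f y * k (min X y - y)) = W X"
   unfolding W_def by (intro integral_cong) auto
  finally have "integral {0..X} V = integral {0..X} (\<lambda>y. k 0 * f y) + W X - W 0" .
  moreover have "integral {0..X} (\<lambda>x. V x - k 0 * f x) = integral {0..X} V - integral {0..X} (\<lambda>x. k 0 * f x)"
   using X by (intro HK_diff LINT_HK(1) abs_integrable_subinterval[OF V_int]
     set_integrable_mult_right abs_integrable_subinterval[OF f]) auto
  ultimately show ?thesis by simp
 qed
 show ?thesis
  unfolding primitive_on_def V_def[symmetric] W_def[symmetric]
  using eq V_int f by (auto intro!: set_integral_diff(1) set_integrable_mult_right)
qed


section \<open>Smooth bump functions and the fundamental lemma of the calculus of variations\<close>

lemma poly_mult_exp_tendsto_0: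
 assumes "0 < c"
 shows "((\<lambda>y. poly q y * exp (- (c * y))) \<longlongrightarrow> (0::real)) at_top"
proof -
 have cy: "filterlim (\<lambda>y. c * y) at_top at_top"
  using assms by (intro filterlim_tendsto_pos_mult_at_top[OF tendsto_const] filterlim_ident)
 have term_lim: "((\<lambda>y. a * y ^ i * exp (- (c * y))) \<longlongrightarrow> 0) at_top" for a i
 proof -
  have "((\<lambda>y. (a / c ^ i) * ((c * y) ^ i / exp (c * y))) \<longlongrightarrow> 0) at_top"
   by (intro tendsto_mult_right_zero filterlim_compose[OF tendsto_power_div_exp_0 cy])
  moreover have "(a / c ^ i) * ((c * y) ^ i / exp (c * y)) = a * y ^ i * exp (- (c * y))" for y
   using assms by (simp add: power_mult_distrib exp_minus field_simps)
  ultimately show ?thesis by simp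
 qed
 have "((\<lambda>y. \<Sum>i\<le>degree q. coeff q i * y ^ i * exp (- (c * y))) \<longlongrightarrow> (\<Sum>i\<le>degree q. 0)) at_top"
  by (intro tendsto_sum term_lim)
 then show ?thesis by (simp add: poly_altdef sum_distrib_right)
qed

text \<open>
 The functions \<open>p(1/x) e\<^bsup>-c/x\<^esup>\<close> on the positive axis, extended by zero, are closed under
 differentiation, which gives their smoothness.
\<close>

definition bump_term :: "real poly \<Rightarrow> real \<Rightarrow> real \<Rightarrow> real" where
 "bump_term p c x = (if 0 < x then poly p (1 / x) * exp (- (c * (1 / x))) else 0)"

lemma bump_term_deriv:
 assumes c: "0 < c"
 shows "(bump_term p c has_real_derivative bump_term ([:0, 0, 1:] * (smult c p - pderiv p)) c x) (at x)"
proof (cases "x = 0")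
 case False
 show ?thesis
 proof (cases "0 < x")
  case True
  have d1: "((\<lambda>x. 1 / x) has_real_derivative - (1 / x * (1 / x))) (at x)"
   using True by (auto intro!: derivative_eq_intros)
  have "((\<lambda>x. poly p (1 / x) * exp (- (c * (1 / x)))) has_real_derivative
    poly (pderiv p) (1 / x) * - (1 / x * (1 / x)) * exp (- (c * (1 / x)))
    + exp (- (c * (1 / x))) * - (c * - (1 / x * (1 / x))) * poly p (1 / x)) (at x)"
   by (intro DERIV_mult DERIV_chain2[OF poly_DERIV d1] DERIV_fun_exp DERIV_minus DERIV_cmult d1)
  moreover have "poly (pderiv p) (1 / x) * - (1 / x * (1 / x)) * exp (- (c * (1 / x)))
    + exp (- (c * (1 / x))) * - (c * - (1 / x * (1 / x))) * poly p (1 / x)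
    = bump_term ([:0, 0, 1:] * (smult c p - pderiv p)) c x"
   using True by (simp add: bump_term_def algebra_simps)
  ultimately have "((\<lambda>x. poly p (1 / x) * exp (- (c * (1 / x)))) has_real_derivative
    bump_term ([:0, 0, 1:] * (smult c p - pderiv p)) c x) (at x)" by simp
  then show ?thesis
   by (rule has_field_derivative_transform_within_open[OF _ open_greaterThan[of 0]])
    (use True in \<open>simp_all add: bump_term_def\<close>)
 next
  case neg: False
  have "((\<lambda>_. 0) has_real_derivative 0) (at x)" by simp
  then have "(bump_term p c has_real_derivative 0) (at x)"
   by (rule has_field_derivative_transform_within_open[OF _ open_lessThan[of 0]])
    (use neg False in \<open>simp_all add: bump_term_def\<close>)
  then show ?thesis using neg by (simp add: bump_term_def)
 qed
next
 case True
 have "((\<lambda>h. (bump_term p c (0 + h) - bump_term p c 0) / h) \<longlongrightarrow> 0) (at 0)"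
 proof (rule filterlim_split_at)
  have "\<forall>\<^sub>F h in at_left 0. (bump_term p c (0 + h) - bump_term p c 0) / h = 0"
   by (auto simp: eventually_at_filter bump_term_def)
  then show "((\<lambda>h. (bump_term p c (0 + h) - bump_term p c 0) / h) \<longlongrightarrow> 0) (at_left 0)"
   by (rule tendsto_eventually)
  have "\<forall>\<^sub>F y in at_top. poly ([:0, 1:] * p) y * exp (- (c * y))
    = (bump_term p c (0 + inverse y) - bump_term p c 0) / inverse y"
   using eventually_gt_at_top[of "0::real"]
   by eventually_elim (simp add: bump_term_def field_simps)
  from Lim_transform_eventually[OF poly_mult_exp_tendsto_0[OF c] this]
  show "((\<lambda>h. (bump_term p c (0 + h) - bump_term p c 0) / h) \<longlongrightarrow> 0) (at_right 0)"
   unfolding filterlim_at_right_to_top .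
 qed
 then show ?thesis using True by (simp add: DERIV_def bump_term_def)
qed

text \<open>
 Sums and products of bump terms at the two ends of an interval again form a class that is closed under
 differentiation.
\<close>

inductive bump_algebra :: "real \<Rightarrow> real \<Rightarrow> real \<Rightarrow> (real \<Rightarrow> real) \<Rightarrow> bool" for a b c where
 left: "bump_algebra a b c (\<lambda>x. bump_term p c (x - a))"
| right: "bump_algebra a b c (\<lambda>x. bump_term p c (b - x))"
| add: "bump_algebra a b c f \<Longrightarrow> bump_algebra a b c g \<Longrightarrow> bump_algebra a b c (\<lambda>x. f x + g x)"
| mult: "bump_algebra a b c f \<Longrightarrow> bump_algebra a b c g \<Longrightarrow> bump_algebra a b c (\<lambda>x. f x * g x)"

lemma bump_algebra_deriv:
 assumes c: "0 < c" and "bump_algebra a b c f"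
 shows "\<exists>f'. bump_algebra a b c f' \<and> (\<forall>x. (f has_real_derivative f' x) (at x))"
 using assms(2)
proof induction
 case (left p)
 have "((\<lambda>x. bump_term p c (x - a)) has_real_derivative bump_term ([:0, 0, 1:] * (smult c p - pderiv p)) c (x - a) * 1) (at x)" for x
  by (rule DERIV_chain2[OF bump_term_deriv[OF c]]) (auto intro!: derivative_eq_intros)
 then show ?case by (auto intro: bump_algebra.left)
next
 case (right p)
 have m: "- bump_term q c y = bump_term (- q) c y" for q y by (simp add: bump_term_def)
 have "((\<lambda>x. bump_term p c (b - x)) has_real_derivative bump_term ([:0, 0, 1:] * (smult c p - pderiv p)) c (b - x) * (-1)) (at x)" for x
  by (rule DERIV_chain2[OF bump_term_deriv[OF c]]) (auto intro!: derivative_eq_intros)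
 then have "((\<lambda>x. bump_term p c (b - x)) has_real_derivative bump_term (- ([:0, 0, 1:] * (smult c p - pderiv p))) c (b - x)) (at x)" for x
  unfolding m[symmetric] by simp
 then show ?case using bump_algebra.right by blast
next
 case (add f g)
 then obtain f' g' where "bump_algebra a b c f'" "bump_algebra a b c g'"
  and d: "\<And>x. (f has_real_derivative f' x) (at x)" "\<And>x. (g has_real_derivative g' x) (at x)" by blast
 then show ?case
  by (intro exI[of _ "\<lambda>x. f' x + g' x"] conjI bump_algebra.add allI DERIV_add)
next
 case (mult f g)
 then obtain f' g' where *: "bump_algebra a b c f'" "bump_algebra a b c g'"
  and d: "\<And>x. (f has_real_derivative f' x) (at x)" "\<And>x. (g has_real_derivative g' x) (at x)" by blast
 have "bump_algebra a b c (\<lambda>x. f' x * g x + g' x * f x)"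
  using * mult by (intro bump_algebra.add bump_algebra.mult)
 then show ?case
  by (intro exI[of _ "\<lambda>x. f' x * g x + g' x * f x"] conjI allI DERIV_mult d)
qed

definition smooth :: "(real \<Rightarrow> real) \<Rightarrow> bool" where
 "smooth f \<longleftrightarrow> (\<forall>k x. (deriv ^^ k) f field_differentiable at x)"

lemma smooth_coinduct:
 assumes "P f" and "\<And>f. P f \<Longrightarrow> \<exists>f'. P f' \<and> (\<forall>x. (f has_real_derivative f' x) (at x))"
 shows "smooth f"
proof -
 have "P ((deriv ^^ k) f)" for k
 proof (induction k)
  case (Suc k)
  then obtain f' where "P f'" "\<And>x. ((deriv ^^ k) f has_real_derivative f' x) (at x)" using assms(2) by blast
  then have "(deriv ^^ Suc k) f = f'" by (auto intro!: DERIV_imp_deriv)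
  then show ?case using \<open>P f'\<close> by simp
 qed (use assms in simp)
 then show ?thesis unfolding smooth_def field_differentiable_def using assms(2) by blast
qed

lemma smooth_deriv: "smooth f \<Longrightarrow> smooth (deriv f)"
 unfolding smooth_def by (metis funpow_swap1 funpow.simps(2) comp_apply)

lemma smooth_DERIV: "smooth f \<Longrightarrow> (f has_real_derivative deriv f x) (at x)"
 unfolding smooth_def by (metis funpow_0 field_differentiable_derivI)

lemma smooth_primitive:
 assumes "\<And>x. (F has_real_derivative f x) (at x)" "smooth f"
 shows "smooth F" "deriv F = f"
proof -
 show "deriv F = f" using assms(1) by (auto intro!: DERIV_imp_deriv)
 show "smooth F"
  by (rule smooth_coinduct[where P = "\<lambda>g. g = F \<or> smooth g"])
   (use assms smooth_deriv smooth_DERIV in blast)+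
qed

lemma smooth_lincomb:
 assumes "smooth f" "smooth g"
 shows "smooth (\<lambda>x. f x + c * g x)"
proof (rule smooth_coinduct[where P = "\<lambda>h. \<exists>f g. smooth f \<and> smooth g \<and> h = (\<lambda>x. f x + c * g x)"])
 fix h assume "\<exists>f g. smooth f \<and> smooth g \<and> h = (\<lambda>x. f x + c * g x)"
 then obtain f g where h: "smooth f" "smooth g" "h = (\<lambda>x. f x + c * g x)" by blast
 have "(h has_real_derivative deriv f x + c * deriv g x) (at x)" for x
  unfolding h(3) by (intro DERIV_add DERIV_cmult smooth_DERIV h)
 then show "\<exists>f'. (\<exists>f g. smooth f \<and> smooth g \<and> f' = (\<lambda>x. f x + c * g x)) \<and> (\<forall>x. (h has_real_derivative f' x) (at x))"
  using smooth_deriv h by blast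
qed (use assms in blast)

lemma smooth_continuous: "smooth f \<Longrightarrow> continuous_on A f"
 by (rule DERIV_continuous_on[OF DERIV_subset[OF smooth_DERIV]]) auto

lemma test_functions_iff:
 "\<phi> \<in> test_functions l \<longleftrightarrow> smooth \<phi> \<and> (\<exists>a b. 0 < a \<and> a < b \<and> b < l \<and> (\<forall>x. x \<notin> {a..b} \<longrightarrow> \<phi> x = 0))"
 by (simp add: test_functions_def smooth_def)

lemma test_function_deriv:
 assumes "\<phi> \<in> test_functions l"
 shows "deriv \<phi> \<in> test_functions l"
proof -
 obtain a b where ab: "0 < a" "a < b" "b < l" "\<And>x. x \<notin> {a..b} \<Longrightarrow> \<phi> x = 0" and s: "smooth \<phi>"
  using assms unfolding test_functions_iff by blast
 have "deriv \<phi> x = 0" if "x \<notin> {a..b}" for x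
 proof -
  have "open (- {a..b})" by (intro open_Compl closed_atLeastAtMost)
  then have "(\<phi> has_real_derivative 0) (at x)"
   using that ab by (intro has_field_derivative_transform_within_open[of "\<lambda>_. 0" 0 x "- {a..b}" \<phi>]) auto
  then show ?thesis by (rule DERIV_imp_deriv)
 qed
 then show ?thesis using ab smooth_deriv[OF s] unfolding test_functions_iff by blast
qed

lemma test_function_primitive_on:
 assumes "\<phi> \<in> test_functions l"
 shows "primitive_on l \<phi> (deriv \<phi>)" "\<phi> 0 = 0" "\<phi> l = 0"
proof -
 have s: "smooth \<phi>" using assms by (simp add: test_functions_iff)
 show "primitive_on l \<phi> (deriv \<phi>)"
  by (intro primitive_on_C1 smooth_continuous smooth_deriv s DERIV_subset[OF smooth_DERIV[OF s]]) auto
 show "\<phi> 0 = 0" "\<phi> l = 0" using assms unfolding test_functions_iff by auto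
qed

definition bump :: "real \<Rightarrow> real \<Rightarrow> real \<Rightarrow> real \<Rightarrow> real" where
 "bump a b c x = bump_term 1 c (x - a) * bump_term 1 c (b - x)"

lemma bump_test_function:
 assumes "0 < a" "a < b" "b < l" "0 < c"
 shows "bump a b c \<in> test_functions l"
proof -
 have "bump a b c = (\<lambda>x. bump_term 1 c (x - a) * bump_term 1 c (b - x))" by (simp add: fun_eq_iff bump_def)
 then have "bump_algebra a b c (bump a b c)"
  using bump_algebra.mult[OF bump_algebra.left bump_algebra.right, of a b c 1 1] by simp
 then have "smooth (bump a b c)" by (rule smooth_coinduct[where P = "bump_algebra a b c"]) (rule bump_algebra_deriv[OF assms(4)])
 moreover have "bump a b c x = 0" if "x \<notin> {a..b}" for x using that by (auto simp: bump_def bump_term_def)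
 ultimately show ?thesis using assms unfolding test_functions_iff by blast
qed

lemma bump_bounds: "0 < c \<Longrightarrow> 0 \<le> bump a b c x \<and> bump a b c x \<le> 1"
proof -
 assume "0 < c"
 then have "0 \<le> bump_term 1 c y \<and> bump_term 1 c y \<le> 1" for y by (simp add: bump_term_def)
 then show ?thesis by (simp add: bump_def mult_le_one)
qed

lemma bump_tendsto: "(\<lambda>n. bump a b (1 / real (Suc n)) x) \<longlonglongrightarrow> indicator {a<..<b} x"
proof (cases "x \<in> {a<..<b}")
 case True
 have z: "(\<lambda>n. 1 / real (Suc n)) \<longlonglongrightarrow> 0" using LIMSEQ_inverse_real_of_nat by (simp add: inverse_eq_divide)
 have "(\<lambda>n. exp (- (1 / real (Suc n) * (1 / (x - a)))) * exp (- (1 / real (Suc n) * (1 / (b - x)))))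
   \<longlonglongrightarrow> exp (- (0 * (1 / (x - a)))) * exp (- (0 * (1 / (b - x))))"
  by (intro tendsto_mult tendsto_exp tendsto_minus z tendsto_const)
 then show ?thesis using True by (simp add: bump_def bump_term_def)
qed (auto simp: bump_def bump_term_def)

text \<open>
 The sets over which the integral vanishes are closed under complements and disjoint unions, so with
 the intervals they contain all Borel sets.
\<close>

lemma AE_eq_0_if_interval_integrals:
 fixes f :: "real \<Rightarrow> real"
 assumes f: "integrable lebesgue f" and 0: "\<And>a b. (LINT x:{a..b}|lebesgue. f x) = 0"
 shows "AE x in lebesgue. f x = 0"
proof -
 have all: "(LINT x|lebesgue. f x) = 0"
 proof -
  have "(\<lambda>n. LINT x|lebesgue. indicator {-real n..real n} x *\<^sub>R f x) \<longlonglongrightarrow> (LINT x|lebesgue. f x)"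
  proof (rule integral_dominated_convergence[where w = "\<lambda>x. \<bar>f x\<bar>"])
   show "AE x in lebesgue. (\<lambda>n. indicator {-real n..real n} x *\<^sub>R f x) \<longlonglongrightarrow> f x"
   proof (rule AE_I2)
    fix x :: real
    have "\<forall>\<^sub>F n in sequentially. \<bar>x\<bar> \<le> real n"
     using filterlim_real_sequentially by (auto simp: filterlim_at_top)
    then have "\<forall>\<^sub>F n in sequentially. indicator {-real n..real n} x *\<^sub>R f x = f x"
     by eventually_elim (auto simp: indicator_def)
    then show "(\<lambda>n. indicator {-real n..real n} x *\<^sub>R f x) \<longlonglongrightarrow> f x" by (rule tendsto_eventually)
   qed
  qed (use f in \<open>auto simp: indicator_def\<close>)
  then show ?thesis using 0 LIMSEQ_unique[OF _ tendsto_const] by (simp add: set_lebesgue_integral_def)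
 qed
 have borel: "(LINT x:A|lebesgue. f x) = 0" if "A \<in> sets borel" for A
  using that
 proof (induction rule: borel_set_induct)
  case (compl A)
  have "(LINT x:- A|lebesgue. f x) = (LINT x|lebesgue. f x - indicator A x *\<^sub>R f x)"
   unfolding set_lebesgue_integral_def by (intro LINT_cong) (auto simp: indicator_def)
  also have "\<dots> = (LINT x|lebesgue. f x) - (LINT x:A|lebesgue. f x)"
   unfolding set_lebesgue_integral_def using compl(1) f
   by (intro Bochner_Integration.integral_diff integrable_mult_indicator) auto
  finally show ?case using compl all by simp
 next
  case (union A)
  have "(LINT x:(\<Union>i. A i)|lebesgue. f x) = (\<Sum>i. (LINT x:(A i)|lebesgue. f x))"
  proof (rule lebesgue_integral_countable_add)
   have "(\<Union>i. A i) \<in> sets lebesgue" using union(2) by (intro sets.countable_UN) auto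
   then show "set_integrable lebesgue (\<Union>i. A i) f"
    unfolding set_integrable_def using f by (intro integrable_mult_indicator)
  qed (use union(1,2) in \<open>auto simp: disjoint_family_on_def\<close>)
  then show ?case using union(3) by simp
 qed (use 0 in \<open>auto simp: set_lebesgue_integral_def\<close>)
 show ?thesis
 proof (rule sigma_finite_measure.density_zero[OF sigma_finite_lebesgue f])
  fix A :: "real set" assume A: "A \<in> sets lebesgue"
  then obtain S N N0 where S: "A = S \<union> N" "N \<subseteq> N0" "N0 \<in> null_sets lborel" "S \<in> sets lborel"
   by (rule sets_completionE)
  have "AE x in lebesgue. x \<notin> N0" using S(3) by (intro AE_not_in null_sets_completionI)
  then have "AE x in lebesgue. indicator A x *\<^sub>R f x = indicator S x *\<^sub>R f x"
   by eventually_elim (use S in \<open>auto simp: indicator_def\<close>)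
  then have "(LINT x:A|lebesgue. f x) = (LINT x:S|lebesgue. f x)"
   unfolding set_lebesgue_integral_def using A S(4) f by (intro integral_cong_AE) auto
  then show "set_lebesgue_integral lebesgue A f = 0" using borel[of S] S(4) by simp
 qed
qed

lemma AE_eq_0_if_primitive_0:
 fixes f :: "real \<Rightarrow> real"
 assumes f: "f absolutely_integrable_on {0..l}" and 0: "\<And>x. x \<in> {0..l} \<Longrightarrow> integral {0..x} f = 0" and l: "0 \<le> l"
 shows "AE x in lebesgue. x \<in> {0..l} \<longrightarrow> f x = 0"
proof -
 define g where "g = (\<lambda>x. indicator {0..l} x *\<^sub>R f x)"
 have g: "integrable lebesgue g" using f by (simp add: g_def set_integrable_def)
 have sub: "(LINT x:{a..b}|lebesgue. f x) = 0" if ab: "0 \<le> a" "a \<le> b" "b \<le> l" for a b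
 proof -
  have fi: "f integrable_on {0..b}"
   using abs_integrable_subinterval[OF f, of 0 b] ab by (intro LINT_HK(1)) auto
  have "(LINT x:{a..b}|lebesgue. f x) = integral {a..b} f"
   using ab by (intro LINT_HK(2) abs_integrable_subinterval[OF f]) auto
  moreover have "integral {0..a} f + integral {a..b} f = integral {0..b} f"
   using ab fi by (intro HK_combine) auto
  ultimately show ?thesis using 0[of a] 0[of b] ab by auto
 qed
 have "(LINT x:{a..b}|lebesgue. g x) = 0" for a b
 proof (cases "max 0 a \<le> min l b")
  case True
  have "(LINT x:{a..b}|lebesgue. g x) = (LINT x:{max 0 a..min l b}|lebesgue. f x)"
   unfolding set_lebesgue_integral_def g_def by (intro LINT_cong) (auto simp: indicator_def)
  then show ?thesis using sub[of "max 0 a" "min l b"] True by auto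
 next
  case False
  then have "(\<lambda>x. indicator {a..b} x *\<^sub>R g x) = (\<lambda>x. 0)" by (auto simp: fun_eq_iff g_def indicator_def)
  then show ?thesis by (simp add: set_lebesgue_integral_def)
 qed
 from AE_eq_0_if_interval_integrals[OF g this]
 show ?thesis by eventually_elim (auto simp: g_def indicator_def)
qed

text \<open>
 The powers \<open>\<phi>\<^bsup>1/n\<^esup>\<close> of a bump function \<open>\<phi>\<close> on \<open>(a,b)\<close> are again bump functions and converge boundedly
 to the indicator of \<open>(a,b)\<close>; a function orthogonal to all test functions thus has integral \<open>0\<close> over
 every interval.
\<close>

lemma fundamental_lemma:
 fixes f :: "real \<Rightarrow> real"
 assumes f: "f absolutely_integrable_on {0..l}" and l: "0 \<le> l"
  and orth: "\<And>\<phi>. \<phi> \<in> test_functions l \<Longrightarrow> integral {0..l} (\<lambda>x. f x * \<phi> x) = 0"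
 shows "AE x in lebesgue. x \<in> {0..l} \<longrightarrow> f x = 0"
proof -
 have fm: "(\<lambda>x. indicator {0..l} x *\<^sub>R f x) \<in> borel_measurable lebesgue"
  using f by (auto simp: set_integrable_def)
 have bm [measurable]: "bump a b c \<in> borel_measurable lebesgue" if "0 < a" "a < b" "b < l" "0 < c" for a b c
  using smooth_continuous[of "bump a b c" UNIV] bump_test_function[OF that]
  by (intro measurable_completion) (auto simp: test_functions_iff intro: borel_measurable_continuous_onI)
 have zero: "integral {a..b} f = 0" if ab: "0 < a" "a < b" "b < l" for a b
 proof -
  define \<phi> where "\<phi> n = bump a b (1 / real (Suc n))" for n
  have \<phi>: "\<phi> n \<in> test_functions l" for n unfolding \<phi>_def using ab by (intro bump_test_function) auto
  have "(\<lambda>n. LINT x|lebesgue. (indicator {0..l} x *\<^sub>R f x) * \<phi> n x)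
    \<longlonglongrightarrow> (LINT x|lebesgue. (indicator {0..l} x *\<^sub>R f x) * indicator {a<..<b} x)"
  proof (rule integral_dominated_convergence[where w = "\<lambda>x. \<bar>indicator {0..l} x *\<^sub>R f x\<bar>"])
   show "(\<lambda>x. (indicator {0..l} x *\<^sub>R f x) * indicator {a<..<b} x) \<in> borel_measurable lebesgue"
    using fm by (intro borel_measurable_times) auto
   show "(\<lambda>x. (indicator {0..l} x *\<^sub>R f x) * \<phi> n x) \<in> borel_measurable lebesgue" for n
    unfolding \<phi>_def using fm ab by (intro borel_measurable_times bm) auto
   show "integrable lebesgue (\<lambda>x. \<bar>indicator {0..l} x *\<^sub>R f x\<bar>)"
    using f unfolding set_integrable_def by (rule integrable_abs)
   show "AE x in lebesgue. (\<lambda>n. (indicator {0..l} x *\<^sub>R f x) * \<phi> n x) \<longlonglongrightarrow> (indicator {0..l} x *\<^sub>R f x) * indicator {a<..<b} x"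
    unfolding \<phi>_def by (intro AE_I2 tendsto_mult tendsto_const bump_tendsto)
   have "norm ((indicator {0..l} x *\<^sub>R f x) * \<phi> n x) \<le> \<bar>indicator {0..l} x *\<^sub>R f x\<bar>" for n x
    using bump_bounds[of "1 / real (Suc n)" a b x] unfolding \<phi>_def
    by (auto simp: abs_mult indicator_def intro!: mult_left_le)
   then show "AE x in lebesgue. norm ((indicator {0..l} x *\<^sub>R f x) * \<phi> n x) \<le> \<bar>indicator {0..l} x *\<^sub>R f x\<bar>" for n
    by simp
  qed
  moreover have "(LINT x|lebesgue. (indicator {0..l} x *\<^sub>R f x) * \<phi> n x) = 0" for n
  proof -
   have "(LINT x|lebesgue. (indicator {0..l} x *\<^sub>R f x) * \<phi> n x) = (LINT x:{0..l}|lebesgue. f x * \<phi> n x)"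
    by (simp add: set_lebesgue_integral_def mult.assoc)
   also have "\<dots> = integral {0..l} (\<lambda>x. f x * \<phi> n x)"
    using \<phi>[of n] by (intro LINT_HK(2) abs_integrable_mult_continuous[OF smooth_continuous f]) (simp add: test_functions_iff)
   finally show ?thesis using orth[OF \<phi>[of n]] by simp
  qed
  ultimately have "(LINT x|lebesgue. (indicator {0..l} x *\<^sub>R f x) * indicator {a<..<b} x) = 0"
   using LIMSEQ_unique[OF _ tendsto_const] by simp
  moreover have "(LINT x|lebesgue. (indicator {0..l} x *\<^sub>R f x) * indicator {a<..<b} x) = (LINT x:{a<..<b}|lebesgue. f x)"
   unfolding set_lebesgue_integral_def using ab by (intro LINT_cong) (auto simp: indicator_def)
  moreover have "(LINT x:{a<..<b}|lebesgue. f x) = integral {a<..<b} f"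
   using ab by (intro LINT_HK(2) set_integrable_subset[OF f]) auto
  ultimately show ?thesis by (simp add: integral_open_interval_real)
 qed
 define F where "F x = integral {0..x} f" for x
 have fi: "f integrable_on {0..l}" using f by (rule LINT_HK(1))
 have F: "continuous_on {0..l} F" unfolding F_def using fi by (rule indefinite_integral_continuous_1)
 have F0: "F 0 = 0" by (simp add: F_def)
 have "F x = 0" if x: "x \<in> {0..l}" for x
 proof (cases "l = 0")
  case True
  then show ?thesis using x F0 by simp
 next
  case False
  then have l0: "0 < l" using l by simp
  have const: "F b = F a" if "0 < a" "a < b" "b < l" for a b
  proof -
   have "integral {0..a} f + integral {a..b} f = integral {0..b} f"
    using that integrable_on_subinterval[OF fi, of 0 b] by (intro HK_combine) auto
   then show ?thesis using zero[OF that] by (simp add: F_def)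
  qed
  have eq: "F y = F (l/2)" if "y \<in> {0<..<l}" for y
   using const[of y "l/2"] const[of "l/2" y] that l0 by (cases y "l/2" rule: linorder_cases) auto
  \<comment> \<open>constancy on the open interval extends to the end points by continuity\<close>
  have "F y = F (l / 2)" if "y \<in> {0..l}" for y
  proof (rule continuous_constant_on_closure[of "{0<..<l}" F "F (l/2)" y])
   show "continuous_on (closure {0<..<l}) F" using F l0 by simp
   show "y \<in> closure {0<..<l}" using that l0 by simp
   show "F z = F (l / 2)" if "z \<in> {0<..<l}" for z by (rule eq[OF that])
  qed
  from this[of x] this[of 0] show ?thesis using x F0 l by simp
 qed
 then show ?thesis using AE_eq_0_if_primitive_0[OF f _ l] by (simp add: F_def)
qed

text \<open>
 Lemma of Du Bois-Reymond. For a bump function \<open>\<rho>\<close> and a suitable multiple \<open>d\<close>, the function \<open>\<phi> - d \<rho>\<close>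
 has integral zero and is thus the derivative of a test function. Hence \<open>f - c\<close> is orthogonal to every
 \<open>\<phi>\<close>, where \<open>c\<close> is the mean of \<open>f\<close> weighted by \<open>\<rho>\<close>.
\<close>

lemma weak_deriv_0_const:
 fixes f :: "real \<Rightarrow> real"
 assumes f: "f absolutely_integrable_on {0..l}" and l: "0 < l"
  and orth: "\<And>\<phi>. \<phi> \<in> test_functions l \<Longrightarrow> integral {0..l} (\<lambda>x. f x * deriv \<phi> x) = 0"
 shows "\<exists>c. AE x in lebesgue. x \<in> {0..l} \<longrightarrow> f x = c"
proof -
 define \<rho> where "\<rho> = bump (l/3) (l/2) 1"
 have \<rho>: "\<rho> \<in> test_functions l" unfolding \<rho>_def using l by (intro bump_test_function) auto
 have cont: "\<phi> \<in> test_functions l \<Longrightarrow> continuous_on A \<phi>" for \<phi> A by (simp add: test_functions_iff smooth_continuous)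
 define m where "m = integral {0..l} \<rho>"
 have "m \<noteq> 0"
 proof
  assume "m = 0"
  then have "(\<rho> has_integral 0) (cbox 0 l)"
   unfolding m_def using integrable_continuous_real[OF cont[OF \<rho>]] by (metis box_real(2) integrable_integral)
  then have "\<rho> (5 * l / 12) = 0"
   using l by (intro has_integral_0_cbox_imp_0[of 0 l \<rho>]) (auto simp: \<rho>_def bump_bounds intro!: cont[OF \<rho>, unfolded \<rho>_def])
  moreover have "\<rho> (5 * l / 12) \<noteq> 0" using l by (simp add: \<rho>_def bump_def bump_term_def)
  ultimately show False by simp
 qed
 define c where "c = integral {0..l} (\<lambda>x. f x * \<rho> x) / m"
 have fphi: "(\<lambda>x. f x * \<phi> x) integrable_on {0..l}" if "\<phi> \<in> test_functions l" for \<phi>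
  by (intro LINT_HK(1) abs_integrable_mult_continuous f cont that)
 have "integral {0..l} (\<lambda>x. (f x - c) * \<phi> x) = 0" if \<phi>: "\<phi> \<in> test_functions l" for \<phi>
 proof -
  define d where "d = integral {0..l} \<phi> / m"
  define \<eta> where "\<eta> = (\<lambda>x. \<phi> x + (- d) * \<rho> x)"
  have \<eta>s: "smooth \<eta>" unfolding \<eta>_def using \<phi> \<rho> by (intro smooth_lincomb) (auto simp: test_functions_iff)
  obtain a b where ab: "0 < a" "a < b" "b < l" "\<And>x. x \<notin> {a..b} \<Longrightarrow> \<phi> x = 0"
   using \<phi> unfolding test_functions_iff by blast
  obtain a' b' where ab': "0 < a'" "a' < b'" "b' < l" "\<And>x. x \<notin> {a'..b'} \<Longrightarrow> \<rho> x = 0"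
   using \<rho> unfolding test_functions_iff by blast
  define A B where "A = min a a'" and "B = max b b'"
  have AB1: "0 < A" "A < B" "B < l" using ab(1-3) ab'(1-3) by (auto simp: A_def B_def)
  have AB2: "\<eta> x = 0" if "x \<notin> {A..B}" for x
  proof -
   have "x \<notin> {a..b}" "x \<notin> {a'..b'}" using that by (auto simp: A_def B_def)
   then show ?thesis using ab(4)[of x] ab'(4)[of x] by (simp add: \<eta>_def)
  qed
  note AB = AB1 AB2
  define \<psi> where "\<psi> x = (if x \<ge> 0 then integral {0..x} \<eta> else 0)" for x
  have \<eta>i: "\<eta> integrable_on {u..v}" for u v by (intro integrable_continuous_real smooth_continuous \<eta>s)
  have "integral {0..l} \<eta> = integral {0..l} \<phi> + integral {0..l} (\<lambda>x. (- d) * \<rho> x)"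
   unfolding \<eta>_def by (intro integral_add integrable_continuous_real continuous_intros cont \<phi> \<rho>)
  also have "\<dots> = 0" using \<open>m \<noteq> 0\<close> by (simp add: d_def m_def[symmetric])
  finally have tot: "integral {0..l} \<eta> = 0" .
  have \<psi>0: "\<psi> x = 0" if "x \<notin> {A..B}" for x
  proof (cases "x < A")
   case True
   have "integral {0..x} \<eta> = integral {0..x} (\<lambda>x. 0)" using AB True by (intro integral_cong) auto
   then show ?thesis by (simp add: \<psi>_def)
  next
   case False
   then have xB: "x > B" using that by auto
   have out: "integral {u..v} \<eta> = 0" if "B < u" for u v
   proof -
    have "integral {u..v} \<eta> = integral {u..v} (\<lambda>x. 0)" using AB that by (intro integral_cong) auto
    then show ?thesis by simp
   qed
   have "integral {0..x} \<eta> = 0"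
   proof (cases "x \<le> l")
    case True
    have "integral {0..x} \<eta> + integral {x..l} \<eta> = integral {0..l} \<eta>"
     using True xB AB by (intro HK_combine \<eta>i) auto
    then show ?thesis using out[of x l] xB tot by simp
   next
    case False
    have "integral {0..l} \<eta> + integral {l..x} \<eta> = integral {0..x} \<eta>"
     using False l by (intro HK_combine \<eta>i) auto
    then show ?thesis using out[of l x] AB tot by simp
   qed
   then show ?thesis by (simp add: \<psi>_def)
  qed
  have "(\<psi> has_real_derivative \<eta> x) (at x)" for x
  proof (cases "0 < x")
   case True
   have "((\<lambda>u. integral {0..u} \<eta>) has_real_derivative \<eta> x) (at x within {0..x+1})"
    using True by (intro integral_has_real_derivative smooth_continuous \<eta>s) auto
   moreover have "at x within {0..x+1} = at x" using True by (intro at_within_interior) auto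
   ultimately have "((\<lambda>u. integral {0..u} \<eta>) has_real_derivative \<eta> x) (at x)" by simp
   then show ?thesis
    by (rule has_field_derivative_transform_within_open[OF _ open_greaterThan[of 0]]) (use True in \<open>auto simp: \<psi>_def\<close>)
  next
   case False
   have "((\<lambda>_. 0) has_real_derivative 0) (at x)" by simp
   then have "(\<psi> has_real_derivative 0) (at x)"
    by (rule has_field_derivative_transform_within_open[OF _ open_lessThan[of A]]) (use False AB1 \<psi>0 in auto)
   then show ?thesis using False AB1 AB2[of x] by simp
  qed
  note \<psi> = smooth_primitive[OF this \<eta>s]
  have "\<psi> \<in> test_functions l" using \<psi>(1) \<psi>0 AB unfolding test_functions_iff by blast
  then have "integral {0..l} (\<lambda>x. f x * \<eta> x) = 0" using orth \<psi>(2) by metis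
  moreover have "integral {0..l} (\<lambda>x. f x * \<eta> x) = integral {0..l} (\<lambda>x. f x * \<phi> x - d * (f x * \<rho> x))"
   by (simp add: \<eta>_def algebra_simps)
  moreover have "\<dots> = integral {0..l} (\<lambda>x. f x * \<phi> x) - integral {0..l} (\<lambda>x. d * (f x * \<rho> x))"
   using fphi[OF \<phi>] integrable_on_cmult_left[OF fphi[OF \<rho>], of d]
   by (intro HK_diff) auto
  moreover have "integral {0..l} (\<lambda>x. d * (f x * \<rho> x)) = d * (c * m)"
   using \<open>m \<noteq> 0\<close> by (simp add: c_def)
  moreover have "d * (c * m) = c * integral {0..l} \<phi>" using \<open>m \<noteq> 0\<close> by (simp add: d_def)
  moreover have "integral {0..l} (\<lambda>x. (f x - c) * \<phi> x) = integral {0..l} (\<lambda>x. f x * \<phi> x - c * \<phi> x)"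
   by (simp add: algebra_simps)
  moreover have "\<dots> = integral {0..l} (\<lambda>x. f x * \<phi> x) - integral {0..l} (\<lambda>x. c * \<phi> x)"
   by (intro HK_diff fphi[OF \<phi>] integrable_continuous_real
     continuous_on_mult continuous_on_const cont[OF \<phi>])
  ultimately show ?thesis by simp
 qed
 then have "AE x in lebesgue. x \<in> {0..l} \<longrightarrow> f x - c = 0"
  using l by (intro fundamental_lemma set_integral_diff(1) f absolutely_integrable_continuous_real continuous_on_const) auto
 then show ?thesis by auto
qed


section \<open>Sobolev functions on an interval as iterated primitives\<close>

lemma LINT_open_interval:
 fixes f :: "real \<Rightarrow> real"
 assumes "f absolutely_integrable_on {0..l}"
 shows "(LINT x:{0<..<l}|lebesgue. f x) = integral {0..l} f"
proof -
 have "(LINT x:{0<..<l}|lebesgue. f x) = integral {0<..<l} f"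
  by (rule LINT_HK(2)[OF set_integrable_subset[OF assms]]) auto
 then show ?thesis by (simp add: integral_open_interval_real)
qed

lemma AE_open_closed_interval:
 "(AE x in lebesgue. x \<in> {0<..<l} \<longrightarrow> P x) \<longleftrightarrow> (AE x in lebesgue. x \<in> {0..l} \<longrightarrow> P (x::real))"
proof -
 have ends: "AE x in lebesgue. x \<notin> {0, l}"
 proof (rule AE_not_in)
  show "{0, l} \<in> null_sets lebesgue" unfolding negligible_iff_null_sets[symmetric] by simp
 qed
 show ?thesis
 proof
  assume "AE x in lebesgue. x \<in> {0<..<l} \<longrightarrow> P x"
  with ends show "AE x in lebesgue. x \<in> {0..l} \<longrightarrow> P x"
   by eventually_elim auto
 next
  assume "AE x in lebesgue. x \<in> {0..l} \<longrightarrow> P x"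
  then show "AE x in lebesgue. x \<in> {0<..<l} \<longrightarrow> P x" by eventually_elim auto
 qed
qed

definition L2_restrict :: "real \<Rightarrow> (real \<Rightarrow> real) \<Rightarrow> L2" where
 "L2_restrict l F = L2_of (\<lambda>x. indicator {0<..<l} x * F x)"

definition sqint :: "real \<Rightarrow> (real \<Rightarrow> real) \<Rightarrow> bool" where
 "sqint l F \<longleftrightarrow> (\<lambda>x. indicator {0<..<l} x * F x) square_integrable_on UNIV"

lemma sqint_measurable: "sqint l F \<Longrightarrow> (\<lambda>x. indicator {0<..<l} x * F x) \<in> borel_measurable lebesgue"
 by (simp add: sqint_def square_integrable_UNIV_iff)

lemma indicator_mult_mult: "(indicator S x * a) * (indicator S x * b) = indicator S x *\<^sub>R (a * (b::real))"
 by (auto simp: indicator_def)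

lemma abs_integrable_closed_if_open:
 fixes f :: "real \<Rightarrow> real"
 assumes "set_integrable lebesgue {0<..<l} f"
 shows "f absolutely_integrable_on {0..l}"
proof -
 have "negligible {0, l}" by simp
 then show ?thesis
  by (rule absolutely_integrable_spike_set[OF assms negligible_subset[of "{0, l}"] negligible_subset[of "{0, l}"]]) auto
qed

lemma sqint_mult:
 assumes "sqint l F" "sqint l G"
 shows "(\<lambda>x. F x * G x) absolutely_integrable_on {0..l}"
proof (rule abs_integrable_closed_if_open)
 show "set_integrable lebesgue {0<..<l} (\<lambda>x. F x * G x)"
  using square_integrable_mult assms unfolding sqint_def set_integrable_def indicator_mult_mult[symmetric] by blast
qed

lemma sqint_add: "sqint l F \<Longrightarrow> sqint l G \<Longrightarrow> sqint l (\<lambda>x. F x + G x)"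
 unfolding sqint_def distrib_left by (rule square_integrable_add)

lemma sqint_cmult: "sqint l F \<Longrightarrow> sqint l (\<lambda>x. c * F x)"
 unfolding sqint_def mult.left_commute[of _ c] by (rule square_integrable_scale)

lemma sqint_continuous:
 assumes "continuous_on {0..l} F"
 shows "sqint l F"
proof -
 have F: "F absolutely_integrable_on {0..l}" "(\<lambda>x. F x * F x) absolutely_integrable_on {0..l}"
  using assms by (intro absolutely_integrable_continuous_real continuous_intros; simp)+
 have "set_integrable lebesgue {0<..<l} F" "set_integrable lebesgue {0<..<l} (\<lambda>x. F x * F x)"
  by (rule set_integrable_subset[OF F(1)] set_integrable_subset[OF F(2)]; force)+
 then show ?thesis
  unfolding sqint_def square_integrable_UNIV_iff power2_eq_square indicator_mult_mult
  by (auto simp: set_integrable_def)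
qed

lemma sqint_1: "sqint l (\<lambda>x. 1)"
 by (intro sqint_continuous continuous_intros)

lemma sqint_abs_integrable: "sqint l F \<Longrightarrow> F absolutely_integrable_on {0..l}"
 using sqint_mult[OF _ sqint_1, of l F] by simp

lemma sqint_fun_of_L2: "sqint l (fun_of_L2 a)"
proof -
 have [measurable]: "fun_of_L2 a \<in> borel_measurable lebesgue"
  using fun_of_L2_square_integrable[of a] by (simp add: square_integrable_UNIV_iff)
 have i: "integrable lebesgue (\<lambda>x. (fun_of_L2 a x)\<^sup>2)"
  using fun_of_L2_square_integrable[of a] by (simp add: square_integrable_UNIV_iff)
 show ?thesis
  unfolding sqint_def square_integrable_UNIV_iff
 proof
  show "(\<lambda>x. indicator {0<..<l} x * fun_of_L2 a x) \<in> borel_measurable lebesgue" by measurable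
  show "integrable lebesgue (\<lambda>x. (indicator {0<..<l} x * fun_of_L2 a x)\<^sup>2)"
   by (rule Bochner_Integration.integrable_bound[OF i]) (auto simp: indicator_def)
 qed
qed

lemma L2_restrict_class: "sqint l F \<Longrightarrow> L2_restrict l F = L2_class (\<lambda>x. indicator {0<..<l} x * F x)"
 by (simp add: L2_restrict_def L2_of_def sqint_def)

lemma fun_of_L2_restrict:
 "sqint l F \<Longrightarrow> AE x in lebesgue. fun_of_L2 (L2_restrict l F) x = indicator {0<..<l} x * F x"
 by (simp add: L2_restrict_class sqint_def fun_of_L2_class)

lemma fun_of_L2_restrict_on:
 "sqint l F \<Longrightarrow> AE x in lebesgue. x \<in> {0<..<l} \<longrightarrow> fun_of_L2 (L2_restrict l F) x = F x"
 using fun_of_L2_restrict[of l F] by (auto elim: eventually_mono)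

lemma L2_restrict_L2_on: "sqint l F \<Longrightarrow> L2_restrict l F \<in> L2_on {0<..<l}"
 using fun_of_L2_restrict[of l F] by (auto simp: L2_on_def elim: eventually_mono)

lemma L2_restrict_eq_iff:
 assumes "sqint l F" "sqint l G"
 shows "L2_restrict l F = L2_restrict l G \<longleftrightarrow> (AE x in lebesgue. x \<in> {0<..<l} \<longrightarrow> F x = G x)"
proof -
 have "L2_restrict l F = L2_restrict l G \<longleftrightarrow> (AE x in lebesgue. indicator {0<..<l} x * F x = indicator {0<..<l} x * G x)"
  using assms by (simp add: L2_restrict_class sqint_def L2_class_eq_iff)
 also have "\<dots> \<longleftrightarrow> (AE x in lebesgue. x \<in> {0<..<l} \<longrightarrow> F x = G x)"
  by (intro arg_cong[where f = "\<lambda>P. eventually P _"] ext) (auto simp: indicator_def)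
 finally show ?thesis .
qed

lemma L2_restrict_cong:
 assumes "\<And>x. x \<in> {0<..<l} \<Longrightarrow> F x = G x"
 shows "L2_restrict l F = L2_restrict l G" "sqint l F \<longleftrightarrow> sqint l G"
proof -
 have "(\<lambda>x. indicator {0<..<l} x * F x) = (\<lambda>x. indicator {0<..<l} x * G x)"
  using assms by (auto simp: fun_eq_iff indicator_def)
 then show "L2_restrict l F = L2_restrict l G" "sqint l F \<longleftrightarrow> sqint l G"
  by (simp_all add: L2_restrict_def sqint_def)
qed

lemma L2_restrict_fun_of_L2: "a \<in> L2_on {0<..<l} \<Longrightarrow> L2_restrict l (fun_of_L2 a) = a"
proof -
 assume a: "a \<in> L2_on {0<..<l}"
 have "L2_class (\<lambda>x. indicator {0<..<l} x * fun_of_L2 a x) = L2_class (fun_of_L2 a)"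
  using sqint_fun_of_L2[of l a] fun_of_L2_square_integrable[of a] a
  by (subst L2_class_eq_iff) (auto simp: sqint_def L2_on_def indicator_def elim: eventually_mono)
 then show ?thesis by (simp add: L2_restrict_class sqint_fun_of_L2 L2_class_fun_of_L2)
qed

lemma L2_restrict_add: "sqint l F \<Longrightarrow> sqint l G \<Longrightarrow> L2_restrict l F + L2_restrict l G = L2_restrict l (\<lambda>x. F x + G x)"
 using sqint_add[of l F G] by (simp add: L2_restrict_class L2_class_add sqint_def distrib_left)

lemma L2_restrict_scale: "sqint l F \<Longrightarrow> c *\<^sub>R L2_restrict l F = L2_restrict l (\<lambda>x. c * F x)"
 using sqint_cmult[of l F c] by (simp add: L2_restrict_class L2_class_scale sqint_def mult.left_commute)

lemma inner_L2_restrict: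
 assumes "sqint l F" "sqint l G"
 shows "inner (L2_restrict l F) (L2_restrict l G) = integral {0..l} (\<lambda>x. F x * G x)"
proof -
 have "inner (L2_restrict l F) (L2_restrict l G) = (LINT x:{0<..<l}|lebesgue. F x * G x)"
  using assms by (simp add: L2_restrict_class sqint_def inner_L2.abs_eq indicator_mult_mult set_lebesgue_integral_def)
 also have "\<dots> = integral {0..l} (\<lambda>x. F x * G x)" by (rule LINT_open_interval[OF sqint_mult[OF assms]])
 finally show ?thesis .
qed

lemma norm_L2_restrict: "sqint l F \<Longrightarrow> (norm (L2_restrict l F))\<^sup>2 = integral {0..l} (\<lambda>x. F x * F x)"
 by (simp add: power2_norm_eq_inner inner_L2_restrict)

lemma primitive_on_AE_cong:
 assumes F: "primitive_on l F f" and g: "sqint l g" and eq: "AE x in lebesgue. x \<in> {0<..<l} \<longrightarrow> f x = g x"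
 shows "primitive_on l F g"
proof -
 have f: "f absolutely_integrable_on {0..l}" using F by (simp add: primitive_on_def)
 have g': "g absolutely_integrable_on {0..l}" by (rule sqint_abs_integrable[OF g])
 have eq': "AE x in lebesgue. x \<in> {0..l} \<longrightarrow> f x = g x" using eq by (rule AE_open_closed_interval[THEN iffD1])
 have "integral {0..x} g = integral {0..x} f" if x: "x \<in> {0..l}" for x
 proof -
  have fx: "f absolutely_integrable_on {0..x}" "g absolutely_integrable_on {0..x}"
   using x by (auto intro: abs_integrable_subinterval[OF f] abs_integrable_subinterval[OF g'])
  have "(LINT y:{0..x}|lebesgue. g y) = (LINT y:{0..x}|lebesgue. f y)"
   unfolding set_lebesgue_integral_def
  proof (rule integral_cong_AE)
   show "AE y in lebesgue. indicator {0..x} y *\<^sub>R g y = indicator {0..x} y *\<^sub>R f y"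
    using eq' by eventually_elim (use x in \<open>auto simp: indicator_def\<close>)
  qed (use fx in \<open>auto simp: set_integrable_def\<close>)
  then show ?thesis using LINT_HK(2)[OF fx(1)] LINT_HK(2)[OF fx(2)] by simp
 qed
 then show ?thesis using F g' by (simp add: primitive_on_def)
qed

lemma test_function_sqint:
 assumes "\<phi> \<in> test_functions l"
 shows "sqint l \<phi>" "continuous_on A \<phi>"
 using assms by (auto simp: test_functions_iff intro: sqint_continuous smooth_continuous)

lemma has_weak_deriv_iff:
 "has_weak_deriv l k f g \<longleftrightarrow> (\<forall>\<phi>\<in>test_functions l.
   integral {0..l} (\<lambda>x. fun_of_L2 f x * (deriv ^^ k) \<phi> x) = (-1) ^ k * integral {0..l} (\<lambda>x. fun_of_L2 g x * \<phi> x))"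
proof -
 have D: "(deriv ^^ k) \<phi> \<in> test_functions l" if "\<phi> \<in> test_functions l" for \<phi> :: "real \<Rightarrow> real"
  using that by (induction k) (auto intro: test_function_deriv)
 show ?thesis
  unfolding has_weak_deriv_def
  using LINT_open_interval[OF sqint_mult[OF sqint_fun_of_L2 test_function_sqint(1)]] D by simp
qed

lemma weak_deriv_unique:
 assumes l: "0 < l" and g: "g1 \<in> L2_on {0<..<l}" "g2 \<in> L2_on {0<..<l}"
  and w: "has_weak_deriv l k f g1" "has_weak_deriv l k f g2"
 shows "g1 = g2"
proof -
 define h where "h x = fun_of_L2 g1 x + (-1) * fun_of_L2 g2 x" for x
 have h: "sqint l h" unfolding h_def by (intro sqint_add sqint_cmult sqint_fun_of_L2)
 have "AE x in lebesgue. x \<in> {0..l} \<longrightarrow> h x = 0"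
 proof (rule fundamental_lemma)
  show "h absolutely_integrable_on {0..l}" using h by (rule sqint_abs_integrable)
  fix \<phi> assume \<phi>: "\<phi> \<in> test_functions l"
  have i: "(\<lambda>x. fun_of_L2 g x * \<phi> x) integrable_on {0..l}" for g
   by (intro LINT_HK(1) sqint_mult sqint_fun_of_L2 test_function_sqint \<phi>)
  have "integral {0..l} (\<lambda>x. h x * \<phi> x) = integral {0..l} (\<lambda>x. fun_of_L2 g1 x * \<phi> x - fun_of_L2 g2 x * \<phi> x)"
   by (simp add: h_def algebra_simps)
  also have "\<dots> = integral {0..l} (\<lambda>x. fun_of_L2 g1 x * \<phi> x) - integral {0..l} (\<lambda>x. fun_of_L2 g2 x * \<phi> x)"
   by (intro HK_diff i)
  also have "(-1) ^ k * integral {0..l} (\<lambda>x. fun_of_L2 g1 x * \<phi> x) = (-1) ^ k * integral {0..l} (\<lambda>x. fun_of_L2 g2 x * \<phi> x)"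
   using w \<phi> by (simp add: has_weak_deriv_iff)
  then have "integral {0..l} (\<lambda>x. fun_of_L2 g1 x * \<phi> x) - integral {0..l} (\<lambda>x. fun_of_L2 g2 x * \<phi> x) = 0" by simp
  finally show "integral {0..l} (\<lambda>x. h x * \<phi> x) = 0" .
 qed (use l in simp)
 then have "AE x in lebesgue. x \<in> {0<..<l} \<longrightarrow> fun_of_L2 g1 x = fun_of_L2 g2 x"
  by eventually_elim (auto simp: h_def)
 then have "L2_restrict l (fun_of_L2 g1) = L2_restrict l (fun_of_L2 g2)"
  by (simp add: L2_restrict_eq_iff sqint_fun_of_L2)
 then show ?thesis using g by (simp add: L2_restrict_fun_of_L2)
qed

lemma weak_deriv_eqI:
 assumes "0 < l" "g \<in> L2_on {0<..<l}" "has_weak_deriv l k f g"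
 shows "weak_deriv l k f = g"
 unfolding weak_deriv_def using assms weak_deriv_unique[OF assms(1)] by (intro the_equality) blast+

lemma integral_primitive_mult_test_deriv:
 assumes F: "primitive_on l F f" and l: "0 < l" and \<phi>: "\<phi> \<in> test_functions l"
 shows "integral {0..l} (\<lambda>x. F x * deriv \<phi> x) = - integral {0..l} (\<lambda>x. f x * \<phi> x)"
proof -
 have "integral {0..l} (\<lambda>x. f x * \<phi> x + F x * deriv \<phi> x) = 0"
  using integral_by_parts[OF F test_function_primitive_on(1)[OF \<phi>]] test_function_primitive_on(2,3)[OF \<phi>] l by simp
 moreover have "integral {0..l} (\<lambda>x. f x * \<phi> x + F x * deriv \<phi> x)
   = integral {0..l} (\<lambda>x. f x * \<phi> x) + integral {0..l} (\<lambda>x. F x * deriv \<phi> x)"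
 proof (rule integral_add)
  show "(\<lambda>x. f x * \<phi> x) integrable_on {0..l}"
   by (intro LINT_HK(1)[OF abs_integrable_mult_continuous] test_function_sqint(2)[OF \<phi>] primitive_on_integrable[OF F])
  show "(\<lambda>x. F x * deriv \<phi> x) integrable_on {0..l}"
   by (intro integrable_continuous_real continuous_on_mult primitive_on_continuous[OF F] test_function_sqint(2)[OF test_function_deriv[OF \<phi>]])
 qed
 ultimately show ?thesis by simp
qed

lemma integral_L2_restrict_mult:
 assumes F: "sqint l F"
 shows "integral {0..l} (\<lambda>x. fun_of_L2 (L2_restrict l F) x * \<phi> x) = integral {0..l} (\<lambda>x. F x * \<phi> x)"
proof -
 have "AE x in lebesgue. x \<in> {0..l} \<longrightarrow> fun_of_L2 (L2_restrict l F) x = F x"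
  using fun_of_L2_restrict_on[OF F] by (rule AE_open_closed_interval[THEN iffD1])
 then obtain N where N: "N \<in> null_sets lebesgue" "\<And>x. x \<notin> N \<Longrightarrow> x \<in> {0..l} \<longrightarrow> fun_of_L2 (L2_restrict l F) x = F x"
  unfolding completion.AE_iff_null_sets by auto
 show ?thesis
  by (rule integral_spike[of N]) (use N in \<open>auto simp: negligible_iff_null_sets\<close>)
qed

lemma has_weak_deriv_L2_restrict:
 assumes "sqint l F" "sqint l G"
 shows "has_weak_deriv l k (L2_restrict l F) (L2_restrict l G) \<longleftrightarrow> (\<forall>\<phi>\<in>test_functions l.
   integral {0..l} (\<lambda>x. F x * (deriv ^^ k) \<phi> x) = (-1) ^ k * integral {0..l} (\<lambda>x. G x * \<phi> x))"
 unfolding has_weak_deriv_iff by (simp add: integral_L2_restrict_mult assms)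

text \<open>The difference between \<open>f\<close> and any primitive of \<open>g\<close> has weak derivative zero.\<close>

lemma has_weak_deriv_primitive:
 assumes l: "0 < l" and g: "g \<in> L2_on {0<..<l}" and f: "f \<in> L2_on {0<..<l}" and w: "has_weak_deriv l 1 f g"
 obtains F where "primitive_on l F (fun_of_L2 g)" "f = L2_restrict l F"
proof -
 define G where "G x = integral {0..x} (fun_of_L2 g)" for x
 have gi: "fun_of_L2 g absolutely_integrable_on {0..l}" by (rule sqint_abs_integrable[OF sqint_fun_of_L2])
 have G: "primitive_on l G (fun_of_L2 g)" using gi by (simp add: primitive_on_def G_def)
 have Gs: "sqint l G" using primitive_on_continuous[OF G] by (rule sqint_continuous)
 have fG: "sqint l (\<lambda>x. fun_of_L2 f x + (-1) * G x)" by (intro sqint_add sqint_cmult Gs sqint_fun_of_L2)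
 have "\<exists>c. AE x in lebesgue. x \<in> {0..l} \<longrightarrow> fun_of_L2 f x + (-1) * G x = c"
 proof (rule weak_deriv_0_const[OF sqint_abs_integrable[OF fG] l])
  fix \<phi> assume \<phi>: "\<phi> \<in> test_functions l"
  have "integral {0..l} (\<lambda>x. (fun_of_L2 f x + (-1) * G x) * deriv \<phi> x)
    = integral {0..l} (\<lambda>x. fun_of_L2 f x * deriv \<phi> x - G x * deriv \<phi> x)" by (simp add: algebra_simps)
  also have "\<dots> = integral {0..l} (\<lambda>x. fun_of_L2 f x * deriv \<phi> x) - integral {0..l} (\<lambda>x. G x * deriv \<phi> x)"
   by (intro HK_diff LINT_HK(1) sqint_mult sqint_fun_of_L2 Gs
     test_function_sqint test_function_deriv \<phi>)
  also have "\<dots> = 0"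
   using w \<phi> integral_primitive_mult_test_deriv[OF G l \<phi>] by (simp add: has_weak_deriv_iff)
  finally show "integral {0..l} (\<lambda>x. (fun_of_L2 f x + (-1) * G x) * deriv \<phi> x) = 0" .
 qed
 then obtain c where c: "AE x in lebesgue. x \<in> {0..l} \<longrightarrow> fun_of_L2 f x + (-1) * G x = c" by blast
 define F where "F x = G x + c" for x
 have F: "primitive_on l F (fun_of_L2 g)"
  using G by (simp add: F_def primitive_on_def)
 have "AE x in lebesgue. x \<in> {0<..<l} \<longrightarrow> fun_of_L2 f x = F x"
  using c by eventually_elim (auto simp: F_def)
 then have "L2_restrict l (fun_of_L2 f) = L2_restrict l F"
  using sqint_continuous[OF primitive_on_continuous[OF F]] by (simp add: L2_restrict_eq_iff sqint_fun_of_L2)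
 then show thesis using that[OF F] L2_restrict_fun_of_L2[OF f] by simp
qed

lemma continuous_AE_0:
 fixes h :: "real \<Rightarrow> real"
 assumes h: "continuous_on {0..l} h" and l: "0 < l" and ae: "AE x in lebesgue. x \<in> {0<..<l} \<longrightarrow> h x = 0" and x: "x \<in> {0..l}"
 shows "h x = 0"
proof -
 have ae': "AE x in lebesgue. x \<in> {0..l} \<longrightarrow> h x = 0" using ae by (rule AE_open_closed_interval[THEN iffD1])
 then obtain N where N: "N \<in> null_sets lebesgue" "\<And>x. x \<notin> N \<Longrightarrow> x \<in> {0..l} \<longrightarrow> h x = 0"
  unfolding completion.AE_iff_null_sets by auto
 have "((\<lambda>x. \<bar>h x\<bar>) has_integral 0) (cbox 0 l)"
  by (rule has_integral_spike[of N _ _ "\<lambda>_. 0"]) (use N in \<open>auto simp: negligible_iff_null_sets\<close>)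
 then have "\<bar>h x\<bar> = 0"
  using h x l by (intro has_integral_0_cbox_imp_0[of 0 l "\<lambda>x. \<bar>h x\<bar>"]) (auto intro: continuous_on_rabs)
 then show ?thesis by simp
qed

lemma point_value_L2_restrict:
 assumes F: "continuous_on {0..l} F" and l: "0 < l" and x: "x \<in> {0..l}"
 shows "point_value l (L2_restrict l F) x = F x"
 unfolding point_value_def
proof (rule the_equality)
 have ae: "AE z in lebesgue_on {0<..<l}. fun_of_L2 (L2_restrict l F) z = F z"
  using fun_of_L2_restrict_on[OF sqint_continuous[OF F]] by (subst AE_restrict_space_iff) auto
 show "\<exists>h. continuous_on {0..l} h \<and> (AE z in lebesgue_on {0<..<l}. fun_of_L2 (L2_restrict l F) z = h z) \<and> F x = h x"
  using ae F by blast
 fix y assume "\<exists>h. continuous_on {0..l} h \<and> (AE z in lebesgue_on {0<..<l}. fun_of_L2 (L2_restrict l F) z = h z) \<and> y = h x"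
 then obtain h where h: "continuous_on {0..l} h" "AE z in lebesgue_on {0<..<l}. fun_of_L2 (L2_restrict l F) z = h z" "y = h x"
  by blast
 have "AE z in lebesgue_on {0<..<l}. h z - F z = 0" using ae h(2) by eventually_elim simp
 then have "AE z in lebesgue. z \<in> {0<..<l} \<longrightarrow> h z - F z = 0" by (subst (asm) AE_restrict_space_iff) auto
 then have "h x - F x = 0" using continuous_AE_0[of l "\<lambda>z. h z - F z" x] h F l x by (auto intro: continuous_on_diff)
 then show "y = F x" using h by simp
qed

text \<open>
 Elements of \<open>H\<^sup>1\<close> and \<open>H\<^sup>3\<close> with pointwise defined representatives of the function and its
 derivatives.
\<close>

definition H1_rep :: "real \<Rightarrow> L2 \<Rightarrow> (real \<Rightarrow> real) \<Rightarrow> (real \<Rightarrow> real) \<Rightarrow> bool" where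
 "H1_rep l u F F1 \<longleftrightarrow> primitive_on l F F1 \<and> sqint l F1 \<and> u = L2_restrict l F"

definition H3_rep :: "real \<Rightarrow> L2 \<Rightarrow> (real \<Rightarrow> real) \<Rightarrow> (real \<Rightarrow> real) \<Rightarrow> (real \<Rightarrow> real) \<Rightarrow> (real \<Rightarrow> real) \<Rightarrow> bool" where
 "H3_rep l u F F1 F2 F3 \<longleftrightarrow> primitive_on l F F1 \<and> primitive_on l F1 F2 \<and> primitive_on l F2 F3 \<and> sqint l F3 \<and> u = L2_restrict l F"

lemma primitive_on_sqint: "primitive_on l F f \<Longrightarrow> sqint l F"
 by (intro sqint_continuous primitive_on_continuous)

lemma weak_deriv_0: "0 < l \<Longrightarrow> u \<in> L2_on {0<..<l} \<Longrightarrow> weak_deriv l 0 u = u"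
 by (rule weak_deriv_eqI) (auto simp: has_weak_deriv_def)

lemma has_weak_deriv_0: "has_weak_deriv l 0 u u"
 by (simp add: has_weak_deriv_def)

lemma has_weak_deriv_1_H1:
 assumes l: "0 < l" and F: "primitive_on l F F1" "sqint l F1"
 shows "has_weak_deriv l 1 (L2_restrict l F) (L2_restrict l F1)"
 using integral_primitive_mult_test_deriv[OF F(1) l] primitive_on_sqint[OF F(1)] F(2)
 by (simp add: has_weak_deriv_L2_restrict)

lemma H1_rep_weak_deriv:
 assumes l: "0 < l" and F: "H1_rep l u F F1"
 shows "u \<in> Sobolev 1 l" "weak_deriv l 1 u = L2_restrict l F1"
  "x \<in> {0..l} \<Longrightarrow> point_value l u x = F x"
proof -
 have u: "u \<in> L2_on {0<..<l}" using F by (auto simp: H1_rep_def intro: L2_restrict_L2_on primitive_on_sqint)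
 have w: "has_weak_deriv l 1 u (L2_restrict l F1)" using has_weak_deriv_1_H1[OF l] F by (simp add: H1_rep_def)
 have F1: "L2_restrict l F1 \<in> L2_on {0<..<l}" using F by (simp add: H1_rep_def L2_restrict_L2_on)
 show "weak_deriv l 1 u = L2_restrict l F1" by (rule weak_deriv_eqI[OF l F1 w])
 show "u \<in> Sobolev 1 l"
  unfolding Sobolev_def using u w F1 has_weak_deriv_0 by (auto simp: le_Suc_eq)
 show "x \<in> {0..l} \<Longrightarrow> point_value l u x = F x"
  using F l by (auto simp: H1_rep_def intro!: point_value_L2_restrict primitive_on_continuous)
qed

lemma Sobolev_1_rep:
 assumes l: "0 < l" and u: "u \<in> Sobolev 1 l"
 obtains F F1 where "H1_rep l u F F1"
proof -
 obtain g where g: "g \<in> L2_on {0<..<l}" "has_weak_deriv l 1 u g" and uL: "u \<in> L2_on {0<..<l}"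
  using u unfolding Sobolev_def by auto
 obtain F where "primitive_on l F (fun_of_L2 g)" "u = L2_restrict l F"
  by (rule has_weak_deriv_primitive[OF l g(1) uL g(2)])
 then show thesis by (intro that[of F "fun_of_L2 g"]) (simp add: H1_rep_def sqint_fun_of_L2)
qed

lemma H3_rep_D:
 assumes l: "0 < l" and F: "H3_rep l u F F1 F2 F3"
 shows "u \<in> Sobolev 3 l" "u \<in> Sobolev 2 l" "u \<in> Sobolev 1 l"
  "weak_deriv l 0 u = u" "weak_deriv l 1 u = L2_restrict l F1" "weak_deriv l 2 u = L2_restrict l F2" "weak_deriv l 3 u = L2_restrict l F3"
  "x \<in> {0..l} \<Longrightarrow> point_value l u x = F x" "x \<in> {0..l} \<Longrightarrow> point_value l (L2_restrict l F1) x = F1 x"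
  "x \<in> {0..l} \<Longrightarrow> point_value l (L2_restrict l F2) x = F2 x"
  "H1_rep l u F F1"
proof -
 have p: "primitive_on l F F1" "primitive_on l F1 F2" "primitive_on l F2 F3" and s3: "sqint l F3" and u: "u = L2_restrict l F"
  using F by (auto simp: H3_rep_def)
 note s = p[THEN primitive_on_sqint] s3
 note L = s[THEN L2_restrict_L2_on]
 have w: "has_weak_deriv l 1 u (L2_restrict l F1)" "has_weak_deriv l 2 u (L2_restrict l F2)" "has_weak_deriv l 3 u (L2_restrict l F3)"
 proof -
  show "has_weak_deriv l 1 u (L2_restrict l F1)" unfolding u by (rule has_weak_deriv_1_H1[OF l p(1) s(2)])
  show "has_weak_deriv l 2 u (L2_restrict l F2)"
   unfolding u
  proof (subst has_weak_deriv_L2_restrict[OF s(1) s(3)], intro ballI)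
   fix \<phi> assume \<phi>: "\<phi> \<in> test_functions l"
   show "integral {0..l} (\<lambda>x. F x * (deriv ^^ 2) \<phi> x) = (-1)\<^sup>2 * integral {0..l} (\<lambda>x. F2 x * \<phi> x)"
    using integral_primitive_mult_test_deriv[OF p(1) l test_function_deriv[OF \<phi>]] integral_primitive_mult_test_deriv[OF p(2) l \<phi>]
    by (simp add: numeral_2_eq_2)
  qed
  show "has_weak_deriv l 3 u (L2_restrict l F3)"
   unfolding u
  proof (subst has_weak_deriv_L2_restrict[OF s(1) s(4)], intro ballI)
   fix \<phi> assume \<phi>: "\<phi> \<in> test_functions l"
   show "integral {0..l} (\<lambda>x. F x * (deriv ^^ 3) \<phi> x) = (-1)^3 * integral {0..l} (\<lambda>x. F3 x * \<phi> x)"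
    using integral_primitive_mult_test_deriv[OF p(1) l test_function_deriv[OF test_function_deriv[OF \<phi>]]]
     integral_primitive_mult_test_deriv[OF p(2) l test_function_deriv[OF \<phi>]] integral_primitive_mult_test_deriv[OF p(3) l \<phi>]
    by (simp add: numeral_3_eq_3)
  qed
 qed
 have w0: "has_weak_deriv l 0 u u" by (rule has_weak_deriv_0)
 have uL: "u \<in> L2_on {0<..<l}" using L(1) u by simp
 show "weak_deriv l 0 u = u" by (rule weak_deriv_0[OF l uL])
 show "weak_deriv l 1 u = L2_restrict l F1" by (rule weak_deriv_eqI[OF l L(2) w(1)])
 show "weak_deriv l 2 u = L2_restrict l F2" by (rule weak_deriv_eqI[OF l L(3) w(2)])
 show "weak_deriv l 3 u = L2_restrict l F3" by (rule weak_deriv_eqI[OF l L(4) w(3)])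
 have S: "u \<in> Sobolev n l" if "n \<le> 3" for n
 proof -
  have "\<exists>g\<in>L2_on {0<..<l}. has_weak_deriv l k u g" if "k \<le> 3" for k
  proof -
   have "k = 0 \<or> k = 1 \<or> k = 2 \<or> k = 3" using that by auto
   then show ?thesis using w w0 L uL by auto
  qed
  then show ?thesis using uL \<open>n \<le> 3\<close> unfolding Sobolev_def by auto
 qed
 show "u \<in> Sobolev 3 l" "u \<in> Sobolev 2 l" "u \<in> Sobolev 1 l" by (auto intro: S)
 show "x \<in> {0..l} \<Longrightarrow> point_value l u x = F x" "x \<in> {0..l} \<Longrightarrow> point_value l (L2_restrict l F1) x = F1 x"
  "x \<in> {0..l} \<Longrightarrow> point_value l (L2_restrict l F2) x = F2 x"
  unfolding u using p[THEN primitive_on_continuous] l by (auto intro: point_value_L2_restrict)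
 show "H1_rep l u F F1" using p s u by (simp add: H1_rep_def)
qed

text \<open>
 In \<open>Sobolev 3 l\<close> the derivatives of the various orders are defined independently of each other.
 Inserting \<open>deriv \<phi>\<close> as test function shows that each is the weak derivative of the preceding one.
\<close>

lemma Sobolev_3_rep:
 assumes l: "0 < l" and u: "u \<in> Sobolev 3 l"
 obtains F F1 F2 F3 where "H3_rep l u F F1 F2 F3"
proof -
 have uL: "u \<in> L2_on {0<..<l}" and ex: "k \<le> 3 \<Longrightarrow> \<exists>g\<in>L2_on {0<..<l}. has_weak_deriv l k u g" for k
  using u unfolding Sobolev_def by auto
 obtain g1 g2 g3 where g: "g1 \<in> L2_on {0<..<l}" "g2 \<in> L2_on {0<..<l}" "g3 \<in> L2_on {0<..<l}"
  and w: "has_weak_deriv l 1 u g1" "has_weak_deriv l 2 u g2" "has_weak_deriv l 3 u g3"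
  using ex[of 1] ex[of 2] ex[of 3] by auto
 have w12: "has_weak_deriv l 1 g1 g2"
  unfolding has_weak_deriv_iff
 proof
  fix \<phi> assume \<phi>: "\<phi> \<in> test_functions l"
  show "integral {0..l} (\<lambda>x. fun_of_L2 g1 x * (deriv ^^ 1) \<phi> x) = (-1) ^ 1 * integral {0..l} (\<lambda>x. fun_of_L2 g2 x * \<phi> x)"
   using w(1)[unfolded has_weak_deriv_iff, rule_format, OF test_function_deriv[OF \<phi>]] w(2)[unfolded has_weak_deriv_iff, rule_format, OF \<phi>]
   by (simp add: numeral_2_eq_2)
 qed
 have w23: "has_weak_deriv l 1 g2 g3"
  unfolding has_weak_deriv_iff
 proof
  fix \<phi> assume \<phi>: "\<phi> \<in> test_functions l"
  show "integral {0..l} (\<lambda>x. fun_of_L2 g2 x * (deriv ^^ 1) \<phi> x) = (-1) ^ 1 * integral {0..l} (\<lambda>x. fun_of_L2 g3 x * \<phi> x)"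
   using w(2)[unfolded has_weak_deriv_iff, rule_format, OF test_function_deriv[OF \<phi>]] w(3)[unfolded has_weak_deriv_iff, rule_format, OF \<phi>]
   by (simp add: numeral_2_eq_2 numeral_3_eq_3)
 qed
 obtain F where F: "primitive_on l F (fun_of_L2 g1)" "u = L2_restrict l F" by (rule has_weak_deriv_primitive[OF l g(1) uL w(1)])
 obtain F1 where F1: "primitive_on l F1 (fun_of_L2 g2)" "g1 = L2_restrict l F1" by (rule has_weak_deriv_primitive[OF l g(2,1) w12])
 obtain F2 where F2: "primitive_on l F2 (fun_of_L2 g3)" "g2 = L2_restrict l F2" by (rule has_weak_deriv_primitive[OF l g(3,2) w23])
 have "primitive_on l F F1" "primitive_on l F1 F2"
  using F F1 F2 primitive_on_sqint fun_of_L2_restrict_on primitive_on_AE_cong by blast+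
 then show thesis using F F2 by (intro that[of F F1 F2 "fun_of_L2 g3"]) (auto simp: H3_rep_def sqint_fun_of_L2)
qed


section \<open>Energy identities on one edge\<close>

lemma primitive_on_integral: "primitive_on l F f \<Longrightarrow> 0 \<le> l \<Longrightarrow> integral {0..l} f = F l - F 0"
 by (auto simp: primitive_on_def)

lemma primitive_on_id: "0 \<le> l \<Longrightarrow> primitive_on l (\<lambda>x. x) (\<lambda>x. 1)"
 by (intro primitive_on_C1) (auto intro!: derivative_eq_intros)

text \<open>The integrand has the primitive \<open>- F\<^sup>2/2 - F'' F + F'\<^sup>2/2\<close>.\<close>

lemma edge_energy:
 assumes l: "0 < l" and F: "primitive_on l F F1" "primitive_on l F1 F2" "primitive_on l F2 F3"
  and bc: "F l = 0" "F1 l = 0"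
 shows "integral {0..l} (\<lambda>x. (- F1 x - F3 x) * F x) = (F 0)\<^sup>2 / 2 + F2 0 * F 0 - (F1 0)\<^sup>2 / 2"
proof -
 have "primitive_on l (\<lambda>x. - (1/2) * (F x * F x) + ((- 1) * (F2 x * F x) + (1/2) * (F1 x * F1 x)))
   (\<lambda>x. - (1/2) * (F1 x * F x + F x * F1 x) + ((- 1) * (F3 x * F x + F2 x * F1 x) + (1/2) * (F2 x * F1 x + F1 x * F2 x)))"
  by (intro primitive_on_add primitive_on_cmult primitive_on_mult F)
 then have "primitive_on l (\<lambda>x. - (1/2) * (F x * F x) + ((- 1) * (F2 x * F x) + (1/2) * (F1 x * F1 x)))
   (\<lambda>x. (- F1 x - F3 x) * F x)"
  by (rule primitive_on_cong) (use l in \<open>auto simp: algebra_simps\<close>)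
 from primitive_on_integral[OF this] show ?thesis using l bc by (simp add: power2_eq_square)
qed

text \<open>
 Up to the two quadratic terms on the right, the integrand is the derivative of
 \<open>- x F\<^sup>2/2 - x F'' F + x F'\<^sup>2/2 + F' F\<close>.
\<close>

lemma edge_smoothing:
 assumes l: "0 < l" and F: "primitive_on l F F1" "primitive_on l F1 F2" "primitive_on l F2 F3"
  and bc: "F l = 0" "F1 l = 0"
 shows "integral {0..l} (\<lambda>x. (- F1 x - F3 x) * (x * F x))
  = integral {0..l} (\<lambda>x. F x * F x) / 2 - F 0 * F1 0 - 3 / 2 * integral {0..l} (\<lambda>x. F1 x * F1 x)"
proof -
 have i: "(\<lambda>x. F x * F x) integrable_on {0..l}" "(\<lambda>x. F1 x * F1 x) integrable_on {0..l}"
  by (intro integrable_continuous_real continuous_on_mult primitive_on_continuous[OF F(1)] primitive_on_continuous[OF F(2)])+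
 have "(\<lambda>x. (- F1 x - F3 x) * (x * F x)) absolutely_integrable_on {0..l}"
  by (intro abs_integrable_mult_continuous set_integral_diff(1) primitive_on_integrable[OF F(3)] continuous_intros
    primitive_on_continuous[OF F(1)] absolutely_integrable_continuous_real primitive_on_continuous[OF F(2)])
 then have i': "(\<lambda>x. (- F1 x - F3 x) * (x * F x)) integrable_on {0..l}" by (rule LINT_HK(1))
 have x: "primitive_on l (\<lambda>x. x) (\<lambda>x. 1)" using l by (intro primitive_on_id) auto
 have "primitive_on l (\<lambda>x. - (1/2) * (x * (F x * F x)) + ((- 1) * (x * (F2 x * F x)) + ((1/2) * (x * (F1 x * F1 x)) + F1 x * F x)))
   (\<lambda>x. - (1/2) * (1 * (F x * F x) + x * (F1 x * F x + F x * F1 x)) + ((- 1) * (1 * (F2 x * F x) + x * (F3 x * F x + F2 x * F1 x))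
    + ((1/2) * (1 * (F1 x * F1 x) + x * (F2 x * F1 x + F1 x * F2 x)) + (F2 x * F x + F1 x * F1 x))))"
  by (intro primitive_on_add primitive_on_cmult primitive_on_mult F x)
 then have "primitive_on l (\<lambda>x. - (1/2) * (x * (F x * F x)) + ((- 1) * (x * (F2 x * F x)) + ((1/2) * (x * (F1 x * F1 x)) + F1 x * F x)))
   (\<lambda>x. (- F1 x - F3 x) * (x * F x) + ((3/2) * (F1 x * F1 x) - (1/2) * (F x * F x)))"
  by (rule primitive_on_cong) (use l in \<open>auto simp: algebra_simps\<close>)
 from primitive_on_integral[OF this]
 have "integral {0..l} (\<lambda>x. (- F1 x - F3 x) * (x * F x) + ((3/2) * (F1 x * F1 x) - (1/2) * (F x * F x))) = - (F1 0 * F 0)"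
  using l bc by simp
 moreover have "integral {0..l} (\<lambda>x. (- F1 x - F3 x) * (x * F x) + ((3/2) * (F1 x * F1 x) - (1/2) * (F x * F x)))
   = integral {0..l} (\<lambda>x. (- F1 x - F3 x) * (x * F x)) + (3/2 * integral {0..l} (\<lambda>x. F1 x * F1 x) - 1/2 * integral {0..l} (\<lambda>x. F x * F x))"
  using i i' integrable_on_cmult_left[OF i(1), of "1/2"] integrable_on_cmult_left[OF i(2), of "3/2"]
  by (simp add: integral_add HK_diff Henstock_Kurzweil_Integration.integrable_diff)
 ultimately show ?thesis by (simp add: algebra_simps)
qed

section \<open>The resolvent equation on one edge\<close>

text \<open>The fundamental solution of the equation \<open>k''' + k' + \<lambda> k = 0\<close>.\<close>

definition resolvent_kernel :: "real \<Rightarrow> (real \<Rightarrow> real) \<Rightarrow> (real \<Rightarrow> real) \<Rightarrow> (real \<Rightarrow> real) \<Rightarrow> bool" where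
 "resolvent_kernel lam k k1 k2 \<longleftrightarrow>
  (\<forall>s. (k has_real_derivative k1 s) (at s)) \<and> (\<forall>s. (k1 has_real_derivative k2 s) (at s)) \<and>
  (\<forall>s. (k2 has_real_derivative - k1 s - lam * k s) (at s)) \<and> k 0 = 0 \<and> k1 0 = 0 \<and> k2 0 = 1"

text \<open>
 The characteristic polynomial \<open>z\<^sup>3 + z + \<lambda>\<close> has one real root \<open>-a\<close> and the conjugate pair \<open>a/2 \<plusminus> i w\<close>
 with \<open>w\<^sup>2 = 3a\<^sup>2/4 + 1\<close>, so the kernel is a combination of \<open>E\<close>, \<open>P\<close> and \<open>Q\<close>; the coefficients are
 those with the prescribed initial values.
\<close>

lemma resolvent_kernel_exists:
 assumes lam: "0 < (lam::real)"
 shows "\<exists>k k1 k2. resolvent_kernel lam k k1 k2"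
proof -
 have "\<exists>a. 0 \<le> a \<and> a \<le> lam \<and> a ^ 3 + a = lam"
  using lam by (intro IVT') (auto intro!: continuous_intros)
 then obtain a where a: "0 \<le> a" "a ^ 3 + a = lam" by blast
 define w where "w = sqrt (3 * a\<^sup>2 / 4 + 1)"
 have pos: "0 < 3 * a\<^sup>2 / 4 + 1" by (intro add_nonneg_pos) auto
 have w: "0 < w" "w * w = 3 * a\<^sup>2 / 4 + 1" using pos by (auto simp: w_def)
 define E where "E s = exp (- a * s)" for s
 define P where "P s = exp (a / 2 * s) * cos (w * s)" for s
 define Q where "Q s = exp (a / 2 * s) * sin (w * s)" for s
 have E: "(E has_real_derivative - a * E s) (at s)" for s
  unfolding E_def by (auto intro!: derivative_eq_intros)
 have P: "(P has_real_derivative (a / 2 * P s - w * Q s)) (at s)" for s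
  unfolding P_def Q_def by (auto intro!: derivative_eq_intros simp: algebra_simps)
 have Q: "(Q has_real_derivative (a / 2 * Q s + w * P s)) (at s)" for s
  unfolding P_def Q_def by (auto intro!: derivative_eq_intros simp: algebra_simps)
 have 0: "E 0 = 1" "P 0 = 1" "Q 0 = 0" by (auto simp: E_def P_def Q_def)
 define c where "c = 1 / (3 * a\<^sup>2 + 1)"
 \<comment> \<open>Differentiation maps combinations of \<open>E\<close>, \<open>P\<close>, \<open>Q\<close> to such combinations and acts linearly on the coefficients.\<close>
 define comb where "comb x y z s = x * E s + y * P s + z * Q s" for x y z s
 have comb: "(comb x y z has_real_derivative comb (- a * x) (a / 2 * y + w * z) (a / 2 * z - w * y) s) (at s)" for x y z s
  unfolding comb_def by (rule derivative_eq_intros E P Q refl)+ (simp add: algebra_simps)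
 define z where "z = 3 * a / (2 * w) * c"
 have wz: "w * z = 3 * a / 2 * c" using w by (simp add: z_def)
 define y1 z1 where "y1 = a / 2 * (- c) + w * z" and "z1 = a / 2 * z - w * (- c)"
 define y2 z2 where "y2 = a / 2 * y1 + w * z1" and "z2 = a / 2 * z1 - w * y1"
 have wz1: "w * z1 = a / 2 * (3 * a / 2 * c) + (3 * a\<^sup>2 / 4 + 1) * c"
  using wz w by (simp add: z1_def algebra_simps)
 have y1: "y1 = a * c" by (simp add: y1_def wz)
 have c1: "c * (3 * a\<^sup>2 + 1) = 1"
 proof -
  have "0 < 3 * a\<^sup>2 + 1" by (intro add_nonneg_pos) auto
  then show ?thesis by (simp add: c_def)
 qed
 show ?thesis
 proof (rule exI[of _ "comb c (- c) z"], rule exI[of _ "comb (- a * c) y1 z1"],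
   rule exI[of _ "comb (- a * (- a * c)) y2 z2"], unfold resolvent_kernel_def, intro conjI allI)
  show "(comb c (- c) z has_real_derivative comb (- a * c) y1 z1 s) (at s)" for s
   unfolding y1_def z1_def by (rule comb)
  show "(comb (- a * c) y1 z1 has_real_derivative comb (- a * (- a * c)) y2 z2 s) (at s)" for s
   unfolding y2_def z2_def by (rule comb)
  have y3: "a / 2 * y2 + w * z2 = - y1 - lam * (- c)"
  proof -
   have "w * z2 = a / 2 * (w * z1) - (w * w) * y1" by (simp add: z2_def algebra_simps)
   then show ?thesis
    unfolding y2_def wz1 y1 w(2) a(2)[symmetric] by (simp add: field_simps power2_eq_square power3_eq_cube)
  qed
  have z3: "a / 2 * z2 - w * y2 = - z1 - lam * z"
  proof -
   have "w * (a / 2 * z2 - w * y2) = a / 2 * (a / 2 * (w * z1) - (w * w) * y1) - (w * w) * (a / 2 * y1 + w * z1)"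
    by (simp add: z2_def y2_def algebra_simps)
   also have "\<dots> = - (w * z1) - lam * (w * z)"
    unfolding wz1 wz y1 w(2) a(2)[symmetric] by (simp add: field_simps power2_eq_square power3_eq_cube)
   also have "\<dots> = w * (- z1 - lam * z)" by (simp add: algebra_simps)
   finally show ?thesis using w(1) by (simp only: mult_cancel_left) auto
  qed
  have x3: "- a * (- a * (- a * c)) = - (- a * c) - lam * c"
   unfolding a(2)[symmetric] by (simp add: algebra_simps power3_eq_cube)
  have "comb (- a * (- a * (- a * c))) (a / 2 * y2 + w * z2) (a / 2 * z2 - w * y2) s
    = - comb (- a * c) y1 z1 s - lam * comb c (- c) z s" for s
   unfolding x3 y3 z3 by (simp add: comb_def algebra_simps)
  then show "(comb (- a * (- a * c)) y2 z2 has_real_derivative - comb (- a * c) y1 z1 s - lam * comb c (- c) z s) (at s)" for s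
   using comb[of "- a * (- a * c)" y2 z2 s] by simp
  show "comb c (- c) z 0 = 0" "comb (- a * c) y1 z1 0 = 0" by (auto simp: comb_def 0 y1)
  have "comb (- a * (- a * c)) y2 z2 0 = c * (3 * a\<^sup>2 + 1)"
   unfolding comb_def 0 y2_def wz1 y1 by (simp add: algebra_simps power2_eq_square)
  then show "comb (- a * (- a * c)) y2 z2 0 = 1" using c1 by simp
 qed
qed

text \<open>
 The kernel with base point \<open>l\<close> satisfies both conditions there. If it vanished at \<open>0\<close>, the energy
 identity would make it vanish on the whole edge. Normalised to \<open>p 0 = 1\<close>, the same identity reads
 \<open>\<lambda> \<integral> p\<^sup>2 = 1/2 + p''(0) - p'(0)\<^sup>2/2\<close>, hence the lower bound for \<open>p''(0)\<close>, on which the solvability of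
 the node condition depends.
\<close>

lemma edge_homogeneous_solution:
 assumes l: "0 < l" and lam: "0 < lam"
 obtains p p1 p2 where "primitive_on l p p1" "primitive_on l p1 p2" "primitive_on l p2 (\<lambda>x. - p1 x - lam * p x)"
  "p l = 0" "p1 l = 0" "p 0 = 1" "- (1 / 2) \<le> p2 0"
proof -
 obtain k k1 k2 where "resolvent_kernel lam k k1 k2" using resolvent_kernel_exists[OF lam] by blast
 then have k: "\<And>s. (k has_real_derivative k1 s) (at s)" "\<And>s. (k1 has_real_derivative k2 s) (at s)"
  "\<And>s. (k2 has_real_derivative - k1 s - lam * k s) (at s)" and k0: "k 0 = 0" "k1 0 = 0" "k2 0 = 1"
  by (simp_all add: resolvent_kernel_def)
 have shift: "((\<lambda>x. f (x - l)) has_real_derivative f' (x - l)) (at x within S)"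
  if "\<And>s. (f has_real_derivative f' s) (at s)" for f f' x S
 proof -
  have "((\<lambda>x. x - l) has_real_derivative 1) (at x within S)" by (auto intro!: derivative_eq_intros)
  from DERIV_chain2[OF that[of "x - l"] this] show ?thesis by simp
 qed
 have cont: "continuous_on A (\<lambda>x. f (x - l))" if "\<And>s. (f has_real_derivative f' s) (at s)" for f f' A
  by (rule DERIV_continuous_on[OF shift[OF that]])
 have P: "primitive_on l (\<lambda>x. k (x - l)) (\<lambda>x. k1 (x - l))" "primitive_on l (\<lambda>x. k1 (x - l)) (\<lambda>x. k2 (x - l))"
  "primitive_on l (\<lambda>x. k2 (x - l)) (\<lambda>x. - k1 (x - l) - lam * k (x - l))"
  by (rule primitive_on_C1[OF shift[OF k(1)] cont[OF k(2)]] primitive_on_C1[OF shift[OF k(2)] cont[OF k(3)]]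
    primitive_on_C1[OF shift[OF k(3)] continuous_on_diff[OF continuous_on_minus[OF cont[OF k(2)]] continuous_on_mult_left[OF cont[OF k(1)]]]])+
 have en: "lam * integral {0..l} (\<lambda>x. k (x - l) * k (x - l)) = (k (- l))\<^sup>2 / 2 + k2 (- l) * k (- l) - (k1 (- l))\<^sup>2 / 2"
  using edge_energy[OF l P] k0 by (simp add: mult.assoc)
 have nn: "0 \<le> integral {0..l} (\<lambda>x. k (x - l) * k (x - l))"
  by (intro integral_nonneg integrable_continuous_real continuous_intros cont[OF k(1)]) auto
 have nz: "k (- l) \<noteq> 0"
 proof
  assume z: "k (- l) = 0"
  have "lam * integral {0..l} (\<lambda>x. k (x - l) * k (x - l)) \<le> 0" using en z by simp
  then have "integral {0..l} (\<lambda>x. k (x - l) * k (x - l)) = 0" using nn lam by (simp add: mult_le_0_iff)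
  then have "((\<lambda>x. k (x - l) * k (x - l)) has_integral 0) (cbox 0 l)"
   by (metis box_real(2) integrable_continuous_real integrable_integral continuous_on_mult cont[OF k(1)])
  then have "k (x - l) * k (x - l) = 0" if "x \<in> {0..l}" for x
   using that l by (intro has_integral_0_cbox_imp_0[of 0 l "\<lambda>x. k (x - l) * k (x - l)"])
    (auto intro!: continuous_intros cont[OF k(1)])
  then have kz: "k (x - l) = 0" if "x \<in> {0..l}" for x using that by simp
  have kz: "k s = 0" if "s \<in> {-l..0}" for s using kz[of "s + l"] that by simp
  have z0: "f' s = 0" if "\<And>s. s \<in> {-l<..<0} \<Longrightarrow> f s = 0" "\<And>s. (f has_real_derivative f' s) (at s)" "s \<in> {-l<..<0}" for f f' :: "real \<Rightarrow> real" and s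
  proof -
   have "((\<lambda>_. 0) has_real_derivative 0) (at s)" by simp
   then have "(f has_real_derivative 0) (at s)"
    by (rule has_field_derivative_transform_within_open[of _ _ _ "{-l<..<0}"]) (use that in auto)
   then show ?thesis using that(2) DERIV_unique by blast
  qed
  have "k1 s = 0" if "s \<in> {-l<..<0}" for s by (rule z0[OF _ k(1) that]) (use kz in auto)
  then have k2z: "k2 s = 0" if "s \<in> {-l<..<0}" for s by (rule z0[OF _ k(2) that])
  have "k2 0 = 0"
  proof (rule continuous_constant_on_closure[of "{-l<..<0}" k2 0 0])
   show "continuous_on (closure {-l<..<0}) k2" by (rule DERIV_continuous_on[OF DERIV_subset[OF k(3)]]) auto
   show "0 \<in> closure {-l<..<0}" using l by simp
  qed (rule k2z)
  then show False using k0 by simp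
 qed
 define m where "m = 1 / k (- l)"
 have M: "primitive_on l (\<lambda>x. m * k (x - l)) (\<lambda>x. m * k1 (x - l))" "primitive_on l (\<lambda>x. m * k1 (x - l)) (\<lambda>x. m * k2 (x - l))"
  "primitive_on l (\<lambda>x. m * k2 (x - l)) (\<lambda>x. - (m * k1 (x - l)) - lam * (m * k (x - l)))"
 proof -
  have "primitive_on l (\<lambda>x. m * k2 (x - l)) (\<lambda>x. m * (- k1 (x - l) - lam * k (x - l)))"
   by (intro primitive_on_cmult P)
  then show "primitive_on l (\<lambda>x. m * k2 (x - l)) (\<lambda>x. - (m * k1 (x - l)) - lam * (m * k (x - l)))"
   by (simp add: algebra_simps)
 qed (intro primitive_on_cmult P)+
 have "0 \<le> lam * integral {0..l} (\<lambda>x. (m * k (x - l)) * (m * k (x - l)))"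
  by (rule mult_nonneg_nonneg[OF less_imp_le[OF lam] integral_nonneg])
   (auto intro!: integrable_continuous_real continuous_intros cont[OF k(1)])
 also have "\<dots> = (m * k (- l))\<^sup>2 / 2 + (m * k2 (- l)) * (m * k (- l)) - (m * k1 (- l))\<^sup>2 / 2"
  using edge_energy[OF l M] k0 by (simp add: mult.assoc)
 also have "m * k (- l) = 1" using nz by (simp add: m_def)
 finally have "(m * k1 (- l))\<^sup>2 \<le> 1 + m * k2 (- l) * 2" by simp
 then have "0 \<le> 1 + m * k2 (- l) * 2" by (rule order_trans[OF zero_le_power2])
 then have p2: "- (1 / 2) \<le> m * k2 (0 - l)" by simp
 show thesis by (rule that[OF M _ _ _ p2]) (use k0 nz in \<open>auto simp: m_def\<close>)
qed

text \<open>Variation of constants from the right end, where the conditions are imposed.\<close>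

lemma edge_inhomogeneous_solution:
 assumes l: "0 < l" and lam: "0 < lam" and f: "f absolutely_integrable_on {0..l}"
 obtains q q1 q2 where "primitive_on l q q1" "primitive_on l q1 q2" "primitive_on l q2 (\<lambda>x. f x - q1 x - lam * q x)"
  "q l = 0" "q1 l = 0"
proof -
 obtain k k1 k2 where "resolvent_kernel lam k k1 k2" using resolvent_kernel_exists[OF lam] by blast
 then have k: "\<And>s. (k has_real_derivative k1 s) (at s)" "\<And>s. (k1 has_real_derivative k2 s) (at s)"
  "\<And>s. (k2 has_real_derivative - k1 s - lam * k s) (at s)" and k0: "k 0 = 0" "k1 0 = 0" "k2 0 = 1"
  by (simp_all add: resolvent_kernel_def)
 have cont: "continuous_on A g" if "\<And>s. (g has_real_derivative g' s) (at s)" for g g' :: "real \<Rightarrow> real" and A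
  by (rule DERIV_continuous_on[OF DERIV_subset[OF that]]) auto
 define W where "W g x = integral {x..l} (\<lambda>y. g (x - y) * f y)" for g x
 have V: "primitive_on l (W g) (\<lambda>x. W g' x - g 0 * f x)"
  if "\<And>s. (g has_real_derivative g' s) (at s)" "continuous_on UNIV g'" for g g'
  using primitive_on_Volterra[OF _ f that] l unfolding W_def by simp
 have kc: "continuous_on UNIV (\<lambda>s. - k1 s - lam * k s)" by (intro continuous_intros cont[OF k(1)] cont[OF k(2)])
 note V1 = V[OF k(1) cont[OF k(2)]] and V2 = V[OF k(2) cont[OF k(3)]] and V3 = V[OF k(3) kc]
 have fi: "(\<lambda>y. g (x - y) * f y) integrable_on {x..l}" if x: "x \<in> {0..l}" and g: "continuous_on UNIV g" for g x
 proof -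
  have "(\<lambda>y. f y * g (x - y)) absolutely_integrable_on {x..l}"
   using x by (intro abs_integrable_mult_continuous continuous_on_compose2[OF g] continuous_intros abs_integrable_subinterval[OF f]) auto
  then show ?thesis by (simp add: mult.commute LINT_HK(1))
 qed
 have W3: "W (\<lambda>s. - k1 s - lam * k s) x = - W k1 x - lam * W k x" if x: "x \<in> {0..l}" for x
 proof -
  note i = fi[OF x cont[OF k(1)]] fi[OF x cont[OF k(2)]]
  have "W (\<lambda>s. - k1 s - lam * k s) x = integral {x..l} (\<lambda>y. - (k1 (x - y) * f y) - lam * (k (x - y) * f y))"
   unfolding W_def by (simp add: algebra_simps)
  also have "\<dots> = integral {x..l} (\<lambda>y. - (k1 (x - y) * f y)) - integral {x..l} (\<lambda>y. lam * (k (x - y) * f y))"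
   using i integrable_on_cmult_left[OF i(1), of lam] by (intro HK_diff integrable_neg) auto
  finally show ?thesis by (simp add: W_def)
 qed
 have R: "primitive_on l (\<lambda>x. (-1) * W k x) (\<lambda>x. (-1) * W k1 x)" "primitive_on l (\<lambda>x. (-1) * W k1 x) (\<lambda>x. (-1) * W k2 x)"
  using V1 V2 k0 by (intro primitive_on_cmult; simp)+
 have "primitive_on l (\<lambda>x. (-1) * W k2 x) (\<lambda>x. (-1) * (W (\<lambda>s. - k1 s - lam * k s) x - k2 0 * f x))"
  by (rule primitive_on_cmult[OF V3])
 then have R3: "primitive_on l (\<lambda>x. (-1) * W k2 x) (\<lambda>x. f x - (-1) * W k1 x - lam * ((-1) * W k x))"
  by (rule primitive_on_cong) (use l k0 in \<open>auto simp: W3\<close>)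
 show thesis by (rule that[OF R R3]) (auto simp: W_def)
qed


section \<open>Multiplication operators\<close>

lemma fun_of_L2_add: "AE x in lebesgue. fun_of_L2 (a + b) x = fun_of_L2 a x + fun_of_L2 b x"
proof -
 have "a + b = L2_class (\<lambda>x. fun_of_L2 a x + fun_of_L2 b x)"
  using L2_class_add[OF fun_of_L2_square_integrable fun_of_L2_square_integrable, of a b] by (simp add: L2_class_fun_of_L2)
 then show ?thesis
  using fun_of_L2_class[OF square_integrable_add[OF fun_of_L2_square_integrable fun_of_L2_square_integrable]] by simp
qed

lemma fun_of_L2_scale: "AE x in lebesgue. fun_of_L2 (c *\<^sub>R a) x = c * fun_of_L2 a x"
proof -
 have "c *\<^sub>R a = L2_class (\<lambda>x. c * fun_of_L2 a x)"
  using L2_class_scale[OF fun_of_L2_square_integrable, of c a] by (simp add: L2_class_fun_of_L2)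
 then show ?thesis
  using fun_of_L2_class[OF square_integrable_scale[OF fun_of_L2_square_integrable]] by simp
qed

lemma continuous_on_interval_bound:
 fixes m :: "real \<Rightarrow> real"
 assumes "continuous_on {0..l} m"
 shows "\<exists>B\<ge>0. \<forall>x\<in>{0..l}. \<bar>m x\<bar> \<le> B"
proof -
 have "bounded (m ` {0..l})" using assms by (intro compact_imp_bounded compact_continuous_image) auto
 then obtain B where "0 < B" "\<And>y. y \<in> m ` {0..l} \<Longrightarrow> norm y \<le> B" unfolding bounded_pos by blast
 then show ?thesis by (intro exI[of _ B]) auto
qed

lemma sqint_mult_continuous:
 assumes m: "continuous_on {0..l} m" and F: "sqint l F"
 shows "sqint l (\<lambda>x. m x * F x)"
proof -
 obtain B where B: "0 \<le> B" "\<And>x. x \<in> {0..l} \<Longrightarrow> \<bar>m x\<bar> \<le> B" using continuous_on_interval_bound[OF m] by blast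
 have eq: "indicator {0<..<l} x * (m x * F x) = (indicator {0<..<l} x * m x) * (indicator {0<..<l} x * F x)" for x
  by (simp add: indicator_def)
 have meas: "(\<lambda>x. indicator {0<..<l} x * (m x * F x)) \<in> borel_measurable lebesgue"
  unfolding eq by (intro borel_measurable_times sqint_measurable sqint_continuous m F)
 have i: "integrable lebesgue (\<lambda>x. B\<^sup>2 * (indicator {0<..<l} x * F x)\<^sup>2)"
  using F by (intro integrable_mult_right) (simp add: sqint_def square_integrable_UNIV_iff)
 have "(indicator {0<..<l} x * (m x * F x))\<^sup>2 \<le> B\<^sup>2 * (indicator {0<..<l} x * F x)\<^sup>2" for x
 proof (cases "x \<in> {0<..<l}")
  case True
  then have "(m x)\<^sup>2 \<le> B\<^sup>2" using B(2)[of x] B(1) by (simp add: abs_le_square_iff[symmetric])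
  then show ?thesis using True by (simp add: power_mult_distrib mult_right_mono)
 qed simp
 then have "integrable lebesgue (\<lambda>x. (indicator {0<..<l} x * (m x * F x))\<^sup>2)"
  using meas by (intro Bochner_Integration.integrable_bound[OF i]) auto
 then show ?thesis using meas by (simp add: sqint_def square_integrable_UNIV_iff)
qed

lemma norm_L2_restrict_mult_le:
 assumes m: "continuous_on {0..l} m" and F: "sqint l F" and B: "0 \<le> B" "\<And>x. x \<in> {0..l} \<Longrightarrow> \<bar>m x\<bar> \<le> B"
 shows "norm (L2_restrict l (\<lambda>x. m x * F x)) \<le> B * norm (L2_restrict l F)"
proof -
 have mF: "sqint l (\<lambda>x. m x * F x)" by (rule sqint_mult_continuous[OF m F])
 have "(norm (L2_restrict l (\<lambda>x. m x * F x)))\<^sup>2 = integral {0..l} (\<lambda>x. (m x * F x) * (m x * F x))"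
  by (rule norm_L2_restrict[OF mF])
 also have "\<dots> \<le> integral {0..l} (\<lambda>x. B\<^sup>2 * (F x * F x))"
 proof (rule integral_le)
  show "(\<lambda>x. (m x * F x) * (m x * F x)) integrable_on {0..l}"
   by (intro LINT_HK(1) sqint_mult mF)
  show "(\<lambda>x. B\<^sup>2 * (F x * F x)) integrable_on {0..l}"
   using integrable_on_cmult_left[OF LINT_HK(1)[OF sqint_mult[OF F F]], of "B\<^sup>2"] by simp
  fix x assume "x \<in> {0..l}"
  then have "(m x)\<^sup>2 \<le> B\<^sup>2" using B(2)[of x] B(1) by (simp add: abs_le_square_iff[symmetric])
  then have "(m x)\<^sup>2 * (F x * F x) \<le> B\<^sup>2 * (F x * F x)" by (intro mult_right_mono) auto
  then show "(m x * F x) * (m x * F x) \<le> B\<^sup>2 * (F x * F x)" by (simp add: power2_eq_square mult_ac)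
 qed
 also have "\<dots> = (B * norm (L2_restrict l F))\<^sup>2" by (simp add: power_mult_distrib norm_L2_restrict[OF F])
 finally show ?thesis by (rule power2_le_imp_le) (use B(1) in simp)
qed

lemma norm_L2_restrict_fun_le: "norm (L2_restrict l (fun_of_L2 a)) \<le> norm a"
proof -
 have "(norm (L2_restrict l (fun_of_L2 a)))\<^sup>2 = (LINT x|lebesgue. (indicator {0<..<l} x * fun_of_L2 a x)\<^sup>2)"
  using sqint_fun_of_L2[of l a] by (simp add: L2_restrict_class norm_L2_class sqint_def)
 also have "\<dots> \<le> (LINT x|lebesgue. (fun_of_L2 a x)\<^sup>2)"
 proof (rule integral_mono)
  show "integrable lebesgue (\<lambda>x. (indicator {0<..<l} x * fun_of_L2 a x)\<^sup>2)"
   using sqint_fun_of_L2[of l a] by (simp add: sqint_def square_integrable_UNIV_iff)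
  show "integrable lebesgue (\<lambda>x. (fun_of_L2 a x)\<^sup>2)"
   using fun_of_L2_square_integrable[of a] by (simp add: square_integrable_UNIV_iff)
  show "(indicator {0<..<l} x * fun_of_L2 a x)\<^sup>2 \<le> (fun_of_L2 a x)\<^sup>2" for x by (simp add: indicator_def)
 qed
 also have "\<dots> = (norm a)\<^sup>2"
  using norm_L2_class[OF fun_of_L2_square_integrable, of a] by (simp add: L2_class_fun_of_L2)
 finally show ?thesis by (rule power2_le_imp_le) simp
qed

lemma L2_restrict_neg_diff:
 assumes "sqint l F" "sqint l G"
 shows "- L2_restrict l F - L2_restrict l G = L2_restrict l (\<lambda>x. - F x - G x)"
proof -
 have "- L2_restrict l F - L2_restrict l G = (-1) *\<^sub>R L2_restrict l F + (-1) *\<^sub>R L2_restrict l G" by simp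
 also have "\<dots> = L2_restrict l (\<lambda>x. (-1) * F x + (-1) * G x)"
  by (simp only: L2_restrict_scale assms L2_restrict_add sqint_cmult)
 finally show ?thesis by simp
qed

definition L2_mult :: "real \<Rightarrow> (real \<Rightarrow> real) \<Rightarrow> L2 \<Rightarrow> L2" where
 "L2_mult l m a = L2_restrict l (\<lambda>x. m x * fun_of_L2 a x)"

lemma bounded_linear_L2_mult:
 assumes m: "continuous_on {0..l} m"
 shows "bounded_linear (L2_mult l m)"
proof -
 obtain B where B: "0 \<le> B" "\<And>x. x \<in> {0..l} \<Longrightarrow> \<bar>m x\<bar> \<le> B" using continuous_on_interval_bound[OF m] by blast
 have s: "sqint l (\<lambda>x. m x * fun_of_L2 a x)" for a by (rule sqint_mult_continuous[OF m sqint_fun_of_L2])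
 show ?thesis
 proof (rule bounded_linear_intro[where K = B])
  fix a b :: L2 and c :: real
  have "L2_restrict l (\<lambda>x. m x * fun_of_L2 (a + b) x) = L2_restrict l (\<lambda>x. m x * fun_of_L2 a x + m x * fun_of_L2 b x)"
   using fun_of_L2_add[of a b] by (subst L2_restrict_eq_iff) (auto intro!: s sqint_add simp: distrib_left elim: eventually_mono)
  then show "L2_mult l m (a + b) = L2_mult l m a + L2_mult l m b"
   by (simp add: L2_mult_def L2_restrict_add s)
  have "L2_restrict l (\<lambda>x. m x * fun_of_L2 (c *\<^sub>R a) x) = L2_restrict l (\<lambda>x. c * (m x * fun_of_L2 a x))"
   using fun_of_L2_scale[of c a] by (subst L2_restrict_eq_iff) (auto intro!: s sqint_cmult elim: eventually_mono)
  then show "L2_mult l m (c *\<^sub>R a) = c *\<^sub>R L2_mult l m a"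
   by (simp add: L2_mult_def L2_restrict_scale s)
  have "norm (L2_mult l m a) \<le> B * norm (L2_restrict l (fun_of_L2 a))"
   unfolding L2_mult_def by (rule norm_L2_restrict_mult_le[OF m sqint_fun_of_L2 B])
  also have "\<dots> \<le> B * norm a" by (intro mult_left_mono norm_L2_restrict_fun_le B)
  finally show "norm (L2_mult l m a) \<le> norm a * B" by (simp add: mult.commute)
 qed
qed

lemma L2_mult_restrict:
 assumes m: "continuous_on {0..l} m" and F: "sqint l F"
 shows "L2_mult l m (L2_restrict l F) = L2_restrict l (\<lambda>x. m x * F x)"
 unfolding L2_mult_def
 using fun_of_L2_restrict_on[OF F]
 by (subst L2_restrict_eq_iff) (auto intro!: sqint_mult_continuous m F sqint_fun_of_L2 elim: eventually_mono)

lemma L2_mult_L2_on: "continuous_on {0..l} m \<Longrightarrow> L2_mult l m a \<in> L2_on {0<..<l}"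
 unfolding L2_mult_def by (intro L2_restrict_L2_on sqint_mult_continuous sqint_fun_of_L2)

lemma L2_on_iff: "a \<in> L2_on {0<..<l} \<longleftrightarrow> L2_mult l (\<lambda>_. 1) a = a"
 using L2_restrict_fun_of_L2[of a l] L2_mult_L2_on[of l "\<lambda>_. 1" a] by (auto simp: L2_mult_def)

lemma bounded_linear_componentwise:
 fixes f :: "'n::finite \<Rightarrow> 'a::real_normed_vector \<Rightarrow> 'b::real_normed_vector"
 assumes "\<And>j. bounded_linear (f j)"
 shows "bounded_linear (\<lambda>u. \<chi> j. f j (u $ j))"
proof -
 have "\<exists>K. \<forall>x. norm (f j x) \<le> norm x * K" for j using bounded_linear.bounded[OF assms] by blast
 then obtain K where K: "\<And>j x. norm (f j x) \<le> norm x * K j" by metis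
 show ?thesis
 proof (rule bounded_linear_intro[where K = "\<Sum>j\<in>UNIV. \<bar>K j\<bar>"])
  fix x y :: "'a^'n" and r :: real
  show "(\<chi> j. f j ((x + y) $ j)) = (\<chi> j. f j (x $ j)) + (\<chi> j. f j (y $ j))"
   by (simp add: vec_eq_iff linear_add[OF bounded_linear.linear[OF assms]])
  show "(\<chi> j. f j ((r *\<^sub>R x) $ j)) = r *\<^sub>R (\<chi> j. f j (x $ j))"
   by (simp add: vec_eq_iff linear_scale[OF bounded_linear.linear[OF assms]])
  have "norm (\<chi> j. f j (x $ j)) \<le> (\<Sum>j\<in>UNIV. norm (f j (x $ j)))"
   unfolding norm_vec_def by (rule order_trans[OF L2_set_le_sum]) auto
  also have "\<dots> \<le> (\<Sum>j\<in>UNIV. norm x * \<bar>K j\<bar>)"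
  proof (rule sum_mono)
   fix j
   have "norm (f j (x $ j)) \<le> norm (x $ j) * \<bar>K j\<bar>"
    by (rule order_trans[OF K]) (auto intro: mult_left_mono)
   also have "\<dots> \<le> norm x * \<bar>K j\<bar>" by (intro mult_right_mono Finite_Cartesian_Product.norm_nth_le) auto
   finally show "norm (f j (x $ j)) \<le> norm x * \<bar>K j\<bar>" .
  qed
  finally show "norm (\<chi> j. f j (x $ j)) \<le> norm x * (\<Sum>j\<in>UNIV. \<bar>K j\<bar>)" by (simp add: sum_distrib_left)
 qed
qed

lemma norm_vec_power2: "(norm (u :: L2 ^ 'n::finite))\<^sup>2 = (\<Sum>j\<in>UNIV. (norm (u $ j))\<^sup>2)"
 by (simp add: power2_norm_eq_inner inner_vec_def)

section \<open>The Korteweg-de Vries operator on the network\<close>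

locale kdv_network =
 fixes \<alpha> :: real and len :: "'n::finite \<Rightarrow> real" and e1 :: 'n
 assumes alpha: "\<alpha> > real CARD('n) / 2" and len: "\<And>j. 0 < len j"
begin

text \<open>Restriction to the edges: the orthogonal projection onto \<open>net_L2 len\<close>.\<close>

definition net_proj :: "L2 ^ 'n \<Rightarrow> L2 ^ 'n" where
 "net_proj u = (\<chi> j. L2_mult (len j) (\<lambda>_. 1) (u $ j))"

text \<open>
 Multiplication by the coordinate \<open>x\<close> of each edge, the multiplier of the smoothing estimate.
\<close>

definition net_weight :: "L2 ^ 'n \<Rightarrow> L2 ^ 'n" where
 "net_weight u = (\<chi> j. L2_mult (len j) (\<lambda>x. x) (u $ j))"

lemma bounded_linear_net_proj: "bounded_linear net_proj"
 unfolding net_proj_def by (intro bounded_linear_componentwise bounded_linear_L2_mult continuous_intros)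

lemma bounded_linear_net_weight: "bounded_linear net_weight"
 unfolding net_weight_def by (intro bounded_linear_componentwise bounded_linear_L2_mult continuous_intros)

lemma net_L2_iff: "u \<in> net_L2 len \<longleftrightarrow> net_proj u = u"
 by (simp add: net_L2_def net_proj_def vec_eq_iff L2_on_iff)

lemma net_proj_net_L2: "net_proj u \<in> net_L2 len"
 by (auto simp: net_L2_def net_proj_def intro: L2_mult_L2_on)

lemma closed_net_L2: "closed (net_L2 len)"
proof -
 have "continuous_on UNIV net_proj" by (rule linear_continuous_on[OF bounded_linear_net_proj])
 then have "closed {u. net_proj u = u}" by (intro closed_Collect_eq) auto
 then show ?thesis by (simp add: net_L2_iff[symmetric])
qed

lemma subspace_net_L2: "subspace (net_L2 len)"
proof -
 interpret bounded_linear net_proj by (rule bounded_linear_net_proj)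
 show ?thesis by (auto simp: subspace_def net_L2_iff zero add scaleR)
qed

definition net_length :: real where "net_length = (\<Sum>j\<in>UNIV. len j)"

lemma len_le_net_length: "len j \<le> net_length"
 unfolding net_length_def using len by (intro member_le_sum) (auto intro: less_imp_le)

lemma net_length_pos: "0 < net_length"
 using len_le_net_length[of undefined] len[of undefined] by linarith

lemma norm_net_weight: 
 assumes "u \<in> net_L2 len"
 shows "norm (net_weight u) \<le> net_length * norm u"
proof -
 have "norm (net_weight u $ j) \<le> net_length * norm (u $ j)" for j
 proof -
  have "norm (net_weight u $ j) \<le> net_length * norm (L2_restrict (len j) (fun_of_L2 (u $ j)))"
   unfolding net_weight_def L2_mult_def vec_lambda_beta
   using len_le_net_length[of j] net_length_pos
   by (intro norm_L2_restrict_mult_le continuous_intros sqint_fun_of_L2) auto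
  also have "\<dots> \<le> net_length * norm (u $ j)"
   using net_length_pos by (intro mult_left_mono norm_L2_restrict_fun_le) auto
  finally show ?thesis .
 qed
 then have "(\<Sum>j\<in>UNIV. (norm (net_weight u $ j))\<^sup>2) \<le> (\<Sum>j\<in>UNIV. (net_length * norm (u $ j))\<^sup>2)"
  by (intro sum_mono power_mono) auto
 then have "(norm (net_weight u))\<^sup>2 \<le> (net_length * norm u)\<^sup>2"
  unfolding norm_vec_power2 power_mult_distrib by (simp add: sum_distrib_left)
 then show ?thesis by (rule power2_le_imp_le) (use net_length_pos in simp)
qed

lemma inner_net_weight:
 assumes "u \<in> net_L2 len" "v \<in> net_L2 len"
 shows "inner (net_weight u) v = (\<Sum>j\<in>UNIV. integral {0..len j} (\<lambda>x. x * fun_of_L2 (u $ j) x * fun_of_L2 (v $ j) x))"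
proof -
 have "inner (net_weight u $ j) (v $ j) = integral {0..len j} (\<lambda>x. x * fun_of_L2 (u $ j) x * fun_of_L2 (v $ j) x)" for j
 proof -
  have "v $ j = L2_restrict (len j) (fun_of_L2 (v $ j))" using assms by (simp add: net_L2_def L2_restrict_fun_of_L2)
  then have "inner (net_weight u $ j) (v $ j)
    = inner (L2_restrict (len j) (\<lambda>x. x * fun_of_L2 (u $ j) x)) (L2_restrict (len j) (fun_of_L2 (v $ j)))"
   by (simp add: net_weight_def L2_mult_def)
  also have "\<dots> = integral {0..len j} (\<lambda>x. x * fun_of_L2 (u $ j) x * fun_of_L2 (v $ j) x)"
   by (intro inner_L2_restrict sqint_mult_continuous sqint_fun_of_L2 continuous_intros)
  finally show ?thesis .
 qed
 then show ?thesis by (simp add: inner_vec_def)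
qed

lemma net_weight_symmetric: "u \<in> net_L2 len \<Longrightarrow> v \<in> net_L2 len \<Longrightarrow> inner (net_weight u) v = inner (net_weight v) u"
 by (simp add: inner_net_weight mult_ac)

lemma net_weight_nonneg: "u \<in> net_L2 len \<Longrightarrow> 0 \<le> inner (net_weight u) u"
proof -
 assume u: "u \<in> net_L2 len"
 have "0 \<le> integral {0..len j} (\<lambda>x. x * fun_of_L2 (u $ j) x * fun_of_L2 (u $ j) x)" for j
 proof (rule integral_nonneg)
  show "(\<lambda>x. x * fun_of_L2 (u $ j) x * fun_of_L2 (u $ j) x) integrable_on {0..len j}"
   by (intro LINT_HK(1) sqint_mult sqint_mult_continuous sqint_fun_of_L2 continuous_intros)
 qed (simp add: mult.assoc)
 then show ?thesis using u by (simp add: inner_net_weight sum_nonneg)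
qed

text \<open>
 The domain of the operator before the condition on the flux at the central node is imposed; boundary
 data make this condition inhomogeneous.
\<close>

definition Dmax :: "(L2 ^ 'n) set" where "Dmax = net_He 2 len \<inter> net_Sobolev 3 len"

definition node :: "L2 ^ 'n \<Rightarrow> real" where "node u = point_value (len e1) (u $ e1) 0"

definition flux :: "L2 ^ 'n \<Rightarrow> real" where "flux u = (\<Sum>j\<in>UNIV. point_value (len j) (net_deriv len 2 u $ j) 0)"

abbreviation kdv :: "L2 ^ 'n \<Rightarrow> L2 ^ 'n" where "kdv \<equiv> kdv_operator len"

text \<open>
 Edgewise representatives of \<open>u\<close> and of its first three derivatives, together with the boundary and
 node conditions.
\<close>

definition net_rep :: "L2 ^ 'n \<Rightarrow> ('n \<Rightarrow> real \<Rightarrow> real) \<Rightarrow> ('n \<Rightarrow> real \<Rightarrow> real) \<Rightarrow> ('n \<Rightarrow> real \<Rightarrow> real) \<Rightarrow> ('n \<Rightarrow> real \<Rightarrow> real) \<Rightarrow> bool" where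
 "net_rep u F F1 F2 F3 \<longleftrightarrow> (\<forall>j. H3_rep (len j) (u $ j) (F j) (F1 j) (F2 j) (F3 j) \<and>
  F j (len j) = 0 \<and> F1 j (len j) = 0 \<and> F j 0 = F e1 0)"

lemma kdv_domain_eq: "kdv_domain \<alpha> len e1 = {u \<in> Dmax. flux u = - \<alpha> * node u}"
 by (simp add: kdv_domain_def Dmax_def flux_def node_def)

lemma net_rep_D:
 assumes r: "net_rep u F F1 F2 F3"
 shows "H3_rep (len j) (u $ j) (F j) (F1 j) (F2 j) (F3 j)" "F j (len j) = 0" "F1 j (len j) = 0" "F j 0 = F e1 0"
  "u $ j = L2_restrict (len j) (F j)" "u \<in> net_L2 len" "node u = F e1 0" "flux u = (\<Sum>j\<in>UNIV. F2 j 0)"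
  "net_deriv len 1 u = (\<chi> j. L2_restrict (len j) (F1 j))"
  "kdv u = (\<chi> j. L2_restrict (len j) (\<lambda>x. - F1 j x - F3 j x))"
  "sqint (len j) (F j)" "sqint (len j) (F1 j)" "sqint (len j) (F3 j)" "sqint (len j) (\<lambda>x. - F1 j x - F3 j x)"
proof -
 show h: "H3_rep (len j) (u $ j) (F j) (F1 j) (F2 j) (F3 j)" "F j (len j) = 0" "F1 j (len j) = 0" "F j 0 = F e1 0" for j
  using r unfolding net_rep_def by blast+
 show u: "u $ j = L2_restrict (len j) (F j)" for j using h(1)[of j] by (simp add: H3_rep_def)
 show s: "sqint (len j) (F j)" "sqint (len j) (F1 j)" "sqint (len j) (F3 j)" for j
  using h(1)[of j] by (auto simp: H3_rep_def intro: primitive_on_sqint)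
 show s': "sqint (len j) (\<lambda>x. - F1 j x - F3 j x)" for j
  using sqint_add[OF sqint_cmult[OF s(2)[of j], of "-1"] sqint_cmult[OF s(3)[of j], of "-1"]] by simp
 show "u \<in> net_L2 len" unfolding net_L2_def using u s by (simp add: L2_restrict_L2_on)
 have l0: "0 \<in> {0..len j}" for j using len[of j] by simp
 show "node u = F e1 0" unfolding node_def by (rule H3_rep_D(8)[OF len h(1) l0])
 have "net_deriv len 2 u $ j = L2_restrict (len j) (F2 j)" for j
  using H3_rep_D(6)[OF len h(1)[of j]] by (simp add: net_deriv_def)
 moreover have "point_value (len j) (L2_restrict (len j) (F2 j)) 0 = F2 j 0" for j
  by (rule H3_rep_D(10)[OF len h(1) l0])
 ultimately show "flux u = (\<Sum>j\<in>UNIV. F2 j 0)" by (simp add: flux_def)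
 show d1: "net_deriv len 1 u = (\<chi> j. L2_restrict (len j) (F1 j))" using H3_rep_D(5)[OF len h(1)] by (simp add: net_deriv_def vec_eq_iff)
 have d3: "net_deriv len 3 u = (\<chi> j. L2_restrict (len j) (F3 j))" using H3_rep_D(7)[OF len h(1)] by (simp add: net_deriv_def vec_eq_iff)
 show "kdv u = (\<chi> j. L2_restrict (len j) (\<lambda>x. - F1 j x - F3 j x))"
  unfolding kdv_operator_def d1 d3
  by (simp only: vec_eq_iff vector_minus_component vector_uminus_component vec_lambda_beta L2_restrict_neg_diff[OF s(2,3)]) simp
qed

lemma Dmax_iff: "u \<in> Dmax \<longleftrightarrow> (\<exists>F F1 F2 F3. net_rep u F F1 F2 F3)"
proof
 assume u: "u \<in> Dmax"
 then have "u $ j \<in> Sobolev 3 (len j)" for j unfolding Dmax_def net_Sobolev_def by blast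
 then have "\<exists>F F1 F2 F3. H3_rep (len j) (u $ j) F F1 F2 F3" for j
  by (rule Sobolev_3_rep[OF len]) blast
 then obtain F F1 F2 F3 where R: "\<And>j. H3_rep (len j) (u $ j) (F j) (F1 j) (F2 j) (F3 j)" by metis
 have l0: "0 \<in> {0..len j}" and l1: "len j \<in> {0..len j}" for j using len[of j] by auto
 have bc: "point_value (len j) (net_deriv len (i - 1) u $ j) (len j) = 0" if "i \<in> {1..2}" for i j
  using u that unfolding Dmax_def net_He_def by blast
 have "F j (len j) = 0" for j
  using bc[of 1 j] H3_rep_D(4)[OF len R[of j]] H3_rep_D(8)[OF len R[of j] l1] by (simp add: net_deriv_def)
 moreover have "F1 j (len j) = 0" for j
  using bc[of 2 j] H3_rep_D(5)[OF len R[of j]] H3_rep_D(9)[OF len R[of j] l1] by (simp add: net_deriv_def)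
 moreover have "F j 0 = F e1 0" for j
 proof -
  have "point_value (len j) (u $ j) 0 = point_value (len e1) (u $ e1) 0"
   using u unfolding Dmax_def net_He_def by blast
  then show ?thesis using H3_rep_D(8)[OF len R[of j] l0] H3_rep_D(8)[OF len R[of e1] l0] by simp
 qed
 ultimately have "net_rep u F F1 F2 F3" using R by (simp add: net_rep_def)
 then show "\<exists>F F1 F2 F3. net_rep u F F1 F2 F3" by blast
next
 assume "\<exists>F F1 F2 F3. net_rep u F F1 F2 F3"
 then obtain F F1 F2 F3 where r: "net_rep u F F1 F2 F3" by blast
 note h = net_rep_D[OF r] and R = net_rep_D(1)[OF r]
 have l0: "0 \<in> {0..len j}" and l1: "len j \<in> {0..len j}" for j using len[of j] by auto
 have pv: "point_value (len j) (u $ j) 0 = F j 0" for j by (rule H3_rep_D(8)[OF len R l0])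
 have "point_value (len j) (net_deriv len (i - 1) u $ j) (len j) = 0" if "i \<in> {1..2}" for i j
 proof -
  have "i = 1 \<or> i = 2" using that by auto
  then show ?thesis
   using H3_rep_D(4,5)[OF len R[of j]] H3_rep_D(8,9)[OF len R[of j] l1] h(2,3)[of j] by (auto simp: net_deriv_def)
 qed
 moreover have "point_value (len j) (u $ j) 0 = point_value (len k) (u $ k) 0" for j k
  using h(4)[of j] h(4)[of k] by (simp add: pv)
 ultimately show "u \<in> Dmax"
  unfolding Dmax_def net_He_def net_Sobolev_def using H3_rep_D(1,2)[OF len R] by blast
qed

lemma net_rep_lincomb:
 assumes u: "net_rep u F F1 F2 F3" and v: "net_rep v G G1 G2 G3"
 shows "net_rep (a *\<^sub>R u + b *\<^sub>R v) (\<lambda>j x. a * F j x + b * G j x) (\<lambda>j x. a * F1 j x + b * G1 j x)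
  (\<lambda>j x. a * F2 j x + b * G2 j x) (\<lambda>j x. a * F3 j x + b * G3 j x)"
 unfolding net_rep_def
proof (intro allI conjI)
 fix j
 note U = net_rep_D[OF u] and V = net_rep_D[OF v]
 show "H3_rep (len j) ((a *\<^sub>R u + b *\<^sub>R v) $ j) (\<lambda>x. a * F j x + b * G j x) (\<lambda>x. a * F1 j x + b * G1 j x)
  (\<lambda>x. a * F2 j x + b * G2 j x) (\<lambda>x. a * F3 j x + b * G3 j x)"
  unfolding H3_rep_def
 proof (intro conjI primitive_on_add primitive_on_cmult sqint_add sqint_cmult)
  show "(a *\<^sub>R u + b *\<^sub>R v) $ j = L2_restrict (len j) (\<lambda>x. a * F j x + b * G j x)"
   using U(5,11)[of j] V(5,11)[of j] by (simp add: L2_restrict_scale L2_restrict_add sqint_cmult)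
 qed (use U(1)[of j] V(1)[of j] in \<open>auto simp: H3_rep_def\<close>)
 show "a * F j (len j) + b * G j (len j) = 0" "a * F1 j (len j) + b * G1 j (len j) = 0"
  "a * F j 0 + b * G j 0 = a * F e1 0 + b * G e1 0" using U(2-4)[of j] V(2-4)[of j] by simp_all
qed

lemma Dmax_lincomb:
 assumes "u \<in> Dmax" "v \<in> Dmax"
 shows "a *\<^sub>R u + b *\<^sub>R v \<in> Dmax" "node (a *\<^sub>R u + b *\<^sub>R v) = a * node u + b * node v"
  "flux (a *\<^sub>R u + b *\<^sub>R v) = a * flux u + b * flux v"
  "kdv (a *\<^sub>R u + b *\<^sub>R v) = a *\<^sub>R kdv u + b *\<^sub>R kdv v"
proof -
 obtain F F1 F2 F3 where u: "net_rep u F F1 F2 F3" using assms Dmax_iff by blast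
 obtain G G1 G2 G3 where v: "net_rep v G G1 G2 G3" using assms Dmax_iff by blast
 note r = net_rep_lincomb[OF u v, of a b]
 note U = net_rep_D[OF u] and V = net_rep_D[OF v] and R = net_rep_D[OF r]
 show "a *\<^sub>R u + b *\<^sub>R v \<in> Dmax" using r Dmax_iff by blast
 show "node (a *\<^sub>R u + b *\<^sub>R v) = a * node u + b * node v" using U(7) V(7) R(7) by simp
 show "flux (a *\<^sub>R u + b *\<^sub>R v) = a * flux u + b * flux v"
  unfolding R(8) U(8) V(8) by (simp add: sum.distrib sum_distrib_left)
 have "a *\<^sub>R L2_restrict (len j) (\<lambda>x. - F1 j x - F3 j x) + b *\<^sub>R L2_restrict (len j) (\<lambda>x. - G1 j x - G3 j x)
   = L2_restrict (len j) (\<lambda>x. a * (- F1 j x - F3 j x) + b * (- G1 j x - G3 j x))" for j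
  by (simp add: L2_restrict_scale L2_restrict_add sqint_cmult U(14) V(14))
 moreover have "(\<lambda>x. a * (- F1 j x - F3 j x) + b * (- G1 j x - G3 j x))
   = (\<lambda>x. - (a * F1 j x + b * G1 j x) - (a * F3 j x + b * G3 j x))" for j
  by (simp add: fun_eq_iff algebra_simps)
 ultimately show "kdv (a *\<^sub>R u + b *\<^sub>R v) = a *\<^sub>R kdv u + b *\<^sub>R kdv v"
  unfolding R(10) U(10) V(10) by (simp add: vec_eq_iff)
qed

lemma Dmax_net_L2: "u \<in> Dmax \<Longrightarrow> u \<in> net_L2 len" "u \<in> Dmax \<Longrightarrow> kdv u \<in> net_L2 len"
proof -
 assume "u \<in> Dmax"
 then obtain F F1 F2 F3 where u: "net_rep u F F1 F2 F3" using Dmax_iff by blast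
 note U = net_rep_D[OF u]
 show "u \<in> net_L2 len" by (rule U(6))
 show "kdv u \<in> net_L2 len" unfolding net_L2_def U(10) using U(14) by (simp add: L2_restrict_L2_on)
qed

lemma zero_Dmax: "0 \<in> Dmax" "kdv 0 = 0" "node 0 = 0" "flux 0 = 0"
proof -
 have p: "primitive_on (len j) (\<lambda>_. 0) (\<lambda>_. 0)" for j using len[of j] by (intro primitive_on_const) simp
 have "L2_restrict (len j) (\<lambda>_. 0) = 0" for j
  using L2_restrict_scale[OF primitive_on_sqint[OF p[of j]], of 0] by simp
 then have "net_rep 0 (\<lambda>_ _. 0) (\<lambda>_ _. 0) (\<lambda>_ _. 0) (\<lambda>_ _. 0)"
  unfolding net_rep_def H3_rep_def using p primitive_on_sqint[OF p] by simp
 then show z: "0 \<in> Dmax" using Dmax_iff by blast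
 show "kdv 0 = 0" "node 0 = 0" "flux 0 = 0" using Dmax_lincomb(2-4)[OF z z, of 0 0] by simp_all
qed

lemma net_energy:
 assumes r: "net_rep u F F1 F2 F3"
 shows "inner (kdv u) u = real CARD('n) / 2 * (node u)\<^sup>2 + node u * flux u - (\<Sum>j\<in>UNIV. (F1 j 0)\<^sup>2) / 2"
proof -
 note U = net_rep_D[OF r]
 have "inner (kdv u $ j) (u $ j) = (node u)\<^sup>2 / 2 + F2 j 0 * node u - (F1 j 0)\<^sup>2 / 2" for j
 proof -
  have "inner (kdv u $ j) (u $ j) = integral {0..len j} (\<lambda>x. (- F1 j x - F3 j x) * F j x)"
   unfolding U(10) U(5)[of j] vec_lambda_beta by (rule inner_L2_restrict[OF U(14) U(11)])
  also have "\<dots> = (F j 0)\<^sup>2 / 2 + F2 j 0 * F j 0 - (F1 j 0)\<^sup>2 / 2"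
   using U(1)[of j] U(2,3)[of j] len[of j] by (intro edge_energy) (auto simp: H3_rep_def)
  finally show ?thesis using U(4)[of j] U(7) by simp
 qed
 then have "inner (kdv u) u = (\<Sum>j\<in>UNIV. (node u)\<^sup>2 / 2 + F2 j 0 * node u - (F1 j 0)\<^sup>2 / 2)"
  by (simp add: inner_vec_def)
 also have "\<dots> = real CARD('n) * ((node u)\<^sup>2 / 2) + (\<Sum>j\<in>UNIV. F2 j 0) * node u - (\<Sum>j\<in>UNIV. (F1 j 0)\<^sup>2) / 2"
  by (simp add: sum_subtractf sum.distrib sum_distrib_right sum_divide_distrib)
 finally show ?thesis using U(8) by (simp add: mult_ac)
qed

lemma net_smoothing:
 assumes r: "net_rep u F F1 F2 F3"
 shows "inner (kdv u) (net_weight u) = (norm u)\<^sup>2 / 2 - node u * (\<Sum>j\<in>UNIV. F1 j 0) - 3 / 2 * (norm (net_deriv len 1 u))\<^sup>2"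
proof -
 note U = net_rep_D[OF r]
 have w: "net_weight u $ j = L2_restrict (len j) (\<lambda>x. x * F j x)" for j
  unfolding net_weight_def vec_lambda_beta U(5)[of j] by (intro L2_mult_restrict U(11) continuous_intros)
 have "inner (kdv u $ j) (net_weight u $ j) = (norm (u $ j))\<^sup>2 / 2 - node u * F1 j 0 - 3 / 2 * (norm (net_deriv len 1 u $ j))\<^sup>2" for j
 proof -
  have "inner (kdv u $ j) (net_weight u $ j) = integral {0..len j} (\<lambda>x. (- F1 j x - F3 j x) * (x * F j x))"
   unfolding U(10) w vec_lambda_beta by (rule inner_L2_restrict[OF U(14) sqint_mult_continuous[OF _ U(11)]]) (intro continuous_intros)
  also have "\<dots> = integral {0..len j} (\<lambda>x. F j x * F j x) / 2 - F j 0 * F1 j 0 - 3 / 2 * integral {0..len j} (\<lambda>x. F1 j x * F1 j x)"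
   using U(1)[of j] U(2,3)[of j] len[of j] by (intro edge_smoothing) (auto simp: H3_rep_def)
  also have "integral {0..len j} (\<lambda>x. F j x * F j x) = (norm (u $ j))\<^sup>2" unfolding U(5)[of j] by (simp add: norm_L2_restrict U(11))
  also have "integral {0..len j} (\<lambda>x. F1 j x * F1 j x) = (norm (net_deriv len 1 u $ j))\<^sup>2" unfolding U(9) by (simp add: norm_L2_restrict U(12))
  finally show ?thesis using U(4)[of j] U(7) by simp
 qed
 then show ?thesis
  unfolding norm_vec_power2 inner_vec_def
  by (simp add: sum_subtractf sum.distrib sum_distrib_left sum_divide_distrib)
qed

end


context kdv_network
begin

text \<open>
 The margin in the hypothesis on \<open>\<alpha>\<close>, which is the strength of the dissipation at the node.
\<close>

definition gap :: real where "gap = \<alpha> - real CARD('n) / 2"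

text \<open>
 The factor of the smoothing multiplier, chosen so that half of the dissipation at the node absorbs the
 cross term \<open>2 kap v(0) \<Sum> \<partial>\<^sub>x v\<^sub>j(0)\<close>: the inequality of Young on each edge costs \<open>kap\<^sup>2 v(0)\<^sup>2\<close>.
\<close>

definition kap :: real where "kap = sqrt (gap / real CARD('n))"

lemma gap_pos: "0 < gap"
 using alpha by (simp add: gap_def)

lemma kap_pos: "0 < kap" and kap_square: "real CARD('n) * kap\<^sup>2 = gap"
 using gap_pos by (auto simp: kap_def)

text \<open>
 One half of the dissipation \<open>2 gap v(0)\<^sup>2\<close> absorbs the boundary datum; the other half and the traces
 \<open>\<partial>\<^sub>x v\<^sub>j(0)\<close> absorb the boundary term of the weighted identity.
\<close>

lemma energy_dissipation:
 assumes u: "u \<in> Dmax" and b: "flux u = - \<alpha> * node u + b"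
 shows "2 * inner (kdv u) u \<le> b\<^sup>2 / gap"
  "2 * inner (kdv u) u + 2 * kap * inner (kdv u) (net_weight u)
   \<le> b\<^sup>2 / gap + kap * (norm u)\<^sup>2 - 3 * kap * (norm (net_deriv len 1 u))\<^sup>2"
proof -
 obtain F F1 F2 F3 where r: "net_rep u F F1 F2 F3" using u Dmax_iff by blast
 define y where "y = node u"
 define S1 where "S1 = (\<Sum>j\<in>UNIV. F1 j 0)"
 define S2 where "S2 = (\<Sum>j\<in>UNIV. (F1 j 0)\<^sup>2)"
 have S2: "0 \<le> S2" unfolding S2_def by (intro sum_nonneg) auto
 have E: "2 * inner (kdv u) u = - 2 * gap * y\<^sup>2 + 2 * b * y - S2"
  unfolding net_energy[OF r] b y_def[symmetric] S2_def[symmetric] gap_def by (simp add: algebra_simps power2_eq_square)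
 have young: "2 * b * y \<le> gap * y\<^sup>2 + b\<^sup>2 / gap"
 proof -
  have "0 \<le> (gap * y - b)\<^sup>2 / gap" using gap_pos by simp
  also have "\<dots> = gap * y\<^sup>2 + b\<^sup>2 / gap - 2 * b * y" using gap_pos by (simp add: power2_eq_square field_simps)
  finally show ?thesis by simp
 qed
 have "0 \<le> gap * y\<^sup>2" using gap_pos by simp
 then show "2 * inner (kdv u) u \<le> b\<^sup>2 / gap" using E young S2 by linarith
 have "- (2 * kap * y * S1) = (\<Sum>j\<in>UNIV. - (2 * kap * y * F1 j 0))"
  unfolding S1_def by (simp add: sum_distrib_left sum_negf)
 also have "\<dots> \<le> (\<Sum>j\<in>UNIV. kap\<^sup>2 * y\<^sup>2 + (F1 j 0)\<^sup>2)"
 proof (rule sum_mono)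
  fix j
  have "0 \<le> (kap * y + F1 j 0)\<^sup>2" by simp
  then show "- (2 * kap * y * F1 j 0) \<le> kap\<^sup>2 * y\<^sup>2 + (F1 j 0)\<^sup>2" by (simp add: power2_eq_square algebra_simps)
 qed
 also have "\<dots> = gap * y\<^sup>2 + S2" unfolding S2_def by (simp add: sum.distrib kap_square[symmetric])
 finally have cross: "- (2 * kap * y * S1) \<le> gap * y\<^sup>2 + S2" .
 have "2 * kap * inner (kdv u) (net_weight u) = kap * (norm u)\<^sup>2 - 2 * kap * y * S1 - 3 * kap * (norm (net_deriv len 1 u))\<^sup>2"
  unfolding net_smoothing[OF r] y_def[symmetric] S1_def[symmetric] by (simp add: algebra_simps)
 then show "2 * inner (kdv u) u + 2 * kap * inner (kdv u) (net_weight u)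
   \<le> b\<^sup>2 / gap + kap * (norm u)\<^sup>2 - 3 * kap * (norm (net_deriv len 1 u))\<^sup>2"
  using E young cross by linarith
qed

text \<open>
 Applied to differences, this makes \<open>\<partial>\<^sub>x v\<close> continuous in time along classical solutions.
\<close>

lemma net_deriv_bound:
 assumes u: "u \<in> Dmax" and b: "flux u = - \<alpha> * node u + b"
 shows "3 * kap * (norm (net_deriv len 1 u))\<^sup>2
  \<le> b\<^sup>2 / gap + kap * (norm u)\<^sup>2 + 2 * (1 + kap * net_length) * (norm (kdv u) * norm u)"
proof -
 have "- inner (kdv u) u \<le> norm (kdv u) * norm u"
  using Cauchy_Schwarz_ineq2[of "kdv u" u] by linarith
 moreover have "- inner (kdv u) (net_weight u) \<le> norm (kdv u) * (net_length * norm u)"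
 proof -
  have "- inner (kdv u) (net_weight u) \<le> norm (kdv u) * norm (net_weight u)"
   using Cauchy_Schwarz_ineq2[of "kdv u" "net_weight u"] by linarith
  also have "\<dots> \<le> norm (kdv u) * (net_length * norm u)"
   by (intro mult_left_mono norm_net_weight Dmax_net_L2 u) auto
  finally show ?thesis .
 qed
 then have "kap * - inner (kdv u) (net_weight u) \<le> kap * (norm (kdv u) * (net_length * norm u))"
  using kap_pos by (intro mult_left_mono) auto
 ultimately show ?thesis using energy_dissipation(2)[OF u b] by (simp add: algebra_simps)
qed

text \<open>
 On each edge the solution is \<open>c p + q\<close> with the homogeneous solution \<open>p\<close> and a particular solution
 \<open>q\<close>. Continuity at the central node expresses each \<open>c\<close> by the common value \<open>y\<close>, and the flux condition
 becomes \<open>s y = b + \<Sum> (q p'' - q'')(0)\<close>, where \<open>s = \<alpha> + \<Sum> p''(0) \<ge> \<alpha> - N/2 > 0\<close>.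
\<close>

lemma solve_stationary:
 assumes lam: "0 < lam" and f: "f \<in> net_L2 len"
 shows "\<exists>u\<in>Dmax. lam *\<^sub>R u - kdv u = f \<and> flux u = - \<alpha> * node u + b"
proof -
 define hom where "hom j p p1 p2 \<longleftrightarrow> primitive_on (len j) p p1 \<and> primitive_on (len j) p1 p2 \<and>
  primitive_on (len j) p2 (\<lambda>x. - p1 x - lam * p x) \<and> p (len j) = 0 \<and> p1 (len j) = 0 \<and> p 0 = 1 \<and> - (1 / 2) \<le> p2 0" for j p p1 p2
 have "\<exists>p p1 p2. hom j p p1 p2" for j
  unfolding hom_def by (rule edge_homogeneous_solution[OF len[of j] lam]) blast
 then obtain p p1 p2 where "\<And>j. hom j (p j) (p1 j) (p2 j)" by metis
 then have P: "\<And>j. primitive_on (len j) (p j) (p1 j)" "\<And>j. primitive_on (len j) (p1 j) (p2 j)"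
  "\<And>j. primitive_on (len j) (p2 j) (\<lambda>x. - p1 j x - lam * p j x)"
  "\<And>j. p j (len j) = 0" "\<And>j. p1 j (len j) = 0" "\<And>j. p j 0 = 1" "\<And>j. - (1 / 2) \<le> p2 j 0"
  unfolding hom_def by blast+
 define inh where "inh j q q1 q2 \<longleftrightarrow> primitive_on (len j) q q1 \<and> primitive_on (len j) q1 q2 \<and>
  primitive_on (len j) q2 (\<lambda>x. fun_of_L2 (f $ j) x - q1 x - lam * q x) \<and> q (len j) = 0 \<and> q1 (len j) = 0" for j q q1 q2
 have "\<exists>q q1 q2. inh j q q1 q2" for j
  unfolding inh_def by (rule edge_inhomogeneous_solution[OF len[of j] lam sqint_abs_integrable[OF sqint_fun_of_L2]]) blast
 then obtain q q1 q2 where "\<And>j. inh j (q j) (q1 j) (q2 j)" by metis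
 then have Q: "\<And>j. primitive_on (len j) (q j) (q1 j)" "\<And>j. primitive_on (len j) (q1 j) (q2 j)"
  "\<And>j. primitive_on (len j) (q2 j) (\<lambda>x. fun_of_L2 (f $ j) x - q1 j x - lam * q j x)"
  "\<And>j. q j (len j) = 0" "\<And>j. q1 j (len j) = 0"
  unfolding inh_def by blast+
 define s where "s = (\<Sum>j\<in>UNIV. p2 j 0) + \<alpha>"
 have "(\<Sum>j\<in>(UNIV::'n set). - (1/2)) \<le> (\<Sum>j\<in>UNIV. p2 j 0)" by (intro sum_mono P)
 then have s: "0 < s" using alpha by (simp add: s_def)
 define y where "y = (b + (\<Sum>j\<in>UNIV. q j 0 * p2 j 0 - q2 j 0)) / s"
 define c where "c j = y - q j 0" for j
 define U U1 U2 U3 where "U j x = c j * p j x + q j x" and "U1 j x = c j * p1 j x + q1 j x"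
  and "U2 j x = c j * p2 j x + q2 j x" and "U3 j x = fun_of_L2 (f $ j) x - U1 j x - lam * U j x" for j x
 have prim: "primitive_on (len j) (U j) (U1 j)" "primitive_on (len j) (U1 j) (U2 j)" "primitive_on (len j) (U2 j) (U3 j)" for j
 proof -
  show "primitive_on (len j) (U j) (U1 j)" "primitive_on (len j) (U1 j) (U2 j)"
   unfolding U_def U1_def U2_def by (intro primitive_on_add primitive_on_cmult P Q)+
  have "primitive_on (len j) (U2 j) (\<lambda>x. c j * (- p1 j x - lam * p j x) + (fun_of_L2 (f $ j) x - q1 j x - lam * q j x))"
   unfolding U2_def by (intro primitive_on_add primitive_on_cmult P Q)
  then show "primitive_on (len j) (U2 j) (U3 j)"
   unfolding U3_def U1_def U_def by (simp add: algebra_simps)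
 qed
 have sU: "sqint (len j) (U j)" "sqint (len j) (U1 j)" for j by (rule primitive_on_sqint[OF prim(1)] primitive_on_sqint[OF prim(2)])+
 have sU3: "sqint (len j) (U3 j)" for j
  using sqint_add[OF sqint_add[OF sqint_fun_of_L2[of "len j" "f $ j"] sqint_cmult[OF sU(2)[of j], of "-1"]] sqint_cmult[OF sU(1)[of j], of "- lam"]]
  unfolding U3_def by (simp add: algebra_simps)
 define u where "u = (\<chi> j. L2_restrict (len j) (U j))"
 have U0: "U j 0 = y" for j by (simp add: U_def c_def P)
 have r: "net_rep u U U1 U2 U3"
  unfolding net_rep_def H3_rep_def using prim sU3 U0 by (simp add: u_def U_def U1_def P Q)
 note R = net_rep_D[OF r]
 have "kdv u $ j = lam *\<^sub>R (u $ j) - f $ j" for j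
 proof -
  have "kdv u $ j = L2_restrict (len j) (\<lambda>x. lam * U j x + (-1) * fun_of_L2 (f $ j) x)"
   unfolding R(10) by (simp add: U3_def)
  also have "\<dots> = lam *\<^sub>R L2_restrict (len j) (U j) + (-1) *\<^sub>R L2_restrict (len j) (fun_of_L2 (f $ j))"
   by (simp only: L2_restrict_scale sU sqint_fun_of_L2 L2_restrict_add sqint_cmult)
  also have "L2_restrict (len j) (fun_of_L2 (f $ j)) = f $ j"
   using f by (simp add: net_L2_def L2_restrict_fun_of_L2)
  finally show ?thesis by (simp add: u_def)
 qed
 then have "lam *\<^sub>R u - kdv u = f" by (simp add: vec_eq_iff)
 moreover have "flux u = - \<alpha> * node u + b"
 proof -
  have "flux u = (\<Sum>j\<in>UNIV. y * p2 j 0 - (q j 0 * p2 j 0 - q2 j 0))"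
   unfolding R(8) by (intro sum.cong) (auto simp: U2_def c_def algebra_simps)
  also have "\<dots> = y * (\<Sum>j\<in>UNIV. p2 j 0) - (\<Sum>j\<in>UNIV. q j 0 * p2 j 0 - q2 j 0)"
   by (simp add: sum_subtractf sum_distrib_left)
  also have "y * (\<Sum>j\<in>UNIV. p2 j 0) = y * s - \<alpha> * y" by (simp add: s_def algebra_simps)
  also have "y * s = b + (\<Sum>j\<in>UNIV. q j 0 * p2 j 0 - q2 j 0)" using s by (simp add: y_def)
  finally show ?thesis by (simp add: R(7) U0)
 qed
 moreover have "u \<in> Dmax" using r Dmax_iff by blast
 ultimately show ?thesis by blast
qed

sublocale gen: m_dissipative "net_L2 len" "kdv_domain \<alpha> len e1" "kdv_operator len"
proof
 show "subspace (net_L2 len)" by (rule subspace_net_L2)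
 show "closed (net_L2 len)" by (rule closed_net_L2)
 show "subspace (kdv_domain \<alpha> len e1)"
 proof (rule subspaceI)
  show "0 \<in> kdv_domain \<alpha> len e1" by (simp add: kdv_domain_eq zero_Dmax)
  fix x y c assume "x \<in> kdv_domain \<alpha> len e1" "y \<in> kdv_domain \<alpha> len e1"
  then show "x + y \<in> kdv_domain \<alpha> len e1" "c *\<^sub>R x \<in> kdv_domain \<alpha> len e1"
   using Dmax_lincomb[of x y 1 1] Dmax_lincomb[of x x c 0] by (auto simp: kdv_domain_eq algebra_simps)
 qed
 show "kdv_domain \<alpha> len e1 \<subseteq> net_L2 len" using Dmax_net_L2 by (auto simp: kdv_domain_eq)
 fix x assume x: "x \<in> kdv_domain \<alpha> len e1"
 then show "kdv x \<in> net_L2 len" using Dmax_net_L2 by (auto simp: kdv_domain_eq)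
 show "kdv (x + y) = kdv x + kdv y" if "y \<in> kdv_domain \<alpha> len e1" for y
  using Dmax_lincomb(4)[of x y 1 1] x that by (simp add: kdv_domain_eq)
 show "kdv (c *\<^sub>R x) = c *\<^sub>R kdv x" for c
  using Dmax_lincomb(4)[of x x c 0] x by (simp add: kdv_domain_eq)
 show "inner (kdv x) x \<le> 0"
  using energy_dissipation(1)[of x 0] x by (simp add: kdv_domain_eq)
next
 fix h :: real and f assume h: "0 < h" and f: "f \<in> net_L2 len"
 have "(1/h) *\<^sub>R f \<in> net_L2 len" using subspace_net_L2 f by (rule subspace_scale)
 then obtain u where u: "u \<in> Dmax" "(1/h) *\<^sub>R u - kdv u = (1/h) *\<^sub>R f" "flux u = - \<alpha> * node u + 0"
  using solve_stationary[of "1/h" "(1/h) *\<^sub>R f" 0] h by auto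
 have "h *\<^sub>R ((1/h) *\<^sub>R u - kdv u) = h *\<^sub>R ((1/h) *\<^sub>R f)" using u(2) by simp
 then have "u - h *\<^sub>R kdv u = f" using h by (simp add: scaleR_right_diff_distrib)
 then show "\<exists>u\<in>kdv_domain \<alpha> len e1. u - h *\<^sub>R kdv u = f" using u by (auto simp: kdv_domain_eq)
qed

abbreviation S :: "real \<Rightarrow> L2 ^ 'n \<Rightarrow> L2 ^ 'n" where "S \<equiv> kdv_semigroup \<alpha> len e1"

sublocale gen: m_dissipative_semigroup "net_L2 len" "kdv_domain \<alpha> len e1" "kdv_operator len" "kdv_semigroup \<alpha> len e1"
proof -
 have "\<exists>S. C0_semigroup_on (net_L2 len) S \<and> is_generator (net_L2 len) S (kdv_domain \<alpha> len e1) (kdv_operator len)"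
  using gen.generates_semigroup by blast
 then have "C0_semigroup_on (net_L2 len) (kdv_semigroup \<alpha> len e1) \<and>
   is_generator (net_L2 len) (kdv_semigroup \<alpha> len e1) (kdv_domain \<alpha> len e1) (kdv_operator len)"
  unfolding kdv_semigroup_def by (rule someI_ex)
 then show "m_dissipative_semigroup (net_L2 len) (kdv_domain \<alpha> len e1) (kdv_operator len) (kdv_semigroup \<alpha> len e1)"
  by unfold_locales auto
qed

end


section \<open>Functions in \<open>H\<^sup>1\<close> of the network as primitives of their derivatives\<close>

definition tail :: "real \<Rightarrow> real \<Rightarrow> L2" where
 "tail l x = L2_restrict l (indicator {x..l})"

text \<open>
 The primitive of \<open>a\<close> that vanishes at \<open>l\<close>. As an inner product it is visibly linear and bounded in
 \<open>a\<close>.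
\<close>

definition prim :: "real \<Rightarrow> L2 \<Rightarrow> real \<Rightarrow> real" where
 "prim l a x = - inner (L2_restrict l (fun_of_L2 a)) (tail l x)"

lemma sqint_indicator: "sqint l (indicator {x..l})"
proof -
 have eq: "(\<lambda>y. indicator {0<..<l} y * indicator {x..l} y) = (indicator ({0<..<l} \<inter> {x..l}) :: real \<Rightarrow> real)"
  by (auto simp: fun_eq_iff indicator_def)
 have "emeasure lebesgue ({0<..<l} \<inter> {x..l}) \<le> emeasure lebesgue {0..l}" by (intro emeasure_mono) auto
 also have "\<dots> < \<infinity>" by (simp add: emeasure_lborel_Icc_eq)
 finally show ?thesis unfolding sqint_def eq by (intro square_integrable_indicator) auto
qed

lemma prim_eq:
 assumes "x \<in> {0..l}"
 shows "prim l a x = - integral {x..l} (fun_of_L2 a)"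
proof -
 have f: "fun_of_L2 a absolutely_integrable_on {0..l}" by (rule sqint_abs_integrable[OF sqint_fun_of_L2])
 have "inner (L2_restrict l (fun_of_L2 a)) (tail l x) = integral {0..l} (\<lambda>y. fun_of_L2 a y * indicator {x..l} y)"
  unfolding tail_def by (rule inner_L2_restrict[OF sqint_fun_of_L2 sqint_indicator])
 also have "\<dots> = integral {0..l} (\<lambda>y. if y \<in> {x..l} then fun_of_L2 a y else 0)"
  by (intro integral_cong) (auto simp: indicator_def)
 also have "\<dots> = integral ({x..l} \<inter> {0..l}) (fun_of_L2 a)" by (rule integral_restrict_Int)
 also have "{x..l} \<inter> {0..l} = {x..l}" using assms by auto
 finally show ?thesis by (simp add: prim_def)
qed

lemma prim_primitive:
 assumes "0 \<le> l"
 shows "primitive_on l (prim l a) (fun_of_L2 a)" "prim l a l = 0"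
proof -
 have f: "fun_of_L2 a absolutely_integrable_on {0..l}" by (rule sqint_abs_integrable[OF sqint_fun_of_L2])
 have "integral {0..x} (fun_of_L2 a) = prim l a x - prim l a 0" if x: "x \<in> {0..l}" for x
 proof -
  have "integral {0..x} (fun_of_L2 a) + integral {x..l} (fun_of_L2 a) = integral {0..l} (fun_of_L2 a)"
   using x LINT_HK(1)[OF f] by (intro HK_combine) auto
  then show ?thesis using x assms by (simp add: prim_eq)
 qed
 then show "primitive_on l (prim l a) (fun_of_L2 a)" using f by (simp add: primitive_on_def)
 show "prim l a l = 0" using assms by (simp add: prim_eq)
qed

lemma prim_unique:
 assumes F: "primitive_on l F f" and f: "AE x in lebesgue. x \<in> {0<..<l} \<longrightarrow> f x = fun_of_L2 a x" and Fl: "F l = 0" and x: "x \<in> {0..l}"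
 shows "F x = prim l a x"
proof -
 have F': "primitive_on l F (fun_of_L2 a)" by (rule primitive_on_AE_cong[OF F sqint_fun_of_L2 f])
 have l: "0 \<le> l" using x by simp
 note P = prim_primitive[OF l, of a]
 have 1: "integral {0..y} (fun_of_L2 a) = F y - F 0" "integral {0..y} (fun_of_L2 a) = prim l a y - prim l a 0" if "y \<in> {0..l}" for y
  using F' P(1) that unfolding primitive_on_def by blast+
 show ?thesis using 1[OF x] 1[of l] l Fl P(2) by simp
qed

lemma norm_L2_restrict_1: "0 \<le> l \<Longrightarrow> norm (L2_restrict l (\<lambda>_. 1)) = sqrt l"
 using norm_L2_restrict[OF sqint_1, of l] by (simp add: real_sqrt_unique)

lemma prim_bound:
 assumes "x \<in> {0..l}"
 shows "\<bar>prim l a x\<bar> \<le> sqrt l * norm a"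
proof -
 have l: "0 \<le> l" using assms by simp
 have "(norm (tail l x))\<^sup>2 = integral {0..l} (\<lambda>y. indicator {x..l} y * indicator {x..l} y)"
  unfolding tail_def by (rule norm_L2_restrict[OF sqint_indicator])
 also have "\<dots> \<le> integral {0..l} (\<lambda>_. 1)"
 proof (rule integral_le)
  show "(\<lambda>y. indicator {x..l} y * indicator {x..l} y :: real) integrable_on {0..l}"
   by (intro LINT_HK(1) sqint_mult sqint_indicator)
 qed (auto simp: indicator_def)
 finally have "(norm (tail l x))\<^sup>2 \<le> l" using l by simp
 then have t: "norm (tail l x) \<le> sqrt l" by (simp add: real_le_rsqrt)
 have "\<bar>prim l a x\<bar> \<le> norm (L2_restrict l (fun_of_L2 a)) * norm (tail l x)"
  unfolding prim_def abs_minus_cancel by (rule Cauchy_Schwarz_ineq2)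
 also have "\<dots> \<le> norm a * sqrt l" by (intro mult_mono norm_L2_restrict_fun_le t) auto
 finally show ?thesis by (simp add: mult.commute)
qed

lemma L2_restrict_fun_linear: "bounded_linear (\<lambda>a. L2_restrict l (fun_of_L2 a))"
proof -
 have "(\<lambda>a. L2_restrict l (fun_of_L2 a)) = L2_mult l (\<lambda>_. 1)" by (auto simp: L2_mult_def)
 then show ?thesis using bounded_linear_L2_mult[of l "\<lambda>_. 1"] by simp
qed

lemma prim_linear: "prim l (a + b) x = prim l a x + prim l b x" "prim l (c *\<^sub>R a) x = c * prim l a x"
proof -
 interpret bounded_linear "\<lambda>a. L2_restrict l (fun_of_L2 a)" by (rule L2_restrict_fun_linear)
 show "prim l (a + b) x = prim l a x + prim l b x" "prim l (c *\<^sub>R a) x = c * prim l a x"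
  by (simp_all add: prim_def add scaleR inner_add_left)
qed

lemma bounded_linear_prim: "bounded_linear (\<lambda>a. prim l a x)"
 unfolding prim_def
 by (intro bounded_linear_minus bounded_linear_compose[OF bounded_linear_inner_left L2_restrict_fun_linear])

definition L2_prim :: "real \<Rightarrow> L2 \<Rightarrow> L2" where
 "L2_prim l a = L2_restrict l (prim l a)"

lemma prim_continuous: "0 \<le> l \<Longrightarrow> continuous_on {0..l} (prim l a)"
 by (rule primitive_on_continuous[OF prim_primitive(1)])

lemma prim_sqint: "0 \<le> l \<Longrightarrow> sqint l (prim l a)"
 by (rule sqint_continuous[OF prim_continuous])

lemma bounded_linear_L2_prim:
 assumes l: "0 \<le> l"
 shows "bounded_linear (L2_prim l)"
proof (rule bounded_linear_intro[where K = l])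
 fix a b :: L2 and c :: real
 show "L2_prim l (a + b) = L2_prim l a + L2_prim l b"
  unfolding L2_prim_def by (simp add: L2_restrict_add prim_sqint l prim_linear[abs_def])
 show "L2_prim l (c *\<^sub>R a) = c *\<^sub>R L2_prim l a"
  unfolding L2_prim_def by (simp add: L2_restrict_scale prim_sqint l prim_linear[abs_def])
 have "norm (L2_restrict l (\<lambda>x. prim l a x * 1)) \<le> (sqrt l * norm a) * norm (L2_restrict l (\<lambda>_. 1))"
  using l by (intro norm_L2_restrict_mult_le prim_continuous sqint_1 prim_bound) auto
 moreover have sq: "sqrt l * norm a * sqrt l = norm a * l"
 proof -
  have "sqrt l * norm a * sqrt l = norm a * (sqrt l * sqrt l)" by (simp only: mult_ac)
  then show ?thesis using l by simp
 qed
 ultimately show "norm (L2_prim l a) \<le> norm a * l"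
  using l by (simp add: L2_prim_def norm_L2_restrict_1 sq)
qed

lemma H1_rep_prim:
 assumes l: "0 < l" and a: "a \<in> L2_on {0<..<l}"
 shows "H1_rep l (L2_prim l a) (prim l a) (fun_of_L2 a)" "weak_deriv l 1 (L2_prim l a) = a"
  "x \<in> {0..l} \<Longrightarrow> point_value l (L2_prim l a) x = prim l a x"
proof -
 show r: "H1_rep l (L2_prim l a) (prim l a) (fun_of_L2 a)"
  using prim_primitive(1)[of l a] l by (simp add: H1_rep_def sqint_fun_of_L2 L2_prim_def)
 show "weak_deriv l 1 (L2_prim l a) = a"
  using H1_rep_weak_deriv(2)[OF l r] a by (simp add: L2_restrict_fun_of_L2)
 show "x \<in> {0..l} \<Longrightarrow> point_value l (L2_prim l a) x = prim l a x"
  by (rule H1_rep_weak_deriv(3)[OF l r])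
qed

lemma H1_rep_eq_prim:
 assumes l: "0 < l" and r: "H1_rep l u F F1" and Fl: "F l = 0"
 shows "u = L2_prim l (weak_deriv l 1 u)" "weak_deriv l 1 u \<in> L2_on {0<..<l}" "x \<in> {0..l} \<Longrightarrow> F x = prim l (weak_deriv l 1 u) x"
proof -
 have w: "weak_deriv l 1 u = L2_restrict l F1" by (rule H1_rep_weak_deriv(2)[OF l r])
 have s: "sqint l F1" using r by (simp add: H1_rep_def)
 show "weak_deriv l 1 u \<in> L2_on {0<..<l}" unfolding w by (rule L2_restrict_L2_on[OF s])
 show *: "F x = prim l (weak_deriv l 1 u) x" if "x \<in> {0..l}" for x
  unfolding w
 proof (rule prim_unique[where f = F1])
  show "primitive_on l F F1" using r by (simp add: H1_rep_def)
  show "AE x in lebesgue. x \<in> {0<..<l} \<longrightarrow> F1 x = fun_of_L2 (L2_restrict l F1) x"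
   using fun_of_L2_restrict_on[OF s] by eventually_elim simp
 qed (fact Fl that)+
 have "L2_restrict l F = L2_restrict l (prim l (weak_deriv l 1 u))"
  by (rule L2_restrict_cong(1)) (use * in auto)
 then show "u = L2_prim l (weak_deriv l 1 u)" using r by (simp add: L2_prim_def H1_rep_def)
qed

text \<open>\<open>F(0)\<^sup>2 = - 2 \<integral> F F'\<close> for a primitive \<open>F\<close> that vanishes at \<open>l\<close>.\<close>

lemma prim_square_bound:
 assumes l: "0 < l" and a: "a \<in> L2_on {0<..<l}"
 shows "(prim l a 0)\<^sup>2 \<le> 2 * norm (L2_prim l a) * norm a"
proof -
 have P: "primitive_on l (prim l a) (fun_of_L2 a)" "prim l a l = 0" using prim_primitive[of l a] l by auto
 have "primitive_on l (\<lambda>x. prim l a x * prim l a x) (\<lambda>x. fun_of_L2 a x * prim l a x + prim l a x * fun_of_L2 a x)"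
  by (rule primitive_on_mult[OF P(1) P(1)])
 from primitive_on_integral[OF this] l P(2)
 have "integral {0..l} (\<lambda>x. fun_of_L2 a x * prim l a x + prim l a x * fun_of_L2 a x) = - (prim l a 0)\<^sup>2"
  by (simp add: power2_eq_square)
 moreover have twice: "(\<lambda>x. fun_of_L2 a x * prim l a x + prim l a x * fun_of_L2 a x) = (\<lambda>x. 2 * (prim l a x * fun_of_L2 a x))"
  by (rule ext) (simp only: mult_2 mult.commute)
 ultimately have "integral {0..l} (\<lambda>x. 2 * (prim l a x * fun_of_L2 a x)) = - (prim l a 0)\<^sup>2"
  unfolding twice by argo
 moreover have "inner (L2_prim l a) a = integral {0..l} (\<lambda>x. prim l a x * fun_of_L2 a x)"
  using inner_L2_restrict[OF prim_sqint sqint_fun_of_L2, of l a a] l a by (simp add: L2_prim_def L2_restrict_fun_of_L2)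
 ultimately have "(prim l a 0)\<^sup>2 = - 2 * inner (L2_prim l a) a" by simp
 also have "\<dots> \<le> 2 * (norm (L2_prim l a) * norm a)" using Cauchy_Schwarz_ineq2[of "L2_prim l a" a] by linarith
 finally show ?thesis by (simp add: mult.assoc)
qed

text \<open>
 The product of \<open>b\<close> with the primitive of \<open>a\<close>. In terms of derivatives the nonlinearity is thus a
 bounded bilinear map on \<open>L\<^sup>2\<close>.
\<close>

definition L2_product :: "real \<Rightarrow> L2 \<Rightarrow> L2 \<Rightarrow> L2" where
 "L2_product l a b = L2_mult l (prim l a) b"

lemma bounded_bilinear_L2_product:
 assumes l: "0 \<le> l"
 shows "bounded_bilinear (L2_product l)"
proof
 fix a a' b b' :: L2 and r :: real
 have s: "sqint l (\<lambda>x. prim l a x * fun_of_L2 b x)" for a b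
  using l by (intro sqint_mult_continuous prim_continuous sqint_fun_of_L2)
 interpret m: bounded_linear "L2_mult l (prim l a)" using l by (intro bounded_linear_L2_mult prim_continuous)
 show "L2_product l (a + a') b = L2_product l a b + L2_product l a' b"
  unfolding L2_product_def L2_mult_def by (simp add: L2_restrict_add s prim_linear distrib_right)
 show "L2_product l a (b + b') = L2_product l a b + L2_product l a b'" unfolding L2_product_def by (rule m.add)
 show "L2_product l (r *\<^sub>R a) b = r *\<^sub>R L2_product l a b"
  unfolding L2_product_def L2_mult_def by (simp add: L2_restrict_scale s prim_linear mult.assoc)
 show "L2_product l a (r *\<^sub>R b) = r *\<^sub>R L2_product l a b" unfolding L2_product_def by (rule m.scaleR)
 have "norm (L2_product l a b) \<le> norm a * norm b * sqrt l" for a b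
 proof -
  have "norm (L2_product l a b) \<le> (sqrt l * norm a) * norm (L2_restrict l (fun_of_L2 b))"
   unfolding L2_product_def L2_mult_def using l
   by (intro norm_L2_restrict_mult_le prim_continuous sqint_fun_of_L2 prim_bound) auto
  also have "\<dots> \<le> (sqrt l * norm a) * norm b" using l by (intro mult_left_mono norm_L2_restrict_fun_le) auto
  finally show ?thesis by (simp add: mult_ac)
 qed
 then show "\<exists>K. \<forall>a b. norm (L2_product l a b) \<le> norm a * norm b * K" by blast
qed

lemma bounded_bilinear_componentwise:
 fixes f :: "'n::finite \<Rightarrow> 'a::real_normed_vector \<Rightarrow> 'b::real_normed_vector \<Rightarrow> 'c::real_normed_vector"
 assumes "\<And>j. bounded_bilinear (f j)"
 shows "bounded_bilinear (\<lambda>u v. \<chi> j. f j (u $ j) (v $ j))"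
proof
 have "\<exists>K. 0 \<le> K \<and> (\<forall>x y. norm (f j x y) \<le> norm x * norm y * K)" for j
  using bounded_bilinear.nonneg_bounded[OF assms] by blast
 then obtain K where K: "\<And>j. 0 \<le> K j" "\<And>j x y. norm (f j x y) \<le> norm x * norm y * K j" by metis
 have "norm (\<chi> j. f j (u $ j) (v $ j)) \<le> norm u * norm v * (\<Sum>j\<in>UNIV. K j)" for u v
 proof -
  have "norm (\<chi> j. f j (u $ j) (v $ j)) \<le> (\<Sum>j\<in>UNIV. norm (f j (u $ j) (v $ j)))"
   unfolding norm_vec_def by (rule order_trans[OF L2_set_le_sum]) auto
  also have "\<dots> \<le> (\<Sum>j\<in>UNIV. norm u * norm v * K j)"
  proof (rule sum_mono)
   fix j
   have "norm (u $ j) * norm (v $ j) * K j \<le> norm u * norm v * K j"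
    using K(1) by (intro mult_right_mono mult_mono Finite_Cartesian_Product.norm_nth_le) auto
   then show "norm (f j (u $ j) (v $ j)) \<le> norm u * norm v * K j" using K(2)[of j "u $ j" "v $ j"] by linarith
  qed
  finally show ?thesis by (simp add: sum_distrib_left)
 qed
 then show "\<exists>K. \<forall>u v. norm (\<chi> j. f j (u $ j) (v $ j)) \<le> norm u * norm v * K" by blast
qed (simp_all add: vec_eq_iff bounded_bilinear.add_left[OF assms] bounded_bilinear.add_right[OF assms]
  bounded_bilinear.scaleR_left[OF assms] bounded_bilinear.scaleR_right[OF assms])

context kdv_network
begin

abbreviation ND :: "L2 ^ 'n \<Rightarrow> L2 ^ 'n" where "ND \<equiv> net_deriv len 1"

definition net_prim :: "L2 ^ 'n \<Rightarrow> L2 ^ 'n" where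
 "net_prim d = (\<chi> j. L2_prim (len j) (d $ j))"

definition nodeval :: "L2 ^ 'n \<Rightarrow> real" where
 "nodeval d = prim (len e1) (d $ e1) 0"

text \<open>
 The derivatives of the elements of \<open>H\<^sup>1\<^sub>e\<close>: the primitives that vanish at the outer nodes have to
 agree at the centre.
\<close>

definition H1_derivs :: "(L2 ^ 'n) set" where
 "H1_derivs = {d \<in> net_L2 len. \<forall>j. prim (len j) (d $ j) 0 = nodeval d}"

definition net_product :: "L2 ^ 'n \<Rightarrow> L2 ^ 'n \<Rightarrow> L2 ^ 'n" where
 "net_product d d' = (\<chi> j. L2_product (len j) (d $ j) (d' $ j))"

lemma bounded_linear_net_prim: "bounded_linear net_prim"
 unfolding net_prim_def using len by (intro bounded_linear_componentwise bounded_linear_L2_prim) (auto intro: less_imp_le)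

lemma bounded_linear_nth: "bounded_linear (\<lambda>d :: L2 ^ 'n. d $ j)"
 by (rule bounded_linear_vec_nth)

lemma bounded_linear_nodeval: "bounded_linear nodeval"
 unfolding nodeval_def by (rule bounded_linear_compose[OF bounded_linear_prim bounded_linear_nth])

lemma bounded_bilinear_net_product: "bounded_bilinear net_product"
 unfolding net_product_def using len by (intro bounded_bilinear_componentwise bounded_bilinear_L2_product) (auto intro: less_imp_le)

lemma net_product_net_L2: "net_product d d' \<in> net_L2 len"
 unfolding net_L2_def net_product_def L2_product_def using len prim_continuous by (simp add: L2_mult_L2_on less_imp_le)

lemma closed_H1_derivs: "closed H1_derivs"
proof -
 have "H1_derivs = net_L2 len \<inter> (\<Inter>j. {d. prim (len j) (d $ j) 0 = nodeval d})" by (auto simp: H1_derivs_def)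
 moreover have "closed {d. prim (len j) (d $ j) 0 = nodeval d}" for j
  by (intro closed_Collect_eq linear_continuous_on bounded_linear_nodeval
    bounded_linear_compose[OF bounded_linear_prim bounded_linear_nth])
 ultimately show ?thesis using closed_net_L2 by (auto intro!: closed_Int closed_INT)
qed

lemma subspace_H1_derivs: "subspace H1_derivs"
proof -
 interpret n: bounded_linear nodeval by (rule bounded_linear_nodeval)
 show ?thesis
  using subspace_net_L2 bounded_linear.linear[OF bounded_linear_prim, THEN linear_0]
  unfolding H1_derivs_def subspace_def by (auto simp: n.zero n.add n.scaleR prim_linear)
qed

lemma He1_I:
 assumes d: "d \<in> H1_derivs"
 shows "net_prim d \<in> net_He 1 len" "ND (net_prim d) = d" "node (net_prim d) = nodeval d" "net_prim d \<in> net_L2 len"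
proof -
 have dL: "d $ j \<in> L2_on {0<..<len j}" and d0: "prim (len j) (d $ j) 0 = nodeval d" for j
  using d by (auto simp: H1_derivs_def net_L2_def)
 have l0: "0 \<in> {0..len j}" "len j \<in> {0..len j}" for j using len[of j] by auto
 have comp: "net_prim d $ j = L2_prim (len j) (d $ j)" for j by (simp add: net_prim_def)
 have S: "net_prim d $ j \<in> Sobolev 1 (len j)" for j
  unfolding comp by (rule H1_rep_weak_deriv(1)[OF len H1_rep_prim(1)[OF len dL]])
 have L: "net_prim d $ j \<in> L2_on {0<..<len j}" for j using S[of j] by (simp add: Sobolev_def)
 have pv: "x \<in> {0..len j} \<Longrightarrow> point_value (len j) (net_prim d $ j) x = prim (len j) (d $ j) x" for j x
  unfolding comp by (rule H1_rep_prim(3)[OF len dL])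
 have end0: "prim (len j) (d $ j) (len j) = 0" for j using len[of j] by (intro prim_primitive) simp
 show "ND (net_prim d) = d"
  by (simp add: net_deriv_def vec_eq_iff comp H1_rep_prim(2)[OF len dL, unfolded One_nat_def])
 show "net_prim d \<in> net_He 1 len"
  unfolding net_He_def net_Sobolev_def
  using S weak_deriv_0[OF len L] pv[OF l0(1)] pv[OF l0(2)] d0 end0 by (auto simp: net_deriv_def)
 show "node (net_prim d) = nodeval d" unfolding node_def using pv[OF l0(1)] d0 by simp
 show "net_prim d \<in> net_L2 len" using L by (simp add: net_L2_def)
qed

lemma He1_D:
 assumes u: "u \<in> net_He 1 len"
 shows "ND u \<in> H1_derivs" "u = net_prim (ND u)" "node u = nodeval (ND u)" "u \<in> net_L2 len"
proof -
 have S: "u $ j \<in> Sobolev 1 (len j)" for j using u unfolding net_He_def net_Sobolev_def by blast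
 have L: "u $ j \<in> L2_on {0<..<len j}" for j using S[of j] by (simp add: Sobolev_def)
 have l0: "0 \<in> {0..len j}" "len j \<in> {0..len j}" for j using len[of j] by auto
 have ends: "point_value (len j) (net_deriv len (1 - 1) u $ j) (len j) = 0" for j
  using u unfolding net_He_def by (auto simp del: One_nat_def)
 have cont: "point_value (len j) (u $ j) 0 = point_value (len e1) (u $ e1) 0" for j
  using u unfolding net_He_def by blast
 have comp: "ND u $ j = weak_deriv (len j) 1 (u $ j)" for j by (simp add: net_deriv_def)
 have *: "u $ j = L2_prim (len j) (ND u $ j) \<and> ND u $ j \<in> L2_on {0<..<len j} \<and> point_value (len j) (u $ j) 0 = prim (len j) (ND u $ j) 0" for j
 proof -
  obtain F F1 where r: "H1_rep (len j) (u $ j) F F1" by (rule Sobolev_1_rep[OF len S])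
  have "F (len j) = 0"
   using ends[of j] H1_rep_weak_deriv(3)[OF len r l0(2)] weak_deriv_0[OF len L] by (simp add: net_deriv_def)
  note q = H1_rep_eq_prim[OF len r this]
  show ?thesis unfolding comp using q(1,2) q(3)[OF l0(1)] H1_rep_weak_deriv(3)[OF len r l0(1)] by simp
 qed
 show n: "node u = nodeval (ND u)" unfolding node_def nodeval_def using *[of e1] by blast
 have "prim (len j) (ND u $ j) 0 = nodeval (ND u)" for j unfolding nodeval_def using *[of j] *[of e1] cont[of j] by argo
 then show "ND u \<in> H1_derivs" unfolding H1_derivs_def net_L2_def using * by blast
 show "u = net_prim (ND u)" unfolding net_prim_def vec_eq_iff vec_lambda_beta using * by blast
 show "u \<in> net_L2 len" using L by (simp add: net_L2_def)
qed

lemma He1_lincomb: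
 assumes "u \<in> net_He 1 len" "v \<in> net_He 1 len"
 shows "a *\<^sub>R u + b *\<^sub>R v \<in> net_He 1 len" "ND (a *\<^sub>R u + b *\<^sub>R v) = a *\<^sub>R ND u + b *\<^sub>R ND v"
proof -
 interpret bounded_linear net_prim by (rule bounded_linear_net_prim)
 have d: "a *\<^sub>R ND u + b *\<^sub>R ND v \<in> H1_derivs"
  using He1_D(1)[OF assms(1)] He1_D(1)[OF assms(2)] subspace_H1_derivs by (simp add: subspace_add subspace_scale)
 have e: "a *\<^sub>R u + b *\<^sub>R v = net_prim (a *\<^sub>R ND u + b *\<^sub>R ND v)"
  using He1_D(2)[OF assms(1)] He1_D(2)[OF assms(2)] by (simp add: add scaleR)
 show "a *\<^sub>R u + b *\<^sub>R v \<in> net_He 1 len" "ND (a *\<^sub>R u + b *\<^sub>R v) = a *\<^sub>R ND u + b *\<^sub>R ND v"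
  unfolding e using He1_I[OF d] by auto
qed

lemma He1_diff: "u \<in> net_He 1 len \<Longrightarrow> v \<in> net_He 1 len \<Longrightarrow> u - v \<in> net_He 1 len \<and> ND (u - v) = ND u - ND v"
 using He1_lincomb[of u v 1 "-1"] by simp

lemma Dmax_He1: "u \<in> Dmax \<Longrightarrow> u \<in> net_He 1 len"
proof -
 assume u: "u \<in> Dmax"
 obtain F F1 F2 F3 where r: "net_rep u F F1 F2 F3" using u Dmax_iff by blast
 have "u $ j \<in> Sobolev 1 (len j)" for j using H3_rep_D(3)[OF len net_rep_D(1)[OF r]] .
 moreover have "point_value (len j) (net_deriv len (i - 1) u $ j) (len j) = 0" if "i \<in> {1..1}" for i j
 proof -
  have "i \<in> {1..2}" using that by auto
  then show ?thesis using u unfolding Dmax_def net_He_def by blast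
 qed
 moreover have "point_value (len j) (u $ j) 0 = point_value (len k) (u $ k) 0" for j k
  using u unfolding Dmax_def net_He_def by blast
 ultimately show ?thesis unfolding net_He_def net_Sobolev_def by blast
qed

lemma node_square_bound:
 assumes u: "u \<in> net_He 1 len"
 shows "(node u)\<^sup>2 \<le> 2 * norm u * norm (ND u)"
proof -
 note U = He1_D[OF u]
 have a: "ND u $ e1 \<in> L2_on {0<..<len e1}" using U(1) by (auto simp: H1_derivs_def net_L2_def)
 have ue: "u $ e1 = L2_prim (len e1) (ND u $ e1)" using U(2) by (metis net_prim_def vec_lambda_beta)
 have "(node u)\<^sup>2 \<le> 2 * norm (u $ e1) * norm (ND u $ e1)"
  unfolding U(3) nodeval_def ue by (rule prim_square_bound[OF len a])
 also have "\<dots> \<le> 2 * norm u * norm (ND u)"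
  by (intro mult_mono Finite_Cartesian_Product.norm_nth_le) auto
 finally show ?thesis .
qed

lemma kdv_nonlinearity_eq:
 assumes u: "u \<in> net_He 1 len"
 shows "kdv_nonlinearity len u = - net_product (ND u) (ND u)"
proof -
 note U = He1_D[OF u]
 have "L2_of (\<lambda>x. - (fun_of_L2 (u $ j) x * fun_of_L2 (ND u $ j) x)) = - L2_product (len j) (ND u $ j) (ND u $ j)" for j
 proof -
  define d where "d = ND u $ j"
  define P where "P = (\<lambda>x. (-1) * (prim (len j) d x * fun_of_L2 d x))"
  have dL: "d \<in> L2_on {0<..<len j}" using U(1) by (auto simp: H1_derivs_def net_L2_def d_def)
  have l: "0 \<le> len j" using len[of j] by simp
  have s: "sqint (len j) (\<lambda>x. prim (len j) d x * fun_of_L2 d x)"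
   by (intro sqint_mult_continuous prim_continuous l sqint_fun_of_L2)
  have sP: "sqint (len j) P" unfolding P_def by (rule sqint_cmult[OF s])
  have uj: "u $ j = L2_restrict (len j) (prim (len j) d)" using U(2) by (metis net_prim_def vec_lambda_beta L2_prim_def d_def)
  have ae: "AE x in lebesgue. indicator {0<..<len j} x * P x = - (fun_of_L2 (u $ j) x * fun_of_L2 d x)"
   using fun_of_L2_restrict[OF prim_sqint[OF l, of d]] unfolding uj
   by eventually_elim (simp add: P_def indicator_def)
  have [measurable]: "fun_of_L2 a \<in> borel_measurable lebesgue" for a
   using fun_of_L2_square_integrable[of a] by (simp add: square_integrable_UNIV_iff)
  have "(\<lambda>x. - (fun_of_L2 (u $ j) x * fun_of_L2 d x)) square_integrable_on UNIV \<and>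
    L2_class (\<lambda>x. indicator {0<..<len j} x * P x) = L2_class (\<lambda>x. - (fun_of_L2 (u $ j) x * fun_of_L2 d x))"
   using sP ae by (intro L2_class_cong) (auto simp: sqint_def)
  then have "L2_of (\<lambda>x. - (fun_of_L2 (u $ j) x * fun_of_L2 d x)) = L2_restrict (len j) P"
   by (simp add: L2_of_def L2_restrict_class sP)
  also have "\<dots> = (-1) *\<^sub>R L2_product (len j) d d"
   unfolding P_def L2_product_def L2_mult_def by (rule L2_restrict_scale[OF s, symmetric])
  finally show ?thesis by (simp add: d_def)
 qed
 then show ?thesis by (simp add: kdv_nonlinearity_def net_product_def vec_eq_iff)
qed

lemma net_H1_norm_square: "(net_H1_norm len u)\<^sup>2 = (norm u)\<^sup>2 + (norm (ND u))\<^sup>2"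
proof -
 have "0 \<le> (\<Sum>j\<in>UNIV. (norm (u $ j))\<^sup>2 + (norm (ND u $ j))\<^sup>2)" by (intro sum_nonneg) auto
 then show ?thesis unfolding net_H1_norm_def norm_vec_power2 sum.distrib[symmetric] by (rule real_sqrt_pow2)
qed

end


section \<open>Square integrable functions of time\<close>

declare One_nat_def [simp del]

abbreviation time :: "real \<Rightarrow> real measure" where "time T \<equiv> lebesgue_on {0<..<T}"

lemma finite_measure_time: "finite_measure (time T)"
 by (rule finite_measureI, cases "0 \<le> T") (auto simp: emeasure_restrict_space)

lemma measure_time: "0 \<le> T \<Longrightarrow> measure (time T) {0<..<T} = T"
 by (simp add: measure_restrict_space)

text \<open>
 Completeness of the measure makes subsets of null sets measurable, whatever the target space.
\<close>

lemma borel_measurable_lebesgue_on_AE_cong: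
 assumes S: "S \<in> sets lebesgue" and f: "f \<in> measurable (lebesgue_on S) N" and eq: "AE t in lebesgue_on S. f t = g t" and g: "\<And>t. g t \<in> space N"
 shows "g \<in> measurable (lebesgue_on S) N"
proof (rule measurableI)
 obtain Z where Z: "{t \<in> space (lebesgue_on S). f t \<noteq> g t} \<subseteq> Z" "Z \<in> null_sets (lebesgue_on S)"
  using eq unfolding eventually_ae_filter by blast
 have null: "B \<in> sets (lebesgue_on S)" if "B \<subseteq> Z" for B
 proof -
  have "Z \<in> null_sets lebesgue" "Z \<subseteq> S" using Z(2) S by (auto simp: null_sets_restrict_space)
  then have "B \<in> null_sets lebesgue" "B \<subseteq> S" using that null_sets_completion_subset by blast+
  then show ?thesis using S by (auto simp: sets_restrict_space_iff)
 qed
 fix A assume A: "A \<in> sets N"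
 have fA: "f -` A \<inter> space (lebesgue_on S) \<in> sets (lebesgue_on S)" using f A by (rule measurable_sets)
 have eq': "g -` A \<inter> space (lebesgue_on S) = (f -` A \<inter> space (lebesgue_on S) - Z) \<union> (g -` A \<inter> space (lebesgue_on S) \<inter> Z)"
  using Z(1) by auto
 show "g -` A \<inter> space (lebesgue_on S) \<in> sets (lebesgue_on S)"
  by (subst eq') (intro sets.Un sets.Diff null fA; blast)
qed (rule g)

lemma borel_measurable_time_AE_cong:
 assumes "f \<in> measurable (time T) N" "AE t in time T. f t = g t" "\<And>t. g t \<in> space N"
 shows "g \<in> measurable (time T) N"
 by (rule borel_measurable_lebesgue_on_AE_cong[OF _ assms]) simp

lemma borel_measurable_time_continuous:
 fixes f :: "real \<Rightarrow> 'b::real_normed_vector"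
 assumes "continuous_on {0..T} f"
 shows "f \<in> borel_measurable (time T)"
proof -
 have "(\<lambda>x. indicator {0..T} x *\<^sub>R f x) \<in> borel_measurable borel"
  using assms by (intro borel_measurable_continuous_on_indicator) auto
 then have "(\<lambda>x. indicator {0..T} x *\<^sub>R f x) \<in> borel_measurable lebesgue"
  by (intro measurable_completion) simp
 then have "(\<lambda>x. indicator {0..T} x *\<^sub>R f x) \<in> borel_measurable (time T)"
  by (rule measurable_restrict_space1)
 then show ?thesis by (rule measurable_cong[THEN iffD1, rotated]) auto
qed

lemma integrable_time_bounded:
 fixes f :: "real \<Rightarrow> 'b::{banach, second_countable_topology}"
 assumes "f \<in> borel_measurable (time T)" "\<And>t. t \<in> {0<..<T} \<Longrightarrow> norm (f t) \<le> B"
 shows "integrable (time T) f"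
proof -
 interpret finite_measure "time T" by (rule finite_measure_time)
 show ?thesis using assms by (intro integrable_const_bound[where B = B]) auto
qed

lemma integrable_time_continuous:
 fixes f :: "real \<Rightarrow> 'b::{banach, second_countable_topology}"
 assumes f: "continuous_on {0..T} f"
 shows "integrable (time T) f"
proof -
 have "bounded (f ` {0..T})" using f by (intro compact_imp_bounded compact_continuous_image) auto
 then obtain B where "\<forall>y\<in>f ` {0..T}. norm y \<le> B" unfolding bounded_iff by blast
 then show ?thesis by (intro integrable_time_bounded[where B = B] borel_measurable_time_continuous f) auto
qed

lemma LINT_time_continuous:
 fixes f :: "real \<Rightarrow> real"
 assumes f: "continuous_on {0..T} f"
 shows "(LINT t|time T. f t) = integral {0..T} f"
proof -
 have "(LINT t|time T. f t) = (LINT t:{0<..<T}|lebesgue. f t)"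
  by (simp add: integral_restrict_space set_lebesgue_integral_def)
 then show ?thesis using LINT_open_interval[OF absolutely_integrable_continuous_real[OF f]] by simp
qed

definition sqint_time :: "real \<Rightarrow> (real \<Rightarrow> 'b::real_normed_vector) \<Rightarrow> bool" where
 "sqint_time T q \<longleftrightarrow> q \<in> borel_measurable (time T) \<and> integrable (time T) (\<lambda>t. (norm (q t))\<^sup>2)"

definition N2 :: "real \<Rightarrow> (real \<Rightarrow> 'b::real_normed_vector) \<Rightarrow> real" where
 "N2 T q = sqrt (LINT t|time T. (norm (q t))\<^sup>2)"

lemma N2_nonneg: "0 \<le> N2 T q"
 by (simp add: N2_def)

lemma N2_square: "(N2 T q)\<^sup>2 = (LINT t|time T. (norm (q t))\<^sup>2)"
 by (simp add: N2_def)

lemma N2_cong_AE: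
 assumes "AE t in time T. q t = r t" "q \<in> borel_measurable (time T)" "r \<in> borel_measurable (time T)"
 shows "N2 T q = N2 T r"
proof -
 have "(LINT t|time T. (norm (q t))\<^sup>2) = (LINT t|time T. (norm (r t))\<^sup>2)"
  using assms by (intro integral_cong_AE) auto
 then show ?thesis by (simp add: N2_def)
qed

lemma sqint_time_cong_AE:
 assumes eq: "AE t in time T. q t = r t" and q: "sqint_time T q"
 shows "sqint_time T r" "N2 T r = N2 T q"
proof -
 have m: "r \<in> borel_measurable (time T)"
  using q eq by (intro borel_measurable_time_AE_cong[of q T borel r]) (auto simp: sqint_time_def)
 have qm: "q \<in> borel_measurable (time T)" using q by (simp add: sqint_time_def)
 show "N2 T r = N2 T q" by (rule N2_cong_AE[OF eq qm m, symmetric])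
 have "integrable (time T) (\<lambda>t. (norm (r t))\<^sup>2) \<longleftrightarrow> integrable (time T) (\<lambda>t. (norm (q t))\<^sup>2)"
  using eq m qm by (intro integrable_cong_AE) auto
 then show "sqint_time T r" using q m by (simp add: sqint_time_def)
qed

lemma sqint_time_mult:
 fixes q :: "real \<Rightarrow> 'b::{second_countable_topology, real_normed_vector}" and r :: "real \<Rightarrow> 'c::{second_countable_topology, real_normed_vector}"
 assumes q: "sqint_time T q" and r: "sqint_time T r"
 shows "integrable (time T) (\<lambda>t. norm (q t) * norm (r t))"
  "(LINT t|time T. norm (q t) * norm (r t)) \<le> N2 T q * N2 T r"
proof -
 have m[measurable]: "q \<in> borel_measurable (time T)" "r \<in> borel_measurable (time T)"
  and i: "integrable (time T) (\<lambda>t. (norm (q t))\<^sup>2)" "integrable (time T) (\<lambda>t. (norm (r t))\<^sup>2)"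
  using q r by (auto simp: sqint_time_def)
 have young: "2 * (a * b) \<le> s * a\<^sup>2 + b\<^sup>2 / s" if "0 < s" for s a b :: real
 proof -
  have "0 \<le> (s * a - b)\<^sup>2 / s" using that by simp
  also have "\<dots> = s * a\<^sup>2 + b\<^sup>2 / s - 2 * (a * b)" using that by (simp add: power2_eq_square field_simps)
  finally show ?thesis by simp
 qed
 show int: "integrable (time T) (\<lambda>t. norm (q t) * norm (r t))"
 proof (rule Bochner_Integration.integrable_bound)
  show "integrable (time T) (\<lambda>t. (norm (q t))\<^sup>2 + (norm (r t))\<^sup>2)" using i by simp
  have "norm (q t) * norm (r t) \<le> (norm (q t))\<^sup>2 + (norm (r t))\<^sup>2" for t
  proof -
   have "0 \<le> norm (q t) * norm (r t)" by simp
   then show ?thesis using young[of 1 "norm (q t)" "norm (r t)"] unfolding mult_1 div_by_1 by linarith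
  qed
  then show "AE t in time T. norm (norm (q t) * norm (r t)) \<le> norm ((norm (q t))\<^sup>2 + (norm (r t))\<^sup>2)"
   by (simp add: abs_mult)
 qed measurable
 define I where "I = (LINT t|time T. norm (q t) * norm (r t))"
 have I: "2 * I \<le> s * (N2 T q)\<^sup>2 + (N2 T r)\<^sup>2 / s" if s: "0 < s" for s
 proof -
  have "2 * I = (LINT t|time T. 2 * (norm (q t) * norm (r t)))" unfolding I_def by simp
  also have "\<dots> \<le> (LINT t|time T. s * (norm (q t))\<^sup>2 + (norm (r t))\<^sup>2 / s)"
   using int i young[OF s] by (intro integral_mono) auto
  also have "\<dots> = s * (N2 T q)\<^sup>2 + (N2 T r)\<^sup>2 / s" using i by (simp add: N2_square)
  finally show ?thesis .
 qed
 show "(LINT t|time T. norm (q t) * norm (r t)) \<le> N2 T q * N2 T r"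
  unfolding I_def[symmetric]
 proof (rule field_le_epsilon)
  fix e :: real assume e: "0 < e"
  define a b where "a = N2 T q" and "b = N2 T r"
  have ab: "0 \<le> a" "0 \<le> b" by (auto simp: a_def b_def N2_nonneg)
  define d where "d = min 1 (e / (a + b + 1))"
  have d: "0 < d" "d \<le> 1" using e ab by (auto simp: d_def)
  have "d * (a + b + 1) \<le> e / (a + b + 1) * (a + b + 1)" using ab by (intro mult_right_mono) (auto simp: d_def)
  then have "d * (a + b + 1) \<le> e" using ab by simp
  note d = d this
  have "2 * I \<le> ((b + d) / (a + d)) * a\<^sup>2 + b\<^sup>2 / ((b + d) / (a + d))"
   using I[of "(b + d) / (a + d)"] ab d by (simp add: a_def b_def)
  also have "\<dots> \<le> (b + d) * (a + d) + (b + d) * (a + d)"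
  proof (rule add_mono)
   have "(b + d) / (a + d) * a\<^sup>2 \<le> (b + d) / (a + d) * (a + d)\<^sup>2"
    using ab d by (intro mult_left_mono power_mono) auto
   then show "(b + d) / (a + d) * a\<^sup>2 \<le> (b + d) * (a + d)" using ab d by (simp add: power2_eq_square)
   have "b\<^sup>2 / ((b + d) / (a + d)) \<le> (b + d)\<^sup>2 / ((b + d) / (a + d))"
    using ab d by (intro divide_right_mono power_mono) auto
   then show "b\<^sup>2 / ((b + d) / (a + d)) \<le> (b + d) * (a + d)" using ab d by (simp add: power2_eq_square)
  qed
  finally have "I \<le> (b + d) * (a + d)" by (simp add: mult.commute)
  also have "\<dots> = a * b + d * (a + b + d)" by (simp add: algebra_simps)
  also have "d * (a + b + d) \<le> d * (a + b + 1)" using d by (intro mult_left_mono) auto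
  finally show "I \<le> N2 T q * N2 T r + e" using d(3) unfolding a_def b_def by linarith
 qed
qed

lemma sqint_time_L1:
 fixes q :: "real \<Rightarrow> 'b::{banach, second_countable_topology}"
 assumes q: "sqint_time T q" and T: "0 \<le> T"
 shows "integrable (time T) q" "(LINT t|time T. norm (q t)) \<le> sqrt T * N2 T q"
proof -
 have one: "sqint_time T (\<lambda>t. 1::real)"
  by (simp add: sqint_time_def) (rule integrable_time_continuous, intro continuous_intros)
 have "N2 T (\<lambda>t. 1::real) = sqrt T" using measure_time[OF T] by (simp add: N2_def)
 then show "(LINT t|time T. norm (q t)) \<le> sqrt T * N2 T q"
  using sqint_time_mult(2)[OF q one] by (simp add: mult.commute)
 have "integrable (time T) (\<lambda>t. norm (q t))" using sqint_time_mult(1)[OF q one] by simp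
 then show "integrable (time T) q"
  using q by (subst (asm) integrable_norm_iff) (auto simp: sqint_time_def)
qed

lemma sqint_time_add:
 fixes q r :: "real \<Rightarrow> 'b::{second_countable_topology, real_normed_vector}"
 assumes q: "sqint_time T q" and r: "sqint_time T r"
 shows "sqint_time T (\<lambda>t. q t + r t)" "N2 T (\<lambda>t. q t + r t) \<le> N2 T q + N2 T r"
proof -
 have m[measurable]: "q \<in> borel_measurable (time T)" "r \<in> borel_measurable (time T)"
  and i: "integrable (time T) (\<lambda>t. (norm (q t))\<^sup>2)" "integrable (time T) (\<lambda>t. (norm (r t))\<^sup>2)"
  using q r by (auto simp: sqint_time_def)
 have le: "(norm (q t + r t))\<^sup>2 \<le> (norm (q t))\<^sup>2 + (norm (r t))\<^sup>2 + 2 * (norm (q t) * norm (r t))" for t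
 proof -
  have "(norm (q t + r t))\<^sup>2 \<le> (norm (q t) + norm (r t))\<^sup>2" by (intro power_mono norm_triangle_ineq) auto
  then show ?thesis by (simp add: power2_sum mult.assoc)
 qed
 have j: "integrable (time T) (\<lambda>t. (norm (q t))\<^sup>2 + (norm (r t))\<^sup>2 + 2 * (norm (q t) * norm (r t)))"
  using i sqint_time_mult(1)[OF q r] by simp
 have k: "integrable (time T) (\<lambda>t. (norm (q t + r t))\<^sup>2)"
  by (rule Bochner_Integration.integrable_bound[OF j]) (use le in \<open>auto simp: abs_mult intro: order_trans\<close>)
 then show "sqint_time T (\<lambda>t. q t + r t)" by (simp add: sqint_time_def)
 have "(N2 T (\<lambda>t. q t + r t))\<^sup>2 \<le> (LINT t|time T. (norm (q t))\<^sup>2 + (norm (r t))\<^sup>2 + 2 * (norm (q t) * norm (r t)))"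
  unfolding N2_square by (rule integral_mono[OF k j le])
 also have "\<dots> = (N2 T q)\<^sup>2 + (N2 T r)\<^sup>2 + 2 * (LINT t|time T. norm (q t) * norm (r t))"
  using i sqint_time_mult(1)[OF q r] by (simp add: N2_square)
 also have "\<dots> \<le> (N2 T q + N2 T r)\<^sup>2" using sqint_time_mult(2)[OF q r] by (simp add: power2_sum)
 finally show "N2 T (\<lambda>t. q t + r t) \<le> N2 T q + N2 T r"
  by (rule power2_le_imp_le) (simp add: N2_nonneg)
qed

lemma sqint_time_scale:
 fixes q :: "real \<Rightarrow> 'b::{second_countable_topology, real_normed_vector}"
 assumes q: "sqint_time T q"
 shows "sqint_time T (\<lambda>t. c *\<^sub>R q t)" "N2 T (\<lambda>t. c *\<^sub>R q t) = \<bar>c\<bar> * N2 T q"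
proof -
 show "sqint_time T (\<lambda>t. c *\<^sub>R q t)" using q by (auto simp: sqint_time_def power_mult_distrib)
 show "N2 T (\<lambda>t. c *\<^sub>R q t) = \<bar>c\<bar> * N2 T q" by (simp add: N2_def power_mult_distrib real_sqrt_mult)
qed

lemma sqint_time_diff:
 fixes q r :: "real \<Rightarrow> 'b::{second_countable_topology, real_normed_vector}"
 assumes q: "sqint_time T q" and r: "sqint_time T r"
 shows "sqint_time T (\<lambda>t. q t - r t)" "N2 T (\<lambda>t. q t - r t) \<le> N2 T q + N2 T r"
 using sqint_time_add[OF q sqint_time_scale(1)[OF r, of "-1"]] sqint_time_scale(2)[OF r, of "-1"] by auto

lemma N2_minus_commute: "N2 T (\<lambda>t. q t - r t) = N2 T (\<lambda>t. r t - q t)"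
 by (simp add: N2_def norm_minus_commute)

lemma N2_triangle:
 fixes q r :: "real \<Rightarrow> 'b::{second_countable_topology, real_normed_vector}"
 assumes "sqint_time T q" "sqint_time T r"
 shows "N2 T q \<le> N2 T r + N2 T (\<lambda>t. q t - r t)"
 using sqint_time_add(2)[OF assms(2) sqint_time_diff(1)[OF assms]] by simp

lemma sqint_time_continuous:
 fixes q :: "real \<Rightarrow> 'b::{second_countable_topology, real_normed_vector}"
 assumes "continuous_on {0..T} q"
 shows "sqint_time T q"
 unfolding sqint_time_def
 using borel_measurable_time_continuous[OF assms] integrable_time_continuous[OF continuous_on_power[OF continuous_on_norm[OF assms]], of 2]
 by simp

text \<open>
 A subsequence converges almost everywhere, and the lemma of Fatou bounds the distance to the limit.
 The subsequence is kept in the statement to identify the limit of derivatives pointwise in time.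
\<close>

theorem sqint_time_complete:
 fixes q :: "nat \<Rightarrow> real \<Rightarrow> 'b::{banach, second_countable_topology}"
 assumes T: "0 \<le> T" and q: "\<And>n. sqint_time T (q n)"
  and Cauchy: "\<And>e. 0 < e \<Longrightarrow> \<exists>N. \<forall>m\<ge>N. \<forall>n\<ge>N. N2 T (\<lambda>t. q m t - q n t) \<le> e"
 shows "\<exists>r D. strict_mono (r :: nat \<Rightarrow> nat) \<and> sqint_time T D \<and> (AE t in time T. (\<lambda>i. q (r i) t) \<longlonglongrightarrow> D t) \<and>
  (\<lambda>n. N2 T (\<lambda>t. q n t - D t)) \<longlonglongrightarrow> 0"
proof -
 have [measurable]: "q n \<in> borel_measurable (time T)" for n using q[of n] by (simp add: sqint_time_def)
 have L1: "\<exists>N. \<forall>i\<ge>N. \<forall>j\<ge>N. (LINT t|time T. norm (q i t - q j t)) < e" if "0 < e" for e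
 proof -
  have "0 < e / (sqrt T + 1)" using that T by (simp add: add_nonneg_pos)
  then obtain N where N: "\<And>m n. m \<ge> N \<Longrightarrow> n \<ge> N \<Longrightarrow> N2 T (\<lambda>t. q m t - q n t) \<le> e / (sqrt T + 1)" using Cauchy by blast
  have "(LINT t|time T. norm (q i t - q j t)) < e" if "i \<ge> N" "j \<ge> N" for i j
  proof -
   have "(LINT t|time T. norm (q i t - q j t)) \<le> sqrt T * N2 T (\<lambda>t. q i t - q j t)"
    by (rule sqint_time_L1(2)[OF sqint_time_diff(1)[OF q q] T])
   also have "\<dots> \<le> sqrt T * (e / (sqrt T + 1))" using N[OF that] T by (intro mult_left_mono) auto
   also have "\<dots> < (sqrt T + 1) * (e / (sqrt T + 1))" using \<open>0 < e / (sqrt T + 1)\<close> by (intro mult_strict_right_mono) auto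
   also have "\<dots> = e" using T by (simp add: add_nonneg_eq_0_iff)
   finally show ?thesis .
  qed
  then show ?thesis by blast
 qed
 obtain r where r: "strict_mono r" and ae: "AE t in time T. Cauchy (\<lambda>i. q (r i) t)"
  by (rule cauchy_L1_AE_cauchy_subseq[of "time T" q]) (use L1 sqint_time_L1(1)[OF q T] in auto)
 define D where "D t = lim (\<lambda>i. q (r i) t)" for t
 have Dm[measurable]: "D \<in> borel_measurable (time T)" unfolding D_def by measurable
 have lim: "AE t in time T. (\<lambda>i. q (r i) t) \<longlonglongrightarrow> D t"
  using ae by eventually_elim (simp add: D_def Cauchy_convergent_iff convergent_LIMSEQ_iff)
 have close: "sqint_time T (\<lambda>t. q n t - D t) \<and> N2 T (\<lambda>t. q n t - D t) \<le> e"
  if N: "\<And>m n. m \<ge> N \<Longrightarrow> n \<ge> N \<Longrightarrow> N2 T (\<lambda>t. q m t - q n t) \<le> e" and n: "n \<ge> N" and e: "0 < e" for N n e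
 proof -
  have "(\<integral>\<^sup>+ t. ennreal ((norm (q n t - D t))\<^sup>2) \<partial>time T)
    = (\<integral>\<^sup>+ t. liminf (\<lambda>i. ennreal ((norm (q n t - q (r i) t))\<^sup>2)) \<partial>time T)"
  proof (rule nn_integral_cong_AE)
   show "AE t in time T. ennreal ((norm (q n t - D t))\<^sup>2) = liminf (\<lambda>i. ennreal ((norm (q n t - q (r i) t))\<^sup>2))"
    using lim
   proof eventually_elim
    case (elim t)
    then have "(\<lambda>i. ennreal ((norm (q n t - q (r i) t))\<^sup>2)) \<longlonglongrightarrow> ennreal ((norm (q n t - D t))\<^sup>2)"
     by (intro tendsto_ennrealI tendsto_power tendsto_norm tendsto_diff tendsto_const)
    from lim_imp_Liminf[OF sequentially_bot this] show ?case by (rule sym)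
   qed
  qed
  also have "\<dots> \<le> liminf (\<lambda>i. \<integral>\<^sup>+ t. ennreal ((norm (q n t - q (r i) t))\<^sup>2) \<partial>time T)"
   by (rule nn_integral_liminf) measurable
  also have "\<dots> \<le> ennreal (e\<^sup>2)"
  proof -
   have "\<forall>\<^sub>F i in sequentially. (\<integral>\<^sup>+ t. ennreal ((norm (q n t - q (r i) t))\<^sup>2) \<partial>time T) \<le> ennreal (e\<^sup>2)"
    using eventually_ge_at_top[of N]
   proof eventually_elim
    case (elim i)
    have ri: "r i \<ge> N" using seq_suble[OF r, of i] elim by linarith
    have "(\<integral>\<^sup>+ t. ennreal ((norm (q n t - q (r i) t))\<^sup>2) \<partial>time T) = ennreal ((N2 T (\<lambda>t. q n t - q (r i) t))\<^sup>2)"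
     unfolding N2_square using sqint_time_diff(1)[OF q q, of n "r i"]
     by (intro nn_integral_eq_integral) (auto simp: sqint_time_def)
    also have "\<dots> \<le> ennreal (e\<^sup>2)" using N[OF n ri] by (intro ennreal_leI power_mono N2_nonneg)
    finally show ?case .
   qed
   then show ?thesis by (rule order_trans[OF Liminf_le_Limsup[OF sequentially_bot] Limsup_bounded])
  qed
  finally have le: "(\<integral>\<^sup>+ t. ennreal ((norm (q n t - D t))\<^sup>2) \<partial>time T) \<le> ennreal (e\<^sup>2)" .
  then have "(\<integral>\<^sup>+ t. ennreal (norm ((norm (q n t - D t))\<^sup>2)) \<partial>time T) < \<infinity>"
   by (simp add: le_less_trans)
  then have i: "integrable (time T) (\<lambda>t. (norm (q n t - D t))\<^sup>2)"
   by (intro integrableI_bounded) auto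
  have "ennreal ((N2 T (\<lambda>t. q n t - D t))\<^sup>2) \<le> ennreal (e\<^sup>2)"
   using le i unfolding N2_square by (subst (asm) nn_integral_eq_integral) auto
  then have "(N2 T (\<lambda>t. q n t - D t))\<^sup>2 \<le> e\<^sup>2" by simp
  then have "N2 T (\<lambda>t. q n t - D t) \<le> e" by (rule power2_le_imp_le) (use e in simp)
  then show ?thesis using i by (simp add: sqint_time_def)
 qed
 obtain N1 where N1: "\<And>m n. m \<ge> N1 \<Longrightarrow> n \<ge> N1 \<Longrightarrow> N2 T (\<lambda>t. q m t - q n t) \<le> 1" using Cauchy[of 1] by auto
 have "sqint_time T (\<lambda>t. q N1 t - D t)" using close[of N1 1 N1] N1 by auto
 then have "sqint_time T D" using sqint_time_diff(1)[OF q[of N1]] by fastforce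
 moreover have "(\<lambda>n. N2 T (\<lambda>t. q n t - D t)) \<longlonglongrightarrow> 0"
 proof (rule LIMSEQ_I)
  fix e :: real assume e: "0 < e"
  then obtain N where N: "\<And>m n. m \<ge> N \<Longrightarrow> n \<ge> N \<Longrightarrow> N2 T (\<lambda>t. q m t - q n t) \<le> e / 2" using Cauchy[of "e/2"] by auto
  have "norm (N2 T (\<lambda>t. q n t - D t) - 0) < e" if "n \<ge> N" for n
   using close[of N "e/2" n] N that e N2_nonneg[of T "\<lambda>t. q n t - D t"] by auto
  then show "\<exists>N. \<forall>n\<ge>N. norm (N2 T (\<lambda>t. q n t - D t) - 0) < e" by blast
 qed
 ultimately show ?thesis using r lim by blast
qed

section \<open>The energy space\<close>

context kdv_network
begin

abbreviation spaceB :: "real \<Rightarrow> (real \<Rightarrow> L2 ^ 'n) set" where "spaceB T \<equiv> energy_space T len"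

abbreviation normB :: "real \<Rightarrow> (real \<Rightarrow> L2 ^ 'n) \<Rightarrow> real" where "normB T \<equiv> energy_norm T len"

lemma energy_space_D:
 assumes "u \<in> spaceB T"
 shows "t \<in> {0..T} \<Longrightarrow> u t \<in> net_L2 len" "continuous_on {0..T} u" "AE t in time T. u t \<in> net_He 1 len"
  "sqint_time T (\<lambda>t. ND (u t))"
proof -
 show "t \<in> {0..T} \<Longrightarrow> u t \<in> net_L2 len" "continuous_on {0..T} u" "AE t in time T. u t \<in> net_He 1 len"
  using assms by (auto simp: energy_space_def)
 have m[measurable]: "(\<lambda>t. ND (u t)) \<in> borel_measurable (time T)" "u \<in> borel_measurable (time T)"
  and i: "integrable (time T) (\<lambda>t. (norm (u t))\<^sup>2 + (norm (ND (u t)))\<^sup>2)"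
  using assms by (auto simp: energy_space_def net_H1_norm_square)
 have "integrable (time T) (\<lambda>t. (norm (ND (u t)))\<^sup>2)"
  by (rule Bochner_Integration.integrable_bound[OF i]) auto
 then show "sqint_time T (\<lambda>t. ND (u t))" using m by (simp add: sqint_time_def)
qed

text \<open>
 Membership is checked on a candidate \<open>D\<close> for the spatial derivative, which may be known almost
 everywhere only.
\<close>

lemma energy_space_I:
 assumes u: "continuous_on {0..T} u" "\<And>t. t \<in> {0..T} \<Longrightarrow> u t \<in> net_L2 len" and D: "sqint_time T D"
  and ae: "AE t in time T. D t \<in> H1_derivs \<and> u t = net_prim (D t)"
 shows "u \<in> spaceB T" "AE t in time T. ND (u t) = D t"
proof -
 show eq: "AE t in time T. ND (u t) = D t" using ae by eventually_elim (auto simp: He1_I)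
 have "AE t in time T. D t = ND (u t)" using eq by eventually_elim simp
 note ND = sqint_time_cong_AE(1)[OF this D]
 have "sqint_time T u" by (rule sqint_time_continuous[OF u(1)])
 moreover have "AE t in time T. u t \<in> net_He 1 len" using ae by eventually_elim (auto simp: He1_I)
 ultimately show "u \<in> spaceB T"
  using u ND by (auto simp: energy_space_def sqint_time_def net_H1_norm_square)
qed

lemma energy_norm_ge:
 assumes u: "u \<in> spaceB T" and T: "0 < T"
 shows "t \<in> {0..T} \<Longrightarrow> norm (u t) \<le> normB T u" "N2 T (\<lambda>t. ND (u t)) \<le> normB T u"
proof -
 note U = energy_space_D[OF u]
 have us: "sqint_time T u" by (rule sqint_time_continuous[OF U(2)])
 have "bounded ((\<lambda>t. norm (u t)) ` {0..T})"
  using U(2) by (intro compact_imp_bounded compact_continuous_image continuous_intros) auto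
 then have bdd: "bdd_above ((\<lambda>t. norm (u t)) ` {0..T})" by (rule bounded_imp_bdd_above)
 have s: "norm (u t) \<le> (SUP t\<in>{0..T}. norm (u t))" if "t \<in> {0..T}" for t by (rule cSUP_upper[OF that bdd])
 have s0: "0 \<le> (SUP t\<in>{0..T}. norm (u t))" using order_trans[OF norm_ge_zero s[of 0]] T by simp
 have i: "(LINT t|time T. (net_H1_norm len (u t))\<^sup>2) = (N2 T u)\<^sup>2 + (N2 T (\<lambda>t. ND (u t)))\<^sup>2"
  using us U(4) by (simp add: net_H1_norm_square N2_square sqint_time_def)
 have "N2 T (\<lambda>t. ND (u t)) \<le> sqrt ((N2 T u)\<^sup>2 + (N2 T (\<lambda>t. ND (u t)))\<^sup>2)"
  by (rule real_le_rsqrt) simp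
 then show "N2 T (\<lambda>t. ND (u t)) \<le> normB T u" using s0 unfolding energy_norm_def i by linarith
 have "0 \<le> sqrt ((N2 T u)\<^sup>2 + (N2 T (\<lambda>t. ND (u t)))\<^sup>2)" by simp
 then show "norm (u t) \<le> normB T u" if "t \<in> {0..T}" using s[OF that] unfolding energy_norm_def i by linarith
qed

lemma energy_norm_le:
 assumes u: "u \<in> spaceB T" and T: "0 < T"
  and a: "\<And>t. t \<in> {0..T} \<Longrightarrow> norm (u t) \<le> a" and b: "N2 T (\<lambda>t. ND (u t)) \<le> b"
 shows "normB T u \<le> (1 + sqrt T) * a + b"
proof -
 note U = energy_space_D[OF u]
 have us: "sqint_time T u" by (rule sqint_time_continuous[OF U(2)])
 have a0: "0 \<le> a" using order_trans[OF norm_ge_zero a[of 0]] T by simp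
 have i: "(LINT t|time T. (net_H1_norm len (u t))\<^sup>2) = (N2 T u)\<^sup>2 + (N2 T (\<lambda>t. ND (u t)))\<^sup>2"
  using us U(4) by (simp add: net_H1_norm_square N2_square sqint_time_def)
 have "(N2 T u)\<^sup>2 \<le> (LINT t|time T. a\<^sup>2)"
  unfolding N2_square using us a
  by (intro integral_mono) (auto simp: sqint_time_def intro!: power_mono integrable_time_continuous continuous_intros)
 also have "\<dots> = (sqrt T * a)\<^sup>2" using measure_time[of T] T by (simp add: power_mult_distrib)
 finally have Nu: "N2 T u \<le> sqrt T * a" by (rule power2_le_imp_le) (use a0 T in simp)
 have "sqrt ((N2 T u)\<^sup>2 + (N2 T (\<lambda>t. ND (u t)))\<^sup>2) \<le> N2 T u + N2 T (\<lambda>t. ND (u t))"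
  by (rule real_le_lsqrt) (auto simp: N2_nonneg power2_sum)
 also have "\<dots> \<le> sqrt T * a + b" using Nu b by linarith
 finally have "sqrt ((N2 T u)\<^sup>2 + (N2 T (\<lambda>t. ND (u t)))\<^sup>2) \<le> sqrt T * a + b" .
 moreover have "(SUP t\<in>{0..T}. norm (u t)) \<le> a" using T a by (intro cSUP_least) auto
 ultimately show ?thesis by (simp add: energy_norm_def i algebra_simps)
qed

lemma energy_space_lincomb:
 assumes u: "u \<in> spaceB T" and v: "v \<in> spaceB T"
 shows "(\<lambda>t. a *\<^sub>R u t + b *\<^sub>R v t) \<in> spaceB T"
  "AE t in time T. ND (a *\<^sub>R u t + b *\<^sub>R v t) = a *\<^sub>R ND (u t) + b *\<^sub>R ND (v t)"
proof -
 note U = energy_space_D[OF u] and V = energy_space_D[OF v]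
 interpret bounded_linear net_prim by (rule bounded_linear_net_prim)
 have c: "continuous_on {0..T} (\<lambda>t. a *\<^sub>R u t + b *\<^sub>R v t)" using U(2) V(2) by (intro continuous_intros)
 have L: "a *\<^sub>R u t + b *\<^sub>R v t \<in> net_L2 len" if "t \<in> {0..T}" for t
  using U(1)[OF that] V(1)[OF that] subspace_net_L2 by (simp add: subspace_add subspace_scale)
 have D: "sqint_time T (\<lambda>t. a *\<^sub>R ND (u t) + b *\<^sub>R ND (v t))"
  by (intro sqint_time_add sqint_time_scale U V)
 have ae: "AE t in time T. a *\<^sub>R ND (u t) + b *\<^sub>R ND (v t) \<in> H1_derivs \<and>
   a *\<^sub>R u t + b *\<^sub>R v t = net_prim (a *\<^sub>R ND (u t) + b *\<^sub>R ND (v t))"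
  using U(3) V(3)
 proof eventually_elim
  case (elim t)
  then have "a *\<^sub>R u t + b *\<^sub>R v t \<in> net_He 1 len" "ND (a *\<^sub>R u t + b *\<^sub>R v t) = a *\<^sub>R ND (u t) + b *\<^sub>R ND (v t)"
   by (rule He1_lincomb)+
  then show ?case using He1_D(1,2)[of "a *\<^sub>R u t + b *\<^sub>R v t"] by simp
 qed
 show "(\<lambda>t. a *\<^sub>R u t + b *\<^sub>R v t) \<in> spaceB T"
  "AE t in time T. ND (a *\<^sub>R u t + b *\<^sub>R v t) = a *\<^sub>R ND (u t) + b *\<^sub>R ND (v t)"
  by (rule energy_space_I[OF c L D ae]; simp)+
qed

lemma energy_space_diff:
 assumes u: "u \<in> spaceB T" and v: "v \<in> spaceB T"
 shows "(\<lambda>t. u t - v t) \<in> spaceB T" "N2 T (\<lambda>t. ND (u t - v t)) = N2 T (\<lambda>t. ND (u t) - ND (v t))"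
proof -
 show w: "(\<lambda>t. u t - v t) \<in> spaceB T" using energy_space_lincomb(1)[OF u v, of 1 "-1"] by simp
 have "AE t in time T. ND (u t - v t) = ND (u t) - ND (v t)"
  using energy_space_lincomb(2)[OF u v, of 1 "-1"] by simp
 moreover have "sqint_time T (\<lambda>t. ND (u t) - ND (v t))" by (intro sqint_time_diff energy_space_D(4)[OF u] energy_space_D(4)[OF v])
 ultimately show "N2 T (\<lambda>t. ND (u t - v t)) = N2 T (\<lambda>t. ND (u t) - ND (v t))"
  using energy_space_D(4)[OF w] by (intro N2_cong_AE) (auto simp: sqint_time_def)
qed

lemma energy_space_add:
 assumes u: "u \<in> spaceB T" and v: "v \<in> spaceB T"
 shows "(\<lambda>t. u t + v t) \<in> spaceB T" "N2 T (\<lambda>t. ND (u t + v t)) \<le> N2 T (\<lambda>t. ND (u t)) + N2 T (\<lambda>t. ND (v t))"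
proof -
 show w: "(\<lambda>t. u t + v t) \<in> spaceB T" using energy_space_lincomb(1)[OF u v, of 1 1] by simp
 have "AE t in time T. ND (u t + v t) = ND (u t) + ND (v t)"
  using energy_space_lincomb(2)[OF u v, of 1 1] by simp
 moreover note s = sqint_time_add[OF energy_space_D(4)[OF u] energy_space_D(4)[OF v]]
 ultimately have "N2 T (\<lambda>t. ND (u t + v t)) = N2 T (\<lambda>t. ND (u t) + ND (v t))"
  using energy_space_D(4)[OF w] by (intro N2_cong_AE) (auto simp: sqint_time_def)
 then show "N2 T (\<lambda>t. ND (u t + v t)) \<le> N2 T (\<lambda>t. ND (u t)) + N2 T (\<lambda>t. ND (v t))" using s(2) by simp
qed

text \<open>
 The functions converge uniformly, their derivatives in \<open>L\<^sup>2(0,T; L\<^sup>2)\<close>; along a subsequence the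
 derivatives converge at almost every time, and there the limit is the derivative of the limit because
 \<open>H1_derivs\<close> is closed and \<open>net_prim\<close> is continuous.
\<close>

theorem energy_space_complete:
 assumes T: "0 < T" and u: "\<And>n. u n \<in> spaceB T"
  and Cauchy: "\<And>e. 0 < e \<Longrightarrow> \<exists>N. \<forall>m\<ge>N. \<forall>n\<ge>N. normB T (\<lambda>t. u m t - u n t) \<le> e"
 shows "\<exists>v\<in>spaceB T. (\<lambda>n. normB T (\<lambda>t. u n t - v t)) \<longlonglongrightarrow> 0"
proof -
 note U = energy_space_D[OF u]
 have diff: "norm (u m t - u n t) \<le> normB T (\<lambda>t. u m t - u n t)" if "t \<in> {0..T}" for m n t
  using energy_norm_ge(1)[OF energy_space_diff(1)[OF u u] T that] .
 have diffN: "N2 T (\<lambda>t. ND (u m t) - ND (u n t)) \<le> normB T (\<lambda>t. u m t - u n t)" for m n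
  using energy_norm_ge(2)[OF energy_space_diff(1)[OF u u] T] energy_space_diff(2)[OF u u] by simp
 have unif: "\<exists>N. \<forall>m\<ge>N. \<forall>n\<ge>N. \<forall>t\<in>{0..T}. norm (u m t - u n t) \<le> e" if "0 < e" for e
  using Cauchy[OF that] diff by (meson order_trans)
 have conv: "Cauchy (\<lambda>n. u n t)" if t: "t \<in> {0..T}" for t
  unfolding Cauchy_iff
 proof (intro allI impI)
  fix e :: real assume "0 < e"
  then obtain N where "\<forall>m\<ge>N. \<forall>n\<ge>N. \<forall>t\<in>{0..T}. norm (u m t - u n t) \<le> e / 2" using unif[of "e/2"] by auto
  then show "\<exists>N. \<forall>m\<ge>N. \<forall>n\<ge>N. norm (u m t - u n t) < e"
   using t \<open>0 < e\<close> by (intro exI[of _ N]) fastforce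
 qed
 define v where "v t = lim (\<lambda>n. u n t)" for t
 have lim: "(\<lambda>n. u n t) \<longlonglongrightarrow> v t" if "t \<in> {0..T}" for t
  using conv[OF that] by (simp add: v_def Cauchy_convergent_iff convergent_LIMSEQ_iff)
 have unif_lim: "\<exists>N. \<forall>n\<ge>N. \<forall>t\<in>{0..T}. norm (u n t - v t) \<le> e" if e: "0 < e" for e
 proof -
  obtain N where N: "\<And>m n t. m \<ge> N \<Longrightarrow> n \<ge> N \<Longrightarrow> t \<in> {0..T} \<Longrightarrow> norm (u m t - u n t) \<le> e" using unif[OF e] by blast
  have "norm (u n t - v t) \<le> e" if "n \<ge> N" "t \<in> {0..T}" for n t
  proof (rule LIMSEQ_le_const2)
   show "(\<lambda>m. norm (u n t - u m t)) \<longlonglongrightarrow> norm (u n t - v t)"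
    by (intro tendsto_norm tendsto_diff tendsto_const lim that)
   show "\<exists>M. \<forall>m\<ge>M. norm (u n t - u m t) \<le> e" using N that by blast
  qed
  then show ?thesis by blast
 qed
 have "uniform_limit {0..T} u v sequentially"
  unfolding uniform_limit_sequentially_iff
 proof (intro allI impI)
  fix e :: real assume "0 < e"
  then obtain N where "\<forall>n\<ge>N. \<forall>t\<in>{0..T}. norm (u n t - v t) \<le> e / 2" using unif_lim[of "e/2"] by auto
  then show "\<exists>N. \<forall>n\<ge>N. \<forall>x\<in>{0..T}. dist (u n x) (v x) < e"
   using \<open>0 < e\<close> by (intro exI[of _ N]) (fastforce simp: dist_norm)
 qed
 then have vc: "continuous_on {0..T} v"
  by (rule uniform_limit_theorem[rotated]) (use U(2) in auto)
 have vL: "v t \<in> net_L2 len" if "t \<in> {0..T}" for t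
  using closed_sequentially[OF closed_net_L2 _ lim[OF that]] U(1) that by blast
 have "\<exists>r D. strict_mono (r :: nat \<Rightarrow> nat) \<and> sqint_time T D \<and> (AE t in time T. (\<lambda>i. ND (u (r i) t)) \<longlonglongrightarrow> D t) \<and>
   (\<lambda>n. N2 T (\<lambda>t. ND (u n t) - D t)) \<longlonglongrightarrow> 0"
 proof (rule sqint_time_complete)
  show "\<exists>N. \<forall>m\<ge>N. \<forall>n\<ge>N. N2 T (\<lambda>t. ND (u m t) - ND (u n t)) \<le> e" if "0 < e" for e
   using Cauchy[OF that] diffN by (meson order_trans)
 qed (use T U(4) in auto)
 then obtain r D where r: "strict_mono r" and D: "sqint_time T D"
  and aeD: "AE t in time T. (\<lambda>i. ND (u (r i) t)) \<longlonglongrightarrow> D t"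
  and N2D: "(\<lambda>n. N2 T (\<lambda>t. ND (u n t) - D t)) \<longlonglongrightarrow> 0" by blast
 have "AE t in time T. \<forall>n. u n t \<in> net_He 1 len" using U(3) by (simp add: AE_all_countable)
 moreover have "AE t in time T. t \<in> {0<..<T}" by (rule AE_I2) simp
 ultimately have ae: "AE t in time T. D t \<in> H1_derivs \<and> v t = net_prim (D t)"
  using aeD
 proof eventually_elim
  case (elim t)
  have D1: "ND (u (r i) t) \<in> H1_derivs" "net_prim (ND (u (r i) t)) = u (r i) t" for i
   using He1_D(1,2)[of "u (r i) t"] elim(1) by auto
  have "D t \<in> H1_derivs" by (rule closed_sequentially[OF closed_H1_derivs D1(1) elim(3)])
  moreover have "(\<lambda>i. net_prim (ND (u (r i) t))) \<longlonglongrightarrow> net_prim (D t)"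
   by (rule bounded_linear.tendsto[OF bounded_linear_net_prim elim(3)])
  moreover have "(\<lambda>i. u (r i) t) \<longlonglongrightarrow> v t"
   using LIMSEQ_subseq_LIMSEQ[OF lim r, of t] elim(2) by (simp add: comp_def)
  ultimately show ?case unfolding D1(2) using LIMSEQ_unique by blast
 qed
 note V = energy_space_I[OF vc vL D ae]
 have N2v: "N2 T (\<lambda>t. ND (u n t - v t)) = N2 T (\<lambda>t. ND (u n t) - D t)" for n
 proof -
  have "N2 T (\<lambda>t. ND (u n t) - ND (v t)) = N2 T (\<lambda>t. ND (u n t) - D t)"
   using V(2) U(4)[of n] D energy_space_D(4)[OF V(1)]
   by (intro N2_cong_AE) (auto simp: sqint_time_def elim: eventually_mono)
  then show ?thesis using energy_space_diff(2)[OF u V(1)] by simp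
 qed
 have "(\<lambda>n. normB T (\<lambda>t. u n t - v t)) \<longlonglongrightarrow> 0"
 proof (rule LIMSEQ_I)
  fix e :: real assume e: "0 < e"
  define e' where "e' = (e / 4) / (1 + sqrt T)"
  have sT: "0 < 1 + sqrt T" using T by (simp add: add_pos_nonneg)
  have e': "0 < e'" using e sT by (simp add: e'_def)
  have ne: "1 + sqrt T \<noteq> 0" using sT by linarith
  have "e' * (1 + sqrt T) = e / 4" by (rule nonzero_eq_divide_eq[THEN iffD1, OF ne e'_def])
  then have e'2: "(1 + sqrt T) * e' = e / 4" by (simp only: mult.commute)
  note e' = e' e'2
  obtain N where N: "\<forall>n\<ge>N. \<forall>t\<in>{0..T}. norm (u n t - v t) \<le> e'" using unif_lim[OF e'(1)] by blast
  obtain M where M: "\<forall>n\<ge>M. norm (N2 T (\<lambda>t. ND (u n t) - D t) - 0) < e / 4" using LIMSEQ_D[OF N2D, of "e/4"] e by auto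
  have "norm (normB T (\<lambda>t. u n t - v t) - 0) < e" if n: "n \<ge> max N M" for n
  proof -
   have w: "(\<lambda>t. u n t - v t) \<in> spaceB T" by (rule energy_space_diff(1)[OF u V(1)])
   have "normB T (\<lambda>t. u n t - v t) \<le> (1 + sqrt T) * e' + e / 4"
    using N M n by (intro energy_norm_le[OF w T]) (auto simp: N2v)
   moreover have "0 \<le> normB T (\<lambda>t. u n t - v t)"
    by (rule order_trans[OF N2_nonneg energy_norm_ge(2)[OF w T]])
   ultimately show ?thesis using e' e by simp
  qed
  then show "\<exists>no. \<forall>n\<ge>no. norm (normB T (\<lambda>t. u n t - v t) - 0) < e" by blast
 qed
 then show ?thesis using V(1) by blast
qed

end


section \<open>Classical solutions\<close>

lemma real_derivative_bound:
 fixes h h' p :: "real \<Rightarrow> real"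
 assumes t: "0 \<le> t" "t \<le> T" and h: "\<And>s. s \<in> {0..T} \<Longrightarrow> (h has_real_derivative h' s) (at s within {0..T})"
  and p: "continuous_on {0..T} p" and le: "\<And>s. s \<in> {0..T} \<Longrightarrow> h' s \<le> p s"
 shows "h t - h 0 \<le> integral {0..t} p"
proof -
 have "(h' has_integral h t - h 0) {0..t}"
 proof (rule fundamental_theorem_of_calculus[OF t(1)])
  fix s assume s: "s \<in> {0..t}"
  then have "(h has_real_derivative h' s) (at s within {0..t})"
   using h[of s] t by (intro DERIV_subset[of h "h' s" s "{0..T}" "{0..t}"]) auto
  then show "(h has_vector_derivative h' s) (at s within {0..t})" by (simp add: has_real_derivative_iff_has_vector_derivative)
 qed
 moreover have "(p has_integral integral {0..t} p) {0..t}"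
  using t by (intro integrable_integral integrable_continuous_real continuous_on_subset[OF p]) auto
 ultimately show ?thesis by (rule has_integral_le) (use le t in auto)
qed

context kdv_network
begin

text \<open>Classical solutions with interior source \<open>f\<close> and boundary datum \<open>g\<close>.\<close>

definition forced :: "real \<Rightarrow> (real \<Rightarrow> L2 ^ 'n) \<Rightarrow> (real \<Rightarrow> L2 ^ 'n) \<Rightarrow> (real \<Rightarrow> real) \<Rightarrow> bool" where
 "forced T v f g \<longleftrightarrow> (\<forall>t\<in>{0..T}. v t \<in> Dmax \<and> flux (v t) = - \<alpha> * node (v t) + g t \<and>
   (v has_vector_derivative kdv (v t) + f t) (at t within {0..T}) \<and> f t \<in> net_L2 len) \<and>
  continuous_on {0..T} (\<lambda>t. kdv (v t)) \<and> continuous_on {0..T} f \<and> continuous_on {0..T} g"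

lemma forced_D:
 assumes "forced T v f g"
 shows "t \<in> {0..T} \<Longrightarrow> v t \<in> Dmax" "t \<in> {0..T} \<Longrightarrow> flux (v t) = - \<alpha> * node (v t) + g t"
  "t \<in> {0..T} \<Longrightarrow> (v has_vector_derivative kdv (v t) + f t) (at t within {0..T})"
  "t \<in> {0..T} \<Longrightarrow> f t \<in> net_L2 len"
  "continuous_on {0..T} (\<lambda>t. kdv (v t))" "continuous_on {0..T} f" "continuous_on {0..T} g" "continuous_on {0..T} v"
proof -
 show d: "t \<in> {0..T} \<Longrightarrow> (v has_vector_derivative kdv (v t) + f t) (at t within {0..T})" for t
  using assms unfolding forced_def by blast
 show "continuous_on {0..T} v" by (rule continuous_on_vector_derivative[OF d])
qed (use assms in \<open>auto simp: forced_def\<close>)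

text \<open>The bound \<open>net_deriv_bound\<close> is applied to \<open>v s - v t\<close>.\<close>

lemma forced_ND_continuous:
 assumes v: "forced T v f g"
 shows "continuous_on {0..T} (\<lambda>t. ND (v t))"
 unfolding continuous_on_def
proof
 fix t assume t: "t \<in> {0..T}"
 note V = forced_D[OF v]
 define R where "R s = ((g s - g t)\<^sup>2 / gap + kap * (norm (v s - v t))\<^sup>2
   + 2 * (1 + kap * net_length) * (norm (kdv (v s) - kdv (v t)) * norm (v s - v t))) / (3 * kap)" for s
 have "((\<lambda>s. sqrt (R s)) \<longlongrightarrow> sqrt (((g t - g t)\<^sup>2 / gap + kap * (norm (v t - v t))\<^sup>2
   + 2 * (1 + kap * net_length) * (norm (kdv (v t) - kdv (v t)) * norm (v t - v t))) / (3 * kap))) (at t within {0..T})"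
  unfolding R_def
  by (intro tendsto_real_sqrt tendsto_divide tendsto_add tendsto_mult tendsto_power tendsto_norm tendsto_diff tendsto_const
    V(5)[unfolded continuous_on_def, rule_format, OF t] V(7)[unfolded continuous_on_def, rule_format, OF t]
    V(8)[unfolded continuous_on_def, rule_format, OF t]) (use gap_pos kap_pos in auto)
 then have lim: "((\<lambda>s. sqrt (R s)) \<longlongrightarrow> 0) (at t within {0..T})" by simp
 have "\<forall>\<^sub>F s in at t within {0..T}. norm (ND (v s) - ND (v t)) \<le> sqrt (R s)"
  unfolding eventually_at_filter
 proof (intro always_eventually allI impI)
  fix s assume "s \<noteq> t" and s: "s \<in> {0..T}"
  have w: "v s - v t \<in> Dmax" "node (v s - v t) = node (v s) - node (v t)" "flux (v s - v t) = flux (v s) - flux (v t)"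
    "kdv (v s - v t) = kdv (v s) - kdv (v t)"
   using Dmax_lincomb[OF V(1)[OF s] V(1)[OF t], of 1 "-1"] by simp_all
  have "flux (v s - v t) = - \<alpha> * node (v s - v t) + (g s - g t)"
   unfolding w(2,3) V(2)[OF s] V(2)[OF t] by (simp add: algebra_simps)
  from net_deriv_bound[OF w(1) this]
  have "3 * kap * (norm (ND (v s - v t)))\<^sup>2 \<le> R s * (3 * kap)"
   using kap_pos unfolding R_def w(4) by simp
  then have "(norm (ND (v s - v t)))\<^sup>2 \<le> R s" using kap_pos by simp
  moreover have "ND (v s - v t) = ND (v s) - ND (v t)"
   using He1_diff[OF Dmax_He1[OF V(1)[OF s]] Dmax_He1[OF V(1)[OF t]]] by simp
  ultimately show "norm (ND (v s) - ND (v t)) \<le> sqrt (R s)" by (simp add: real_le_rsqrt)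
 qed
 then have "((\<lambda>s. ND (v s) - ND (v t)) \<longlongrightarrow> 0) (at t within {0..T})" by (rule Lim_null_comparison[OF _ lim])
 then show "((\<lambda>s. ND (v s)) \<longlongrightarrow> ND (v t)) (at t within {0..T})" by (simp add: LIM_zero_iff)
qed

lemma forced_energy_space:
 assumes v: "forced T v f g"
 shows "v \<in> spaceB T"
proof (rule energy_space_I(1))
 note V = forced_D[OF v]
 show "continuous_on {0..T} v" by (rule V(8))
 show "v t \<in> net_L2 len" if "t \<in> {0..T}" for t by (rule Dmax_net_L2(1)[OF V(1)[OF that]])
 show "sqint_time T (\<lambda>t. ND (v t))" by (rule sqint_time_continuous[OF forced_ND_continuous[OF v]])
 show "AE t in time T. ND (v t) \<in> H1_derivs \<and> v t = net_prim (ND (v t))"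
 proof (rule AE_I2)
  fix t assume "t \<in> space (time T)"
  then have "t \<in> {0..T}" by simp
  then show "ND (v t) \<in> H1_derivs \<and> v t = net_prim (ND (v t))" using He1_D(1,2)[OF Dmax_He1[OF V(1)]] by blast
 qed
qed

definition sup_const :: real where "sup_const = 2 + 1 / sqrt gap"

definition smoothing_const :: "real \<Rightarrow> real" where
 "smoothing_const T = sqrt (((1 + kap * net_length) + 1 / gap + kap * T * sup_const\<^sup>2 + 2 * (1 + kap * net_length) * sup_const) / (3 * kap))"

definition energy_const :: "real \<Rightarrow> real" where
 "energy_const T = (1 + sqrt T) * sup_const + smoothing_const T"

lemma sup_const_pos: "0 < sup_const"
 unfolding sup_const_def using gap_pos by (intro add_pos_nonneg) auto

lemma smoothing_const_nonneg: "0 \<le> T \<Longrightarrow> 0 \<le> smoothing_const T"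
 unfolding smoothing_const_def using gap_pos kap_pos net_length_pos sup_const_pos by simp

lemma energy_const_pos: "0 \<le> T \<Longrightarrow> 0 < energy_const T"
 unfolding energy_const_def using sup_const_pos smoothing_const_nonneg[of T] by (intro add_pos_nonneg mult_pos_pos) auto

lemma forced_norm_derivative:
 assumes v: "forced T v f g" and t: "t \<in> {0..T}"
 shows "((\<lambda>t. (norm (v t))\<^sup>2) has_real_derivative 2 * inner (kdv (v t) + f t) (v t)) (at t within {0..T})"
  "((\<lambda>t. inner (net_weight (v t)) (v t)) has_real_derivative 2 * inner (kdv (v t) + f t) (net_weight (v t))) (at t within {0..T})"
proof -
 note V = forced_D[OF v]
 define w where "w = kdv (v t) + f t"
 have d: "(v has_vector_derivative w) (at t within {0..T})" unfolding w_def by (rule V(3)[OF t])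
 have wX: "w \<in> net_L2 len" "v t \<in> net_L2 len"
  using Dmax_net_L2[OF V(1)[OF t]] V(4)[OF t] subspace_net_L2 by (auto simp: w_def subspace_add)
 have "((\<lambda>t. inner (v t) (v t)) has_vector_derivative inner (v t) w + inner w (v t)) (at t within {0..T})"
  by (rule bounded_bilinear.has_vector_derivative[OF bounded_bilinear_inner d d])
 then show "((\<lambda>t. (norm (v t))\<^sup>2) has_real_derivative 2 * inner (kdv (v t) + f t) (v t)) (at t within {0..T})"
  by (simp add: power2_norm_eq_inner has_real_derivative_iff_has_vector_derivative inner_commute w_def[symmetric])
 have "((\<lambda>t. net_weight (v t)) has_vector_derivative net_weight w) (at t within {0..T})"
  by (rule bounded_linear.has_vector_derivative[OF bounded_linear_net_weight d])
 then have "((\<lambda>t. inner (net_weight (v t)) (v t)) has_vector_derivative inner (net_weight (v t)) w + inner (net_weight w) (v t)) (at t within {0..T})"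
  by (intro bounded_bilinear.has_vector_derivative[OF bounded_bilinear_inner] d)
 moreover have "inner (net_weight w) (v t) = inner (net_weight (v t)) w" by (rule net_weight_symmetric[OF wX])
 ultimately show "((\<lambda>t. inner (net_weight (v t)) (v t)) has_real_derivative 2 * inner (kdv (v t) + f t) (net_weight (v t))) (at t within {0..T})"
  by (simp add: has_real_derivative_iff_has_vector_derivative inner_commute w_def[symmetric])
qed

text \<open>
 The unweighted energy bounds the maximum \<open>M\<close> of the norm, attained at \<open>t1\<close>, by the data. The energy
 with weight \<open>1 + kap x\<close> then bounds \<open>\<partial>\<^sub>x v\<close> in \<open>L\<^sup>2(0,T; L\<^sup>2)\<close>, since all other terms are controlled
 by \<open>M\<close> and the data.
\<close>

theorem forced_energy_estimate:
 assumes T: "0 < T" and v: "forced T v f g"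
 shows "normB T v \<le> energy_const T * (norm (v 0) + (LINT t|time T. norm (f t)) + N2 T g)"
proof -
 note V = forced_D[OF v]
 define a F G where "a = norm (v 0)" and "F = (LINT t|time T. norm (f t))" and "G = N2 T g"
 define s where "s = a + F + G"
 have nn: "0 \<le> a" "0 \<le> F" "0 \<le> G" "a \<le> s" "F \<le> s" "G \<le> s" "0 \<le> s"
  by (auto simp: a_def F_def G_def s_def N2_nonneg)
 have cf: "continuous_on {0..T} (\<lambda>t. norm (f t))" by (intro continuous_on_norm V(6))
 have cg: "continuous_on {0..T} (\<lambda>t. (g t)\<^sup>2)" by (intro continuous_on_power V(7))
 have F: "F = integral {0..T} (\<lambda>t. norm (f t))" unfolding F_def by (rule LINT_time_continuous[OF cf])
 have G: "G\<^sup>2 = integral {0..T} (\<lambda>t. (g t)\<^sup>2)" unfolding G_def N2_square using LINT_time_continuous[OF cg] by simp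
 have fv: "inner (f t) (v t) \<le> norm (f t) * norm (v t)" for t by (rule norm_cauchy_schwarz)
 obtain t1 where t1: "t1 \<in> {0..T}" "\<And>t. t \<in> {0..T} \<Longrightarrow> norm (v t) \<le> norm (v t1)"
 proof -
  have "\<exists>x\<in>{0..T}. \<forall>y\<in>{0..T}. norm (v y) \<le> norm (v x)"
   using T by (intro continuous_attains_sup continuous_on_norm V(8)) auto
  then show ?thesis using that by blast
 qed
 define M where "M = norm (v t1)"
 have M0: "0 \<le> M" by (simp add: M_def)
 have lin: "integral {0..T} (\<lambda>t. (g t)\<^sup>2 / gap + c * norm (f t)) = G\<^sup>2 / gap + c * F" for c
 proof -
  have "integral {0..T} (\<lambda>t. (g t)\<^sup>2 / gap + c * norm (f t)) = integral {0..T} (\<lambda>t. (g t)\<^sup>2 / gap) + integral {0..T} (\<lambda>t. c * norm (f t))"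
   using gap_pos by (intro integral_add integrable_continuous_real continuous_on_divide continuous_on_mult continuous_on_const cf cg) auto
  then show ?thesis by (simp add: F G)
 qed
 have "(norm (v t1))\<^sup>2 - (norm (v 0))\<^sup>2 \<le> integral {0..t1} (\<lambda>t. (g t)\<^sup>2 / gap + (2 * M) * norm (f t))"
 proof (rule real_derivative_bound[of t1 T "\<lambda>t. (norm (v t))\<^sup>2" "\<lambda>t. 2 * inner (kdv (v t) + f t) (v t)"])
  show "continuous_on {0..T} (\<lambda>t. (g t)\<^sup>2 / gap + (2 * M) * norm (f t))"
   using gap_pos by (intro continuous_on_add continuous_on_divide continuous_on_mult continuous_on_const cf cg) auto
  fix t assume t: "t \<in> {0..T}"
  show "((\<lambda>t. (norm (v t))\<^sup>2) has_real_derivative 2 * inner (kdv (v t) + f t) (v t)) (at t within {0..T})"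
   by (rule forced_norm_derivative(1)[OF v t])
  have "norm (f t) * norm (v t) \<le> norm (f t) * M" using t1(2)[OF t] by (simp add: M_def mult_left_mono)
  then have "inner (f t) (v t) \<le> M * norm (f t)" using fv[of t] by (simp add: mult.commute)
  then show "2 * inner (kdv (v t) + f t) (v t) \<le> (g t)\<^sup>2 / gap + (2 * M) * norm (f t)"
   using energy_dissipation(1)[OF V(1)[OF t] V(2)[OF t]] by (simp add: inner_add_left)
 qed (use t1 in auto)
 also have "\<dots> \<le> integral {0..T} (\<lambda>t. (g t)\<^sup>2 / gap + (2 * M) * norm (f t))"
  using t1(1) gap_pos M0
  by (intro integral_subset_le integrable_continuous_real continuous_on_add continuous_on_divide continuous_on_mult continuous_on_const
    continuous_on_subset[OF cf] continuous_on_subset[OF cg]) auto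
 finally have "M\<^sup>2 \<le> (a\<^sup>2 + G\<^sup>2 / gap) + 2 * (M * F)" unfolding lin by (simp add: M_def[symmetric] a_def[symmetric])
 then have "(M - F)\<^sup>2 \<le> (a\<^sup>2 + G\<^sup>2 / gap) + F\<^sup>2" by (simp add: power2_diff)
 also have "\<dots> \<le> (a + G / sqrt gap + F)\<^sup>2"
 proof -
  have "(a + G / sqrt gap + F)\<^sup>2 = a\<^sup>2 + (G / sqrt gap)\<^sup>2 + F\<^sup>2 + 2 * (a * (G / sqrt gap)) + 2 * (a * F) + 2 * (G / sqrt gap * F)"
   by (simp add: power2_eq_square algebra_simps)
  moreover have "(G / sqrt gap)\<^sup>2 = G\<^sup>2 / gap" using gap_pos by (simp add: power_divide)
  moreover have "0 \<le> a * (G / sqrt gap)" "0 \<le> a * F" "0 \<le> G / sqrt gap * F" using nn gap_pos by auto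
  ultimately show ?thesis by linarith
 qed
 finally have "M - F \<le> a + G / sqrt gap + F"
  by (rule power2_le_imp_le) (use nn gap_pos in simp)
 then have "M \<le> a + 2 * F + (1 / sqrt gap) * G" by simp
 also have "\<dots> \<le> 2 * s + (1 / sqrt gap) * s"
 proof (rule add_mono)
  show "a + 2 * F \<le> 2 * s" using nn by (simp add: s_def)
  show "(1 / sqrt gap) * G \<le> (1 / sqrt gap) * s" using nn gap_pos by (intro mult_left_mono) auto
 qed
 finally have M: "M \<le> sup_const * s" by (simp add: sup_const_def algebra_simps)
 define \<Phi> where "\<Phi> t = (norm (v t))\<^sup>2 + kap * inner (net_weight (v t)) (v t)" for t
 define c where "c = 2 * (1 + kap * net_length) * M"
 have c0: "0 \<le> c" unfolding c_def using kap_pos net_length_pos M0 by (intro mult_nonneg_nonneg) auto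
 have cND: "continuous_on {0..T} (\<lambda>t. 3 * kap * (norm (ND (v t)))\<^sup>2)"
  by (intro continuous_on_mult continuous_on_power continuous_on_norm forced_ND_continuous[OF v] continuous_on_const)
 have "\<Phi> T - \<Phi> 0 \<le> integral {0..T} (\<lambda>t. (g t)\<^sup>2 / gap + c * norm (f t) + kap * M\<^sup>2 - 3 * kap * (norm (ND (v t)))\<^sup>2)"
 proof (rule real_derivative_bound[of T T \<Phi> "\<lambda>t. 2 * inner (kdv (v t) + f t) (v t) + kap * (2 * inner (kdv (v t) + f t) (net_weight (v t)))"])
  show "continuous_on {0..T} (\<lambda>t. (g t)\<^sup>2 / gap + c * norm (f t) + kap * M\<^sup>2 - 3 * kap * (norm (ND (v t)))\<^sup>2)"
   using gap_pos by (intro continuous_on_diff cND continuous_on_add continuous_on_divide continuous_on_mult continuous_on_const cf cg) auto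
  fix t assume t: "t \<in> {0..T}"
  show "(\<Phi> has_real_derivative 2 * inner (kdv (v t) + f t) (v t) + kap * (2 * inner (kdv (v t) + f t) (net_weight (v t)))) (at t within {0..T})"
   unfolding \<Phi>_def by (intro DERIV_add DERIV_cmult forced_norm_derivative[OF v t])
  have vt: "norm (v t) \<le> M" using t1(2)[OF t] by (simp add: M_def)
  have vX: "v t \<in> net_L2 len" by (rule Dmax_net_L2(1)[OF V(1)[OF t]])
  have "norm (f t) * norm (v t) \<le> norm (f t) * M" using vt by (intro mult_left_mono) auto
  then have 1: "inner (f t) (v t) \<le> M * norm (f t)" using fv[of t] by (simp add: mult.commute)
  have "inner (f t) (net_weight (v t)) \<le> norm (f t) * norm (net_weight (v t))" by (rule norm_cauchy_schwarz)
  also have "\<dots> \<le> norm (f t) * (net_length * M)"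
   using net_length_pos vt by (intro mult_left_mono order_trans[OF norm_net_weight[OF vX]]) auto
  finally have "kap * inner (f t) (net_weight (v t)) \<le> kap * (norm (f t) * (net_length * M))"
   using kap_pos by (intro mult_left_mono) auto
  moreover have "kap * (norm (v t))\<^sup>2 \<le> kap * M\<^sup>2" using kap_pos vt by (intro mult_left_mono power_mono) auto
  ultimately show "2 * inner (kdv (v t) + f t) (v t) + kap * (2 * inner (kdv (v t) + f t) (net_weight (v t)))
    \<le> (g t)\<^sup>2 / gap + c * norm (f t) + kap * M\<^sup>2 - 3 * kap * (norm (ND (v t)))\<^sup>2"
   using energy_dissipation(2)[OF V(1)[OF t] V(2)[OF t]] 1 unfolding c_def by (simp add: inner_add_left algebra_simps)
 qed (use T in auto)
 also have "\<dots> = integral {0..T} (\<lambda>t. ((g t)\<^sup>2 / gap + c * norm (f t)) + kap * M\<^sup>2) - integral {0..T} (\<lambda>t. 3 * kap * (norm (ND (v t)))\<^sup>2)"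
  using gap_pos by (intro HK_diff integrable_continuous_real cND continuous_on_add continuous_on_divide continuous_on_mult continuous_on_const cf cg) auto
 also have "integral {0..T} (\<lambda>t. ((g t)\<^sup>2 / gap + c * norm (f t)) + kap * M\<^sup>2)
   = integral {0..T} (\<lambda>t. (g t)\<^sup>2 / gap + c * norm (f t)) + integral {0..T} (\<lambda>t. kap * M\<^sup>2)"
  using gap_pos by (intro integral_add integrable_continuous_real continuous_on_add continuous_on_divide continuous_on_mult continuous_on_const cf cg) auto
 also have "integral {0..T} (\<lambda>t. 3 * kap * (norm (ND (v t)))\<^sup>2) = 3 * kap * (N2 T (\<lambda>t. ND (v t)))\<^sup>2"
  unfolding N2_square using LINT_time_continuous[OF continuous_on_power[OF continuous_on_norm[OF forced_ND_continuous[OF v]], of 2]] by simp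
 finally have "3 * kap * (N2 T (\<lambda>t. ND (v t)))\<^sup>2 \<le> \<Phi> 0 - \<Phi> T + (G\<^sup>2 / gap + c * F) + T * (kap * M\<^sup>2)"
  using T unfolding lin by (simp add: algebra_simps)
 moreover have "\<Phi> 0 \<le> (1 + kap * net_length) * a\<^sup>2"
 proof -
  have "inner (net_weight (v 0)) (v 0) \<le> norm (net_weight (v 0)) * norm (v 0)" by (rule norm_cauchy_schwarz)
  also have "\<dots> \<le> (net_length * a) * a"
   unfolding a_def using V(1)[of 0] T by (intro mult_right_mono norm_net_weight Dmax_net_L2) auto
  finally have "kap * inner (net_weight (v 0)) (v 0) \<le> kap * ((net_length * a) * a)" using kap_pos by (intro mult_left_mono) auto
  then show ?thesis by (simp add: \<Phi>_def a_def[symmetric] power2_eq_square algebra_simps)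
 qed
 moreover have "0 \<le> \<Phi> T"
  unfolding \<Phi>_def using kap_pos net_weight_nonneg[OF Dmax_net_L2(1)[OF V(1)[of T]]] T by (intro add_nonneg_nonneg mult_nonneg_nonneg) auto
 ultimately have "3 * kap * (N2 T (\<lambda>t. ND (v t)))\<^sup>2 \<le> (1 + kap * net_length) * a\<^sup>2 + G\<^sup>2 / gap + c * F + T * (kap * M\<^sup>2)"
  by linarith
 also have "\<dots> \<le> (1 + kap * net_length) * s\<^sup>2 + s\<^sup>2 / gap + (2 * (1 + kap * net_length) * (sup_const * s)) * s + T * (kap * (sup_const * s)\<^sup>2)"
  unfolding c_def using nn M M0 T kap_pos net_length_pos gap_pos sup_const_pos
  by (intro add_mono mult_mono divide_right_mono power_mono order_refl) (auto intro!: add_nonneg_nonneg mult_nonneg_nonneg)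
 also have "\<dots> = 3 * kap * (smoothing_const T * s)\<^sup>2"
 proof -
  have "(smoothing_const T)\<^sup>2 = ((1 + kap * net_length) + 1 / gap + kap * T * sup_const\<^sup>2 + 2 * (1 + kap * net_length) * sup_const) / (3 * kap)"
   unfolding smoothing_const_def using T gap_pos kap_pos net_length_pos sup_const_pos by (intro real_sqrt_pow2) simp
  then have "3 * kap * (smoothing_const T)\<^sup>2 = (1 + kap * net_length) + 1 / gap + kap * T * sup_const\<^sup>2 + 2 * (1 + kap * net_length) * sup_const"
   using kap_pos by simp
  then have "3 * kap * (smoothing_const T)\<^sup>2 * s\<^sup>2 = ((1 + kap * net_length) + 1 / gap + kap * T * sup_const\<^sup>2 + 2 * (1 + kap * net_length) * sup_const) * s\<^sup>2"
   by simp
  then show ?thesis by (simp add: power_mult_distrib algebra_simps power2_eq_square)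
 qed
 finally have "(N2 T (\<lambda>t. ND (v t)))\<^sup>2 \<le> (smoothing_const T * s)\<^sup>2" using kap_pos by simp
 then have N: "N2 T (\<lambda>t. ND (v t)) \<le> smoothing_const T * s"
  by (rule power2_le_imp_le) (use smoothing_const_nonneg[of T] T nn in simp)
 have "normB T v \<le> (1 + sqrt T) * (sup_const * s) + smoothing_const T * s"
  using t1(2) M by (intro energy_norm_le[OF forced_energy_space[OF v] T _ N]) (auto simp: M_def intro: order_trans)
 then show ?thesis by (simp add: energy_const_def s_def a_def F_def G_def algebra_simps)
qed

lemma forced_lincomb:
 assumes "forced T v f g" "forced T w f' g'"
 shows "forced T (\<lambda>t. a *\<^sub>R v t + b *\<^sub>R w t) (\<lambda>t. a *\<^sub>R f t + b *\<^sub>R f' t) (\<lambda>t. a * g t + b * g' t)"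
proof -
 note V = forced_D[OF assms(1)] and W = forced_D[OF assms(2)]
 have "continuous_on {0..T} (\<lambda>t. kdv (a *\<^sub>R v t + b *\<^sub>R w t)) \<longleftrightarrow> continuous_on {0..T} (\<lambda>t. a *\<^sub>R kdv (v t) + b *\<^sub>R kdv (w t))"
  by (rule continuous_on_cong) (auto simp: Dmax_lincomb(4)[OF V(1) W(1)])
 moreover have "continuous_on {0..T} (\<lambda>t. a *\<^sub>R kdv (v t) + b *\<^sub>R kdv (w t))" by (intro continuous_intros V W)
 moreover have "((\<lambda>t. a *\<^sub>R v t + b *\<^sub>R w t) has_vector_derivative kdv (a *\<^sub>R v t + b *\<^sub>R w t) + (a *\<^sub>R f t + b *\<^sub>R f' t)) (at t within {0..T})"
  if t: "t \<in> {0..T}" for t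
 proof -
  have "((\<lambda>t. a *\<^sub>R v t + b *\<^sub>R w t) has_vector_derivative a *\<^sub>R (kdv (v t) + f t) + b *\<^sub>R (kdv (w t) + f' t)) (at t within {0..T})"
   by (intro has_vector_derivative_add bounded_linear.has_vector_derivative[OF bounded_linear_scaleR_right] V(3)[OF t] W(3)[OF t])
  then show ?thesis using Dmax_lincomb(4)[OF V(1)[OF t] W(1)[OF t], of a b] by (simp add: algebra_simps)
 qed
 moreover have "flux (a *\<^sub>R v t + b *\<^sub>R w t) = - \<alpha> * node (a *\<^sub>R v t + b *\<^sub>R w t) + (a * g t + b * g' t)"
  if t: "t \<in> {0..T}" for t
  using Dmax_lincomb(2,3)[OF V(1)[OF t] W(1)[OF t], of a b] V(2)[OF t] W(2)[OF t] by (simp add: algebra_simps)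
 moreover have "a *\<^sub>R f t + b *\<^sub>R f' t \<in> net_L2 len" if t: "t \<in> {0..T}" for t
  by (intro subspace_add subspace_scale subspace_net_L2 V(4) W(4) t)
 moreover have "continuous_on {0..T} (\<lambda>t. a *\<^sub>R f t + b *\<^sub>R f' t)" "continuous_on {0..T} (\<lambda>t. a * g t + b * g' t)"
  by (intro continuous_intros V(6,7) W(6,7))+
 ultimately show ?thesis
  unfolding forced_def using Dmax_lincomb(1)[OF V(1) W(1)] by simp
qed

lemma forced_zero: "forced T (\<lambda>_. 0) (\<lambda>_. 0) (\<lambda>_. 0)"
 unfolding forced_def using zero_Dmax subspace_0[OF subspace_net_L2] by auto

lemma forced_sum:
 assumes "\<And>i. i \<in> I \<Longrightarrow> forced T (v i) (f i) (g i)" "finite I"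
 shows "forced T (\<lambda>t. \<Sum>i\<in>I. c i *\<^sub>R v i t) (\<lambda>t. \<Sum>i\<in>I. c i *\<^sub>R f i t) (\<lambda>t. \<Sum>i\<in>I. c i * g i t)"
 using assms(2,1)
proof induction
 case empty
 then show ?case using forced_zero by simp
next
 case (insert i I)
 then have "forced T (\<lambda>t. c i *\<^sub>R v i t + 1 *\<^sub>R (\<Sum>i\<in>I. c i *\<^sub>R v i t)) (\<lambda>t. c i *\<^sub>R f i t + 1 *\<^sub>R (\<Sum>i\<in>I. c i *\<^sub>R f i t))
   (\<lambda>t. c i * g i t + 1 * (\<Sum>i\<in>I. c i * g i t))"
  by (intro forced_lincomb) auto
 then show ?case using insert by simp
qed

lemma forced_orbit:
 assumes y: "y \<in> kdv_domain \<alpha> len e1"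
 shows "forced T (\<lambda>t. S t y) (\<lambda>_. 0) (\<lambda>_. 0)"
proof -
 have D: "S t y \<in> kdv_domain \<alpha> len e1" "kdv (S t y) = S t (kdv y)" if "0 \<le> t" for t
  using gen.S_D[OF y that] by auto
 have X: "kdv y \<in> net_L2 len" using y Dmax_net_L2 by (auto simp: kdv_domain_eq)
 have "continuous_on {0..T} (\<lambda>t. kdv (S t y)) \<longleftrightarrow> continuous_on {0..T} (\<lambda>t. S t (kdv y))"
  by (rule continuous_on_cong) (auto simp: D)
 moreover have "continuous_on {0..T} (\<lambda>t. S t (kdv y))"
  by (rule continuous_on_subset[OF gen.S_orbit_continuous[OF X]]) auto
 moreover have "((\<lambda>t. S t y) has_vector_derivative kdv (S t y)) (at t within {0..T})" if "t \<in> {0..T}" for t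
  using gen.S_has_derivative[OF y, of t] that by (auto intro: has_vector_derivative_within_subset)
 ultimately show ?thesis
  unfolding forced_def using D(1) subspace_0[OF subspace_net_L2] by (auto simp: kdv_domain_eq)
qed

text \<open>
 Exponentials in time with stationary profiles solve the system with exponential data. Together with
 orbits of the semigroup they are the only classical solutions that are constructed.
\<close>

lemma forced_exponential:
 assumes x: "x \<in> net_L2 len" and y: "y \<in> Dmax" "lam *\<^sub>R y - kdv y = x" "flux y = - \<alpha> * node y + b"
 shows "forced T (\<lambda>t. exp (lam * t) *\<^sub>R y) (\<lambda>t. exp (lam * t) *\<^sub>R x) (\<lambda>t. exp (lam * t) * b)"
proof -
 have L: "c *\<^sub>R y \<in> Dmax" "node (c *\<^sub>R y) = c * node y" "flux (c *\<^sub>R y) = c * flux y" "kdv (c *\<^sub>R y) = c *\<^sub>R kdv y" for c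
  using Dmax_lincomb[OF y(1) y(1), of c 0] by auto
 have "((\<lambda>t. exp (lam * t) *\<^sub>R y) has_vector_derivative exp (lam * t) *\<^sub>R kdv y + exp (lam * t) *\<^sub>R x) (at t within {0..T})" for t
 proof -
  have "((\<lambda>t. exp (lam * t)) has_real_derivative exp (lam * t) * lam) (at t within {0..T})"
   by (auto intro!: derivative_eq_intros)
  then have "((\<lambda>t. exp (lam * t) *\<^sub>R y) has_vector_derivative (exp (lam * t) * lam) *\<^sub>R y) (at t within {0..T})"
   by (auto intro!: derivative_eq_intros)
  moreover have "(exp (lam * t) * lam) *\<^sub>R y = exp (lam * t) *\<^sub>R kdv y + exp (lam * t) *\<^sub>R x"
   unfolding y(2)[symmetric] by (simp add: scaleR_right_diff_distrib)
  ultimately show ?thesis by simp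
 qed
 then show ?thesis
  unfolding forced_def using L y x subspace_scale[OF subspace_net_L2]
  by (auto intro!: continuous_intros simp: algebra_simps)
qed

lemma forced_classical_solution:
 assumes "forced T v (\<lambda>_. 0) g"
 shows "classical_solution \<alpha> len e1 T (v 0) g v"
 using forced_D[OF assms] unfolding classical_solution_def Dmax_def node_def flux_def by simp

lemma classical_solution_forced:
 assumes "classical_solution \<alpha> len e1 T u0 g v" "C2_on T g"
 shows "forced T v (\<lambda>_. 0) g" "v 0 = u0"
proof -
 have "continuous_on {0..T} g" using assms(2) unfolding C2_on_def
  by (metis DERIV_continuous_on)
 then show "forced T v (\<lambda>_. 0) g" "v 0 = u0"
  using assms(1) subspace_0[OF subspace_net_L2] unfolding classical_solution_def forced_def Dmax_def node_def flux_def by auto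
qed

end


section \<open>Approximation of data by exponentials\<close>

lemma N2_dominated:
 fixes q :: "nat \<Rightarrow> real \<Rightarrow> 'b::{banach, second_countable_topology}"
 assumes q: "\<And>n. q n \<in> borel_measurable (time T)" and le: "\<And>n t. t \<in> {0<..<T} \<Longrightarrow> norm (q n t) \<le> d t"
  and d: "integrable (time T) (\<lambda>t. (d t)\<^sup>2)" and lim: "AE t in time T. (\<lambda>n. q n t) \<longlonglongrightarrow> 0"
 shows "(\<lambda>n. N2 T (q n)) \<longlonglongrightarrow> 0"
proof -
 have "(\<lambda>n. LINT t|time T. (norm (q n t))\<^sup>2) \<longlonglongrightarrow> (LINT t|time T. (0::real))"
 proof (rule integral_dominated_convergence[OF _ _ d])
  show "(\<lambda>t. (norm (q n t))\<^sup>2) \<in> borel_measurable (time T)" for n using q[of n] by measurable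
  show "AE t in time T. (\<lambda>n. (norm (q n t))\<^sup>2) \<longlonglongrightarrow> 0"
   using lim
  proof eventually_elim
   case (elim t)
   from tendsto_power[OF tendsto_norm_zero[OF elim], of 2] show ?case by simp
  qed
  show "AE t in time T. norm ((norm (q n t))\<^sup>2) \<le> (d t)\<^sup>2" for n
   using le[of _ n] by (intro AE_I2) (auto intro!: power_mono)
 qed simp
 from tendsto_real_sqrt[OF this] show ?thesis by (simp add: N2_def)
qed

lemma N2_le_const:
 assumes "0 \<le> T" "q \<in> borel_measurable (time T)" "\<And>t. t \<in> {0<..<T} \<Longrightarrow> norm (q t) \<le> c" "0 \<le> c"
 shows "N2 T q \<le> sqrt T * c"
proof -
 interpret finite_measure "time T" by (rule finite_measure_time)
 have le: "(norm (q t))\<^sup>2 \<le> c\<^sup>2" if "t \<in> {0<..<T}" for t using assms(3)[OF that] by (intro power_mono) auto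
 have m: "(\<lambda>t. (norm (q t))\<^sup>2) \<in> borel_measurable (time T)" using assms(2) by measurable
 have "(LINT t|time T. (norm (q t))\<^sup>2) \<le> (LINT t|time T. c\<^sup>2)"
  using le by (intro integral_mono integrable_time_bounded[OF m, of "c\<^sup>2"]) auto
 also have "\<dots> = T * c\<^sup>2" using measure_time[OF assms(1)] by simp
 finally have "N2 T q \<le> sqrt (T * c\<^sup>2)" unfolding N2_def by (rule real_sqrt_le_mono)
 then show ?thesis using assms(4) by (simp add: real_sqrt_mult)
qed

text \<open>
 The exponents are positive because the stationary problem is solved for positive parameters.
\<close>

definition exp_sum :: "nat \<Rightarrow> (nat \<Rightarrow> 'b) \<Rightarrow> real \<Rightarrow> 'b::real_normed_vector" where
 "exp_sum n x t = (\<Sum>i<n. exp (real (Suc i) * t) *\<^sub>R x i)"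

lemma continuous_on_exp_sum: "continuous_on A (exp_sum n x)"
 unfolding exp_sum_def by (intro continuous_intros)

lemma exp_sum_add: "\<exists>k z. \<forall>t. exp_sum n x t + exp_sum m y t = exp_sum k z t"
proof -
 have pad: "exp_sum n x t = exp_sum (max n m) (\<lambda>i. if i < n then x i else 0) t" for n m and x :: "nat \<Rightarrow> 'a" and t
  unfolding exp_sum_def by (rule sum.mono_neutral_cong_left) auto
 have "exp_sum n x t + exp_sum m y t = exp_sum (max n m) (\<lambda>i. (if i < n then x i else 0) + (if i < m then y i else 0)) t" for t
  unfolding pad[of n x t m] pad[of m y t n] max.commute[of m n]
  by (simp only: exp_sum_def scaleR_add_right sum.distrib)
 then show ?thesis by blast
qed

text \<open>
 The theorem of Weierstrass in the variable \<open>e\<^sup>t\<close>. The first coefficient is then changed so that the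
 sum vanishes at time \<open>0\<close>, as does \<open>h\<close>: classical solutions with initial data in the domain need
 boundary data with this property.
\<close>

lemma exp_sum_dense_continuous:
 fixes h :: "real \<Rightarrow> real"
 assumes T: "0 < T" and h: "continuous_on {0..T} h" "h 0 = 0" and e: "0 < e"
 shows "\<exists>n r. (\<Sum>i<n. r i) = 0 \<and> (\<forall>t\<in>{0..T}. \<bar>exp_sum n r t - h t\<bar> \<le> e)"
proof -
 define d where "d = e / (2 * exp T)"
 have d: "0 < d" using e by (simp add: d_def)
 have "continuous_on {1..exp T} (\<lambda>s. h (ln s) / s)"
  by (intro continuous_on_divide continuous_on_compose2[OF h(1)] continuous_on_ln continuous_on_id) (auto simp: ln_ge_zero ln_le_cancel_iff[of _ "exp T", simplified])
 from Stone_Weierstrass_real_polynomial_function[OF compact_Icc this d]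
 obtain p where p: "real_polynomial_function p" "\<And>s. s \<in> {1..exp T} \<Longrightarrow> \<bar>h (ln s) / s - p s\<bar> < d" by metis
 obtain a n where a: "p = (\<lambda>s. \<Sum>i\<le>n. a i * s ^ i)" using p(1) real_polynomial_function_iff_sum by blast
 define c where "c = (\<Sum>i\<le>n. a i)"
 define r where "r i = (if i = 0 then a i - c else a i)" for i
 have split: "(\<Sum>i<Suc n. q i * r i) = (\<Sum>i\<le>n. q i * a i) - q 0 * c" for q :: "nat \<Rightarrow> real"
  unfolding r_def lessThan_Suc_atMost by (simp add: sum.atMost_shift algebra_simps)
 have s0: "(\<Sum>i<Suc n. r i) = 0" using split[of "\<lambda>_. 1"] by (simp add: c_def)
 have c: "\<bar>c\<bar> \<le> d" using p(2)[of 1] h(2) T by (simp add: a c_def)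
 have "\<bar>exp_sum (Suc n) r t - h t\<bar> \<le> e" if t: "t \<in> {0..T}" for t
 proof -
  have "exp_sum (Suc n) r t = (\<Sum>i\<le>n. exp (real (Suc i) * t) * a i) - exp t * c"
   unfolding exp_sum_def using split[of "\<lambda>i. exp (real (Suc i) * t)"] by simp
  also have "(\<Sum>i\<le>n. exp (real (Suc i) * t) * a i) = exp t * p (exp t)"
   unfolding a sum_distrib_left by (rule sum.cong) (auto simp: exp_add exp_of_nat_mult distrib_right)
  finally have eq: "exp_sum (Suc n) r t = exp t * p (exp t) - exp t * c" .
  have "\<bar>h (ln (exp t)) / exp t - p (exp t)\<bar> < d" using t by (intro p(2)) auto
  then have "exp t * \<bar>h t / exp t - p (exp t)\<bar> \<le> exp T * d" using t by (intro mult_mono) auto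
  moreover have "exp t * \<bar>h t / exp t - p (exp t)\<bar> = \<bar>h t - exp t * p (exp t)\<bar>"
  proof -
   have "exp t * \<bar>h t / exp t - p (exp t)\<bar> = \<bar>exp t * (h t / exp t - p (exp t))\<bar>" by (simp add: abs_mult)
   then show ?thesis by (simp add: right_diff_distrib)
  qed
  moreover have "\<bar>exp t * c\<bar> \<le> exp T * d" unfolding abs_mult using t c by (intro mult_mono) auto
  moreover have "exp T * d + exp T * d = e" by (simp add: d_def)
  ultimately show ?thesis unfolding eq by linarith
 qed
 then show ?thesis using s0 by blast
qed

text \<open>
 A measurable function is a limit of continuous ones almost everywhere; they are truncated at the bound
 of \<open>g\<close>, and a factor tending to \<open>1\<close> makes them vanish at \<open>0\<close>.
\<close>

lemma sqint_time_bounded_approx: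
 fixes g :: "real \<Rightarrow> real"
 assumes T: "0 < T" and g: "g \<in> borel_measurable (time T)" "\<And>t. \<bar>g t\<bar> \<le> B" and e: "0 < e"
 shows "\<exists>h. continuous_on {0..T} h \<and> h 0 = 0 \<and> N2 T (\<lambda>t. h t - g t) < e"
proof -
 define F where "F t = (if t \<in> {0<..<T} then g t else 0)" for t
 have "F \<in> borel_measurable lebesgue"
  using g(1) by (subst (asm) borel_measurable_if_lebesgue_on[symmetric]) (auto simp: F_def[abs_def])
 then have "F measurable_on UNIV" by (intro lebesgue_measurable_imp_measurable_on_real) auto
 then obtain Z c where Z: "negligible Z" and c: "\<And>n. continuous_on UNIV (c n)" "\<And>t. t \<notin> Z \<Longrightarrow> (\<lambda>n. c n t) \<longlonglongrightarrow> F t"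
  unfolding measurable_on_def by auto
 have B: "0 \<le> B" using g(2)[of 0] by linarith
 define h where "h n t = min 1 (real n * \<bar>t\<bar>) * max (- B) (min B (c n t))" for n :: nat and t :: real
 have hc: "continuous_on A (h n)" for n A
  unfolding h_def by (intro continuous_intros continuous_on_subset[OF c(1)]) auto
 have "AE t in lebesgue. t \<notin> Z" using Z by (simp add: negligible_iff_null_sets AE_not_in)
 then have ae: "AE t in time T. t \<notin> Z" by (subst AE_restrict_space_iff) auto
 have lim: "(\<lambda>n. h n t - g t) \<longlonglongrightarrow> 0" if "t \<notin> Z" "t \<in> {0<..<T}" for t
 proof -
  have "\<forall>\<^sub>F n in sequentially. 1 / t \<le> real n" using filterlim_real_sequentially by (auto simp: filterlim_at_top)
  then have "\<forall>\<^sub>F n in sequentially. min 1 (real n * \<bar>t\<bar>) = 1"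
   by eventually_elim (use that in \<open>simp add: field_simps\<close>)
  then have "(\<lambda>n. min 1 (real n * \<bar>t\<bar>)) \<longlonglongrightarrow> 1" by (rule tendsto_eventually)
  moreover have "(\<lambda>n. max (- B) (min B (c n t))) \<longlonglongrightarrow> max (- B) (min B (F t))"
   by (intro tendsto_intros c(2) that)
  ultimately have "(\<lambda>n. h n t - g t) \<longlonglongrightarrow> 1 * max (- B) (min B (F t)) - g t"
   unfolding h_def by (intro tendsto_diff tendsto_mult tendsto_const)
  moreover have "max (- B) (min B (F t)) = g t" using that g(2)[of t] by (auto simp: F_def)
  ultimately show ?thesis by simp
 qed
 have "(\<lambda>n. N2 T (\<lambda>t. h n t - g t)) \<longlonglongrightarrow> 0"
 proof (rule N2_dominated[where d = "\<lambda>_. 2 * B"])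
  show "(\<lambda>t. h n t - g t) \<in> borel_measurable (time T)" for n
   by (intro borel_measurable_diff g(1) borel_measurable_time_continuous hc)
  show "norm (h n t - g t) \<le> 2 * B" for n t
  proof -
   have "\<bar>h n t\<bar> \<le> 1 * B" unfolding h_def abs_mult using B by (intro mult_mono) auto
   then show ?thesis using g(2)[of t] by simp
  qed
  show "AE t in time T. (\<lambda>n. h n t - g t) \<longlonglongrightarrow> 0"
   using ae AE_space[of "time T"]
  proof eventually_elim
   case (elim t)
   then show ?case by (intro lim) auto
  qed
  show "integrable (time T) (\<lambda>t. (2 * B)\<^sup>2)" by (rule integrable_time_continuous) (intro continuous_intros)
 qed
 then have "\<forall>\<^sub>F n in sequentially. N2 T (\<lambda>t. h n t - g t) < e" using e by (rule order_tendstoD)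
 then obtain n where "N2 T (\<lambda>t. h n t - g t) < e" using eventually_happens'[OF sequentially_bot] by blast
 moreover have "h n 0 = 0" by (simp add: h_def)
 ultimately show ?thesis using hc by blast
qed

lemma exp_sum_dense_L2:
 fixes g :: "real \<Rightarrow> real"
 assumes T: "0 < T" and g: "sqint_time T g" and e: "0 < e"
 shows "\<exists>n r. (\<Sum>i<n. r i) = 0 \<and> N2 T (\<lambda>t. exp_sum n r t - g t) < e"
proof -
 have gm[measurable]: "g \<in> borel_measurable (time T)" and gi: "integrable (time T) (\<lambda>t. (g t)\<^sup>2)"
  using g by (auto simp: sqint_time_def)
 define b where "b n t = max (- real n) (min (real n) (g t))" for n :: nat and t
 have bm[measurable]: "b n \<in> borel_measurable (time T)" for n unfolding b_def by measurable
 have "(\<lambda>n. N2 T (\<lambda>t. b n t - g t)) \<longlonglongrightarrow> 0"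
 proof (rule N2_dominated[where d = "\<lambda>t. \<bar>g t\<bar>"])
  show "AE t in time T. (\<lambda>n. b n t - g t) \<longlonglongrightarrow> 0"
  proof (rule AE_I2)
   fix t
   have "\<forall>\<^sub>F n in sequentially. \<bar>g t\<bar> \<le> real n" using filterlim_real_sequentially by (auto simp: filterlim_at_top)
   then have "\<forall>\<^sub>F n in sequentially. b n t - g t = 0" by eventually_elim (auto simp: b_def)
   then show "(\<lambda>n. b n t - g t) \<longlonglongrightarrow> 0" by (rule tendsto_eventually)
  qed
 qed (use gi in \<open>auto simp: b_def\<close>)
 then have "\<forall>\<^sub>F n in sequentially. N2 T (\<lambda>t. b n t - g t) < e / 3" using e by (intro order_tendstoD(2)[where y = 0]) auto
 then obtain m where m: "N2 T (\<lambda>t. b m t - g t) < e / 3" using eventually_happens'[OF sequentially_bot] by blast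
 have bs: "sqint_time T (b m)"
 proof -
  have "(b m t)\<^sup>2 \<le> (real m)\<^sup>2" for t by (rule abs_le_square_iff[THEN iffD1]) (auto simp: b_def)
  then show ?thesis unfolding sqint_time_def by (intro conjI bm integrable_time_bounded[where B = "(real m)\<^sup>2"]) (use bm in auto)
 qed
 have bb: "\<bar>b m t\<bar> \<le> real m" for t by (auto simp: b_def abs_le_iff)
 obtain h where h: "continuous_on {0..T} h" "h 0 = 0" "N2 T (\<lambda>t. h t - b m t) < e / 3"
  using sqint_time_bounded_approx[OF T bm bb, of "e / 3"] e by auto
 define d where "d = e / (3 * sqrt T)"
 have "0 < d" using e T by (simp add: d_def)
 from exp_sum_dense_continuous[OF T h(1,2) this] obtain n r
  where r: "(\<Sum>i<n. r i) = 0" "\<forall>t\<in>{0..T}. \<bar>exp_sum n r t - h t\<bar> \<le> d" by blast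
 have E: "sqint_time T (exp_sum n r)" by (rule sqint_time_continuous[OF continuous_on_exp_sum])
 have H: "sqint_time T h" by (rule sqint_time_continuous[OF h(1)])
 have "N2 T (\<lambda>t. exp_sum n r t - h t) \<le> sqrt T * d"
  using r(2) T \<open>0 < d\<close> E H by (intro N2_le_const) (auto simp: sqint_time_def)
 also have "\<dots> = e / 3" using T by (simp add: d_def)
 finally have 1: "N2 T (\<lambda>t. exp_sum n r t - h t) \<le> e / 3" .
 have "N2 T (\<lambda>t. (exp_sum n r t - h t) + ((h t - b m t) + (b m t - g t)))
   \<le> N2 T (\<lambda>t. exp_sum n r t - h t) + (N2 T (\<lambda>t. h t - b m t) + N2 T (\<lambda>t. b m t - g t))"
  by (intro order_trans[OF sqint_time_add(2)] add_left_mono sqint_time_add(1) sqint_time_add(2) sqint_time_diff E H bs g)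
 then have "N2 T (\<lambda>t. exp_sum n r t - g t) < e" using 1 h(3) m by simp
 then show ?thesis using r(1) by blast
qed

text \<open>For indicator functions with a constant vector as factor this is the scalar result.\<close>

lemma exp_sum_dense_L1:
 fixes f :: "real \<Rightarrow> 'b::{banach, second_countable_topology}"
 assumes f: "integrable (time T) f" and T: "0 < T" and e: "0 < e"
 shows "\<exists>n x. (LINT t|time T. norm (exp_sum n x t - f t)) < e"
 using f e
proof (induction arbitrary: e rule: integrable_induct)
 case (base A c)
 have s: "sqint_time T (indicator A :: real \<Rightarrow> real)"
  unfolding sqint_time_def using base by (auto intro!: integrable_time_bounded[where B = 1] simp: indicator_def)
 define d where "d = e / ((norm c + 1) * sqrt T)"
 have "0 < d" unfolding d_def using base(3) T by (intro divide_pos_pos mult_pos_pos add_nonneg_pos) auto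
 from exp_sum_dense_L2[OF T s this] obtain n r where r: "N2 T (\<lambda>t. exp_sum n r t - indicat_real A t) < d" by blast
 have i: "sqint_time T (\<lambda>t. exp_sum n r t - indicator A t)"
  by (intro sqint_time_diff s sqint_time_continuous continuous_on_exp_sum)
 have "exp_sum n (\<lambda>i. r i *\<^sub>R c) t = exp_sum n r t *\<^sub>R c" for t by (simp add: exp_sum_def scaleR_sum_left)
 then have "(LINT t|time T. norm (exp_sum n (\<lambda>i. r i *\<^sub>R c) t - indicator A t *\<^sub>R c))
   = (LINT t|time T. \<bar>exp_sum n r t - indicator A t\<bar>) * norm c"
  by (simp flip: scaleR_left_diff_distrib)
 also have "\<dots> \<le> (sqrt T * N2 T (\<lambda>t. exp_sum n r t - indicator A t)) * norm c"
  using sqint_time_L1(2)[OF i] T by (intro mult_right_mono) auto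
 also have "\<dots> \<le> (sqrt T * d) * norm c" using r T by (intro mult_right_mono mult_left_mono) auto
 also have "\<dots> = e * (norm c / (norm c + 1))" using T by (simp add: d_def)
 also have "\<dots> < e"
 proof -
  have "norm c / (norm c + 1) < 1" by (subst divide_less_eq_1_pos) (auto intro: add_nonneg_pos)
  then show ?thesis using base(3) by (simp only: mult_less_cancel_left2) simp
 qed
 finally show ?case by blast
next
 case (add f g)
 obtain n x m y where a: "(LINT t|time T. norm (exp_sum n x t - f t)) < e / 2" "(LINT t|time T. norm (exp_sum m y t - g t)) < e / 2"
  using add(3,4)[of "e / 2"] add.prems by auto
 obtain k z where z: "\<And>t. exp_sum n x t + exp_sum m y t = exp_sum k z t" using exp_sum_add[of n x m y] by blast
 have i: "integrable (time T) (exp_sum n x)" for n and x :: "nat \<Rightarrow> 'b" by (rule integrable_time_continuous[OF continuous_on_exp_sum])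
 have "(LINT t|time T. norm (exp_sum k z t - (f t + g t)))
   \<le> (LINT t|time T. norm (exp_sum n x t - f t) + norm (exp_sum m y t - g t))"
  using add(1,2) i by (intro integral_mono) (auto simp flip: z intro: order_trans[OF _ norm_triangle_ineq] simp: algebra_simps)
 also have "\<dots> < e" using a add(1,2) i by (subst Bochner_Integration.integral_add) auto
 finally show ?case by blast
next
 case (lim f s)
 have "(\<lambda>i. LINT t|time T. norm (s i t - f t)) \<longlonglongrightarrow> (LINT t|time T. (0::real))"
 proof (rule integral_dominated_convergence[where w = "\<lambda>t. 3 * norm (f t)"])
  show "AE t in time T. (\<lambda>i. norm (s i t - f t)) \<longlonglongrightarrow> 0"
  proof (rule AE_I2)
   fix t assume "t \<in> space (time T)"
   then have "(\<lambda>i. s i t) \<longlonglongrightarrow> f t" by (rule lim(2))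
   then show "(\<lambda>i. norm (s i t - f t)) \<longlonglongrightarrow> 0" by (intro tendsto_norm_zero LIM_zero)
  qed
  show "AE t in time T. norm (norm (s i t - f t)) \<le> 3 * norm (f t)" for i
  proof (rule AE_I2)
   fix t assume "t \<in> space (time T)"
   then have "norm (s i t) \<le> 2 * norm (f t)" by (rule lim(3))
   then show "norm (norm (s i t - f t)) \<le> 3 * norm (f t)" using norm_triangle_ineq4[of "s i t" "f t"] by simp
  qed
 qed (use lim in auto)
 then have "\<forall>\<^sub>F i in sequentially. (LINT t|time T. norm (s i t - f t)) < e / 2"
  using lim.prems by (intro order_tendstoD(2)[where y = 0]) auto
 then obtain i where i: "(LINT t|time T. norm (s i t - f t)) < e / 2" using eventually_happens'[OF sequentially_bot] by blast
 obtain n x where x: "(LINT t|time T. norm (exp_sum n x t - s i t)) < e / 2" using lim.IH[of "e / 2" i] lim.prems by auto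
 have c: "integrable (time T) (exp_sum n x)" by (rule integrable_time_continuous[OF continuous_on_exp_sum])
 have "(LINT t|time T. norm (exp_sum n x t - f t))
   \<le> (LINT t|time T. norm (exp_sum n x t - s i t) + norm (s i t - f t))"
  using lim(1,4) c by (intro integral_mono) (auto intro: order_trans[OF _ norm_triangle_ineq])
 also have "\<dots> < e" using i x lim(1,4) c by (subst Bochner_Integration.integral_add) auto
 finally show ?case by blast
qed


section \<open>The linear problem\<close>

lemma exp_sum_has_derivative: "(exp_sum n r has_real_derivative exp_sum n (\<lambda>i. real (Suc i) * r i) t) (at t within A)"
 unfolding exp_sum_def[abs_def] by (auto intro!: derivative_eq_intros sum.cong simp: algebra_simps)

lemma C2_on_exp_sum: "C2_on T (exp_sum n r)"
 unfolding C2_on_def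
proof (intro exI conjI ballI)
 show "(exp_sum n r has_real_derivative exp_sum n (\<lambda>i. real (Suc i) * r i) t) (at t within {0..T})" for t
  by (rule exp_sum_has_derivative)
 show "(exp_sum n (\<lambda>i. real (Suc i) * r i) has_real_derivative exp_sum n (\<lambda>i. real (Suc i) * (real (Suc i) * r i)) t) (at t within {0..T})" for t
  by (rule exp_sum_has_derivative)
 show "continuous_on {0..T} (exp_sum n (\<lambda>i. real (Suc i) * (real (Suc i) * r i)))" by (rule continuous_on_exp_sum)
qed

lemma exp_sum_bounded_linear:
 assumes "bounded_linear L"
 shows "L (exp_sum n x t) = exp_sum n (\<lambda>i. L (x i)) t"
proof -
 interpret bounded_linear L by fact
 show ?thesis by (simp add: exp_sum_def sum scaleR)
qed

context kdv_network
begin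

lemma energy_space_cong:
 assumes u: "u \<in> spaceB T" and eq: "\<And>t. t \<in> {0..T} \<Longrightarrow> v t = u t"
 shows "v \<in> spaceB T" "normB T v = normB T u"
proof -
 have eq': "t \<in> space (time T) \<Longrightarrow> v t = u t" for t using eq[of t] by auto
 have "AE t in time T. u t \<in> net_He 1 len" using u by (simp add: energy_space_def)
 then have "AE t in time T. v t \<in> net_He 1 len" using AE_space by eventually_elim (simp only: eq')
 moreover have "v \<in> borel_measurable (time T) \<longleftrightarrow> u \<in> borel_measurable (time T)"
  "(\<lambda>t. ND (v t)) \<in> borel_measurable (time T) \<longleftrightarrow> (\<lambda>t. ND (u t)) \<in> borel_measurable (time T)"
  by (rule measurable_cong, simp only: eq')+
 moreover have "integrable (time T) (\<lambda>t. (net_H1_norm len (v t))\<^sup>2) \<longleftrightarrow> integrable (time T) (\<lambda>t. (net_H1_norm len (u t))\<^sup>2)"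
  by (rule Bochner_Integration.integrable_cong) (simp_all only: eq')
 moreover have "continuous_on {0..T} v \<longleftrightarrow> continuous_on {0..T} u" by (rule continuous_on_cong) (simp_all only: eq)
 moreover have "\<forall>t\<in>{0..T}. v t \<in> net_L2 len" using u eq by (simp add: energy_space_def)
 ultimately show "v \<in> spaceB T" using u unfolding energy_space_def by blast
 have "(LINT t|time T. (net_H1_norm len (v t))\<^sup>2) = (LINT t|time T. (net_H1_norm len (u t))\<^sup>2)"
  by (rule LINT_cong) (simp_all only: eq')
 moreover have "(SUP t\<in>{0..T}. norm (v t)) = (SUP t\<in>{0..T}. norm (u t))" by (rule SUP_cong) (simp_all only: eq)
 ultimately show "normB T v = normB T u" by (simp add: energy_norm_def)
qed

lemma energy_norm_nonneg: "u \<in> spaceB T \<Longrightarrow> 0 < T \<Longrightarrow> 0 \<le> normB T u"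
 using order_trans[OF norm_ge_zero energy_norm_ge(1)[of u T 0]] by simp

lemma energy_norm_diff_le:
 assumes u: "u \<in> spaceB T" and v: "v \<in> spaceB T" and T: "0 < T"
 shows "normB T (\<lambda>t. u t - v t) \<le> (2 + sqrt T) * (normB T u + normB T v)"
proof -
 note U = energy_norm_ge[OF u T] and V = energy_norm_ge[OF v T]
 have "norm (u t - v t) \<le> normB T u + normB T v" if "t \<in> {0..T}" for t
  using norm_triangle_ineq4[of "u t" "v t"] U(1)[OF that] V(1)[OF that] by simp
 moreover have "N2 T (\<lambda>t. ND (u t - v t)) \<le> normB T u + normB T v"
  unfolding energy_space_diff(2)[OF u v]
  using sqint_time_diff(2)[OF energy_space_D(4)[OF u] energy_space_D(4)[OF v]] U(2) V(2) by simp
 ultimately have "normB T (\<lambda>t. u t - v t)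
   \<le> (1 + sqrt T) * (normB T u + normB T v) + (normB T u + normB T v)"
  by (rule energy_norm_le[OF energy_space_diff(1)[OF u v] T])
 then show ?thesis by (simp add: algebra_simps)
qed

text \<open>
 The factor comes from comparing the norm with the supremum of \<open>\<parallel>u\<parallel>\<close> and the norm of \<open>\<partial>\<^sub>x u\<close>, for which
 the limit is immediate.
\<close>

lemma energy_norm_limit:
 assumes T: "0 < T" and u: "\<And>n. u n \<in> spaceB T" and v: "v \<in> spaceB T"
  and lim: "(\<lambda>n. normB T (\<lambda>t. u n t - v t)) \<longlonglongrightarrow> 0" and le: "\<And>n. normB T (u n) \<le> c n" and c: "c \<longlonglongrightarrow> d"
 shows "normB T v \<le> (2 + sqrt T) * d"
proof -
 have cl: "(\<lambda>n. c n + normB T (\<lambda>t. u n t - v t)) \<longlonglongrightarrow> d" using tendsto_add[OF c lim] by simp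
 note d = energy_norm_ge[OF energy_space_diff(1)[OF u v] T] and U = energy_norm_ge[OF u T]
 have "norm (v t) \<le> d" if t: "t \<in> {0..T}" for t
 proof (rule LIMSEQ_le_const[OF cl], intro exI allI impI)
  fix n :: nat
  show "norm (v t) \<le> c n + normB T (\<lambda>t. u n t - v t)"
   using d(1)[of t n] U(1)[of t n] le[of n] t norm_triangle_ineq2[of "v t" "u n t"] by (simp add: norm_minus_commute)
 qed
 moreover have "N2 T (\<lambda>t. ND (v t)) \<le> d"
 proof (rule LIMSEQ_le_const[OF cl], intro exI allI impI)
  fix n :: nat
  have "N2 T (\<lambda>t. ND (v t)) \<le> N2 T (\<lambda>t. ND (u n t)) + N2 T (\<lambda>t. ND (v t) - ND (u n t))"
   by (rule N2_triangle[OF energy_space_D(4)[OF v] energy_space_D(4)[OF u]])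
  also have "N2 T (\<lambda>t. ND (v t) - ND (u n t)) = N2 T (\<lambda>t. ND (u n t - v t))"
   unfolding energy_space_diff(2)[OF u v] by (rule N2_minus_commute)
  finally show "N2 T (\<lambda>t. ND (v t)) \<le> c n + normB T (\<lambda>t. u n t - v t)"
   using d(2)[of n] U(2)[of n] le[of n] by simp
 qed
 ultimately have "normB T v \<le> (1 + sqrt T) * d + d" by (rule energy_norm_le[OF v T])
 then show ?thesis by (simp add: algebra_simps)
qed

definition source :: "real \<Rightarrow> (real \<Rightarrow> L2 ^ 'n) \<Rightarrow> bool" where
 "source T f \<longleftrightarrow> integrable (time T) f \<and> (AE t in time T. f t \<in> net_L2 len)"

definition duhamel :: "(real \<Rightarrow> L2 ^ 'n) \<Rightarrow> real \<Rightarrow> L2 ^ 'n" where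
 "duhamel f t = (LINT s:{0..t}|lebesgue. S (t - s) (f s))"

lemma source_lincomb: "source T f \<Longrightarrow> source T g \<Longrightarrow> source T (\<lambda>t. a *\<^sub>R f t + b *\<^sub>R g t)"
 unfolding source_def using subspace_net_L2 by (auto elim!: eventually_elim2 simp: subspace_add subspace_scale)

lemma source_diff: "source T f \<Longrightarrow> source T g \<Longrightarrow> source T (\<lambda>t. f t - g t)"
 using source_lincomb[of T f g 1 "-1"] by simp

lemma source_continuous: "continuous_on {0..T} f \<Longrightarrow> (\<And>t. f t \<in> net_L2 len) \<Longrightarrow> source T f"
 by (simp add: source_def integrable_time_continuous)

text \<open>
 Off a null set the integrand of Duhamel is a continuous function of \<open>t - s\<close> and \<open>f s\<close>; the cut-off and
 the projection extend it to all arguments.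
\<close>

lemma duhamel_kernel:
 assumes f: "source T f" and t: "t \<in> {0..T}"
 defines "h \<equiv> \<lambda>s. indicator {0<..<t} s *\<^sub>R S (max 0 (t - s)) (net_proj (f s))"
 shows "integrable (time T) h" "AE s in time T. norm (h s) \<le> norm (f s)"
  "duhamel f t = (LINT s|time T. h s)"
proof -
 have fi: "integrable (time T) f" and fX: "AE t in time T. f t \<in> net_L2 len" using f by (auto simp: source_def)
 have P: "continuous_on UNIV net_proj" by (rule linear_continuous_on[OF bounded_linear_net_proj])
 have "continuous_on UNIV (\<lambda>z :: real \<times> (L2 ^ 'n). (max 0 (fst z), net_proj (snd z)))"
  by (intro continuous_intros continuous_on_compose2[OF P]) auto
 then have "continuous_on UNIV (\<lambda>z :: real \<times> (L2 ^ 'n). case (max 0 (fst z), net_proj (snd z)) of (r, y) \<Rightarrow> S r y)"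
  by (rule continuous_on_compose2[OF gen.S_jointly_continuous]) (auto simp: net_proj_net_L2)
 then have K: "continuous_on UNIV (\<lambda>z :: real \<times> (L2 ^ 'n). S (max 0 (fst z)) (net_proj (snd z)))" by simp
 have "(\<lambda>s. t - s) \<in> borel_measurable (time T)"
  by (intro borel_measurable_time_continuous continuous_intros)
 from borel_measurable_continuous_Pair[OF this borel_measurable_integrable[OF fi], of "\<lambda>r y. S (max 0 r) (net_proj y)", OF K]
 have "(\<lambda>s. S (max 0 (t - s)) (net_proj (f s))) \<in> borel_measurable (time T)" .
 moreover have "(indicator {0<..<t} :: real \<Rightarrow> real) \<in> borel_measurable (time T)"
  by (intro measurable_restrict_space1 borel_measurable_indicator) auto
 ultimately have hm: "h \<in> borel_measurable (time T)" unfolding h_def by (intro borel_measurable_scaleR)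
 show le: "AE s in time T. norm (h s) \<le> norm (f s)"
  using fX
 proof eventually_elim
  case (elim s)
  then have "net_proj (f s) = f s" by (simp add: net_L2_iff)
  then show ?case using gen.S_contraction[OF elim, of "max 0 (t - s)"] by (auto simp: h_def indicator_def)
 qed
 show "integrable (time T) h" by (rule Bochner_Integration.integrable_bound[OF fi hm le])
 have 0: "AE s in lebesgue. s \<noteq> c" for c :: real using AE_lborel_singleton[of c] by (simp add: AE_completion_iff)
 have "AE s in lebesgue. s \<in> {0<..<T} \<longrightarrow> f s \<in> net_L2 len" using fX by (subst (asm) AE_restrict_space_iff) auto
 then have ae: "AE s in lebesgue. indicator {0<..<T} s *\<^sub>R h s = indicator {0..t} s *\<^sub>R S (t - s) (f s)"
  using 0[of 0] 0[of t] by eventually_elim (use t in \<open>auto simp: h_def indicator_def net_L2_iff\<close>)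
 have m: "(\<lambda>s. indicator {0<..<T} s *\<^sub>R h s) \<in> borel_measurable lebesgue"
  using hm by (subst (asm) borel_measurable_restrict_space_iff) auto
 have m': "(\<lambda>s. indicator {0..t} s *\<^sub>R S (t - s) (f s)) \<in> borel_measurable lebesgue"
  using borel_measurable_lebesgue_on_AE_cong[of UNIV "\<lambda>s. indicator {0<..<T} s *\<^sub>R h s" borel] m ae
  unfolding lebesgue_on_UNIV_eq by auto
 have "duhamel f t = (LINT s|lebesgue. indicator {0<..<T} s *\<^sub>R h s)"
  unfolding duhamel_def set_lebesgue_integral_def by (rule integral_cong_AE[OF m m' ae, symmetric])
 then show "duhamel f t = (LINT s|time T. h s)" by (simp add: integral_restrict_space)
qed

lemma duhamel_lincomb:
 assumes f: "source T f" and g: "source T g" and t: "t \<in> {0..T}"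
 shows "duhamel (\<lambda>s. a *\<^sub>R f s + b *\<^sub>R g s) t = a *\<^sub>R duhamel f t + b *\<^sub>R duhamel g t"
proof -
 interpret P: bounded_linear net_proj by (rule bounded_linear_net_proj)
 define F G where "F s = indicat_real {0<..<t} s *\<^sub>R S (max 0 (t - s)) (net_proj (f s))"
  and "G s = indicat_real {0<..<t} s *\<^sub>R S (max 0 (t - s)) (net_proj (g s))" for s
 have "indicat_real {0<..<t} s *\<^sub>R S (max 0 (t - s)) (net_proj (a *\<^sub>R f s + b *\<^sub>R g s)) = a *\<^sub>R F s + b *\<^sub>R G s" for s
  unfolding P.add P.scaleR F_def G_def
  by (subst gen.S_lin) (auto simp: net_proj_net_L2 scaleR_add_right mult.commute)
 then show ?thesis
  unfolding duhamel_kernel(3)[OF f t] duhamel_kernel(3)[OF g t] duhamel_kernel(3)[OF source_lincomb[OF f g] t] F_def[symmetric] G_def[symmetric]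
  using duhamel_kernel(1)[OF f t] duhamel_kernel(1)[OF g t] by (simp flip: F_def G_def)
qed

lemma duhamel_diff_le:
 assumes f: "source T f" and g: "source T g" and t: "t \<in> {0..T}"
 shows "norm (duhamel f t - duhamel g t) \<le> (LINT s|time T. norm (f s - g s))"
proof -
 have d: "source T (\<lambda>s. f s - g s)" by (rule source_diff[OF f g])
 have "duhamel f t - duhamel g t = duhamel (\<lambda>s. f s - g s) t" using duhamel_lincomb[OF f g t, of 1 "-1"] by simp
 also have "norm \<dots> \<le> (LINT s|time T. norm (f s - g s))"
  unfolding duhamel_kernel(3)[OF d t]
  using d by (intro order_trans[OF integral_norm_bound integral_mono_AE[OF integrable_norm[OF duhamel_kernel(1)[OF d t]] _ duhamel_kernel(2)[OF d t]]])
   (auto simp: source_def)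
 finally show ?thesis .
qed

text \<open>
 Variation of constants for an exponential source: \<open>s \<mapsto> e\<^bsup>\<lambda>s\<^esup> S(t-s) y\<close> is a primitive of the integrand, where
 \<open>y\<close> is the resolvent applied to \<open>x\<close>.
\<close>

lemma duhamel_exponential:
 assumes y: "y \<in> kdv_domain \<alpha> len e1" and x: "lam *\<^sub>R y - kdv y = x" and t: "0 \<le> t"
 shows "duhamel (\<lambda>s. exp (lam * s) *\<^sub>R x) t = exp (lam * t) *\<^sub>R y - S t y"
proof (rule vector_eq_rdot[THEN iffD1, OF allI])
 fix z
 have yX: "y \<in> net_L2 len" "kdv y \<in> net_L2 len" using y Dmax_net_L2 by (auto simp: kdv_domain_eq)
 then have xX: "x \<in> net_L2 len" unfolding x[symmetric] using subspace_net_L2 by (intro subspace_diff subspace_scale)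
 have src: "source t (\<lambda>s. exp (lam * s) *\<^sub>R x)"
  using subspace_scale[OF subspace_net_L2 xX] by (intro source_continuous continuous_intros)
 have cS: "continuous_on {0..t} (\<lambda>s. S (t - s) w)" if "w \<in> net_L2 len" for w
  by (rule continuous_on_compose2[OF gen.S_orbit_continuous[OF that]]) (auto intro!: continuous_intros)
 define \<phi> where "\<phi> s = exp (lam * s) *\<^sub>R S (t - s) x" for s
 have c\<phi>: "continuous_on {0..t} \<phi>" unfolding \<phi>_def by (intro continuous_on_scaleR cS xX continuous_intros)
 have "((\<lambda>s. inner (\<phi> s) z) has_integral inner (exp (lam * t) *\<^sub>R S (t - t) y) z - inner (exp (lam * 0) *\<^sub>R S (t - 0) y) z) {0..t}"
 proof (rule fundamental_theorem_of_calculus[OF t])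
  fix s assume s: "s \<in> {0..t}"
  have "((\<lambda>s. t - s) has_vector_derivative - 1) (at s within {0..t})" by (auto intro!: derivative_eq_intros)
  moreover have "((\<lambda>s. S s y) has_vector_derivative S (t - s) (kdv y)) (at (t - s) within (\<lambda>s. t - s) ` {0..t})"
   using gen.S_has_derivative[OF y, of "t - s"] gen.S_D(2)[OF y, of "t - s"] s by (auto intro: has_vector_derivative_within_subset)
  ultimately have "((\<lambda>s. S s y) \<circ> (\<lambda>s. t - s) has_vector_derivative - 1 *\<^sub>R S (t - s) (kdv y)) (at s within {0..t})"
   by (rule vector_diff_chain_within)
  then have 1: "((\<lambda>s. S (t - s) y) has_vector_derivative - S (t - s) (kdv y)) (at s within {0..t})" by (simp add: o_def)
  have 2: "((\<lambda>s. exp (lam * s)) has_real_derivative exp (lam * s) * lam) (at s within {0..t})"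
   by (auto intro!: derivative_eq_intros)
  have "((\<lambda>s. exp (lam * s) *\<^sub>R S (t - s) y) has_vector_derivative
    exp (lam * s) *\<^sub>R (- S (t - s) (kdv y)) + (exp (lam * s) * lam) *\<^sub>R S (t - s) y) (at s within {0..t})"
   by (rule has_vector_derivative_scaleR[OF 2 1])
  moreover have "exp (lam * s) *\<^sub>R (- S (t - s) (kdv y)) + (exp (lam * s) * lam) *\<^sub>R S (t - s) y = \<phi> s"
   unfolding \<phi>_def x[symmetric] using s yX gen.S_lin[of "t - s" y "kdv y" lam "-1"] by (simp add: scaleR_right_diff_distrib)
  ultimately have "((\<lambda>s. exp (lam * s) *\<^sub>R S (t - s) y) has_vector_derivative \<phi> s) (at s within {0..t})" by simp
  then show "((\<lambda>s. inner (exp (lam * s) *\<^sub>R S (t - s) y) z) has_vector_derivative inner (\<phi> s) z) (at s within {0..t})"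
   by (rule bounded_linear.has_vector_derivative[OF bounded_linear_inner_left])
 qed
 then have I: "integral {0..t} (\<lambda>s. inner (\<phi> s) z) = inner (exp (lam * t) *\<^sub>R y - S t y) z"
  using gen.S_0[OF yX(1)] by (simp add: integral_unique inner_diff_left)
 have "duhamel (\<lambda>s. exp (lam * s) *\<^sub>R x) t = (LINT s|time t. \<phi> s)"
  unfolding duhamel_kernel(3)[OF src, of t, simplified, OF t]
 proof (rule LINT_cong[OF refl])
  fix s assume "s \<in> space (time t)"
  moreover have "net_proj (exp (lam * s) *\<^sub>R x) = exp (lam * s) *\<^sub>R x" using subspace_scale[OF subspace_net_L2 xX] net_L2_iff by blast
  ultimately show "indicator {0<..<t} s *\<^sub>R S (max 0 (t - s)) (net_proj (exp (lam * s) *\<^sub>R x)) = \<phi> s"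
   using gen.S_scale[of "t - s" x] xX by (simp add: \<phi>_def)
 qed
 then have "inner (duhamel (\<lambda>s. exp (lam * s) *\<^sub>R x) t) z = (LINT s|time t. inner (\<phi> s) z)"
  using integrable_time_continuous[OF c\<phi>] by simp
 also have "\<dots> = integral {0..t} (\<lambda>s. inner (\<phi> s) z)"
  by (intro LINT_time_continuous continuous_on_inner c\<phi> continuous_on_const)
 finally show "inner (duhamel (\<lambda>s. exp (lam * s) *\<^sub>R x) t) z = inner (exp (lam * t) *\<^sub>R y - S t y) z" using I by simp
qed


text \<open>
 For exponential sources the integral of Duhamel is a classical solution, to which the energy estimate
 applies.
\<close>

lemma duhamel_exp_sum:
 assumes x: "\<And>i. x i \<in> net_L2 len"
 shows "\<exists>V. forced T V (exp_sum n x) (\<lambda>_. 0) \<and> V 0 = 0 \<and> (\<forall>t\<in>{0..T}. duhamel (exp_sum n x) t = V t)"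
proof (induction n)
 case 0
 have "exp_sum 0 x = (\<lambda>_. 0)" by (simp add: exp_sum_def[abs_def])
 moreover have "duhamel (\<lambda>_. 0) t = 0" if "t \<in> {0..T}" for t
  using duhamel_lincomb[of T "\<lambda>_. 0" "\<lambda>_. 0" t 0 0] that source_continuous[of T "\<lambda>_. 0"] subspace_0[OF subspace_net_L2] by simp
 ultimately show ?case using forced_zero[of T] by (intro exI[of _ "\<lambda>_. 0"]) auto
next
 case (Suc n)
 then obtain V where V: "forced T V (exp_sum n x) (\<lambda>_. 0)" "V 0 = 0" "\<And>t. t \<in> {0..T} \<Longrightarrow> duhamel (exp_sum n x) t = V t" by blast
 define lam where "lam = real (Suc n)"
 obtain y where y: "y \<in> Dmax" "lam *\<^sub>R y - kdv y = x n" "flux y = - \<alpha> * node y + 0"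
  using solve_stationary[of lam "x n" 0] x[of n] unfolding lam_def by auto
 have yD: "y \<in> kdv_domain \<alpha> len e1" using y by (simp add: kdv_domain_eq)
 have step: "exp_sum (Suc n) x = (\<lambda>t. 1 *\<^sub>R exp_sum n x t + 1 *\<^sub>R (exp (lam * t) *\<^sub>R x n))"
  by (simp add: exp_sum_def[abs_def] lam_def)
 have E: "forced T (\<lambda>t. 1 *\<^sub>R (exp (lam * t) *\<^sub>R y) + (- 1) *\<^sub>R S t y) (\<lambda>t. 1 *\<^sub>R (exp (lam * t) *\<^sub>R x n) + (- 1) *\<^sub>R 0) (\<lambda>t. 1 * (exp (lam * t) * 0) + (- 1) * 0)"
  by (intro forced_lincomb forced_exponential forced_orbit x y yD)
 have "forced T (\<lambda>t. 1 *\<^sub>R V t + 1 *\<^sub>R (1 *\<^sub>R (exp (lam * t) *\<^sub>R y) + (- 1) *\<^sub>R S t y))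
   (\<lambda>t. 1 *\<^sub>R exp_sum n x t + 1 *\<^sub>R (1 *\<^sub>R (exp (lam * t) *\<^sub>R x n) + (- 1) *\<^sub>R 0)) (\<lambda>t. 1 * 0 + 1 * (1 * (exp (lam * t) * 0) + (- 1) * 0))"
  by (rule forced_lincomb[OF V(1) E])
 then have "forced T (\<lambda>t. V t + (exp (lam * t) *\<^sub>R y - S t y)) (exp_sum (Suc n) x) (\<lambda>_. 0)" unfolding step by simp
 moreover have "source T (exp_sum n x)"
  unfolding exp_sum_def[abs_def] by (intro source_continuous continuous_intros subspace_sum subspace_scale subspace_net_L2 x)
 then have "duhamel (exp_sum (Suc n) x) t = V t + (exp (lam * t) *\<^sub>R y - S t y)" if t: "t \<in> {0..T}" for t
  unfolding step using duhamel_lincomb[OF _ _ t, of "exp_sum n x" "\<lambda>t. exp (lam * t) *\<^sub>R x n" 1 1] V(3)[OF t]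
   duhamel_exponential[OF yD y(2), of t] t
  by (simp add: source_continuous continuous_intros subspace_scale[OF subspace_net_L2 x])
 moreover have "V 0 + (exp (lam * 0) *\<^sub>R y - S 0 y) = 0" using V(2) gen.S_0[of y] Dmax_net_L2[OF y(1)] by simp
 ultimately show ?case by (intro exI[of _ "\<lambda>t. V t + (exp (lam * t) *\<^sub>R y - S t y)"]) auto
qed

lemma exp_sum_dense_source:
 assumes T: "0 < T" and f: "source T f" and e: "0 < e"
 shows "\<exists>n x. (\<forall>i. x i \<in> net_L2 len) \<and> (LINT t|time T. norm (exp_sum n x t - f t)) < e"
proof -
 interpret P: bounded_linear net_proj by (rule bounded_linear_net_proj)
 have fi: "integrable (time T) f" and fX: "AE t in time T. f t \<in> net_L2 len" using f by (auto simp: source_def)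
 obtain K where K: "K > 0" "\<And>u. norm (net_proj u) \<le> norm u * K" using P.pos_bounded by blast
 obtain n x where x: "(LINT t|time T. norm (exp_sum n x t - f t)) < e / K"
  using exp_sum_dense_L1[OF fi T, of "e / K"] e K(1) by auto
 define z where "z i = net_proj (x i)" for i
 have z: "exp_sum n z t = net_proj (exp_sum n x t)" for t
  unfolding z_def by (rule exp_sum_bounded_linear[OF bounded_linear_net_proj, symmetric])
 have c: "integrable (time T) (exp_sum n w)" for w :: "nat \<Rightarrow> L2 ^ 'n" by (rule integrable_time_continuous[OF continuous_on_exp_sum])
 have "AE t in time T. norm (exp_sum n z t - f t) \<le> norm (exp_sum n x t - f t) * K"
  using fX
 proof eventually_elim
  case (elim t)
  then have "exp_sum n z t - f t = net_proj (exp_sum n x t - f t)" by (simp add: z P.diff net_L2_iff)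
  then show ?case using K(2) by simp
 qed
 then have "(LINT t|time T. norm (exp_sum n z t - f t)) \<le> (LINT t|time T. norm (exp_sum n x t - f t) * K)"
  using fi c by (intro integral_mono_AE) auto
 also have "\<dots> = (LINT t|time T. norm (exp_sum n x t - f t)) * K" by simp
 also have "\<dots> < e" using x K(1) by (simp add: pos_less_divide_eq)
 finally have "(LINT t|time T. norm (exp_sum n z t - f t)) < e" .
 moreover have "\<forall>i. z i \<in> net_L2 len" by (simp add: z_def net_proj_net_L2)
 ultimately show ?thesis by blast
qed

lemma Cauchy_energy_bound:
 assumes b: "\<And>m n. normB T (\<lambda>t. u m t - u n t) \<le> b m + b n" and lim: "b \<longlonglongrightarrow> (0::real)"
 shows "\<And>e. 0 < e \<Longrightarrow> \<exists>N. \<forall>m\<ge>N. \<forall>n\<ge>N. normB T (\<lambda>t. u m t - u n t) \<le> e"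
proof -
 fix e :: real assume "0 < e"
 then have "\<forall>\<^sub>F n in sequentially. b n < e / 2" using lim by (intro order_tendstoD(2)[where y = 0]) auto
 then obtain N where "\<And>n. n \<ge> N \<Longrightarrow> b n < e / 2" unfolding eventually_sequentially by blast
 then have "normB T (\<lambda>t. u m t - u n t) \<le> e" if mn: "m \<ge> N" "n \<ge> N" for m n
  using b[of m n] \<open>\<And>n. n \<ge> N \<Longrightarrow> b n < e / 2\<close>[OF mn(1)] \<open>\<And>n. n \<ge> N \<Longrightarrow> b n < e / 2\<close>[OF mn(2)] by linarith
 then show "\<exists>N. \<forall>m\<ge>N. \<forall>n\<ge>N. normB T (\<lambda>t. u m t - u n t) \<le> e" by blast
qed

lemma forced_diff:
 assumes "forced T v f g" "forced T w f' g'"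
 shows "forced T (\<lambda>t. v t - w t) (\<lambda>t. f t - f' t) (\<lambda>t. g t - g' t)"
 using forced_lincomb[OF assms, of 1 "-1"] by simp

text \<open>
 For approximating exponential sums the energy estimate gives convergence in the energy space, and
 contractivity of the semigroup gives convergence to \<open>duhamel f\<close> at each time.
\<close>

theorem duhamel_energy:
 assumes T: "0 < T" and f: "source T f"
 shows "duhamel f \<in> spaceB T"
  "normB T (duhamel f) \<le> (2 + sqrt T) * (energy_const T * (LINT t|time T. norm (f t)))"
proof -
 define K where "K = energy_const T"
 have K: "0 < K" unfolding K_def using T by (intro energy_const_pos) simp
 have fi: "integrable (time T) f" using f by (simp add: source_def)
 have "\<exists>n x. (\<forall>i. x i \<in> net_L2 len) \<and> (LINT t|time T. norm (exp_sum n x t - f t)) < inverse (real (Suc k))" for k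
  by (rule exp_sum_dense_source[OF T f]) simp
 then obtain n x where x: "\<And>k i. x k i \<in> net_L2 len"
  and small: "\<And>k. (LINT t|time T. norm (exp_sum (n k) (x k) t - f t)) < inverse (real (Suc k))" by metis
 define F where "F k = exp_sum (n k) (x k)" for k
 define d where "d k = (LINT t|time T. norm (F k t - f t))" for k
 have Fi: "integrable (time T) (F k)" for k unfolding F_def by (rule integrable_time_continuous[OF continuous_on_exp_sum])
 have Fs: "source T (F k)" for k
  unfolding F_def exp_sum_def[abs_def] by (intro source_continuous continuous_intros subspace_sum subspace_scale subspace_net_L2 x)
 have d0: "d \<longlonglongrightarrow> 0"
 proof (rule tendsto_0_if_norm_le[OF _ LIMSEQ_inverse_real_of_nat])
  show "norm (d k) \<le> inverse (real (Suc k))" for k using small[of k] by (simp add: d_def F_def)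
 qed
 have "\<forall>k. \<exists>V. forced T V (F k) (\<lambda>_. 0) \<and> V 0 = 0 \<and> (\<forall>t\<in>{0..T}. duhamel (F k) t = V t)"
  unfolding F_def using duhamel_exp_sum x by blast
 then obtain V where V: "\<And>k. forced T (V k) (F k) (\<lambda>_. 0)" "\<And>k. V k 0 = 0" "\<And>k t. t \<in> {0..T} \<Longrightarrow> duhamel (F k) t = V k t"
  by metis
 have VE: "V k \<in> spaceB T" for k by (rule forced_energy_space[OF V(1)])
 have N0: "N2 T (\<lambda>t. 0::real) = 0" by (simp add: N2_def)
 have "normB T (\<lambda>t. V i t - V j t) \<le> K * d i + K * d j" for i j
 proof -
  have "normB T (\<lambda>t. V i t - V j t) \<le> K * (LINT t|time T. norm (F i t - F j t))"
   using forced_energy_estimate[OF T forced_diff[OF V(1)[of i] V(1)[of j]]] V(2) N0 by (simp add: K_def)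
  also have "(LINT t|time T. norm (F i t - F j t)) \<le> (LINT t|time T. norm (F i t - f t) + norm (F j t - f t))"
   using Fi fi by (intro integral_mono) (auto intro: norm_diff_triangle_le simp: norm_minus_commute)
  also have "\<dots> = d i + d j" using Fi fi by (simp add: d_def)
  finally show ?thesis using K by (simp add: distrib_left mult_left_mono)
 qed
 moreover have "(\<lambda>k. K * d k) \<longlonglongrightarrow> 0" using tendsto_mult_left[OF d0, of K] by simp
 ultimately obtain v where v: "v \<in> spaceB T" "(\<lambda>k. normB T (\<lambda>t. V k t - v t)) \<longlonglongrightarrow> 0"
  using energy_space_complete[OF T VE Cauchy_energy_bound[of T V "\<lambda>k. K * d k"]] by blast
 have eq: "duhamel f t = v t" if t: "t \<in> {0..T}" for t
 proof -
  have "(\<lambda>k. duhamel (F k) t - duhamel f t) \<longlonglongrightarrow> 0"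
   by (rule tendsto_0_if_norm_le[OF _ d0]) (simp add: d_def duhamel_diff_le[OF Fs f t])
  then have 1: "(\<lambda>k. V k t) \<longlonglongrightarrow> duhamel f t" using V(3)[OF t] by (simp add: LIM_zero_iff)
  have "(\<lambda>k. V k t - v t) \<longlonglongrightarrow> 0"
   by (rule tendsto_0_if_norm_le[OF _ v(2)]) (rule energy_norm_ge(1)[OF energy_space_diff(1)[OF VE v(1)] T t])
  then have "(\<lambda>k. V k t) \<longlonglongrightarrow> v t" by (simp add: LIM_zero_iff)
  then show ?thesis by (rule LIMSEQ_unique[OF 1])
 qed
 note cong = energy_space_cong[OF v(1) eq]
 show "duhamel f \<in> spaceB T" by (rule cong(1))
 have "normB T (V k) \<le> K * ((LINT t|time T. norm (f t)) + d k)" for k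
 proof -
  have "normB T (V k) \<le> K * (LINT t|time T. norm (F k t))"
   using forced_energy_estimate[OF T V(1)[of k]] V(2) N0 by (simp add: K_def)
  also have "(LINT t|time T. norm (F k t)) \<le> (LINT t|time T. norm (f t) + norm (F k t - f t))"
   using Fi fi by (intro integral_mono) (auto intro: norm_triangle_sub)
  also have "\<dots> = (LINT t|time T. norm (f t)) + d k" using Fi fi by (simp add: d_def)
  finally show ?thesis using K by (simp add: mult_left_mono)
 qed
 moreover have "(\<lambda>k. K * ((LINT t|time T. norm (f t)) + d k)) \<longlonglongrightarrow> K * ((LINT t|time T. norm (f t)) + 0)"
  by (intro tendsto_mult_left tendsto_add tendsto_const d0)
 ultimately have "normB T v \<le> (2 + sqrt T) * (K * ((LINT t|time T. norm (f t)) + 0))"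
  by (rule energy_norm_limit[OF T VE v])
 then show "normB T (duhamel f) \<le> (2 + sqrt T) * (energy_const T * (LINT t|time T. norm (f t)))"
  using cong(2) by (simp add: K_def)
qed

text \<open>
 The sum \<open>P\<close> of exponentials with stationary profiles takes care of the boundary datum. As the
 coefficients \<open>r\<close> add up to zero, \<open>P 0\<close> satisfies the homogeneous flux condition, and the orbit of
 \<open>y m - P 0\<close> corrects the initial value.
\<close>

lemma classical_approximation:
 assumes T: "0 < T" and u0: "u0 \<in> net_L2 len" and g: "sqint_time T g" and e: "0 < e"
 shows "\<exists>U G W. U \<in> kdv_domain \<alpha> len e1 \<and> C2_on T G \<and> G 0 = 0 \<and> forced T W (\<lambda>_. 0) G \<and> W 0 = U \<and>
  norm (U - u0) < e \<and> N2 T (\<lambda>t. G t - g t) < e"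
proof -
 obtain y where y: "\<And>n. y n \<in> kdv_domain \<alpha> len e1" "y \<longlonglongrightarrow> u0" using gen.D_dense_seq[OF u0] by blast
 have "\<forall>\<^sub>F n in sequentially. dist (y n) u0 < e" using y(2) e by (rule tendstoD)
 then obtain m where m: "dist (y m) u0 < e" using eventually_happens'[OF sequentially_bot] by blast
 obtain n r where r: "(\<Sum>i<n. r i) = 0" "N2 T (\<lambda>t. exp_sum n r t - g t) < e" using exp_sum_dense_L2[OF T g e] by blast
 have "\<exists>p. p \<in> Dmax \<and> real (Suc i) *\<^sub>R p - kdv p = 0 \<and> flux p = - \<alpha> * node p + 1" for i
  using solve_stationary[of "real (Suc i)" 0 1] subspace_0[OF subspace_net_L2] by auto
 then obtain p where p: "\<And>i. p i \<in> Dmax" "\<And>i. real (Suc i) *\<^sub>R p i - kdv (p i) = 0" "\<And>i. flux (p i) = - \<alpha> * node (p i) + 1"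
  by metis
 define P where "P t = (\<Sum>i<n. r i *\<^sub>R (exp (real (Suc i) * t) *\<^sub>R p i))" for t
 have P: "forced T P (\<lambda>t. \<Sum>i<n. r i *\<^sub>R (exp (real (Suc i) * t) *\<^sub>R 0)) (\<lambda>t. \<Sum>i<n. r i * (exp (real (Suc i) * t) * 1))"
  unfolding P_def by (intro forced_sum forced_exponential subspace_0 subspace_net_L2 p) auto
 have P0: "P 0 \<in> kdv_domain \<alpha> len e1"
  using forced_D(1,2)[OF P, of 0] T r(1) by (simp add: kdv_domain_eq)
 have z: "y m - P 0 \<in> kdv_domain \<alpha> len e1" by (intro subspace_diff gen.D_subspace y(1) P0)
 have G: "(\<Sum>i<n. r i * (exp (real (Suc i) * t) * 1)) = exp_sum n r t" for t by (simp add: exp_sum_def mult.commute)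
 have "forced T (\<lambda>t. 1 *\<^sub>R P t + 1 *\<^sub>R S t (y m - P 0)) (\<lambda>t. 1 *\<^sub>R (\<Sum>i<n. r i *\<^sub>R (exp (real (Suc i) * t) *\<^sub>R 0)) + 1 *\<^sub>R 0)
   (\<lambda>t. 1 * (\<Sum>i<n. r i * (exp (real (Suc i) * t) * 1)) + 1 * 0)"
  by (intro forced_lincomb P forced_orbit z)
 then have W: "forced T (\<lambda>t. P t + S t (y m - P 0)) (\<lambda>_. 0) (exp_sum n r)" unfolding G by simp
 have W0: "P 0 + S 0 (y m - P 0) = y m" using gen.S_0[of "y m - P 0"] z gen.D_X by auto
 have "exp_sum n r 0 = 0" using r(1) by (simp add: exp_sum_def)
 then show ?thesis
  using W W0 y(1)[of m] m r(2) C2_on_exp_sum[of T n r]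
  by (intro exI[of _ "y m"] exI[of _ "exp_sum n r"] exI[of _ "\<lambda>t. P t + S t (y m - P 0)"]) (auto simp: dist_norm)
qed

lemma sqint_time_square_integrable: "g square_integrable_on {0<..<T} \<longleftrightarrow> sqint_time T g"
 by (simp add: square_integrable_on_def sqint_time_def)

theorem homogeneous_mild_solution_exists:
 assumes T: "0 < T" and u0: "u0 \<in> net_L2 len" and g: "sqint_time T g"
 shows "\<exists>w. homogeneous_mild_solution \<alpha> len e1 T u0 g w"
proof -
 define K where "K = energy_const T"
 have K: "0 < K" unfolding K_def using T by (intro energy_const_pos) simp
 define Q where "Q k U G W \<longleftrightarrow> U \<in> kdv_domain \<alpha> len e1 \<and> C2_on T G \<and> G 0 = 0 \<and> forced T W (\<lambda>_. 0) G \<and> W 0 = U \<and>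
  norm (U - u0) < inverse (real (Suc k)) \<and> N2 T (\<lambda>t. G t - g t) < inverse (real (Suc k))" for k U G W
 have "\<exists>U G W. Q k U G W" for k
  unfolding Q_def by (rule classical_approximation[OF T u0 g]) simp
 then obtain U G W where Q: "\<And>k. Q k (U k) (G k) (W k)" by metis
 have A: "\<And>k. U k \<in> kdv_domain \<alpha> len e1" "\<And>k. C2_on T (G k)" "\<And>k. G k 0 = 0"
  and W: "\<And>k. forced T (W k) (\<lambda>_. 0) (G k)" "\<And>k. W k 0 = U k"
  and small: "\<And>k. norm (U k - u0) < inverse (real (Suc k))" "\<And>k. N2 T (\<lambda>t. G k t - g t) < inverse (real (Suc k))"
  using Q unfolding Q_def by simp_all
 have Gs: "sqint_time T (G k)" for k by (rule sqint_time_continuous[OF forced_D(7)[OF W(1)]])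
 have WE: "W k \<in> spaceB T" for k by (rule forced_energy_space[OF W(1)])
 define b where "b k = K * (2 * inverse (real (Suc k)))" for k
 have "normB T (\<lambda>t. W i t - W j t) \<le> b i + b j" for i j
 proof -
  have "norm (U i - U j) \<le> norm (U i - u0) + norm (U j - u0)"
   using norm_triangle_ineq4[of "U i - u0" "U j - u0"] by simp
  moreover have "N2 T (\<lambda>t. G i t - G j t) \<le> N2 T (\<lambda>t. G i t - g t) + N2 T (\<lambda>t. G j t - g t)"
   using sqint_time_diff(2)[OF sqint_time_diff(1)[OF Gs[of i] g] sqint_time_diff(1)[OF Gs[of j] g]] by simp
  ultimately have "norm (U i - U j) + N2 T (\<lambda>t. G i t - G j t) \<le> 2 * inverse (real (Suc i)) + 2 * inverse (real (Suc j))"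
   using small(1)[of i] small(1)[of j] small(2)[of i] small(2)[of j] by linarith
  then have "K * (norm (U i - U j) + N2 T (\<lambda>t. G i t - G j t)) \<le> b i + b j"
   unfolding b_def distrib_left[symmetric] using K by (intro mult_left_mono) auto
  then show ?thesis
   using forced_energy_estimate[OF T forced_diff[OF W(1)[of i] W(1)[of j]]] W(2) by (simp add: K_def)
 qed
 moreover have "b \<longlonglongrightarrow> K * (2 * 0)" unfolding b_def by (intro tendsto_mult_left LIMSEQ_inverse_real_of_nat)
 ultimately obtain w where w: "w \<in> spaceB T" "(\<lambda>k. normB T (\<lambda>t. W k t - w t)) \<longlonglongrightarrow> 0"
  using energy_space_complete[OF T WE Cauchy_energy_bound[of T W b]] by auto
 have "(\<lambda>k. U k - u0) \<longlonglongrightarrow> 0" by (rule tendsto_0_if_norm_le[OF _ LIMSEQ_inverse_real_of_nat]) (rule less_imp_le[OF small(1)])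
 then have "U \<longlonglongrightarrow> u0" by (simp add: LIM_zero_iff)
 moreover have "(\<lambda>k. N2 T (\<lambda>t. G k t - g t)) \<longlonglongrightarrow> 0"
 proof (rule tendsto_0_if_norm_le[OF _ LIMSEQ_inverse_real_of_nat])
  show "norm (N2 T (\<lambda>t. G k t - g t)) \<le> inverse (real (Suc k))" for k
   using small(2)[of k] N2_nonneg[of T "\<lambda>t. G k t - g t"] by simp
 qed
 from tendsto_power[OF this, of 2] have "(\<lambda>k. LINT t|time T. (G k t - g t)\<^sup>2) \<longlonglongrightarrow> 0" unfolding N2_square by simp
 moreover have "classical_solution \<alpha> len e1 T (U k) (G k) (W k)" for k
  using forced_classical_solution[OF W(1)[of k]] W(2) by simp
 ultimately have "homogeneous_mild_solution \<alpha> len e1 T u0 g w"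
  unfolding homogeneous_mild_solution_def using A w WE by blast
 then show ?thesis by blast
qed

lemma C2_on_continuous: "C2_on T G \<Longrightarrow> continuous_on {0..T} G"
 unfolding C2_on_def by (auto intro: DERIV_continuous_on)

text \<open>
 The estimate for classical solutions is applied to the approximating sequences of both solutions.
\<close>

theorem homogeneous_mild_solution_estimate:
 assumes T: "0 < T" and w: "homogeneous_mild_solution \<alpha> len e1 T u0 g w" and w': "homogeneous_mild_solution \<alpha> len e1 T u0' g' w'"
  and g: "sqint_time T g" and g': "sqint_time T g'"
 shows "normB T (\<lambda>t. w t - w' t) \<le> (2 + sqrt T) * (energy_const T * (norm (u0 - u0') + N2 T (\<lambda>t. g t - g' t)))"
proof -
 define K where "K = energy_const T"
 have K: "0 < K" unfolding K_def using T by (intro energy_const_pos) simp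
 have lim2: "(\<lambda>k. N2 T (\<lambda>t. G k t - g t)) \<longlonglongrightarrow> 0" if "(\<lambda>k. LINT t|time T. (G k t - g t)\<^sup>2) \<longlonglongrightarrow> 0" for G :: "nat \<Rightarrow> real \<Rightarrow> real" and g
  using tendsto_real_sqrt[OF that] by (simp add: N2_def)
 obtain U G W where A: "\<And>k. C2_on T (G k)" "\<And>k. W k \<in> spaceB T" "\<And>k. classical_solution \<alpha> len e1 T (U k) (G k) (W k)"
  "U \<longlonglongrightarrow> u0" "(\<lambda>k. N2 T (\<lambda>t. G k t - g t)) \<longlonglongrightarrow> 0" "(\<lambda>k. normB T (\<lambda>t. W k t - w t)) \<longlonglongrightarrow> 0"
  using w lim2 unfolding homogeneous_mild_solution_def by blast
 obtain U' G' W' where A': "\<And>k. C2_on T (G' k)" "\<And>k. W' k \<in> spaceB T" "\<And>k. classical_solution \<alpha> len e1 T (U' k) (G' k) (W' k)"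
  "U' \<longlonglongrightarrow> u0'" "(\<lambda>k. N2 T (\<lambda>t. G' k t - g' t)) \<longlonglongrightarrow> 0" "(\<lambda>k. normB T (\<lambda>t. W' k t - w' t)) \<longlonglongrightarrow> 0"
  using w' lim2 unfolding homogeneous_mild_solution_def by blast
 have E: "w \<in> spaceB T" "w' \<in> spaceB T" using w w' by (auto simp: homogeneous_mild_solution_def)
 have Gs: "sqint_time T (G k)" "sqint_time T (G' k)" for k by (intro sqint_time_continuous C2_on_continuous A(1) A'(1))+
 define c where "c k = K * (norm (U k - U' k) + (N2 T (\<lambda>t. g t - g' t) + (N2 T (\<lambda>t. G k t - g t) + N2 T (\<lambda>t. G' k t - g' t))))" for k
 have le: "normB T (\<lambda>t. W k t - W' k t) \<le> c k" for k
 proof -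
  note F = classical_solution_forced[OF A(3)[of k] A(1)[of k]] and F' = classical_solution_forced[OF A'(3)[of k] A'(1)[of k]]
  have "N2 T (\<lambda>t. G k t - G' k t) \<le> N2 T (\<lambda>t. g t - g' t) + N2 T (\<lambda>t. (G k t - G' k t) - (g t - g' t))"
   by (intro N2_triangle sqint_time_diff Gs g g')
  also have "(\<lambda>t. (G k t - G' k t) - (g t - g' t)) = (\<lambda>t. (G k t - g t) - (G' k t - g' t))" by auto
  also have "N2 T (\<lambda>t. (G k t - g t) - (G' k t - g' t)) \<le> N2 T (\<lambda>t. G k t - g t) + N2 T (\<lambda>t. G' k t - g' t)"
   by (intro sqint_time_diff Gs g g')
  finally have "K * (norm (U k - U' k) + N2 T (\<lambda>t. G k t - G' k t)) \<le> c k"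
   unfolding c_def using K by (intro mult_left_mono) auto
  then show ?thesis
   using forced_energy_estimate[OF T forced_diff[OF F(1) F'(1)]] F(2) F'(2) by (simp add: K_def)
 qed
 have "c \<longlonglongrightarrow> K * (norm (u0 - u0') + (N2 T (\<lambda>t. g t - g' t) + (0 + 0)))"
  unfolding c_def by (intro tendsto_intros A A')
 moreover have "(\<lambda>k. normB T (\<lambda>t. (W k t - W' k t) - (w t - w' t))) \<longlonglongrightarrow> 0"
 proof (rule tendsto_0_if_norm_le)
  have "(\<lambda>k. (2 + sqrt T) * (normB T (\<lambda>t. W k t - w t) + normB T (\<lambda>t. W' k t - w' t))) \<longlonglongrightarrow> (2 + sqrt T) * (0 + 0)"
   by (intro tendsto_mult_left tendsto_add A A')
  then show "(\<lambda>k. (2 + sqrt T) * (normB T (\<lambda>t. W k t - w t) + normB T (\<lambda>t. W' k t - w' t))) \<longlonglongrightarrow> 0" by simp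
  fix k
  have "(\<lambda>t. (W k t - W' k t) - (w t - w' t)) = (\<lambda>t. (W k t - w t) - (W' k t - w' t))" by auto
  then show "norm (normB T (\<lambda>t. (W k t - W' k t) - (w t - w' t)))
    \<le> (2 + sqrt T) * (normB T (\<lambda>t. W k t - w t) + normB T (\<lambda>t. W' k t - w' t))"
   using energy_norm_diff_le[OF energy_space_diff(1)[OF A(2) E(1)] energy_space_diff(1)[OF A'(2) E(2)] T, of k k]
    energy_norm_nonneg[OF energy_space_diff(1)[OF energy_space_diff(1)[OF A(2) E(1)] energy_space_diff(1)[OF A'(2) E(2)]] T, of k k]
   by simp
 qed
 ultimately have "normB T (\<lambda>t. w t - w' t) \<le> (2 + sqrt T) * (K * (norm (u0 - u0') + (N2 T (\<lambda>t. g t - g' t) + (0 + 0))))"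
  by (rule energy_norm_limit[OF T energy_space_diff(1)[OF A(2) A'(2)] energy_space_diff(1)[OF E] _ le, rotated])
 then show ?thesis by (simp add: K_def)
qed

theorem linear_mild_solution_exists:
 assumes T: "0 < T" and u0: "u0 \<in> net_L2 len" and f: "source T f" and g: "sqint_time T g"
 shows "\<exists>v\<in>spaceB T. linear_mild_solution \<alpha> len e1 T u0 f g v"
proof -
 obtain w where w: "homogeneous_mild_solution \<alpha> len e1 T u0 g w" using homogeneous_mild_solution_exists[OF T u0 g] by blast
 have "linear_mild_solution \<alpha> len e1 T u0 f g (\<lambda>t. duhamel f t + w t)"
  unfolding linear_mild_solution_def sqint_time_square_integrable duhamel_def using w f g by (auto simp: source_def)
 moreover have "(\<lambda>t. duhamel f t + w t) \<in> spaceB T"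
  using w by (intro energy_space_add(1) duhamel_energy(1) T f) (auto simp: homogeneous_mild_solution_def)
 ultimately show ?thesis by blast
qed

definition linear_const :: "real \<Rightarrow> real" where
 "linear_const T = (2 + sqrt T) * ((2 + sqrt T) * energy_const T)"

lemma linear_const_pos: "0 < T \<Longrightarrow> 0 < linear_const T"
 unfolding linear_const_def using energy_const_pos[of T] by (intro mult_pos_pos add_pos_nonneg) auto

theorem linear_mild_solution_estimate:
 assumes T: "0 < T" and v: "linear_mild_solution \<alpha> len e1 T u0 f g v" and v': "linear_mild_solution \<alpha> len e1 T u0' f' g' v'"
 shows "normB T (\<lambda>t. v t - v' t)
  \<le> linear_const T * (norm (u0 - u0') + (LINT t|time T. norm (f t - f' t)) + N2 T (\<lambda>t. g t - g' t))"
proof -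
 obtain w where w: "source T f" "sqint_time T g" "homogeneous_mild_solution \<alpha> len e1 T u0 g w" "\<And>t. t \<in> {0..T} \<Longrightarrow> v t = duhamel f t + w t"
  using v unfolding linear_mild_solution_def sqint_time_square_integrable duhamel_def source_def by blast
 obtain w' where w': "source T f'" "sqint_time T g'" "homogeneous_mild_solution \<alpha> len e1 T u0' g' w'" "\<And>t. t \<in> {0..T} \<Longrightarrow> v' t = duhamel f' t + w' t"
  using v' unfolding linear_mild_solution_def sqint_time_square_integrable duhamel_def source_def by blast
 have d: "source T (\<lambda>t. f t - f' t)" by (rule source_diff[OF w(1) w'(1)])
 have E: "(\<lambda>t. w' t - w t) \<in> spaceB T"
  using w(3) w'(3) by (intro energy_space_diff(1)) (auto simp: homogeneous_mild_solution_def)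
 have "v t - v' t = duhamel (\<lambda>t. f t - f' t) t - (w' t - w t)" if t: "t \<in> {0..T}" for t
  using duhamel_lincomb[OF w(1) w'(1) t, of 1 "-1"] w(4)[OF t] w'(4)[OF t] by simp
 then have "normB T (\<lambda>t. v t - v' t) = normB T (\<lambda>t. duhamel (\<lambda>t. f t - f' t) t - (w' t - w t))"
  by (rule energy_space_cong(2)[OF energy_space_diff(1)[OF duhamel_energy(1)[OF T d] E]])
 also have "\<dots> \<le> (2 + sqrt T) * (normB T (duhamel (\<lambda>t. f t - f' t)) + normB T (\<lambda>t. w' t - w t))"
  by (rule energy_norm_diff_le[OF duhamel_energy(1)[OF T d] E T])
 also have "\<dots> \<le> (2 + sqrt T) * ((2 + sqrt T) * (energy_const T * (LINT t|time T. norm (f t - f' t)))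
   + (2 + sqrt T) * (energy_const T * (norm (u0' - u0) + N2 T (\<lambda>t. g' t - g t))))"
  using T by (intro mult_left_mono add_mono duhamel_energy(2)[OF T d] homogeneous_mild_solution_estimate[OF T w'(3) w(3) w'(2) w(2)]) auto
 also have "\<dots> = linear_const T * (norm (u0 - u0') + (LINT t|time T. norm (f t - f' t)) + N2 T (\<lambda>t. g t - g' t))"
  by (simp add: linear_const_def norm_minus_commute[of u0'] N2_minus_commute[of T g'] algebra_simps)
 finally show ?thesis .
qed

end


section \<open>The nonlinear terms and the fixed point\<close>

context kdv_network
begin

lemma nonlinearity_AE:
 assumes u: "u \<in> spaceB T"
 shows "AE t in time T. kdv_nonlinearity len (u t) = - net_product (ND (u t)) (ND (u t))"
 using energy_space_D(3)[OF u] by eventually_elim (rule kdv_nonlinearity_eq)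

lemma source_nonlinearity:
 assumes u: "u \<in> spaceB T"
 shows "source T (\<lambda>t. kdv_nonlinearity len (u t))"
proof -
 interpret B: bounded_bilinear net_product by (rule bounded_bilinear_net_product)
 obtain M where M: "\<And>a b. norm (net_product a b) \<le> norm a * norm b * M" using B.bounded by blast
 have s: "sqint_time T (\<lambda>t. ND (u t))" by (rule energy_space_D(4)[OF u])
 have m: "(\<lambda>t. ND (u t)) \<in> borel_measurable (time T)" and i: "integrable (time T) (\<lambda>t. (norm (ND (u t)))\<^sup>2)"
  using s by (auto simp: sqint_time_def)
 have "continuous_on UNIV (\<lambda>z :: (L2 ^ 'n) \<times> (L2 ^ 'n). net_product (fst z) (snd z))"
  by (intro B.continuous_on continuous_intros)
 from borel_measurable_continuous_Pair[OF m m this]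
 have pm: "(\<lambda>t. - net_product (ND (u t)) (ND (u t))) \<in> borel_measurable (time T)" by simp
 have "integrable (time T) (\<lambda>t. M * (norm (ND (u t)))\<^sup>2)" using i by simp
 then have "integrable (time T) (\<lambda>t. - net_product (ND (u t)) (ND (u t)))"
  using pm by (rule Bochner_Integration.integrable_bound) (use M in \<open>auto simp: power2_eq_square mult.commute intro!: AE_I2 order_trans[OF M] order_trans[OF _ abs_ge_self]\<close>)
 moreover have km: "(\<lambda>t. kdv_nonlinearity len (u t)) \<in> borel_measurable (time T)"
  using nonlinearity_AE[OF u] by (intro borel_measurable_time_AE_cong[OF pm]) (auto elim: eventually_mono)
 ultimately have "integrable (time T) (\<lambda>t. kdv_nonlinearity len (u t))"
  using integrable_cong_AE[OF km pm nonlinearity_AE[OF u]] by simp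
 moreover have "AE t in time T. kdv_nonlinearity len (u t) \<in> net_L2 len"
  using nonlinearity_AE[OF u] by eventually_elim (simp add: subspace_neg[OF subspace_net_L2] net_product_net_L2)
 ultimately show ?thesis by (simp add: source_def)
qed

definition product_const :: real where
 "product_const = (SOME M. 0 < M \<and> (\<forall>a b. norm (net_product a b) \<le> norm a * norm b * M))"

lemma product_const: "0 < product_const" "norm (net_product a b) \<le> norm a * norm b * product_const"
proof -
 have "\<exists>M. 0 < M \<and> (\<forall>a b. norm (net_product a b) \<le> norm a * norm b * M)"
  by (rule bounded_bilinear.pos_bounded[OF bounded_bilinear_net_product])
 from someI_ex[OF this] show "0 < product_const" "norm (net_product a b) \<le> norm a * norm b * product_const"
  unfolding product_const_def by blast+
qed

lemma nonlinearity_Lipschitz: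
 assumes T: "0 < T" and u: "u \<in> spaceB T" and v: "v \<in> spaceB T"
 shows "(LINT t|time T. norm (kdv_nonlinearity len (u t) - kdv_nonlinearity len (v t)))
  \<le> product_const * ((normB T u + normB T v) * normB T (\<lambda>t. u t - v t))"
proof -
 interpret B: bounded_bilinear net_product by (rule bounded_bilinear_net_product)
 define a b where "a t = ND (u t)" and "b t = ND (v t)" for t
 have s: "sqint_time T a" "sqint_time T b" unfolding a_def b_def by (intro energy_space_D(4) u v)+
 have d: "sqint_time T (\<lambda>t. a t - b t)" by (intro sqint_time_diff s)
 note 1 = sqint_time_mult[OF d s(1)] and 2 = sqint_time_mult[OF d s(2)]
 have N: "integrable (time T) (\<lambda>t. kdv_nonlinearity len (u t))" "integrable (time T) (\<lambda>t. kdv_nonlinearity len (v t))"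
  using source_nonlinearity[OF u] source_nonlinearity[OF v] by (auto simp: source_def)
 have "AE t in time T. norm (kdv_nonlinearity len (u t) - kdv_nonlinearity len (v t))
   \<le> product_const * (norm (a t - b t) * norm (a t) + norm (a t - b t) * norm (b t))"
  using nonlinearity_AE[OF u] nonlinearity_AE[OF v]
 proof eventually_elim
  case (elim t)
  have "norm (kdv_nonlinearity len (u t) - kdv_nonlinearity len (v t)) = norm (net_product (a t) (a t) - net_product (b t) (b t))"
   using elim by (simp add: a_def b_def norm_minus_commute)
  also have "net_product (a t) (a t) - net_product (b t) (b t) = net_product (a t - b t) (a t) + net_product (b t) (a t - b t)"
   by (simp add: B.diff_left B.diff_right)
  also have "norm \<dots> \<le> norm (a t - b t) * norm (a t) * product_const + norm (b t) * norm (a t - b t) * product_const"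
   by (intro order_trans[OF norm_triangle_ineq] add_mono product_const(2))
  finally show ?case by (simp add: algebra_simps)
 qed
 then have "(LINT t|time T. norm (kdv_nonlinearity len (u t) - kdv_nonlinearity len (v t)))
   \<le> (LINT t|time T. product_const * (norm (a t - b t) * norm (a t) + norm (a t - b t) * norm (b t)))"
  using N 1(1) 2(1) by (intro integral_mono_AE) auto
 also have "\<dots> \<le> product_const * (N2 T (\<lambda>t. a t - b t) * N2 T a + N2 T (\<lambda>t. a t - b t) * N2 T b)"
  using 1 2 product_const(1) by simp
 also have "\<dots> = product_const * ((N2 T a + N2 T b) * N2 T (\<lambda>t. a t - b t))" by (simp add: algebra_simps)
 also have "\<dots> \<le> product_const * ((normB T u + normB T v) * normB T (\<lambda>t. u t - v t))"
  using energy_norm_ge(2)[OF u T] energy_norm_ge(2)[OF v T] energy_norm_ge(2)[OF energy_space_diff(1)[OF u v] T]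
   energy_norm_nonneg[OF u T] energy_norm_nonneg[OF v T] product_const(1) energy_space_diff(2)[OF u v]
  by (intro mult_left_mono mult_mono add_mono add_nonneg_nonneg N2_nonneg) (auto simp: a_def[abs_def] b_def[abs_def])
 finally show ?thesis .
qed

lemma node_measurable:
 assumes u: "u \<in> spaceB T"
 shows "(\<lambda>t. node (u t)) \<in> borel_measurable (time T)"
proof -
 have "(\<lambda>t. ND (u t)) \<in> borel_measurable (time T)" using energy_space_D(4)[OF u] by (simp add: sqint_time_def)
 from borel_measurable_continuous_on[OF linear_continuous_on[OF bounded_linear_nodeval] this]
 have m: "(\<lambda>t. nodeval (ND (u t))) \<in> borel_measurable (time T)" .
 have "AE t in time T. nodeval (ND (u t)) = node (u t)"
  using energy_space_D(3)[OF u] by eventually_elim (simp add: He1_D(3))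
 then show ?thesis by (intro borel_measurable_time_AE_cong[OF m]) auto
qed

text \<open>
 At almost every time both factors are bounded by \<open>node_square_bound\<close>; the inequality of Cauchy and
 Schwarz is applied to the norms of the derivatives.
\<close>

lemma sqint_node_product:
 assumes T: "0 < T" and u: "u \<in> spaceB T" and v: "v \<in> spaceB T"
  and bd: "\<And>t. t \<in> {0..T} \<Longrightarrow> norm (u t) \<le> A" "\<And>t. t \<in> {0..T} \<Longrightarrow> norm (v t) \<le> B"
 shows "sqint_time T (\<lambda>t. node (u t) * node (v t))"
  "N2 T (\<lambda>t. node (u t) * node (v t)) \<le> 2 * (sqrt (A * N2 T (\<lambda>t. ND (u t))) * sqrt (B * N2 T (\<lambda>t. ND (v t))))"
proof -
 have AB: "0 \<le> A" "0 \<le> B" using order_trans[OF norm_ge_zero bd(1)[of 0]] order_trans[OF norm_ge_zero bd(2)[of 0]] T by auto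
 note m = node_measurable[OF u] node_measurable[OF v]
 note p = sqint_time_mult[OF energy_space_D(4)[OF u] energy_space_D(4)[OF v]]
 have le: "AE t in time T. (norm (node (u t) * node (v t)))\<^sup>2 \<le> 4 * (A * B) * (norm (ND (u t)) * norm (ND (v t)))"
  using energy_space_D(3)[OF u] energy_space_D(3)[OF v] AE_space[of "time T"]
 proof eventually_elim
  case (elim t)
  then have t: "t \<in> {0..T}" by auto
  have "(norm (node (u t) * node (v t)))\<^sup>2 = (node (u t))\<^sup>2 * (node (v t))\<^sup>2" by (simp add: power_mult_distrib)
  also have "\<dots> \<le> (2 * A * norm (ND (u t))) * (2 * B * norm (ND (v t)))"
  proof (rule mult_mono)
   have "2 * norm (u t) * norm (ND (u t)) \<le> 2 * A * norm (ND (u t))" using bd(1)[OF t] by (intro mult_right_mono) auto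
   then show "(node (u t))\<^sup>2 \<le> 2 * A * norm (ND (u t))" using node_square_bound[OF elim(1)] by linarith
   have "2 * norm (v t) * norm (ND (v t)) \<le> 2 * B * norm (ND (v t))" using bd(2)[OF t] by (intro mult_right_mono) auto
   then show "(node (v t))\<^sup>2 \<le> 2 * B * norm (ND (v t))" using node_square_bound[OF elim(2)] by linarith
  qed (use AB in auto)
  finally show ?case by (simp add: mult_ac)
 qed
 have i: "integrable (time T) (\<lambda>t. (norm (node (u t) * node (v t)))\<^sup>2)"
 proof (rule Bochner_Integration.integrable_bound)
  show "integrable (time T) (\<lambda>t. 4 * (A * B) * (norm (ND (u t)) * norm (ND (v t))))" using p(1) by simp
  show "(\<lambda>t. (norm (node (u t) * node (v t)))\<^sup>2) \<in> borel_measurable (time T)" using m by measurable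
  show "AE t in time T. norm ((norm (node (u t) * node (v t)))\<^sup>2) \<le> norm (4 * (A * B) * (norm (ND (u t)) * norm (ND (v t))))"
   using le by eventually_elim (use AB in \<open>simp add: abs_mult\<close>)
 qed
 show "sqint_time T (\<lambda>t. node (u t) * node (v t))" unfolding sqint_time_def using m i by simp
 have "(N2 T (\<lambda>t. node (u t) * node (v t)))\<^sup>2 \<le> (LINT t|time T. 4 * (A * B) * (norm (ND (u t)) * norm (ND (v t))))"
  unfolding N2_square by (rule integral_mono_AE[OF i _ le]) (use p(1) in simp)
 also have "\<dots> = 4 * (A * B) * (LINT t|time T. norm (ND (u t)) * norm (ND (v t)))" by simp
 also have "\<dots> \<le> 4 * (A * B) * (N2 T (\<lambda>t. ND (u t)) * N2 T (\<lambda>t. ND (v t)))"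
  using p(2) AB by (intro mult_left_mono) auto
 finally have "N2 T (\<lambda>t. node (u t) * node (v t)) \<le> sqrt (4 * (A * B) * (N2 T (\<lambda>t. ND (u t)) * N2 T (\<lambda>t. ND (v t))))"
  by (rule real_le_rsqrt)
 then show "N2 T (\<lambda>t. node (u t) * node (v t)) \<le> 2 * (sqrt (A * N2 T (\<lambda>t. ND (u t))) * sqrt (B * N2 T (\<lambda>t. ND (v t))))"
  by (simp add: real_sqrt_mult mult_ac)
qed

text \<open>
 The difference of the squares is the product of the node values of \<open>u - v\<close> and \<open>u + v\<close>.
\<close>

lemma node_square_Lipschitz:
 assumes T: "0 < T" and u: "u \<in> spaceB T" and v: "v \<in> spaceB T"
 shows "sqint_time T (\<lambda>t. (node (u t))\<^sup>2)"
  "N2 T (\<lambda>t. (node (u t))\<^sup>2 - (node (v t))\<^sup>2) \<le> 2 * ((normB T u + normB T v) * normB T (\<lambda>t. u t - v t))"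
proof -
 note U = energy_norm_ge[OF u T] and V = energy_norm_ge[OF v T]
 show su: "sqint_time T (\<lambda>t. (node (u t))\<^sup>2)" using sqint_node_product(1)[OF T u u U(1) U(1)] by (simp add: power2_eq_square)
 note d = energy_space_diff(1)[OF u v] and a = energy_space_add[OF u v]
 define D \<Sigma> where "D = normB T (\<lambda>t. u t - v t)" and "\<Sigma> = normB T u + normB T v"
 have Db: "norm (u t - v t) \<le> D" if "t \<in> {0..T}" for t unfolding D_def by (rule energy_norm_ge(1)[OF d T that])
 have Sb: "norm (u t + v t) \<le> \<Sigma>" if "t \<in> {0..T}" for t
  unfolding \<Sigma>_def using norm_triangle_ineq[of "u t" "v t"] U(1)[OF that] V(1)[OF that] by linarith
 have nn: "0 \<le> D" "0 \<le> \<Sigma>" using order_trans[OF norm_ge_zero Db[of 0]] order_trans[OF norm_ge_zero Sb[of 0]] T by auto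
 note p = sqint_node_product[OF T d a(1) Db Sb]
 have eq: "AE t in time T. node (u t - v t) * node (u t + v t) = (node (u t))\<^sup>2 - (node (v t))\<^sup>2"
  using energy_space_D(3)[OF u] energy_space_D(3)[OF v]
 proof eventually_elim
  case (elim t)
  interpret bounded_linear nodeval by (rule bounded_linear_nodeval)
  have "node (u t - v t) = node (u t) - node (v t)" "node (u t + v t) = node (u t) + node (v t)"
   using He1_lincomb[OF elim, of 1 "-1"] He1_lincomb[OF elim, of 1 1] He1_D(3)[of "u t - v t"] He1_D(3)[of "u t + v t"] He1_D(3)[OF elim(1)] He1_D(3)[OF elim(2)]
   by (simp_all add: add diff)
  then show ?case by (simp only:) (simp add: power2_eq_square algebra_simps)
 qed
 have "N2 T (\<lambda>t. (node (u t))\<^sup>2 - (node (v t))\<^sup>2) = N2 T (\<lambda>t. node (u t - v t) * node (u t + v t))"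
  by (rule sqint_time_cong_AE(2)[OF eq p(1)])
 also have "\<dots> \<le> 2 * (sqrt (D * N2 T (\<lambda>t. ND (u t - v t))) * sqrt (\<Sigma> * N2 T (\<lambda>t. ND (u t + v t))))" by (rule p(2))
 also have "\<dots> \<le> 2 * (sqrt (D * D) * sqrt (\<Sigma> * \<Sigma>))"
 proof -
  have "N2 T (\<lambda>t. ND (u t - v t)) \<le> D" unfolding D_def by (rule energy_norm_ge(2)[OF d T])
  moreover have "N2 T (\<lambda>t. ND (u t + v t)) \<le> \<Sigma>" using a(2) U(2) V(2) unfolding \<Sigma>_def by linarith
  ultimately show ?thesis using nn by (intro mult_left_mono mult_mono real_sqrt_le_mono) (auto simp: N2_nonneg)
 qed
 also have "\<dots> = 2 * (\<Sigma> * D)" using nn by simp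
 finally show "N2 T (\<lambda>t. (node (u t))\<^sup>2 - (node (v t))\<^sup>2) \<le> 2 * ((normB T u + normB T v) * normB T (\<lambda>t. u t - v t))"
  by (simp add: D_def \<Sigma>_def)
qed

text \<open>
 One iteration of the method of Picard: \<open>v\<close> solves the linear problem with the nonlinear terms
 evaluated at \<open>u\<close>.
\<close>

definition step :: "real \<Rightarrow> L2 ^ 'n \<Rightarrow> (real \<Rightarrow> L2 ^ 'n) \<Rightarrow> (real \<Rightarrow> L2 ^ 'n) \<Rightarrow> bool" where
 "step T u0 u v \<longleftrightarrow> u \<in> spaceB T \<and> v \<in> spaceB T \<and>
  linear_mild_solution \<alpha> len e1 T u0 (\<lambda>t. kdv_nonlinearity len (u t)) (\<lambda>t. - (real CARD('n) / 3) * (node (u t))\<^sup>2) v"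

lemma kdv_solution_iff_step: "kdv_solution \<alpha> len e1 T u0 u \<longleftrightarrow> step T u0 u u"
 by (simp add: kdv_solution_def step_def node_def)

lemma step_exists:
 assumes T: "0 < T" and u0: "u0 \<in> net_L2 len" and u: "u \<in> spaceB T"
 shows "\<exists>v. step T u0 u v"
proof -
 have "sqint_time T (\<lambda>t. - (real CARD('n) / 3) *\<^sub>R (node (u t))\<^sup>2)"
  by (rule sqint_time_scale(1)[OF node_square_Lipschitz(1)[OF T u u]])
 then have "sqint_time T (\<lambda>t. - (real CARD('n) / 3) * (node (u t))\<^sup>2)" by simp
 from linear_mild_solution_exists[OF T u0 source_nonlinearity[OF u] this] show ?thesis using u unfolding step_def by blast
qed

definition Lipschitz_const :: "real \<Rightarrow> real" where
 "Lipschitz_const T = linear_const T * (product_const + 2 * (real CARD('n) / 3))"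

lemma Lipschitz_const_pos: "0 < T \<Longrightarrow> 0 < Lipschitz_const T"
 unfolding Lipschitz_const_def using linear_const_pos product_const(1) by (intro mult_pos_pos add_pos_nonneg) auto

lemma step_estimate:
 assumes T: "0 < T" and s: "step T u0 u v" "step T u0' u' v'"
 shows "normB T (\<lambda>t. v t - v' t)
  \<le> linear_const T * norm (u0 - u0') + Lipschitz_const T * (normB T u + normB T u') * normB T (\<lambda>t. u t - u' t)"
proof -
 define P where "P = (normB T u + normB T u') * normB T (\<lambda>t. u t - u' t)"
 have u: "u \<in> spaceB T" "u' \<in> spaceB T" using s by (auto simp: step_def)
 have sq: "sqint_time T (\<lambda>t. (node (u t))\<^sup>2 - (node (u' t))\<^sup>2)" by (intro sqint_time_diff node_square_Lipschitz(1)[OF T u(1) u(1)] node_square_Lipschitz(1)[OF T u(2) u(2)])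
 have "N2 T (\<lambda>t. - (real CARD('n) / 3) * (node (u t))\<^sup>2 - - (real CARD('n) / 3) * (node (u' t))\<^sup>2)
   = N2 T (\<lambda>t. - (real CARD('n) / 3) *\<^sub>R ((node (u t))\<^sup>2 - (node (u' t))\<^sup>2))"
  by (simp add: algebra_simps)
 also have "\<dots> = real CARD('n) / 3 * N2 T (\<lambda>t. (node (u t))\<^sup>2 - (node (u' t))\<^sup>2)"
  unfolding sqint_time_scale(2)[OF sq] by simp
 also have "\<dots> \<le> real CARD('n) / 3 * (2 * P)"
  unfolding P_def by (intro mult_left_mono node_square_Lipschitz(2)[OF T] u) auto
 finally have "linear_const T * (norm (u0 - u0') + (LINT t|time T. norm (kdv_nonlinearity len (u t) - kdv_nonlinearity len (u' t)))
    + N2 T (\<lambda>t. - (real CARD('n) / 3) * (node (u t))\<^sup>2 - - (real CARD('n) / 3) * (node (u' t))\<^sup>2))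
   \<le> linear_const T * (norm (u0 - u0') + product_const * P + real CARD('n) / 3 * (2 * P))"
  unfolding P_def using linear_const_pos[OF T] by (intro mult_left_mono add_mono nonlinearity_Lipschitz[OF T] u) auto
 also have "\<dots> = linear_const T * norm (u0 - u0') + Lipschitz_const T * P" by (simp add: Lipschitz_const_def algebra_simps)
 finally show ?thesis
  using linear_mild_solution_estimate[OF T, of u0 _ _ v u0' _ _ v'] s unfolding step_def P_def mult.assoc by (blast intro: order_trans)
qed

lemma energy_zero:
 assumes T: "0 < T"
 shows "(\<lambda>_. 0) \<in> spaceB T" "normB T (\<lambda>_. 0) = 0"
proof -
 show z: "(\<lambda>_. 0) \<in> spaceB T" by (rule forced_energy_space[OF forced_zero])
 have "ND 0 = 0" using He1_lincomb(2)[OF Dmax_He1[OF zero_Dmax(1)] Dmax_He1[OF zero_Dmax(1)], of 0 0] by simp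
 then have "normB T (\<lambda>_. 0) \<le> (1 + sqrt T) * 0 + 0" by (intro energy_norm_le[OF z T]) (auto simp: N2_def)
 then show "normB T (\<lambda>_. 0) = 0" using energy_norm_nonneg[OF z T] by simp
qed

lemma step_zero:
 assumes T: "0 < T"
 shows "step T 0 (\<lambda>_. 0) (\<lambda>_. 0)"
proof -
 note z = energy_zero[OF T]
 have 0: "(0 :: L2 ^ 'n) \<in> net_He 1 len" by (rule Dmax_He1[OF zero_Dmax(1)])
 have ND: "ND 0 = 0" using He1_lincomb(2)[OF 0 0, of 0 0] by simp
 have n: "node 0 = 0" by (rule zero_Dmax(3))
 have k: "kdv_nonlinearity len 0 = 0"
  using kdv_nonlinearity_eq[OF 0] bounded_bilinear.zero_left[OF bounded_bilinear_net_product] by (simp add: ND)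
 have X: "(0 :: L2 ^ 'n) \<in> net_L2 len" by (rule subspace_0[OF subspace_net_L2])
 have c: "classical_solution \<alpha> len e1 T 0 (\<lambda>_. 0) (\<lambda>_. 0)" using forced_classical_solution[OF forced_zero[of T]] .
 have C2: "C2_on T (\<lambda>_. 0)" unfolding C2_on_def by (intro exI[of _ "\<lambda>_. 0"]) auto
 have "homogeneous_mild_solution \<alpha> len e1 T 0 (\<lambda>_. 0) (\<lambda>_. 0)"
  unfolding homogeneous_mild_solution_def
  by (intro conjI exI[of _ "\<lambda>_. 0"] exI[of _ "\<lambda>_ _. 0"] allI z c C2) (auto simp: z subspace_0[OF gen.D_subspace])
 moreover have "duhamel (\<lambda>_. 0) t = 0" if "t \<in> {0..T}" for t
  using duhamel_lincomb[of T "\<lambda>_. 0" "\<lambda>_. 0" t 0 0] that source_continuous[of T "\<lambda>_. 0"] X by simp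
 ultimately have "linear_mild_solution \<alpha> len e1 T 0 (\<lambda>_. 0) (\<lambda>_. 0) (\<lambda>_. 0)"
  unfolding linear_mild_solution_def duhamel_def[symmetric] sqint_time_square_integrable
  using X by (auto simp: sqint_time_def intro!: exI[of _ "\<lambda>_. 0"])
 then show ?thesis unfolding step_def using z by (simp add: k n)
qed

lemma step_cong:
 assumes s: "step T u0 u v" and eq: "\<And>t. t \<in> {0..T} \<Longrightarrow> w t = v t"
 shows "step T u0 u w"
proof -
 have "linear_mild_solution \<alpha> len e1 T u0 f g w \<longleftrightarrow> linear_mild_solution \<alpha> len e1 T u0 f g v" for f g
  unfolding linear_mild_solution_def by (simp add: eq)
 then show ?thesis using s energy_space_cong(1)[OF _ eq] unfolding step_def by auto
qed

text \<open>
 The iterates stay in the ball of radius \<open>R\<close>. Their limit and the competitors in the uniqueness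
 statement lie in the larger ball of radius \<open>c R\<close>, the factor being that of \<open>energy_norm_limit\<close>; the
 map contracts there as well.
\<close>

theorem small_data_well_posed:
 assumes T: "0 < T"
 shows "\<exists>\<epsilon>>0. \<exists>C>0. \<forall>u0\<in>net_L2 len. norm u0 < \<epsilon> \<longrightarrow>
  (\<exists>u. kdv_solution \<alpha> len e1 T u0 u \<and> normB T u \<le> C * norm u0 \<and>
   (\<forall>v. kdv_solution \<alpha> len e1 T u0 v \<and> normB T v \<le> C * norm u0 \<longrightarrow> (\<forall>t\<in>{0..T}. v t = u t)))"
proof -
 define K L c where "K = linear_const T" and "L = Lipschitz_const T" and "c = 2 + sqrt T"
 have pos: "0 < K" "0 < L" "2 \<le> c" using linear_const_pos[OF T] Lipschitz_const_pos[OF T] T by (auto simp: K_def L_def c_def)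
 \<comment> \<open>\<open>C * norm u0 = c * R\<close>, and \<open>norm u0 < \<epsilon>\<close> gives the contraction factor \<open>1/2\<close> on the ball of radius \<open>c * R\<close>\<close>
 define \<epsilon> C where "\<epsilon> = 1 / (8 * L * K * c)" and "C = 2 * K * c"
 have \<epsilon>: "0 < \<epsilon>" and C: "0 < C" using pos by (auto simp: \<epsilon>_def C_def)
 have "\<exists>u. kdv_solution \<alpha> len e1 T u0 u \<and> normB T u \<le> C * norm u0 \<and>
   (\<forall>v. kdv_solution \<alpha> len e1 T u0 v \<and> normB T v \<le> C * norm u0 \<longrightarrow> (\<forall>t\<in>{0..T}. v t = u t))"
  if u0: "u0 \<in> net_L2 len" and small: "norm u0 < \<epsilon>" for u0
 proof -
  define R where "R = 2 * K * norm u0"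
  have R0: "0 \<le> R" unfolding R_def using pos by simp
  have CR: "C * norm u0 = c * R" by (simp add: C_def R_def)
  have "8 * L * K * c * norm u0 \<le> 1" using small pos unfolding \<epsilon>_def by (simp add: field_simps)
  then have LcR: "L * (c * R + c * R) \<le> 1 / 2" by (simp add: R_def algebra_simps)
  have RcR: "R \<le> c * R" using mult_right_mono[of 1 c R] pos R0 by simp
  have LR: "L * R \<le> 1 / 4"
  proof -
   have "L * R \<le> L * (c * R)" using RcR pos by (intro mult_left_mono) auto
   then show ?thesis using LcR unfolding distrib_left by linarith
  qed
  have contract: "normB T (\<lambda>t. v t - v' t) \<le> 1 / 2 * normB T (\<lambda>t. u t - u' t)"
   if "step T u0 u v" "step T u0 u' v'" "normB T u \<le> c * R" "normB T u' \<le> c * R" for u v u' v'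
  proof -
   have E: "0 \<le> normB T (\<lambda>t. u t - u' t)"
    using that by (intro energy_norm_nonneg energy_space_diff(1) T) (auto simp: step_def)
   have "L * (normB T u + normB T u') \<le> L * (c * R + c * R)"
    using that pos by (intro mult_left_mono add_mono) auto
   also note LcR
   finally show ?thesis using step_estimate[OF T that(1,2)] mult_right_mono[OF _ E] unfolding L_def[symmetric] by fastforce
  qed
  have ball: "normB T v \<le> R" if "step T u0 u v" "normB T u \<le> R" for u v
  proof -
   have "u \<in> spaceB T" using that(1) by (simp add: step_def)
   from energy_norm_nonneg[OF this T] have "normB T u * normB T u \<le> R * R"
    using that(2) R0 by (intro mult_mono) auto
   then have "L * (normB T u * normB T u) \<le> L * (R * R)" using pos by (intro mult_left_mono) auto
   also have "\<dots> \<le> 1 / 4 * R" using mult_right_mono[OF LR R0] by (simp add: mult.assoc)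
   finally show ?thesis
    using step_estimate[OF T that(1) step_zero[OF T]] energy_zero(2)[OF T] R0 by (simp add: K_def[symmetric] L_def[symmetric] R_def mult.assoc)
  qed
  \<comment> \<open>the right-hand side of the linear problem does not determine \<open>v\<close> outside \<open>[0,T]\<close>, so a choice is made\<close>
  obtain \<Phi> where \<Phi>: "\<And>u. u \<in> spaceB T \<Longrightarrow> step T u0 u (\<Phi> u)" using step_exists[OF T u0] by metis
  define u where "u n = (\<Phi> ^^ n) (\<lambda>_. 0)" for n
  have uE: "u n \<in> spaceB T \<and> normB T (u n) \<le> R" for n
  proof (induction n)
   case 0
   then show ?case using energy_zero[OF T] R0 by (simp add: u_def)
  next
   case (Suc n)
   then have "step T u0 (u n) (u (Suc n))" using \<Phi>[of "u n"] by (simp add: u_def)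
   then show ?case using ball Suc by (auto simp: step_def)
  qed
  then have E: "u n \<in> spaceB T" and B: "normB T (u n) \<le> R" "normB T (u n) \<le> c * R" for n
   using RcR order_trans by blast+
  have st: "step T u0 (u n) (u (Suc n))" for n using \<Phi>[OF E[of n]] by (simp add: u_def)
  have geo: "normB T (\<lambda>t. u m t - u n t) \<le> (1 / 2) ^ k * (c * (R + R))" if "k \<le> m" "k \<le> n" for k m n
   using that
  proof (induction k arbitrary: m n)
   case 0
   have "c * (normB T (u m) + normB T (u n)) \<le> c * (R + R)"
    using pos B(1)[of m] B(1)[of n] by (intro mult_left_mono) auto
   then show ?case using energy_norm_diff_le[OF E[of m] E[of n] T] unfolding c_def by simp
  next
   case (Suc k)
   obtain m' n' where mn: "m = Suc m'" "n = Suc n'" "k \<le> m'" "k \<le> n'" using Suc.prems by (cases m; cases n) auto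
   show ?case using contract[OF st[of m'] st[of n'] B(2) B(2)] Suc.IH[OF mn(3,4)] unfolding mn(1,2) by simp
  qed
  have "normB T (\<lambda>t. u m t - u n t) \<le> (1 / 2) ^ m * (c * (R + R)) + (1 / 2) ^ n * (c * (R + R))" for m n
   using geo[of "min m n" m n] pos R0 by (cases "m \<le> n") (auto simp: min_def intro: order_trans)
  moreover have "(\<lambda>n. (1 / 2) ^ n * (c * (R + R))) \<longlonglongrightarrow> 0"
   using tendsto_mult_right[OF LIMSEQ_realpow_zero[of "1 / 2 :: real"], of "c * (R + R)"] by simp
  ultimately obtain w where w: "w \<in> spaceB T" "(\<lambda>n. normB T (\<lambda>t. u n t - w t)) \<longlonglongrightarrow> 0"
   using energy_space_complete[OF T E Cauchy_energy_bound[of T u "\<lambda>n. (1 / 2) ^ n * (c * (R + R))"]] by blast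
  have wB: "normB T w \<le> c * R"
   unfolding c_def by (rule energy_norm_limit[OF T E w B(1) tendsto_const])
  have ptw: "(\<lambda>n. p n t) \<longlonglongrightarrow> q t"
   if "\<And>n. p n \<in> spaceB T" "q \<in> spaceB T" "(\<lambda>n. normB T (\<lambda>t. p n t - q t)) \<longlonglongrightarrow> 0" "t \<in> {0..T}" for p :: "nat \<Rightarrow> real \<Rightarrow> L2 ^ 'n" and q t
  proof -
   have "(\<lambda>n. p n t - q t) \<longlonglongrightarrow> 0"
    by (rule tendsto_0_if_norm_le[OF _ that(3)]) (rule energy_norm_ge(1)[OF energy_space_diff(1)[OF that(1,2)] T that(4)])
   then show ?thesis by (simp add: LIM_zero_iff)
  qed
  have sw: "step T u0 w (\<Phi> w)" by (rule \<Phi>[OF w(1)])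
  then have \<Phi>w: "\<Phi> w \<in> spaceB T" by (simp add: step_def)
  have "(\<lambda>n. normB T (\<lambda>t. u (Suc n) t - \<Phi> w t)) \<longlonglongrightarrow> 0"
  proof (rule tendsto_0_if_norm_le)
   show "(\<lambda>n. 1 / 2 * normB T (\<lambda>t. u n t - w t)) \<longlonglongrightarrow> 0" using tendsto_mult_left[OF w(2), of "1 / 2"] by simp
   show "norm (normB T (\<lambda>t. u (Suc n) t - \<Phi> w t)) \<le> 1 / 2 * normB T (\<lambda>t. u n t - w t)" for n
    using contract[OF st[of n] sw B(2) wB] energy_norm_nonneg[OF energy_space_diff(1)[OF E[of "Suc n"] \<Phi>w] T] by simp
  qed
  note lim = ptw[OF E \<Phi>w this]
  have "w t = \<Phi> w t" if t: "t \<in> {0..T}" for t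
   by (rule LIMSEQ_unique[OF LIMSEQ_Suc[OF ptw[OF E w t]] lim[OF t]])
  then have "step T u0 w w" by (rule step_cong[OF sw])
  moreover have "v t = w t" if "step T u0 v v" "normB T v \<le> c * R" "t \<in> {0..T}" for v t
  proof -
   have "v \<in> spaceB T" using that(1) by (simp add: step_def)
   note d = energy_space_diff(1)[OF this w(1)]
   have "normB T (\<lambda>t. v t - w t) \<le> 0" using contract[OF that(1) \<open>step T u0 w w\<close> that(2) wB] by simp
   then have "norm (v t - w t) \<le> 0" using energy_norm_ge(1)[OF d T that(3)] by (rule order_trans[rotated])
   then show ?thesis by simp
  qed
  ultimately show ?thesis unfolding kdv_solution_iff_step CR using wB by blast
 qed
 then show ?thesis using \<epsilon> C by blast
qed

end

theorem theorem2p7: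
  fixes \<alpha> T :: real and len :: "'n::finite \<Rightarrow> real" and e1 :: 'n
  assumes "\<alpha> > real CARD('n) / 2"
    and "\<And>j. len j > 0"
    and "T > 0"
  shows "\<exists>\<epsilon>>0. \<exists>C>0. \<forall>u0\<in>net_L2 len. norm u0 < \<epsilon> \<longrightarrow>
    (\<exists>u. kdv_solution \<alpha> len e1 T u0 u \<and> energy_norm T len u \<le> C * norm u0 \<and>
      (\<forall>v. kdv_solution \<alpha> len e1 T u0 v \<and> energy_norm T len v \<le> C * norm u0 \<longrightarrow>
        (\<forall>t\<in>{0..T}. v t = u t)))"
proof -
  interpret kdv_network \<alpha> len e1 by unfold_locales (use assms in auto)
  show ?thesis by (rule small_data_well_posed[OF assms(3)])
qed

end
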